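(* Let $G$ be a finite directed graph on the vertex set $[n]$ such that every directed edge of $G$ belongs to a directed cycle in $G$, and let $X_G$ be the projective toric variety associated to the spanning (face) fan of the directed edge polytope $\mathcal{A}_G=\operatorname{conv}\{\mathbf{e}_i-\mathbf{e}_j : (i,j)\in A(G)\}\subset\mathbb{R}^n$. Then the following are equivalent: (1) $X_G$ is smooth in codimension $2$ and $\mathbb{Q}$-factorial in codimension $3$; (2) $G$ satisfies both of the following: (a) there are no distinct vertices $i_1,i_2,i_3,i_4$ of $G$ such that $(i_1,i_2),(i_1,i_4),(i_3,i_2),(i_3,i_4)$ are all directed edges of $G$; (b) for any distinct vertices $i_1,i_2,i_3,i_4$ of $G$ such that $(i_1,i_2),(i_2,i_3),(i_1,i_4),(i_4,i_3)$ are all directed edges of $G$, either $(i_1,i_3)$ is a directed edge of $G$ or there exists a vertex $j\notin\{i_2,i_4\}$ of $G$ such that $(i_1,j)$ and $(j,i_3)$ are directed edges of $G$. Moreover, in this case $X_G$ is rigid.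
   Context: A finite directed graph $G=(V(G),A(G))$ has vertex set $V(G)=[n]=\{1,\dots,n\}$ and a set $A(G)$ of ordered pairs $(i,j)$, $i\neq j$ (directed edges). The hypothesis that every directed edge lies on a directed cycle guarantees that the origin lies in the interior of $\mathcal{A}_G$ (relative to its affine span, which is a linear subspace) and that $\mathcal{A}_G$ is a terminal reflexive polytope, so $X_G$ (the toric variety of the fan whose cones are the cones over the proper faces of $\mathcal{A}_G$, taken in the lattice $\mathbb{Z}^n\cap\operatorname{span}\mathcal{A}_G$) is a Gorenstein toric Fano variety with terminal singularities. A toric variety is smooth in codimension $2$ if every cone of dimension at most $2$ of its fan is smooth (generated by part of a lattice basis), and $\mathbb{Q}$-factorial in codimension $3$ if every cone of dimension at most $3$ of its fan is simplicial. A scheme $X$ of finite type over $\mathbb{C}$ is rigid if its space of first-order deformations $T^1_X=\mathrm{Def}_X(\mathbb{C}[t]/(t^2))$ is zero. *)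

theory Defs
  imports
    "HOL-Analysis.Analysis"
    "HOL-Library.Poly_Mapping"
    "HOL-Algebra.Ideal"
    "Graph_Theory.Pair_Digraph"
begin

section \<open>The directed edge polytope and its spanning fan\<close>

definition edge_polytope :: "'n::finite pair_pre_digraph \<Rightarrow> (real ^ 'n) set" where
  "edge_polytope G = convex hull {axis i 1 - axis j 1 | i j. (i, j) \<in> parcs G}"

definition edge_lattice :: "'n::finite pair_pre_digraph \<Rightarrow> (real ^ 'n) set" where
  "edge_lattice G = {v \<in> span (edge_polytope G). \<forall>k. v $ k \<in> \<int>}"

text \<open>The cone over the empty face is the zero cone.  It is inserted explicitly so that a graph
  without arcs (whose polytope is empty and has no proper faces) gets the fan of a point.\<close>

definition spanning_fan :: "'a::euclidean_space set \<Rightarrow> 'a set set" where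
  "spanning_fan P = insert {0} {convex_cone hull F | F. F face_of P \<and> F \<noteq> P}"

definition lattice_basis :: "'a::euclidean_space set \<Rightarrow> 'a set \<Rightarrow> bool" where
  "lattice_basis N B \<longleftrightarrow> independent B \<and> N = {\<Sum>b\<in>B. real_of_int (c b) *\<^sub>R b | c. True}"

definition smooth_cone :: "'a::euclidean_space set \<Rightarrow> 'a set \<Rightarrow> bool" where
  "smooth_cone N \<sigma> \<longleftrightarrow> (\<exists>B S. lattice_basis N B \<and> S \<subseteq> B \<and> \<sigma> = convex_cone hull S)"

definition simplicial_cone :: "'a::euclidean_space set \<Rightarrow> bool" where
  "simplicial_cone \<sigma> \<longleftrightarrow> (\<exists>S. independent S \<and> \<sigma> = convex_cone hull S)"

definition smooth_in_codim :: "nat \<Rightarrow> 'a::euclidean_space set \<Rightarrow> 'a set set \<Rightarrow> bool" where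
  "smooth_in_codim k N \<Sigma> \<longleftrightarrow> (\<forall>\<sigma>\<in>\<Sigma>. dim \<sigma> \<le> k \<longrightarrow> smooth_cone N \<sigma>)"

definition Q_factorial_in_codim :: "nat \<Rightarrow> 'a::euclidean_space set set \<Rightarrow> bool" where
  "Q_factorial_in_codim k \<Sigma> \<longleftrightarrow> (\<forall>\<sigma>\<in>\<Sigma>. dim \<sigma> \<le> k \<longrightarrow> simplicial_cone \<sigma>)"


definition no_crossing_pairs :: "'n pair_pre_digraph \<Rightarrow> bool" where
  "no_crossing_pairs G \<longleftrightarrow>
     \<not> (\<exists>i1 i2 i3 i4. {i1, i2, i3, i4} \<subseteq> pverts G \<and> distinct [i1, i2, i3, i4] \<and>
          (i1, i2) \<in> parcs G \<and> (i1, i4) \<in> parcs G \<and> (i3, i2) \<in> parcs G \<and> (i3, i4) \<in> parcs G)"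

definition diamonds_filled :: "'n pair_pre_digraph \<Rightarrow> bool" where
  "diamonds_filled G \<longleftrightarrow>
     (\<forall>i1 i2 i3 i4. {i1, i2, i3, i4} \<subseteq> pverts G \<and> distinct [i1, i2, i3, i4] \<and>
        (i1, i2) \<in> parcs G \<and> (i2, i3) \<in> parcs G \<and> (i1, i4) \<in> parcs G \<and> (i4, i3) \<in> parcs G \<longrightarrow>
        (i1, i3) \<in> parcs G \<or>
        (\<exists>j\<in>pverts G - {i2, i4}. (i1, j) \<in> parcs G \<and> (j, i3) \<in> parcs G))"


section \<open>Ringed spaces\<close>

text \<open>\<open>sec X U\<close> is the ring of sections over \<open>U\<close> and \<open>res X U V\<close> the restriction from
  \<open>U\<close> to \<open>V\<close>; both are meaningful only for open \<open>V \<subseteq> U\<close>.\<close>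

record ('p, 's) rspace =
  pts :: "'p topology"
  sec :: "'p set \<Rightarrow> 's ring"
  res :: "'p set \<Rightarrow> 'p set \<Rightarrow> 's \<Rightarrow> 's"

text \<open>A morphism to an affine scheme \<open>Spec R\<close> is the same as a ring homomorphism from \<open>R\<close> to the
  global sections, so a space over \<open>R\<close> carries such a map.\<close>

record ('r, 'p, 's) rspace_over = "('p, 's) rspace" +
  str :: "'r \<Rightarrow> 's"

abbreviation carr :: "('p, 's, 'z) rspace_scheme \<Rightarrow> 'p set" where
  "carr X \<equiv> topspace (pts X)"

definition ringed_space :: "('p, 's, 'z) rspace_scheme \<Rightarrow> bool" where
  "ringed_space X \<longleftrightarrow>
     (\<forall>U. openin (pts X) U \<longrightarrow> cring (sec X U)) \<and>
     (\<forall>U V. openin (pts X) U \<and> openin (pts X) V \<and> V \<subseteq> U \<longrightarrow>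
        res X U V \<in> ring_hom (sec X U) (sec X V)) \<and>
     (\<forall>U. openin (pts X) U \<longrightarrow> (\<forall>s\<in>carrier (sec X U). res X U U s = s)) \<and>
     (\<forall>U V W. openin (pts X) U \<and> openin (pts X) V \<and> openin (pts X) W \<and> W \<subseteq> V \<and> V \<subseteq> U \<longrightarrow>
        (\<forall>s\<in>carrier (sec X U). res X V W (res X U V s) = res X U W s)) \<and>
     (\<forall>\<U> t. (\<forall>U\<in>\<U>. openin (pts X) U \<and> t U \<in> carrier (sec X U)) \<and>
        (\<forall>U\<in>\<U>. \<forall>V\<in>\<U>. res X U (U \<inter> V) (t U) = res X V (U \<inter> V) (t V)) \<longrightarrow>
        (\<exists>!s. s \<in> carrier (sec X (\<Union>\<U>)) \<and> (\<forall>U\<in>\<U>. res X (\<Union>\<U>) U s = t U)))"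

definition preim :: "('p, 's, 'z) rspace_scheme \<Rightarrow> ('p \<Rightarrow> 'q) \<Rightarrow> 'q set \<Rightarrow> 'p set" where
  "preim X f V = {x \<in> carr X. f x \<in> V}"

text \<open>\<open>fs V\<close> is the component over \<open>V\<close> of the map of sheaves from the structure sheaf of \<open>Y\<close> to
  the direct image of that of \<open>X\<close>.\<close>

definition rs_morphism ::
    "('p, 's, 'z) rspace_scheme \<Rightarrow> ('q, 't, 'y) rspace_scheme \<Rightarrow> ('p \<Rightarrow> 'q) \<Rightarrow> ('q set \<Rightarrow> 't \<Rightarrow> 's) \<Rightarrow> bool"
  where
  "rs_morphism X Y f fs \<longleftrightarrow>
     continuous_map (pts X) (pts Y) f \<and>
     (\<forall>V. openin (pts Y) V \<longrightarrow> fs V \<in> ring_hom (sec Y V) (sec X (preim X f V))) \<and>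
     (\<forall>V W. openin (pts Y) V \<and> openin (pts Y) W \<and> W \<subseteq> V \<longrightarrow>
        (\<forall>s\<in>carrier (sec Y V). fs W (res Y V W s) = res X (preim X f V) (preim X f W) (fs V s)))"

definition rs_iso ::
    "('p, 's, 'z) rspace_scheme \<Rightarrow> ('q, 't, 'y) rspace_scheme \<Rightarrow> ('p \<Rightarrow> 'q) \<Rightarrow> ('q set \<Rightarrow> 't \<Rightarrow> 's) \<Rightarrow> bool"
  where
  "rs_iso X Y f fs \<longleftrightarrow>
     rs_morphism X Y f fs \<and> homeomorphic_map (pts X) (pts Y) f \<and>
     (\<forall>V. openin (pts Y) V \<longrightarrow>
        bij_betw (fs V) (carrier (sec Y V)) (carrier (sec X (preim X f V))))"

definition open_subspace :: "('p, 's, 'z) rspace_scheme \<Rightarrow> 'p set \<Rightarrow> ('p, 's) rspace" where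
  "open_subspace X U = \<lparr>pts = subtopology (pts X) U, sec = sec X, res = res X\<rparr>"

definition germ :: "('p, 's, 'z) rspace_scheme \<Rightarrow> 'p \<Rightarrow> 'p set \<Rightarrow> 's \<Rightarrow> ('p set \<times> 's) set" where
  "germ X x U s = {(V, t). openin (pts X) V \<and> x \<in> V \<and> t \<in> carrier (sec X V) \<and>
     (\<exists>W. openin (pts X) W \<and> x \<in> W \<and> W \<subseteq> U \<inter> V \<and> res X U W s = res X V W t)}"

definition stalk :: "('p, 's, 'z) rspace_scheme \<Rightarrow> 'p \<Rightarrow> ('p set \<times> 's) set ring" where
  "stalk X x = \<lparr>
     carrier = {germ X x U s | U s. openin (pts X) U \<and> x \<in> U \<and> s \<in> carrier (sec X U)},
     mult = (\<lambda>g h. \<Union>(U, s)\<in>g. \<Union>(V, t)\<in>h.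
       germ X x (U \<inter> V) (res X U (U \<inter> V) s \<otimes>\<^bsub>sec X (U \<inter> V)\<^esub> res X V (U \<inter> V) t)),
     one = germ X x (carr X) \<one>\<^bsub>sec X (carr X)\<^esub>,
     zero = germ X x (carr X) \<zero>\<^bsub>sec X (carr X)\<^esub>,
     add = (\<lambda>g h. \<Union>(U, s)\<in>g. \<Union>(V, t)\<in>h.
       germ X x (U \<inter> V) (res X U (U \<inter> V) s \<oplus>\<^bsub>sec X (U \<inter> V)\<^esub> res X V (U \<inter> V) t))\<rparr>"


section \<open>Affine schemes and schemes\<close>

text \<open>The fraction \<open>a/s\<close> in the localization of \<open>R\<close> at the prime ideal \<open>p\<close>.\<close>

definition fraction :: "('a, 'm) ring_scheme \<Rightarrow> 'a set \<Rightarrow> 'a \<Rightarrow> 'a \<Rightarrow> ('a \<times> 'a) set" where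
  "fraction R p a s = {(b, t). b \<in> carrier R \<and> t \<in> carrier R - p \<and>
     (\<exists>u \<in> carrier R - p. u \<otimes>\<^bsub>R\<^esub> (a \<otimes>\<^bsub>R\<^esub> t \<ominus>\<^bsub>R\<^esub> b \<otimes>\<^bsub>R\<^esub> s) = \<zero>\<^bsub>R\<^esub>)}"

definition localization :: "('a, 'm) ring_scheme \<Rightarrow> 'a set \<Rightarrow> ('a \<times> 'a) set ring" where
  "localization R p = \<lparr>
     carrier = {fraction R p a s | a s. a \<in> carrier R \<and> s \<in> carrier R - p},
     mult = (\<lambda>x y. \<Union>(a, s)\<in>x. \<Union>(b, t)\<in>y. fraction R p (a \<otimes>\<^bsub>R\<^esub> b) (s \<otimes>\<^bsub>R\<^esub> t)),
     one = fraction R p \<one>\<^bsub>R\<^esub> \<one>\<^bsub>R\<^esub>,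
     zero = fraction R p \<zero>\<^bsub>R\<^esub> \<one>\<^bsub>R\<^esub>,
     add = (\<lambda>x y. \<Union>(a, s)\<in>x. \<Union>(b, t)\<in>y.
       fraction R p (a \<otimes>\<^bsub>R\<^esub> t \<oplus>\<^bsub>R\<^esub> b \<otimes>\<^bsub>R\<^esub> s) (s \<otimes>\<^bsub>R\<^esub> t))\<rparr>"

definition zariski :: "('a, 'm) ring_scheme \<Rightarrow> 'a set topology" where
  "zariski R = topology_generated_by {{p. primeideal p R \<and> f \<notin> p} | f. f \<in> carrier R}"

text \<open>Sections over \<open>U\<close> are the functions into the localizations that are locally fractions.\<close>

definition Spec :: "('a, 'm) ring_scheme \<Rightarrow> ('a set, 'a set \<Rightarrow> ('a \<times> 'a) set) rspace" where
  "Spec R = \<lparr>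
     pts = zariski R,
     sec = (\<lambda>U. \<lparr>
       carrier = {s \<in> (\<Pi>\<^sub>E p\<in>U. carrier (localization R p)).
         \<forall>p\<in>U. \<exists>V a f. openin (zariski R) V \<and> p \<in> V \<and> V \<subseteq> U \<and> a \<in> carrier R \<and> f \<in> carrier R \<and>
           (\<forall>q\<in>V. f \<notin> q \<and> s q = fraction R q a f)},
       mult = (\<lambda>s t. \<lambda>p\<in>U. s p \<otimes>\<^bsub>localization R p\<^esub> t p),
       one = (\<lambda>p\<in>U. \<one>\<^bsub>localization R p\<^esub>),
       zero = (\<lambda>p\<in>U. \<zero>\<^bsub>localization R p\<^esub>),
       add = (\<lambda>s t. \<lambda>p\<in>U. s p \<oplus>\<^bsub>localization R p\<^esub> t p)\<rparr>),
     res = (\<lambda>U V s. restrict s V)\<rparr>"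

text \<open>An affine scheme is the spectrum of its ring of global sections, so it is no restriction to
  compare an open subspace with the spectrum of that ring only.  Local rings need not be mentioned:
  a ringed space that is locally isomorphic to spectra is locally ringed.\<close>

definition scheme :: "('p, 's, 'z) rspace_scheme \<Rightarrow> bool" where
  "scheme X \<longleftrightarrow> ringed_space X \<and>
     (\<forall>x\<in>carr X. \<exists>U f fs. openin (pts X) U \<and> x \<in> U \<and>
        rs_iso (open_subspace X U) (Spec (sec X U)) f fs)"

text \<open>The morphism of spectra induced by a ring homomorphism \<open>\<phi>\<close> from \<open>R\<close> to \<open>S\<close>.\<close>

definition Spec_map :: "('a, 'm) ring_scheme \<Rightarrow> ('a \<Rightarrow> 'b) \<Rightarrow> 'b set \<Rightarrow> 'a set" where
  "Spec_map R \<phi> q = {a \<in> carrier R. \<phi> a \<in> q}"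

definition Spec_pullback ::
    "('a, 'm) ring_scheme \<Rightarrow> ('b, 'k) ring_scheme \<Rightarrow> ('a \<Rightarrow> 'b) \<Rightarrow> 'a set set \<Rightarrow>
      ('a set \<Rightarrow> ('a \<times> 'a) set) \<Rightarrow> ('b set \<Rightarrow> ('b \<times> 'b) set)" where
  "Spec_pullback R S \<phi> U s =
     (\<lambda>q\<in>preim (Spec S) (Spec_map R \<phi>) U.
        \<Union>(a, b)\<in>s (Spec_map R \<phi> q). fraction S q (\<phi> a) (\<phi> b))"


section \<open>Gluing\<close>

text \<open>The colimit of ringed spaces \<open>X i\<close>, \<open>i \<in> I\<close>, along morphisms \<open>(f i j, fs i j)\<close> from \<open>X i\<close>
  to \<open>X j\<close>, given for \<open>below i j\<close>.  Points are equivalence classes of pairs \<open>(i, x)\<close>, the topology is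
  the quotient topology, and sections are compatible families of sections.\<close>

definition glue_class ::
    "'i set \<Rightarrow> ('i \<Rightarrow> 'i \<Rightarrow> bool) \<Rightarrow> ('i \<Rightarrow> ('p, 's) rspace) \<Rightarrow> ('i \<Rightarrow> 'i \<Rightarrow> 'p \<Rightarrow> 'p) \<Rightarrow>
      'i \<times> 'p \<Rightarrow> ('i \<times> 'p) set" where
  "glue_class I below X f z =
     (let E = {((i, x), (j, f i j x)) | i j x. i \<in> I \<and> j \<in> I \<and> below i j \<and> x \<in> carr (X i)}
      in (E \<union> E\<inverse>)\<^sup>* `` {z})"

definition glue_part ::
    "'i set \<Rightarrow> ('i \<Rightarrow> 'i \<Rightarrow> bool) \<Rightarrow> ('i \<Rightarrow> ('p, 's) rspace) \<Rightarrow> ('i \<Rightarrow> 'i \<Rightarrow> 'p \<Rightarrow> 'p) \<Rightarrow>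
      'i \<Rightarrow> ('i \<times> 'p) set set \<Rightarrow> 'p set" where
  "glue_part I below X f i U = {x \<in> carr (X i). glue_class I below X f (i, x) \<in> U}"

definition glue_topology ::
    "'i set \<Rightarrow> ('i \<Rightarrow> 'i \<Rightarrow> bool) \<Rightarrow> ('i \<Rightarrow> ('p, 's) rspace) \<Rightarrow> ('i \<Rightarrow> 'i \<Rightarrow> 'p \<Rightarrow> 'p) \<Rightarrow>
      ('i \<times> 'p) set topology" where
  "glue_topology I below X f = topology (\<lambda>U.
     U \<subseteq> {glue_class I below X f (i, x) | i x. i \<in> I \<and> x \<in> carr (X i)} \<and>
     (\<forall>i\<in>I. openin (pts (X i)) (glue_part I below X f i U)))"

lemma openin_glue_topology:
  "openin (glue_topology I below X f) U \<longleftrightarrow>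
     U \<subseteq> {glue_class I below X f (i, x) | i x. i \<in> I \<and> x \<in> carr (X i)} \<and>
     (\<forall>i\<in>I. openin (pts (X i)) (glue_part I below X f i U))"
proof -
  have int: "glue_part I below X f i (S \<inter> T) = glue_part I below X f i S \<inter> glue_part I below X f i T"
    for i S T by (auto simp: glue_part_def)
  have un: "glue_part I below X f i (\<Union>\<K>) = \<Union>(glue_part I below X f i ` \<K>)"
    for i \<K> by (auto simp: glue_part_def)
  have "istopology (\<lambda>U. U \<subseteq> {glue_class I below X f (i, x) | i x. i \<in> I \<and> x \<in> carr (X i)} \<and>
     (\<forall>i\<in>I. openin (pts (X i)) (glue_part I below X f i U)))" (is "istopology (\<lambda>U. U \<subseteq> ?Q \<and> ?P U)")
    unfolding istopology_def
  proof (intro conjI allI impI)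
    fix S T assume "S \<subseteq> ?Q \<and> ?P S" "T \<subseteq> ?Q \<and> ?P T"
    then show "S \<inter> T \<subseteq> ?Q" "?P (S \<inter> T)"
      by (simp_all only: int) (blast, simp add: openin_Int)
  next
    fix \<K> assume *: "\<forall>K\<in>\<K>. K \<subseteq> ?Q \<and> ?P K"
    then show "\<Union>\<K> \<subseteq> ?Q" by (meson Sup_least)
    show "?P (\<Union>\<K>)"
      unfolding un using * by (intro ballI openin_Union) auto
  qed
  then show ?thesis
    unfolding glue_topology_def by (simp add: topology_inverse')
qed

definition glue ::
    "'i set \<Rightarrow> ('i \<Rightarrow> 'i \<Rightarrow> bool) \<Rightarrow> ('i \<Rightarrow> ('p, 's) rspace) \<Rightarrow> ('i \<Rightarrow> 'i \<Rightarrow> 'p \<Rightarrow> 'p) \<Rightarrow>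
      ('i \<Rightarrow> 'i \<Rightarrow> 'p set \<Rightarrow> 's \<Rightarrow> 's) \<Rightarrow> (('i \<times> 'p) set, 'i \<Rightarrow> 's) rspace" where
  "glue I below X f fs = \<lparr>
     pts = glue_topology I below X f,
     sec = (\<lambda>U. let R = \<lambda>i. sec (X i) (glue_part I below X f i U) in \<lparr>
       carrier = {s \<in> (\<Pi>\<^sub>E i\<in>I. carrier (R i)).
         \<forall>i\<in>I. \<forall>j\<in>I. below i j \<longrightarrow> s i = fs i j (glue_part I below X f j U) (s j)},
       mult = (\<lambda>s t. \<lambda>i\<in>I. s i \<otimes>\<^bsub>R i\<^esub> t i),
       one = (\<lambda>i\<in>I. \<one>\<^bsub>R i\<^esub>),
       zero = (\<lambda>i\<in>I. \<zero>\<^bsub>R i\<^esub>),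
       add = (\<lambda>s t. \<lambda>i\<in>I. s i \<oplus>\<^bsub>R i\<^esub> t i)\<rparr>),
     res = (\<lambda>U V s. \<lambda>i\<in>I. res (X i) (glue_part I below X f i U) (glue_part I below X f i V) (s i))\<rparr>"


section \<open>Toric varieties\<close>

definition subring_of_type :: "'a::ring_1 set \<Rightarrow> 'a ring" where
  "subring_of_type A = \<lparr>carrier = A, mult = (*), one = 1, zero = 0, add = (+)\<rparr>"

text \<open>The lattice dual to \<open>N\<close>, realized inside the span of \<open>N\<close> by means of the inner product.\<close>

definition dual_lattice :: "'a::euclidean_space set \<Rightarrow> 'a set" where
  "dual_lattice N = {m \<in> span N. \<forall>u\<in>N. m \<bullet> u \<in> \<int>}"

definition dual_monoid :: "'a::euclidean_space set \<Rightarrow> 'a set \<Rightarrow> 'a set" where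
  "dual_monoid N \<sigma> = {m \<in> dual_lattice N. \<forall>u\<in>\<sigma>. 0 \<le> m \<bullet> u}"

text \<open>The semigroup algebra of the dual cone; a polynomial mapping \<open>g\<close> is the finite sum of the
  terms \<open>g(m) \<chi>\<^sup>m\<close>, and multiplication is convolution.\<close>

definition chart_ring :: "'a::euclidean_space set \<Rightarrow> 'a set \<Rightarrow> ('a \<Rightarrow>\<^sub>0 complex) ring" where
  "chart_ring N \<sigma> = subring_of_type {g. Poly_Mapping.keys g \<subseteq> dual_monoid N \<sigma>}"

text \<open>For a face \<open>\<tau>\<close> of \<open>\<sigma>\<close> the ring of \<open>\<sigma>\<close> is a subring of the ring of \<open>\<tau>\<close>, and the gluing map
  is induced by the inclusion.\<close>

definition toric_variety ::
    "'a::euclidean_space set \<Rightarrow> 'a set set \<Rightarrow>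
      (complex, ('a set \<times> ('a \<Rightarrow>\<^sub>0 complex) set) set,
       'a set \<Rightarrow> ('a \<Rightarrow>\<^sub>0 complex) set \<Rightarrow> (('a \<Rightarrow>\<^sub>0 complex) \<times> ('a \<Rightarrow>\<^sub>0 complex)) set) rspace_over" where
  "toric_variety N \<Sigma> =
     rspace.extend
       (glue \<Sigma> (\<lambda>\<tau> \<sigma>. \<tau> face_of \<sigma>) (\<lambda>\<sigma>. Spec (chart_ring N \<sigma>))
         (\<lambda>\<tau> \<sigma>. Spec_map (chart_ring N \<sigma>) (\<lambda>g. g))
         (\<lambda>\<tau> \<sigma>. Spec_pullback (chart_ring N \<sigma>) (chart_ring N \<tau>) (\<lambda>g. g)))
       (rspace_over.fields (\<lambda>c. \<lambda>\<sigma>\<in>\<Sigma>. \<lambda>p\<in>carr (Spec (chart_ring N \<sigma>)).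
          fraction (chart_ring N \<sigma>) p (Poly_Mapping.single 0 c) 1))"

definition edge_variety ::
    "'n::finite pair_pre_digraph \<Rightarrow>
      (complex, ((real ^ 'n) set \<times> (real ^ 'n \<Rightarrow>\<^sub>0 complex) set) set,
       (real ^ 'n) set \<Rightarrow> (real ^ 'n \<Rightarrow>\<^sub>0 complex) set \<Rightarrow>
         ((real ^ 'n \<Rightarrow>\<^sub>0 complex) \<times> (real ^ 'n \<Rightarrow>\<^sub>0 complex)) set) rspace_over" where
  "edge_variety G = toric_variety (edge_lattice G) (spanning_fan (edge_polytope G))"


section \<open>First-order deformations\<close>

text \<open>\<open>R[t]/(t\<^sup>2)\<close>, with \<open>(a, b)\<close> standing for \<open>a + b t\<close>.\<close>

definition dual_numbers :: "'a ring \<Rightarrow> ('a \<times> 'a) ring" where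
  "dual_numbers R = \<lparr>
     carrier = carrier R \<times> carrier R,
     mult = (\<lambda>(a, b) (c, d). (a \<otimes>\<^bsub>R\<^esub> c, (a \<otimes>\<^bsub>R\<^esub> d) \<oplus>\<^bsub>R\<^esub> (b \<otimes>\<^bsub>R\<^esub> c))),
     one = (\<one>\<^bsub>R\<^esub>, \<zero>\<^bsub>R\<^esub>),
     zero = (\<zero>\<^bsub>R\<^esub>, \<zero>\<^bsub>R\<^esub>),
     add = (\<lambda>(a, b) (c, d). (a \<oplus>\<^bsub>R\<^esub> c, b \<oplus>\<^bsub>R\<^esub> d))\<rparr>"

definition complex_dual_numbers :: "(complex \<times> complex) ring" where
  "complex_dual_numbers = dual_numbers (subring_of_type UNIV)"

text \<open>Flatness of \<open>S\<close> as an \<open>R\<close>-module, by the equational criterion: every linear relation in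
  \<open>S\<close> with coefficients in \<open>R\<close> follows from relations in \<open>R\<close>.\<close>

definition flat_ring_hom :: "('a, 'm) ring_scheme \<Rightarrow> ('b, 'k) ring_scheme \<Rightarrow> ('a \<Rightarrow> 'b) \<Rightarrow> bool" where
  "flat_ring_hom R S h \<longleftrightarrow> h \<in> ring_hom R S \<and>
     (\<forall>(n::nat) r m. r \<in> {..<n} \<rightarrow> carrier R \<and> m \<in> {..<n} \<rightarrow> carrier S \<and>
        (\<Oplus>\<^bsub>S\<^esub>i\<in>{..<n}. h (r i) \<otimes>\<^bsub>S\<^esub> m i) = \<zero>\<^bsub>S\<^esub> \<longrightarrow>
        (\<exists>(k::nat) a y. (\<forall>i<n. \<forall>j<k. a i j \<in> carrier R) \<and> y \<in> {..<k} \<rightarrow> carrier S \<and>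
           (\<forall>i<n. m i = (\<Oplus>\<^bsub>S\<^esub>j\<in>{..<k}. h (a i j) \<otimes>\<^bsub>S\<^esub> y j)) \<and>
           (\<forall>j<k. (\<Oplus>\<^bsub>R\<^esub>i\<in>{..<n}. r i \<otimes>\<^bsub>R\<^esub> a i j) = \<zero>\<^bsub>R\<^esub>)))"

text \<open>\<open>Y\<close> is a scheme, flat over the dual numbers, and \<open>(i, ic)\<close> is a closed immersion of \<open>X\<close> into
  \<open>Y\<close> that identifies \<open>X\<close> with the fibre of \<open>Y\<close> over the closed point.  The fibre is the closed
  subscheme with ideal sheaf \<open>t \<O>\<^sub>Y\<close>; it has the same underlying space as \<open>Y\<close> because \<open>t\<close> is
  nilpotent.  Thus \<open>i\<close> is a homeomorphism and \<open>ic\<close> is surjective with kernel \<open>t \<O>\<^sub>Y\<close>, as a map of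
  sheaves, i.e. locally.\<close>

definition first_order_deformation ::
    "(complex, 'p, 's) rspace_over \<Rightarrow> (complex \<times> complex, 'q, 't) rspace_over \<Rightarrow>
      ('p \<Rightarrow> 'q) \<Rightarrow> ('q set \<Rightarrow> 't \<Rightarrow> 's) \<Rightarrow> bool" where
  "first_order_deformation X Y i ic \<longleftrightarrow>
     scheme Y \<and>
     str Y \<in> ring_hom complex_dual_numbers (sec Y (carr Y)) \<and>
     (\<forall>y\<in>carr Y. flat_ring_hom complex_dual_numbers (stalk Y y) (\<lambda>r. germ Y y (carr Y) (str Y r))) \<and>
     rs_morphism X Y i ic \<and>
     (\<forall>a b. ic (carr Y) (str Y (a, b)) = str X a) \<and>
     homeomorphic_map (pts X) (pts Y) i \<and>
     (\<forall>V. openin (pts Y) V \<longrightarrow> (\<forall>s\<in>carrier (sec X (preim X i V)). \<forall>y\<in>V.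
        \<exists>W. openin (pts Y) W \<and> y \<in> W \<and> W \<subseteq> V \<and>
          res X (preim X i V) (preim X i W) s \<in> ic W ` carrier (sec Y W))) \<and>
     (\<forall>V. openin (pts Y) V \<longrightarrow> (\<forall>s\<in>carrier (sec Y V).
        ic V s = \<zero>\<^bsub>sec X (preim X i V)\<^esub> \<longleftrightarrow>
        (\<forall>y\<in>V. \<exists>W. openin (pts Y) W \<and> y \<in> W \<and> W \<subseteq> V \<and>
          (\<exists>u\<in>carrier (sec Y W).
             res Y V W s = res Y (carr Y) W (str Y (0, 1)) \<otimes>\<^bsub>sec Y W\<^esub> u))))"

definition deformation_iso ::
    "('p, 's, 'z) rspace_scheme \<Rightarrow>
      (complex \<times> complex, 'q, 't) rspace_over \<Rightarrow> ('p \<Rightarrow> 'q) \<Rightarrow> ('q set \<Rightarrow> 't \<Rightarrow> 's) \<Rightarrow>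
      (complex \<times> complex, 'q', 't') rspace_over \<Rightarrow> ('p \<Rightarrow> 'q') \<Rightarrow> ('q' set \<Rightarrow> 't' \<Rightarrow> 's) \<Rightarrow> bool" where
  "deformation_iso X Y i ic Y' i' ic' \<longleftrightarrow>
     (\<exists>f fs. rs_iso Y Y' f fs \<and>
        (\<forall>r. fs (carr Y') (str Y' r) = str Y r) \<and>
        (\<forall>x\<in>carr X. f (i x) = i' x) \<and>
        (\<forall>V. openin (pts Y') V \<longrightarrow>
           (\<forall>s\<in>carrier (sec Y' V). ic (preim Y f V) (fs V s) = ic' V s)))"

text \<open>The product of \<open>X\<close> with the spectrum of the dual numbers: the same space with structure sheaf
  \<open>\<O>\<^sub>X[t]/(t\<^sup>2)\<close>.\<close>

definition trivial_deformation ::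
    "(complex, 'p, 's) rspace_over \<Rightarrow> (complex \<times> complex, 'p, 's \<times> 's) rspace_over" where
  "trivial_deformation X = \<lparr>
     pts = pts X,
     sec = (\<lambda>U. dual_numbers (sec X U)),
     res = (\<lambda>U V. map_prod (res X U V) (res X U V)),
     str = map_prod (str X) (str X)\<rparr>"

text \<open>The space of first-order deformations, whose elements are isomorphism classes with the class
  of the trivial deformation as zero, vanishes.  The type arguments say in which types the points
  and sections of the deformations are taken; a statement about all deformations is a
  statement with these types arbitrary.\<close>

definition rigid :: "'q itself \<Rightarrow> 't itself \<Rightarrow> (complex, 'p, 's) rspace_over \<Rightarrow> bool" where
  "rigid _ _ X \<longleftrightarrow>
     (\<forall>(Y :: (complex \<times> complex, 'q, 't) rspace_over) i ic. first_order_deformation X Y i ic \<longrightarrow>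
        deformation_iso X Y i ic (trivial_deformation X) (\<lambda>x. x) (\<lambda>_. fst))"

end

theory Submission
  imports Defs
begin

text \<open>The cones over the proper faces of the polytope are the cones over the sets \<open>V\<^sub>h\<close> of the vectors
  \<open>v\<close> of arcs with \<open>h \<bullet> v = 1\<close>, for the functionals \<open>h\<close> with \<open>h \<bullet> v \<le> 1\<close> on all arcs. A linearly dependent
  \<open>V\<^sub>h\<close> of rank at most 3 contains a cycle of length 4 graded by \<open>h\<close>, that is, a square as in (a) or (b);
  conversely an unfilled square is some \<open>V\<^sub>h\<close>. Independent sets of arcs are forests, which extend to
  lattice bases, so simplicial cones are smooth.

  For rigidity, let \<open>Y\<close> be a first-order deformation. On the chart of a smooth cone the characters lift
  multiplicatively to \<open>Y\<close>, and lifts from two charts differ over the torus by a derivation, whose part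
  of degree \<open>q\<close> is \<open>\<chi>\<^sup>m \<mapsto> (m \<bullet> a) \<chi>\<^sup>m\<^sup>+\<^sup>q\<close> for a vector \<open>a\<close>. A splitting that is regular on every chart exists
  if for every \<open>q\<close> some vector \<open>d\<close> agrees with the vectors \<open>a\<^sub>v\<close> of the rays \<open>v\<close> with \<open>q \<bullet> v \<le> -2\<close>, and up to a
  multiple of \<open>v\<close> with those where \<open>q \<bullet> v = -1\<close>. This holds because, by the existence of improving
  edges, the vertices with \<open>q \<bullet> v \<le> -2\<close> are connected by edges, and so are the vertices and the vertex
  figures of the face \<open>q \<bullet> v = -1\<close> if no \<open>q \<bullet> v\<close> is smaller; simpliciality in codimension 3 says that the
  edges of these vertex figures correspond to triangles.\<close>

section \<open>Spectra of subrings of domains\<close>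

text \<open>The obstacle is that cones of dimension above 3 need not be simplicial, so that
  characters need not lift multiplicatively on their charts. Two facts bypass these charts: a single
  function lifts over every affine chart, by a partition of unity, and the ring of a chart is cut
  out of the Laurent polynomials by its rays alone. A multiplicative lift over the torus that is
  regular along all rays is therefore regular everywhere. The bounds -2 and -1 count poles: along
  the ray of \<open>v\<close> the monomial \<open>\<chi>\<^sup>m\<^sup>+\<^sup>q\<close> has a pole
  if \<open>(m + q) \<bullet> v < 0\<close>, so among the \<open>m\<close> with
  \<open>m \<bullet> v \<ge> 0\<close> a value \<open>q \<bullet> v \<le> -2\<close> obstructs at
  least those with \<open>m \<bullet> v\<close> equal to 0 or 1, which leaves no freedom, while -1
  obstructs only \<open>m \<bullet> v = 0\<close>, which leaves the multiples of \<open>v\<close>.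
  The variety is integral, so a section of its structure sheaf is a single fraction of Laurent
  polynomials, and statements about the sheaf become identities of fractions. Rigidity is shown by
  constructing the isomorphism with the trivial deformation.\<close>

lemma UN2_const:
  assumes "x \<noteq> {}" "y \<noteq> {}" "\<And>a s b t. \<lbrakk>(a, s) \<in> x; (b, t) \<in> y\<rbrakk> \<Longrightarrow> F a s b t = (c :: 'z set)"
  shows "(\<Union>(a, s)\<in>x. \<Union>(b, t)\<in>y. F a s b t) = c"
proof -
  have "(\<Union>(a, s)\<in>x. \<Union>(b, t)\<in>y. F a s b t) = (\<Union>z\<in>x. \<Union>w\<in>y. c)"
    using assms(3) by (intro SUP_cong) (auto split: prod.splits)
  then show ?thesis using assms(1,2) by auto
qed

text \<open>All chart rings lie in one ring of Laurent polynomials. Fractions are formed in this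
  ambient ring, which makes sections on different charts comparable by cross-multiplication. The
  absence of zero divisors is a condition on the whole type, established for Laurent polynomials in
  \<open>poly_mapping_no_zero_divisors\<close>.\<close>

locale domain_subring =
  fixes A :: "'r::comm_ring_1 set"
  assumes one_mem: "1 \<in> A"
    and diff_mem: "\<lbrakk>a \<in> A; b \<in> A\<rbrakk> \<Longrightarrow> a - b \<in> A"
    and mult_mem: "\<lbrakk>a \<in> A; b \<in> A\<rbrakk> \<Longrightarrow> a * b \<in> A"
    and no_zero_divisors: "(x::'r) * y = 0 \<Longrightarrow> x = 0 \<or> y = 0"
begin

lemma zero_mem: "0 \<in> A"
  using diff_mem[OF one_mem one_mem] by simp

lemma uminus_mem: "a \<in> A \<Longrightarrow> - a \<in> A"
  using diff_mem[OF zero_mem] by simp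

lemma add_mem: "\<lbrakk>a \<in> A; b \<in> A\<rbrakk> \<Longrightarrow> a + b \<in> A"
  using diff_mem[of a "- b"] uminus_mem by simp

lemma power_mem: "a \<in> A \<Longrightarrow> a ^ n \<in> A"
  by (induction n) (auto simp: one_mem mult_mem)

lemma sum_mem: "(\<And>i. i \<in> I \<Longrightarrow> f i \<in> A) \<Longrightarrow> sum f I \<in> A"
  by (induction I rule: infinite_finite_induct) (auto simp: zero_mem add_mem)

lemma prod_mem: "(\<And>i. i \<in> I \<Longrightarrow> f i \<in> A) \<Longrightarrow> prod f I \<in> A"
  by (induction I rule: infinite_finite_induct) (auto simp: one_mem mult_mem)

lemma mult_cancel: "\<lbrakk>z \<noteq> 0; x * z = y * z\<rbrakk> \<Longrightarrow> x = (y::'r)"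
  using no_zero_divisors[of "x - y" z] by (simp add: algebra_simps)

lemma mult_nonzero: "\<lbrakk>x \<noteq> 0; y \<noteq> 0\<rbrakk> \<Longrightarrow> x * y \<noteq> (0::'r)"
  using no_zero_divisors by blast

lemma power_nonzero: "x \<noteq> 0 \<Longrightarrow> x ^ n \<noteq> (0::'r)"
  by (induction n) (auto dest: no_zero_divisors)

lemma prod_nonzero: "(\<And>i. i \<in> I \<Longrightarrow> f i \<noteq> 0) \<Longrightarrow> prod f I \<noteq> (0::'r)"
  by (induction I rule: infinite_finite_induct) (auto dest: no_zero_divisors)

abbreviation R :: "'r ring" where "R \<equiv> subring_of_type A"

lemma cring_R: "cring R"
proof (rule cringI)
  show "abelian_group R"
    by (rule abelian_groupI)
       (auto simp: subring_of_type_def add_mem zero_mem algebra_simps intro: bexI[where x="- _"] uminus_mem)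
  show "comm_monoid R"
    by (rule comm_monoidI) (auto simp: subring_of_type_def mult_mem one_mem algebra_simps)
qed (auto simp: subring_of_type_def algebra_simps)

sublocale cring R by (rule cring_R)

lemma R_simps [simp]:
  "carrier R = A" "mult R = (*)" "one R = 1" "zero R = 0" "add R = (+)"
  by (auto simp: subring_of_type_def)

lemma a_inv_R: "b \<in> A \<Longrightarrow> \<ominus>\<^bsub>R\<^esub> b = - b"
  by (rule minus_equality) (auto simp: uminus_mem)

lemma a_minus_R: "\<lbrakk>a \<in> A; b \<in> A\<rbrakk> \<Longrightarrow> a \<ominus>\<^bsub>R\<^esub> b = a - b"
  by (simp add: a_minus_def a_inv_R)

lemma primeideal_iff:
  "primeideal p R \<longleftrightarrow> p \<subseteq> A \<and> 0 \<in> p \<and> (\<forall>a\<in>p. \<forall>b\<in>p. a + b \<in> p) \<and> (\<forall>a\<in>A. \<forall>b\<in>p. a * b \<in> p) \<and>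
     1 \<notin> p \<and> (\<forall>a\<in>A. \<forall>b\<in>A. a * b \<in> p \<longrightarrow> a \<in> p \<or> b \<in> p)" (is "_ \<longleftrightarrow> ?P")
proof
  assume p: "primeideal p R"
  then interpret primeideal p R .
  have "1 \<notin> p" using I_notcarr one_imp_carrier by auto
  moreover have "a \<in> p \<or> b \<in> p" if "a \<in> A" "b \<in> A" "a * b \<in> p" for a b
    using I_prime that by simp
  ultimately show ?P
    using a_subset additive_subgroup.zero_closed[OF is_additive_subgroup]
      additive_subgroup.a_closed[OF is_additive_subgroup] I_l_closed by simp
next
  assume P: ?P
  have "ideal p R"
  proof (rule idealI)
    show "subgroup p (add_monoid R)"
    proof (rule subgroup.intro)
      fix x assume x: "x \<in> p"
      then have "- x \<in> p" using P uminus_mem[OF one_mem] by force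
      then show "inv\<^bsub>add_monoid R\<^esub> x \<in> p"
        using a_inv_R[of x] x P by (auto simp: a_inv_def)
    qed (use P in auto)
  next
    fix a x assume "a \<in> p" "x \<in> carrier R"
    then show "x \<otimes>\<^bsub>R\<^esub> a \<in> p" "a \<otimes>\<^bsub>R\<^esub> x \<in> p" using P by (simp_all, metis mult.commute)
  qed (rule ring_axioms)
  then show "primeideal p R"
    by (rule primeidealI) (use P one_mem in \<open>auto simp: is_cring\<close>)
qed

lemma primeidealD:
  assumes "primeideal p R"
  shows "p \<subseteq> A" "0 \<in> p" "1 \<notin> p" "\<lbrakk>a \<in> p; b \<in> p\<rbrakk> \<Longrightarrow> a + b \<in> p" "\<lbrakk>a \<in> A; b \<in> p\<rbrakk> \<Longrightarrow> a * b \<in> p"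
    "\<lbrakk>a \<in> A; b \<in> p\<rbrakk> \<Longrightarrow> b * a \<in> p" "\<lbrakk>a \<in> A; b \<in> A; a \<notin> p; b \<notin> p\<rbrakk> \<Longrightarrow> a * b \<notin> p"
  using assms unfolding primeideal_iff by (blast, blast, blast, blast, blast, metis mult.commute, blast)

lemma primeideal_power_notin:
  "\<lbrakk>primeideal p R; a \<in> A; a \<notin> p\<rbrakk> \<Longrightarrow> a ^ n \<notin> p"
  by (induction n) (simp_all add: power_mem primeidealD(3,7))

lemma primeideal_zero: "primeideal {0} R"
proof -
  have "primeideal {0} R" if "(1::'r) \<noteq> 0"
    unfolding primeideal_iff using zero_mem that by (auto dest: no_zero_divisors)
  then show ?thesis by simp
qed

text \<open>An ideal maximal among those avoiding the powers of \<open>f\<close> is prime: adjoining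
  an element outside it captures a power of \<open>f\<close>, and the product of two such powers
  would fall into the ideal if the product of the two elements did. Used with \<open>f = h\<close>
  for functions on a basic open set and with \<open>f = 1\<close> to put a proper ideal into a
  prime.\<close>

lemma primeideal_avoiding_powers:
  assumes "I \<subseteq> A" "0 \<in> I" "\<And>a b. \<lbrakk>a \<in> I; b \<in> I\<rbrakk> \<Longrightarrow> a + b \<in> I" "\<And>a b. \<lbrakk>a \<in> A; b \<in> I\<rbrakk> \<Longrightarrow> a * b \<in> I"
    and "f \<in> A" "\<And>n. f ^ n \<notin> I"
  obtains p where "primeideal p R" "I \<subseteq> p" "f \<notin> p"
proof -
  define \<J> where "\<J> = {J. I \<subseteq> J \<and> J \<subseteq> A \<and> (\<forall>a\<in>J. \<forall>b\<in>J. a + b \<in> J) \<and> (\<forall>a\<in>A. \<forall>b\<in>J. a * b \<in> J) \<and>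
     (\<forall>n. f ^ n \<notin> J)}"
  have "I \<in> \<J>" using assms by (auto simp: \<J>_def)
  have "\<exists>M\<in>\<J>. \<forall>X\<in>\<J>. M \<subseteq> X \<longrightarrow> X = M"
  proof (rule subset_Zorn_nonempty)
    show "\<J> \<noteq> {}" using \<open>I \<in> \<J>\<close> by auto
    fix \<C> assume ne: "\<C> \<noteq> {}" and chain: "subset.chain \<J> \<C>"
    have "a + b \<in> \<Union>\<C>" if ab: "a \<in> \<Union>\<C>" "b \<in> \<Union>\<C>" for a b
    proof -
      obtain X Y where XY: "a \<in> X" "X \<in> \<C>" "b \<in> Y" "Y \<in> \<C>" using ab by auto
      then have "X \<subseteq> Y \<or> Y \<subseteq> X" using chain by (auto simp: subset.chain_def)
      moreover have "X \<in> \<J>" "Y \<in> \<J>" using chain XY by (auto simp: subset.chain_def)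
      ultimately have "(a \<in> Y \<and> b \<in> Y) \<or> (a \<in> X \<and> b \<in> X)" "X \<in> \<J>" "Y \<in> \<J>"
        using XY by auto
      then have "a + b \<in> X \<or> a + b \<in> Y" by (auto simp: \<J>_def)
      then show ?thesis using XY by auto
    qed
    moreover have C: "I \<subseteq> X \<and> X \<subseteq> A \<and> (\<forall>a\<in>A. \<forall>b\<in>X. a * b \<in> X) \<and> (\<forall>n. f ^ n \<notin> X)"
      if "X \<in> \<C>" for X
      using chain that by (auto simp: subset.chain_def \<J>_def)
    moreover obtain X where "X \<in> \<C>" using ne by auto
    moreover have "a * b \<in> \<Union>\<C>" if "a \<in> A" "b \<in> \<Union>\<C>" for a b using C that by blast
    ultimately show "\<Union>\<C> \<in> \<J>"
      unfolding \<J>_def by (intro CollectI conjI) (use C in blast)+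
  qed
  then obtain p where p: "p \<in> \<J>" and max: "\<And>X. \<lbrakk>X \<in> \<J>; p \<subseteq> X\<rbrakk> \<Longrightarrow> X = p" by auto
  have pA: "p \<subseteq> A" and padd: "\<And>a b. \<lbrakk>a \<in> p; b \<in> p\<rbrakk> \<Longrightarrow> a + b \<in> p"
    and pmul: "\<And>a b. \<lbrakk>a \<in> A; b \<in> p\<rbrakk> \<Longrightarrow> a * b \<in> p" and pf: "\<And>n. f ^ n \<notin> p" and Ip: "I \<subseteq> p"
    using p by (auto simp: \<J>_def)
  have ext: "\<exists>n. \<exists>c\<in>A. \<exists>z\<in>p. f ^ n = c * a + z" if a: "a \<in> A" "a \<notin> p" for a
  proof (rule ccontr)
    assume no: "\<not> ?thesis"
    define J where "J = {c * a + z | c z. c \<in> A \<and> z \<in> p}"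
    have "p \<subseteq> J"
    proof
      fix z assume "z \<in> p"
      then have "z = 0 * a + z \<and> 0 \<in> A \<and> z \<in> p" using zero_mem by simp
      then show "z \<in> J" unfolding J_def by blast
    qed
    moreover have "J \<in> \<J>"
      unfolding \<J>_def
    proof (intro CollectI conjI ballI allI)
      show "I \<subseteq> J" using \<open>p \<subseteq> J\<close> Ip by auto
      show "J \<subseteq> A" using a pA by (auto simp: J_def intro!: add_mem mult_mem)
      fix x y assume "x \<in> J" "y \<in> J"
      then obtain c z c' z' where "x = c * a + z" "y = c' * a + z'" "c \<in> A" "z \<in> p" "c' \<in> A" "z' \<in> p"
        by (auto simp: J_def)
      then have "x + y = (c + c') * a + (z + z')" "c + c' \<in> A" "z + z' \<in> p"
        using padd add_mem by (auto simp: algebra_simps)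
      then show "x + y \<in> J" unfolding J_def by blast
    next
      fix x y assume "x \<in> A" "y \<in> J"
      then obtain c z where cz: "y = c * a + z" "c \<in> A" "z \<in> p" by (auto simp: J_def)
      then have "x * y = (x * c) * a + x * z" "x * c \<in> A" "x * z \<in> p"
        using pmul mult_mem \<open>x \<in> A\<close> by (auto simp: algebra_simps)
      then show "x * y \<in> J" unfolding J_def by blast
    next
      fix n show "f ^ n \<notin> J" using no by (auto simp: J_def)
    qed
    ultimately have "J = p" using max by auto
    have "a = 1 * a + 0 \<and> 1 \<in> A \<and> 0 \<in> p" using one_mem Ip assms(2) by auto
    then have "a \<in> J" unfolding J_def by blast
    then show False using a \<open>J = p\<close> by auto
  qed
  have "primeideal p R"
    unfolding primeideal_iff
  proof (intro conjI ballI impI)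
    show "1 \<notin> p" using pf[of 0] by simp
    show "0 \<in> p" using Ip assms by auto
    fix a b assume ab: "a \<in> A" "b \<in> A" "a * b \<in> p"
    show "a \<in> p \<or> b \<in> p"
    proof (rule ccontr)
      assume "\<not> ?thesis"
      then obtain n c z n' c' z' where
        *: "f ^ n = c * a + z" "c \<in> A" "z \<in> p" "f ^ n' = c' * b + z'" "c' \<in> A" "z' \<in> p"
        using ext ab by metis
      have "f ^ (n + n') = (c * c') * (a * b) + ((c * a) * z' + f ^ n' * z)"
        by (simp add: power_add *(1)) (simp add: *(4) algebra_simps)
      moreover have "(c * c') * (a * b) + ((c * a) * z' + f ^ n' * z) \<in> p"
        using padd[OF pmul[of "c * c'" "a * b"] padd[OF pmul[of "c * a" z'] pmul[of "f ^ n'" z]]]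
          *(2,3,5,6) ab assms(5) mult_mem power_mem by simp
      ultimately show False using pf by metis
    qed
  qed (use pA padd pmul in auto)
  then show thesis using that Ip pf[of 1] by auto
qed

end

text \<open>The fraction \<open>f/g\<close> of two elements of the ambient domain, viewed in the localization of
  \<open>A\<close> at \<open>p\<close>; it is empty if \<open>f/g\<close> is not in this localization.\<close>

definition gfrac :: "'r::comm_ring_1 set \<Rightarrow> 'r set \<Rightarrow> 'r \<Rightarrow> 'r \<Rightarrow> ('r \<times> 'r) set" where
  "gfrac A p f g = {(b, t). b \<in> A \<and> t \<in> A - p \<and> f * t = b * g}"

definition basic_open :: "'r::comm_ring_1 set \<Rightarrow> 'r \<Rightarrow> 'r set set" where
  "basic_open A f = {p. primeideal p (subring_of_type A) \<and> f \<notin> p}"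

section \<open>Localizations, the Zariski topology and sections in terms of fractions of the ambient
  domain\<close>

context domain_subring
begin

text \<open>The multiplier \<open>u\<close> in the definition of a fraction lies outside
  \<open>p\<close>, so it is nonzero and cancels in a domain.\<close>

lemma fraction_eq_gfrac:
  assumes "primeideal p R" "a \<in> A" "s \<in> A"
  shows "fraction R p a s = gfrac A p a s"
proof -
  have "(\<exists>u\<in>A - p. u * (a * t - b * s) = 0) \<longleftrightarrow> a * t = b * s" for b t
  proof
    assume "\<exists>u\<in>A - p. u * (a * t - b * s) = 0"
    then obtain u where "u \<notin> p" "u * (a * t - b * s) = 0" by auto
    then show "a * t = b * s" using no_zero_divisors[of u "a * t - b * s"] primeidealD(2)[OF assms(1)] by auto
  qed (use primeidealD(3)[OF assms(1)] one_mem in \<open>auto intro: bexI[of _ 1]\<close>)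
  then show ?thesis
    using assms(2,3) unfolding fraction_def gfrac_def by (simp add: a_minus_R mult_mem cong: conj_cong)
qed

lemma gfrac_self_mem: "\<lbrakk>a \<in> A; s \<in> A; s \<notin> p\<rbrakk> \<Longrightarrow> (a, s) \<in> gfrac A p a s"
  by (simp add: gfrac_def)

lemma gfrac_memD:
  assumes "(b, t) \<in> gfrac A p f g" "primeideal p R"
  shows "b \<in> A" "t \<in> A" "t \<notin> p" "f * t = b * g" "t \<noteq> 0"
  using assms primeidealD(2) by (auto simp: gfrac_def)

lemma gfrac_cong:
  assumes "f * g' = f' * g" "g \<noteq> 0" "g' \<noteq> 0"
  shows "gfrac A p f g = gfrac A p f' g'"
proof -
  have "f * t = b * g \<longleftrightarrow> f' * t = b * g'" for b t
  proof
    assume "f * t = b * g"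
    then have "(f' * t) * g = (b * g') * g" using assms(1) by (metis mult.assoc mult.commute)
    then show "f' * t = b * g'" using assms mult_cancel by blast
  next
    assume "f' * t = b * g'"
    then have "(f * t) * g' = (b * g) * g'" using assms(1) by (metis mult.assoc mult.commute)
    then show "f * t = b * g" using assms mult_cancel by blast
  qed
  then show ?thesis by (simp add: gfrac_def)
qed

lemma gfrac_eq_iff:
  assumes "primeideal p R" "g \<noteq> 0" "g' \<noteq> 0" "gfrac A p f g \<noteq> {}"
  shows "gfrac A p f g = gfrac A p f' g' \<longleftrightarrow> f * g' = f' * g"
proof
  assume eq: "gfrac A p f g = gfrac A p f' g'"
  obtain b t where bt: "(b, t) \<in> gfrac A p f g" using assms(4) by auto
  have "f * t = b * g" "f' * t = b * g'" "t \<noteq> 0"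
    using gfrac_memD[OF bt assms(1)] gfrac_memD[of b t p f' g'] bt eq assms(1) by auto
  then have "(f * g') * t = (f' * g) * t" by (metis mult.assoc mult.commute)
  then show "f * g' = f' * g" using \<open>t \<noteq> 0\<close> mult_cancel by blast
qed (use gfrac_cong assms in blast)

lemma gfrac_mem_eq:
  assumes "primeideal p R" "(b, t) \<in> gfrac A p f g" "g \<noteq> 0"
  shows "gfrac A p b t = gfrac A p f g"
  using gfrac_memD[OF assms(2,1)] assms by (intro gfrac_cong) auto

text \<open>Naming the elements by arbitrary ambient \<open>f\<close> and \<open>g\<close> avoids
  choosing numerators and denominators in \<open>A\<close>; regularity at \<open>p\<close> is then
  nonemptiness.\<close>

lemma carrier_localization:
  assumes "primeideal p R"
  shows "carrier (localization R p) = {gfrac A p f g | f g. g \<noteq> 0 \<and> gfrac A p f g \<noteq> {}}"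
proof (intro equalityI subsetI)
  fix x assume "x \<in> carrier (localization R p)"
  then obtain a s where "a \<in> A" "s \<in> A - p" "x = fraction R p a s" by (auto simp: localization_def)
  then show "x \<in> {gfrac A p f g | f g. g \<noteq> 0 \<and> gfrac A p f g \<noteq> {}}"
    using assms fraction_eq_gfrac[OF assms] gfrac_self_mem[of a s p] primeidealD(2)[OF assms] by blast
next
  fix x assume "x \<in> {gfrac A p f g | f g. g \<noteq> 0 \<and> gfrac A p f g \<noteq> {}}"
  then obtain f g b t where *: "x = gfrac A p f g" "g \<noteq> 0" "(b, t) \<in> gfrac A p f g" by auto
  then have "x = fraction R p b t" "b \<in> A" "t \<in> A - p"
    using gfrac_mem_eq[OF assms] gfrac_memD[OF _ assms, of b t f g] fraction_eq_gfrac[OF assms] by auto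
  then show "x \<in> carrier (localization R p)" by (auto simp: localization_def)
qed

lemma localization_mult:
  assumes p: "primeideal p R" and "g \<noteq> 0" "g' \<noteq> 0" "gfrac A p f g \<noteq> {}" "gfrac A p f' g' \<noteq> {}"
  shows "gfrac A p f g \<otimes>\<^bsub>localization R p\<^esub> gfrac A p f' g' = gfrac A p (f * f') (g * g')"
proof -
  have "fraction R p (a * b) (s * t) = gfrac A p (f * f') (g * g')"
    if "(a, s) \<in> gfrac A p f g" "(b, t) \<in> gfrac A p f' g'" for a s b t
  proof -
    note 1 = gfrac_memD[OF that(1) p] and 2 = gfrac_memD[OF that(2) p]
    have "(a * b) * (g * g') = (f * f') * (s * t)" using 1(4) 2(4) by (metis mult.assoc mult.commute)
    then have "gfrac A p (a * b) (s * t) = gfrac A p (f * f') (g * g')"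
      using 1 2 assms by (intro gfrac_cong mult_nonzero) auto
    then show ?thesis using 1 2 p by (simp add: fraction_eq_gfrac mult_mem)
  qed
  then show ?thesis
    unfolding localization_def using assms by (simp add: UN2_const)
qed

lemma localization_add:
  assumes p: "primeideal p R" and "g \<noteq> 0" "g' \<noteq> 0" "gfrac A p f g \<noteq> {}" "gfrac A p f' g' \<noteq> {}"
  shows "gfrac A p f g \<oplus>\<^bsub>localization R p\<^esub> gfrac A p f' g' = gfrac A p (f * g' + f' * g) (g * g')"
proof -
  have "fraction R p (a * t + b * s) (s * t) = gfrac A p (f * g' + f' * g) (g * g')"
    if "(a, s) \<in> gfrac A p f g" "(b, t) \<in> gfrac A p f' g'" for a s b t
  proof -
    note 1 = gfrac_memD[OF that(1) p] and 2 = gfrac_memD[OF that(2) p]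
    have "(a * t + b * s) * (g * g') = (a * g) * t * g' + (b * g') * s * g" by (simp add: algebra_simps)
    also have "\<dots> = (f * g' + f' * g) * (s * t)"
      unfolding 1(4)[symmetric] 2(4)[symmetric] by (simp add: algebra_simps)
    finally have "gfrac A p (a * t + b * s) (s * t) = gfrac A p (f * g' + f' * g) (g * g')"
      using 1 2 assms by (intro gfrac_cong mult_nonzero) auto
    then show ?thesis using 1 2 p by (simp add: fraction_eq_gfrac mult_mem add_mem)
  qed
  then show ?thesis
    unfolding localization_def using assms by (simp add: UN2_const)
qed

lemma localization_one_zero:
  assumes "primeideal p R"
  shows "\<one>\<^bsub>localization R p\<^esub> = gfrac A p 1 1" "\<zero>\<^bsub>localization R p\<^esub> = gfrac A p 0 1"
  using assms by (auto simp: localization_def fraction_eq_gfrac one_mem zero_mem)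

lemma gfrac_mult_nonempty:
  assumes "primeideal p R" "gfrac A p f g \<noteq> {}" "gfrac A p f' g' \<noteq> {}"
  shows "gfrac A p (f * f') (g * g') \<noteq> {}"
proof -
  obtain b t b' t' where 0: "(b, t) \<in> gfrac A p f g" "(b', t') \<in> gfrac A p f' g'" using assms by auto
  note 1 = gfrac_memD[OF 0(1) assms(1)] and 2 = gfrac_memD[OF 0(2) assms(1)]
  have "(b * b', t * t') \<in> gfrac A p (f * f') (g * g')"
    using 1 2 primeidealD(7)[OF assms(1), of t t'] unfolding gfrac_def
    by (simp add: mult_mem) (metis mult.assoc mult.commute)
  then show ?thesis by auto
qed

lemma gfrac_add_nonempty:
  assumes "primeideal p R" "gfrac A p f g \<noteq> {}" "gfrac A p f' g' \<noteq> {}"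
  shows "gfrac A p (f * g' + f' * g) (g * g') \<noteq> {}"
proof -
  obtain b t b' t' where 0: "(b, t) \<in> gfrac A p f g" "(b', t') \<in> gfrac A p f' g'" using assms by auto
  note 1 = gfrac_memD[OF 0(1) assms(1)] and 2 = gfrac_memD[OF 0(2) assms(1)]
  have "(f * g' + f' * g) * (t * t') = (f * t) * g' * t' + (f' * t') * g * t" by (simp add: algebra_simps)
  also have "\<dots> = (b * t' + b' * t) * (g * g')" unfolding 1(4) 2(4) by (simp add: algebra_simps)
  finally have "(b * t' + b' * t, t * t') \<in> gfrac A p (f * g' + f' * g) (g * g')"
    using 1 2 primeidealD(7)[OF assms(1), of t t'] unfolding gfrac_def
    by (simp add: mult_mem add_mem)
  then show ?thesis by auto
qed

lemma gfrac_mem_nonempty: "\<lbrakk>f \<in> A; primeideal p R\<rbrakk> \<Longrightarrow> gfrac A p f 1 \<noteq> {}"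
  using gfrac_self_mem[of f 1 p] one_mem primeidealD(3) by blast

lemma gfrac_uminus_nonempty: "gfrac A p f g \<noteq> {} \<Longrightarrow> gfrac A p (- f) g \<noteq> {}"
proof -
  assume "gfrac A p f g \<noteq> {}"
  then obtain b t where "(b, t) \<in> gfrac A p f g" by auto
  then have "(- b, t) \<in> gfrac A p (- f) g" by (auto simp: gfrac_def uminus_mem)
  then show ?thesis by auto
qed

lemma openin_zariski:
  "openin (zariski R) U \<longleftrightarrow> (\<forall>p\<in>U. \<exists>f\<in>A. p \<in> basic_open A f \<and> basic_open A f \<subseteq> U)"
proof
  assume "openin (zariski R) U"
  then have "generate_topology_on {{p. primeideal p R \<and> f \<notin> p} | f. f \<in> carrier R} U"
    by (simp add: zariski_def openin_topology_generated_by_iff)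
  then show "\<forall>p\<in>U. \<exists>f\<in>A. p \<in> basic_open A f \<and> basic_open A f \<subseteq> U"
  proof induction
    case (Int a b)
    show ?case
    proof
      fix p assume "p \<in> a \<inter> b"
      then obtain f g where fg: "f \<in> A" "p \<in> basic_open A f" "basic_open A f \<subseteq> a"
        "g \<in> A" "p \<in> basic_open A g" "basic_open A g \<subseteq> b" using Int by blast
      have "basic_open A (f * g) \<subseteq> basic_open A f \<inter> basic_open A g"
        using primeidealD(5,6) fg by (auto simp: basic_open_def)
      moreover have "p \<in> basic_open A (f * g)"
        using fg primeidealD(7)[of p f g] by (auto simp: basic_open_def)
      ultimately show "\<exists>f\<in>A. p \<in> basic_open A f \<and> basic_open A f \<subseteq> a \<inter> b"
        using fg mult_mem by blast
    qed
  next
    case (UN K) then show ?case by (meson Sup_upper UnionE subset_trans)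
  next
    case (Basis s) then show ?case by (auto simp: basic_open_def)
  qed auto
next
  assume *: "\<forall>p\<in>U. \<exists>f\<in>A. p \<in> basic_open A f \<and> basic_open A f \<subseteq> U"
  have "U = \<Union>{basic_open A f | f. f \<in> A \<and> basic_open A f \<subseteq> U}" using * by blast
  moreover have "openin (zariski R) (basic_open A f)" if "f \<in> A" for f
    unfolding zariski_def by (rule topology_generated_by_Basis) (use that in \<open>auto simp: basic_open_def\<close>)
  ultimately show "openin (zariski R) U"
    by (subst \<open>U = _\<close>, intro openin_Union) auto
qed

lemma openin_basic_open: "f \<in> A \<Longrightarrow> openin (zariski R) (basic_open A f)"
  unfolding openin_zariski by auto

lemma topspace_zariski: "topspace (zariski R) = {p. primeideal p R}"
proof -
  have "openin (zariski R) {p. primeideal p R}"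
  proof -
    have "basic_open A 1 = {p. primeideal p R}" using primeidealD(3) by (auto simp: basic_open_def)
    then show ?thesis using openin_basic_open[OF one_mem] by simp
  qed
  moreover have "topspace (zariski R) \<subseteq> {p. primeideal p R}"
    using openin_zariski[of "topspace (zariski R)"] by (force simp: basic_open_def)
  ultimately show ?thesis using openin_subset by blast
qed

lemma openin_zariski_prime: "\<lbrakk>openin (zariski R) U; p \<in> U\<rbrakk> \<Longrightarrow> primeideal p R"
  unfolding openin_zariski basic_open_def by blast

text \<open>The zero ideal is the generic point, as no nonzero function vanishes there. Sections are
  compared at this point.\<close>

lemma zero_mem_openin: "\<lbrakk>openin (zariski R) U; p \<in> U\<rbrakk> \<Longrightarrow> {0} \<in> U"
  using primeideal_zero primeidealD(2) unfolding openin_zariski basic_open_def by fastforce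

lemma pts_Spec: "pts (Spec R) = zariski R"
  by (simp add: Spec_def)

lemma carr_Spec: "carr (Spec R) = {p. primeideal p R}"
  by (simp add: pts_Spec topspace_zariski)

text \<open>Any two of the local fractions are equal at the zero ideal, where equality is
  cross-multiplication in the ambient domain; so the fraction of one neighbourhood represents the
  section at every point.\<close>

lemma Spec_sections:
  assumes U: "openin (zariski R) U" "U \<noteq> {}"
    and s: "s \<in> carrier (sec (Spec R) U)"
  obtains f g where "g \<noteq> 0" "\<And>p. p \<in> U \<Longrightarrow> s p = gfrac A p f g \<and> gfrac A p f g \<noteq> {}"
    "s = (\<lambda>p\<in>U. gfrac A p f g)"
proof -
  have loc: "\<exists>V a b. openin (zariski R) V \<and> p \<in> V \<and> V \<subseteq> U \<and> a \<in> A \<and> b \<in> A \<and>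
      (\<forall>q\<in>V. b \<notin> q \<and> s q = gfrac A q a b)" if "p \<in> U" for p
  proof -
    from that have "p \<in> U" .
    have "\<forall>p\<in>U. \<exists>V a b. openin (zariski R) V \<and> p \<in> V \<and> V \<subseteq> U \<and> a \<in> A \<and> b \<in> A \<and>
        (\<forall>q\<in>V. b \<notin> q \<and> s q = fraction R q a b)"
      using s by (simp add: Spec_def)
    from bspec[OF this \<open>p \<in> U\<close>]
    obtain V a b where V: "openin (zariski R) V" "p \<in> V" "V \<subseteq> U" "a \<in> A" "b \<in> A"
        "\<forall>q\<in>V. b \<notin> q \<and> s q = fraction R q a b"
      by (elim exE conjE) (rule that)
    then have "\<forall>q\<in>V. b \<notin> q \<and> s q = gfrac A q a b"
      using fraction_eq_gfrac openin_zariski_prime[OF V(1)] by simp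
    then show ?thesis using V by blast
  qed
  have ext: "s \<in> extensional U" using s by (auto simp: Spec_def PiE_def)
  obtain p0 where p0: "p0 \<in> U" using U by auto
  obtain V a b where V: "openin (zariski R) V" "p0 \<in> V" "V \<subseteq> U" "a \<in> A" "b \<in> A"
     "\<forall>q\<in>V. b \<notin> q \<and> s q = gfrac A q a b" using loc[OF p0] by blast
  have z: "{0} \<in> V" using zero_mem_openin V by auto
  then have b0: "b \<noteq> 0" using V(6) by auto
  have main: "s p = gfrac A p a b \<and> gfrac A p a b \<noteq> {}" if p: "p \<in> U" for p
  proof -
    obtain W c d where W: "openin (zariski R) W" "p \<in> W" "W \<subseteq> U" "c \<in> A" "d \<in> A"
       "\<forall>q\<in>W. d \<notin> q \<and> s q = gfrac A q c d" using loc[OF p] by blast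
    have z': "{0} \<in> W" using zero_mem_openin W by auto
    then have d0: "d \<noteq> 0" using W(6) by auto
    have "gfrac A {0} a b = gfrac A {0} c d" by (rule trans[OF sym[OF conjunct2[OF bspec[OF V(6) z]]] conjunct2[OF bspec[OF W(6) z']]])
    then have "a * d = c * b"
      using gfrac_eq_iff[OF primeideal_zero, of b d a c] gfrac_self_mem[of a b "{0}"] b0 d0 V by auto
    then have "gfrac A p a b = gfrac A p c d" by (rule gfrac_cong[OF _ b0 d0])
    then show ?thesis using W gfrac_self_mem[of c d p] by auto
  qed
  show thesis
  proof (rule that[OF b0 main])
    show "s = (\<lambda>p\<in>U. gfrac A p a b)"
      using ext main by (auto simp: extensional_def restrict_def fun_eq_iff)
  qed
qed

lemma Spec_sectionI:
  assumes U: "openin (zariski R) U" and g: "g \<noteq> 0"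
    and ne: "\<And>p. p \<in> U \<Longrightarrow> gfrac A p f g \<noteq> {}"
  shows "(\<lambda>p\<in>U. gfrac A p f g) \<in> carrier (sec (Spec R) U)"
proof -
  have "\<exists>V a b. openin (zariski R) V \<and> p \<in> V \<and> V \<subseteq> U \<and> a \<in> A \<and> b \<in> A \<and>
           (\<forall>q\<in>V. b \<notin> q \<and> (\<lambda>p\<in>U. gfrac A p f g) q = fraction R q a b)" if p: "p \<in> U" for p
  proof -
    have pp: "primeideal p R" using openin_zariski_prime U p by auto
    obtain a b where "(a, b) \<in> gfrac A p f g" using ne[OF p] by auto
    note ab = gfrac_memD[OF this pp]
    let ?V = "U \<inter> basic_open A b"
    have "openin (zariski R) ?V" using U openin_basic_open ab by auto
    moreover have "p \<in> ?V" using p ab pp by (auto simp: basic_open_def)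
    moreover have "b \<notin> q \<and> (\<lambda>p\<in>U. gfrac A p f g) q = fraction R q a b" if "q \<in> ?V" for q
    proof -
      have "primeideal q R" "b \<notin> q" using that by (auto simp: basic_open_def)
      then show ?thesis using that ab g gfrac_cong[of f b a g q] by (simp add: fraction_eq_gfrac)
    qed
    ultimately show ?thesis using ab by blast
  qed
  moreover have "(\<lambda>p\<in>U. gfrac A p f g) \<in> (\<Pi>\<^sub>E p\<in>U. carrier (localization R p))"
  proof (rule restrict_PiE_iff[THEN iffD2], rule ballI)
    fix p assume "p \<in> U"
    then show "gfrac A p f g \<in> carrier (localization R p)"
      unfolding carrier_localization[OF openin_zariski_prime[OF U \<open>p \<in> U\<close>]] using ne g by blast
  qed
  ultimately show ?thesis by (simp add: Spec_def)
qed

end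

text \<open>The inclusion of \<open>B\<close> into \<open>A\<close> inverts \<open>x\<close> and is the localization of \<open>B\<close> at \<open>x\<close>, so it
  induces an open immersion of spectra.\<close>

locale domain_localization = A: domain_subring A + B: domain_subring B
  for A B :: "'r::comm_ring_1 set" +
  fixes x y :: 'r
  assumes sub: "B \<subseteq> A" and x_mem: "x \<in> B" and y_mem: "y \<in> A" and xy: "x * y = 1"
    and denom: "a \<in> A \<Longrightarrow> \<exists>k. a * x ^ k \<in> B"
begin

lemma contract_prime:
  assumes "primeideal q A.R"
  shows "primeideal (q \<inter> B) B.R"
  unfolding B.primeideal_iff
proof (intro conjI ballI impI)
  fix a b assume "a \<in> B" "b \<in> B" "a * b \<in> q \<inter> B"
  then show "a \<in> q \<inter> B \<or> b \<in> q \<inter> B" using A.primeidealD(7)[OF assms, of a b] sub by auto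
qed (use A.primeidealD[OF assms] B.zero_mem B.add_mem B.mult_mem sub in auto)

lemma denom_mono: "\<lbrakk>a * x ^ k \<in> B; k \<le> l\<rbrakk> \<Longrightarrow> a * x ^ l \<in> B"
  using B.mult_mem[OF _ B.power_mem[OF x_mem], of "a * x ^ k" "l - k"]
  by (simp add: mult.assoc power_add[symmetric])

lemma x_notin: "primeideal q A.R \<Longrightarrow> x \<notin> q"
  using A.primeidealD(3,5) y_mem xy by (metis mult.commute)

text \<open>The prime above \<open>p\<close> consists of the elements that land in \<open>p\<close>
  after a power of \<open>x\<close> has cleared their denominators; primality survives because the
  powers of \<open>x\<close> lie outside \<open>p\<close>.\<close>

lemma extend_prime:
  assumes p: "primeideal p B.R" "x \<notin> p"
  obtains q where "primeideal q A.R" "q \<inter> B = p"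
proof -
  define q where "q = {a \<in> A. \<exists>k. a * x ^ k \<in> p}"
  have xk: "x ^ k \<in> B" "x ^ k \<notin> p" for k
    using B.power_mem x_mem B.primeideal_power_notin p by auto
  have mono: "a * x ^ l \<in> p" if "a * x ^ k \<in> p" "k \<le> l" for a k l
    using B.primeidealD(6)[OF p(1) xk(1)[of "l - k"] that(1)] that(2)
    by (simp add: mult.assoc power_add[symmetric])
  have "primeideal q A.R"
    unfolding A.primeideal_iff
  proof (intro conjI ballI impI)
    show "q \<subseteq> A" by (auto simp: q_def)
    show "0 \<in> q" using B.primeidealD[OF p(1)] A.zero_mem by (auto simp: q_def)
    show "1 \<notin> q" using xk by (auto simp: q_def)
    fix a b
    show "a + b \<in> q" if ab: "a \<in> q" "b \<in> q"
    proof -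
      obtain k l where "a * x ^ k \<in> p" "b * x ^ l \<in> p" "a \<in> A" "b \<in> A" using ab by (auto simp: q_def)
      then have "a * x ^ (k + l) \<in> p" "b * x ^ (k + l) \<in> p" using mono by auto
      then have "(a + b) * x ^ (k + l) \<in> p"
        using B.primeidealD(4)[OF p(1)] by (simp add: distrib_right)
      then show ?thesis using \<open>a \<in> A\<close> \<open>b \<in> A\<close> A.add_mem unfolding q_def by blast
    qed
    show "a * b \<in> q" if ab: "a \<in> A" "b \<in> q"
    proof -
      obtain k l where kl: "a * x ^ k \<in> B" "b * x ^ l \<in> p" "b \<in> A"
        using ab denom[OF ab(1)] by (auto simp: q_def)
      then have "(a * x ^ k) * (b * x ^ l) \<in> p" using B.primeidealD(5)[OF p(1)] by auto
      then have "(a * b) * x ^ (k + l) \<in> p" by (simp add: power_add ac_simps)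
      then show ?thesis using ab(1) kl A.mult_mem unfolding q_def by blast
    qed
    show "a \<in> q \<or> b \<in> q" if ab: "a \<in> A" "b \<in> A" "a * b \<in> q"
    proof -
      obtain k l m where kl: "a * x ^ k \<in> B" "b * x ^ l \<in> B" "(a * b) * x ^ m \<in> p"
        using ab denom[OF ab(1)] denom[OF ab(2)] by (auto simp: q_def)
      have "((a * b) * x ^ m) * x ^ (k + l) \<in> p" using B.primeidealD(6)[OF p(1)] xk kl by blast
      then have "((a * x ^ k) * (b * x ^ l)) * x ^ m \<in> p" by (simp add: power_add ac_simps)
      then have "a * x ^ k \<in> p \<or> b * x ^ l \<in> p"
        using B.primeidealD(7)[OF p(1)] kl xk B.mult_mem by metis
      then show ?thesis using ab by (auto simp: q_def)
    qed
  qed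
  moreover have "q \<inter> B = p"
  proof (intro equalityI subsetI)
    fix a assume "a \<in> q \<inter> B"
    then obtain k where "a * x ^ k \<in> p" "a \<in> B" by (auto simp: q_def)
    then show "a \<in> p" using B.primeidealD(7)[OF p(1) _ xk(1)] xk(2) by blast
  next
    fix a assume "a \<in> p"
    then have "a * x ^ 0 \<in> p" "a \<in> B" using B.primeidealD(1)[OF p(1)] by auto
    then show "a \<in> q \<inter> B" using sub unfolding q_def by blast
  qed
  ultimately show thesis using that by blast
qed

lemma openin_contract_image:
  assumes W: "openin (zariski A.R) W"
  shows "openin (zariski B.R) ((\<lambda>q. q \<inter> B) ` W)"
  unfolding B.openin_zariski
proof
  fix p assume "p \<in> (\<lambda>q. q \<inter> B) ` W"
  then obtain q where q: "q \<in> W" "p = q \<inter> B" by auto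
  then obtain f where f: "f \<in> A" "q \<in> basic_open A f" "basic_open A f \<subseteq> W"
    using W unfolding A.openin_zariski by blast
  obtain k where k: "f * x ^ k \<in> B" using denom f by auto
  have pq: "primeideal q A.R" "f \<notin> q" using f by (auto simp: basic_open_def)
  have xA: "x ^ j \<in> A" for j using A.power_mem x_mem sub by auto
  \<comment> \<open>The extra factor \<open>x\<close> keeps the basic open set away from the primes
    that contain \<open>x\<close>, which are not contractions from \<open>A\<close>. At
    \<open>q\<close> it does no harm, since \<open>x\<close> is a unit of \<open>A\<close>.\<close>
  have g: "f * x ^ Suc k \<in> B" by (rule denom_mono[OF k]) simp
  have "f * x ^ Suc k \<notin> q"
    by (intro A.primeidealD(7)[OF pq(1) f(1) xA pq(2)] A.primeideal_power_notin[OF pq(1)])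
       (use x_notin pq x_mem sub in auto)
  then have "p \<in> basic_open B (f * x ^ Suc k)"
    using q contract_prime pq by (auto simp: basic_open_def)
  moreover have "basic_open B (f * x ^ Suc k) \<subseteq> (\<lambda>q. q \<inter> B) ` W"
  proof
    fix p' assume "p' \<in> basic_open B (f * x ^ Suc k)"
    then have p': "primeideal p' B.R" "(f * x ^ k) * x \<notin> p'" by (auto simp: basic_open_def ac_simps)
    then have "x \<notin> p'" using B.primeidealD(5) k by blast
    then obtain q' where q': "primeideal q' A.R" "q' \<inter> B = p'" using extend_prime p' by blast
    have "f \<notin> q'"
    proof
      assume "f \<in> q'"
      then have "f * x ^ Suc k \<in> q'" using A.primeidealD(6)[OF q'(1) xA] by blast
      then show False using g q' p' by (auto simp: ac_simps)
    qed
    then have "q' \<in> W" using f q' by (auto simp: basic_open_def)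
    then show "p' \<in> (\<lambda>q. q \<inter> B) ` W" using q' by auto
  qed
  ultimately show "\<exists>f\<in>B. p \<in> basic_open B f \<and> basic_open B f \<subseteq> (\<lambda>q. q \<inter> B) ` W" using g by blast
qed

lemma openin_contract_vimage:
  assumes W: "openin (zariski B.R) W"
  shows "openin (zariski A.R) {q. primeideal q A.R \<and> q \<inter> B \<in> W}"
  unfolding A.openin_zariski
proof
  fix q assume "q \<in> {q. primeideal q A.R \<and> q \<inter> B \<in> W}"
  then obtain f where f: "f \<in> B" "q \<inter> B \<in> basic_open B f" "basic_open B f \<subseteq> W" "primeideal q A.R"
    using W unfolding B.openin_zariski by blast
  then have "q \<in> basic_open A f" by (auto simp: basic_open_def)
  moreover have "basic_open A f \<subseteq> {q. primeideal q A.R \<and> q \<inter> B \<in> W}"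
    using f(3) contract_prime by (auto simp: basic_open_def)
  ultimately show "\<exists>f\<in>A. q \<in> basic_open A f \<and> basic_open A f \<subseteq> {q. primeideal q A.R \<and> q \<inter> B \<in> W}"
    using f sub by blast
qed

text \<open>Denominators are cleared by powers of \<open>x\<close>, which lie outside
  \<open>q\<close>. Hence regularity of an ambient fraction at a point does not depend on the chart
  in which the point is seen.\<close>

lemma gfrac_contract_nonempty:
  assumes "primeideal q A.R"
  shows "gfrac B (q \<inter> B) f g \<noteq> {} \<longleftrightarrow> gfrac A q f g \<noteq> {}"
proof
  assume "gfrac A q f g \<noteq> {}"
  then obtain b t where bt: "(b, t) \<in> gfrac A q f g" by auto
  note 1 = A.gfrac_memD[OF bt assms]
  obtain k l where "b * x ^ k \<in> B" "t * x ^ l \<in> B" using denom 1 by meson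
  then have kl: "b * x ^ (k + l) \<in> B" "t * x ^ (k + l) \<in> B" using denom_mono by auto
  have "x ^ (k + l) \<notin> q" "x ^ (k + l) \<in> A"
    using A.primeideal_power_notin[OF assms] x_notin[OF assms] x_mem sub A.power_mem by auto
  then have "t * x ^ (k + l) \<notin> q" using A.primeidealD(7)[OF assms] 1 by auto
  moreover have "f * (t * x ^ (k + l)) = b * x ^ (k + l) * g" using 1(4) by (metis mult.assoc mult.commute)
  ultimately have "(b * x ^ (k + l), t * x ^ (k + l)) \<in> gfrac B (q \<inter> B) f g"
    using kl by (auto simp: gfrac_def)
  then show "gfrac B (q \<inter> B) f g \<noteq> {}" by auto
qed (use sub in \<open>auto simp: gfrac_def\<close>)

end

section \<open>Sections of the structure sheaf of a toric variety\<close>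

text \<open>An extreme point of the Minkowski sum of the supports has a unique decomposition, so its
  coefficient in the product is a product of nonzero coefficients.\<close>

lemma poly_mapping_no_zero_divisors:
  fixes f g :: "'a::euclidean_space \<Rightarrow>\<^sub>0 complex"
  assumes "f * g = 0"
  shows "f = 0 \<or> g = 0"
proof (rule ccontr)
  assume "\<not> ?thesis"
  then have ne: "Poly_Mapping.keys f \<noteq> {}" "Poly_Mapping.keys g \<noteq> {}" by auto
  define S where "S = (\<lambda>(a, b). a + b) ` (Poly_Mapping.keys f \<times> Poly_Mapping.keys g)"
  have "finite S" "S \<noteq> {}" using ne by (auto simp: S_def)
  then have "compact (convex hull S)" "convex hull S \<noteq> {}" by (auto simp: finite_imp_compact_convex_hull)
  then obtain x where x: "x extreme_point_of (convex hull S)"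
    using extreme_point_exists_convex[of "convex hull S"] by auto
  then have "x \<in> S" using extreme_point_of_convex_hull by blast
  then obtain a b where ab: "a \<in> Poly_Mapping.keys f" "b \<in> Poly_Mapping.keys g" "x = a + b"
    by (auto simp: S_def)
  have uniq: "l = a" if l: "l \<in> Poly_Mapping.keys f" "x - l \<in> Poly_Mapping.keys g" for l
  proof -
    \<comment> \<open>Exchanging the second summands of the decompositions \<open>a + b\<close> and
      \<open>l + (x - l)\<close> of \<open>x\<close> gives two points of \<open>S\<close> whose
      midpoint is \<open>x\<close>.\<close>
    let ?p = "a + (x - l)" and ?q = "l + b"
    have "?p \<in> S" "?q \<in> S" using ab l by (auto simp: S_def image_iff intro: rev_bexI)
    then have "?p \<in> convex hull S" "?q \<in> convex hull S" by (auto intro: hull_inc)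
    moreover have "x = midpoint ?p ?q"
      unfolding midpoint_def ab(3) by (simp add: algebra_simps scaleR_2[symmetric])
    ultimately have "?p = ?q" using x unfolding extreme_point_of_def by (metis midpoint_in_open_segment)
    then have "2 *\<^sub>R a = 2 *\<^sub>R l" using ab(3) by (simp add: algebra_simps scaleR_2)
    then show ?thesis by simp
  qed
  have "Poly_Mapping.lookup (f * g) x = (\<Sum>l. Poly_Mapping.lookup f l * (\<Sum>q. Poly_Mapping.lookup g q when q = x - l))"
    unfolding lookup_mult
  proof (rule Sum_any.cong)
    fix l
    have "(x = l + q) = (q = x - l)" for q by (auto simp: algebra_simps)
    then show "Poly_Mapping.lookup f l * (\<Sum>q. Poly_Mapping.lookup g q when x = l + q) = Poly_Mapping.lookup f l * (\<Sum>q. Poly_Mapping.lookup g q when q = x - l)"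
      by simp
  qed
  also have "\<dots> = (\<Sum>l. Poly_Mapping.lookup f l * Poly_Mapping.lookup g (x - l))" by simp
  also have "\<dots> = (\<Sum>l. Poly_Mapping.lookup f l * Poly_Mapping.lookup g b when l = a)"
  proof (rule Sum_any.cong)
    fix l show "Poly_Mapping.lookup f l * Poly_Mapping.lookup g (x - l) = (Poly_Mapping.lookup f l * Poly_Mapping.lookup g b when l = a)"
      using uniq[of l] ab(3) by (auto simp: when_def in_keys_iff)
  qed
  also have "\<dots> = Poly_Mapping.lookup f a * Poly_Mapping.lookup g b" by simp
  finally show False using ab assms by (simp add: in_keys_iff)
qed

section \<open>Semigroup algebras and the inclusions of chart rings\<close>

definition monoid_algebra :: "'a::euclidean_space set \<Rightarrow> ('a \<Rightarrow>\<^sub>0 complex) set" where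
  "monoid_algebra S = {g. Poly_Mapping.keys g \<subseteq> S}"

definition chi :: "'a::euclidean_space \<Rightarrow> ('a \<Rightarrow>\<^sub>0 complex)" where
  "chi m = Poly_Mapping.single m 1"

lemma chi_zero: "chi 0 = 1"
  by (simp add: chi_def)

lemma chi_add: "chi (m + n) = chi m * chi n"
  by (simp add: chi_def mult_single)

lemma chi_power: "chi m ^ k = chi (of_nat k *\<^sub>R m)"
  by (induction k) (auto simp: chi_zero chi_add[symmetric] scaleR_left_distrib)

lemma keys_chi: "Poly_Mapping.keys (chi m) = {m}"
  by (simp add: chi_def)

lemma chi_mem_iff: "chi m \<in> monoid_algebra S \<longleftrightarrow> m \<in> S"
  by (simp add: monoid_algebra_def keys_chi)

lemma monoid_algebra_mono: "S \<subseteq> T \<Longrightarrow> monoid_algebra S \<subseteq> monoid_algebra T"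
  by (auto simp: monoid_algebra_def)

lemma domain_subring_monoid_algebra:
  fixes S :: "'a::euclidean_space set"
  assumes "0 \<in> S" "\<And>m n. \<lbrakk>m \<in> S; n \<in> S\<rbrakk> \<Longrightarrow> m + n \<in> S"
  shows "domain_subring (monoid_algebra S)"
proof
  show "1 \<in> monoid_algebra S" using assms by (simp add: monoid_algebra_def)
  fix f g assume fg: "f \<in> monoid_algebra S" "g \<in> monoid_algebra S"
  show "f - g \<in> monoid_algebra S"
    using fg keys_diff[of f g] by (auto simp: monoid_algebra_def)
  show "f * g \<in> monoid_algebra S"
    using fg keys_mult[of f g] assms(2) unfolding monoid_algebra_def by blast
qed (rule poly_mapping_no_zero_divisors)

lemma dual_monoid_zero: "0 \<in> dual_monoid N \<sigma>"
  by (simp add: dual_monoid_def dual_lattice_def span_zero)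

lemma dual_monoid_add: "\<lbrakk>m \<in> dual_monoid N \<sigma>; n \<in> dual_monoid N \<sigma>\<rbrakk> \<Longrightarrow> m + n \<in> dual_monoid N \<sigma>"
  by (auto simp: dual_monoid_def dual_lattice_def span_add inner_add_left)

lemma dual_monoid_scale: "m \<in> dual_monoid N \<sigma> \<Longrightarrow> of_nat k *\<^sub>R m \<in> dual_monoid N \<sigma>"
  by (induction k) (auto simp: dual_monoid_zero dual_monoid_add scaleR_left_distrib)

lemma dual_monoid_antimono: "\<tau> \<subseteq> \<sigma> \<Longrightarrow> dual_monoid N \<sigma> \<subseteq> dual_monoid N \<tau>"
  by (auto simp: dual_monoid_def)

text \<open>The fans considered here are given by the properties which make the inclusions of the charts
  open immersions: on a face \<open>\<tau>\<close> of \<open>\<sigma>\<close> some monomial \<open>\<chi>\<^sup>m\<close> of the chart of \<open>\<sigma>\<close> becomes invertible,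
  and it suffices as a denominator.\<close>

locale toric_fan =
  fixes N :: "'a::euclidean_space set" and \<Sigma> :: "'a set set"
  assumes origin_mem: "{0} \<in> \<Sigma>"
    and origin_face: "\<sigma> \<in> \<Sigma> \<Longrightarrow> {0} face_of \<sigma>"
    and face_localization: "\<lbrakk>\<sigma> \<in> \<Sigma>; \<tau> \<in> \<Sigma>; \<tau> face_of \<sigma>\<rbrakk> \<Longrightarrow> \<exists>m\<in>dual_monoid N \<sigma>. - m \<in> dual_monoid N \<tau> \<and>
       (\<forall>n\<in>dual_monoid N \<tau>. \<exists>k. n + of_nat k *\<^sub>R m \<in> dual_monoid N \<sigma>)"
begin

definition Rg :: "'a set \<Rightarrow> ('a \<Rightarrow>\<^sub>0 complex) set" where
  "Rg \<sigma> = monoid_algebra (dual_monoid N \<sigma>)"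

abbreviation prm :: "'a set \<Rightarrow> ('a \<Rightarrow>\<^sub>0 complex) set \<Rightarrow> bool" where
  "prm \<sigma> p \<equiv> primeideal p (chart_ring N \<sigma>)"

abbreviation regat :: "'a set \<Rightarrow> ('a \<Rightarrow>\<^sub>0 complex) set \<Rightarrow> ('a \<Rightarrow>\<^sub>0 complex) \<Rightarrow> ('a \<Rightarrow>\<^sub>0 complex) \<Rightarrow> bool" where
  "regat \<sigma> p f g \<equiv> gfrac (Rg \<sigma>) p f g \<noteq> {}"

lemma chart_ring_eq: "chart_ring N \<sigma> = subring_of_type (Rg \<sigma>)"
  by (simp add: chart_ring_def Rg_def monoid_algebra_def)

lemma domain_subring_Rg: "domain_subring (Rg \<sigma>)"
  unfolding Rg_def by (intro domain_subring_monoid_algebra dual_monoid_zero dual_monoid_add)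

sublocale Rg: domain_subring "Rg \<sigma>" for \<sigma>
  by (rule domain_subring_Rg)

lemma Rg_antimono: "\<tau> \<subseteq> \<sigma> \<Longrightarrow> Rg \<sigma> \<subseteq> Rg \<tau>"
  unfolding Rg_def by (intro monoid_algebra_mono dual_monoid_antimono)

lemma face_domain_localization:
  assumes "\<sigma> \<in> \<Sigma>" "\<tau> \<in> \<Sigma>" "\<tau> face_of \<sigma>"
  obtains m where "domain_localization (Rg \<tau>) (Rg \<sigma>) (chi m) (chi (- m))"
proof -
  obtain m where m: "m \<in> dual_monoid N \<sigma>" "- m \<in> dual_monoid N \<tau>"
    "\<And>n. n \<in> dual_monoid N \<tau> \<Longrightarrow> \<exists>k. n + of_nat k *\<^sub>R m \<in> dual_monoid N \<sigma>"
    using face_localization assms by meson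
  have "\<exists>k. a * chi m ^ k \<in> Rg \<sigma>" if a: "a \<in> Rg \<tau>" for a
  proof -
    have ke: "n \<in> dual_monoid N \<tau>" if "n \<in> Poly_Mapping.keys a" for n
      using a that by (auto simp: Rg_def monoid_algebra_def)
    define \<kappa> where "\<kappa> n = (SOME k. n + of_nat k *\<^sub>R m \<in> dual_monoid N \<sigma>)" for n
    have \<kappa>: "n + of_nat (\<kappa> n) *\<^sub>R m \<in> dual_monoid N \<sigma>" if "n \<in> Poly_Mapping.keys a" for n
      using someI_ex[OF m(3)[OF ke[OF that]]] by (simp add: \<kappa>_def)
    \<comment> \<open>One power has to serve the whole finite support: the sum bounds every
      \<open>\<kappa> n\<close>, and surplus multiples of \<open>m\<close> stay in the
      monoid.\<close>
    define k where "k = (\<Sum>n\<in>Poly_Mapping.keys a. \<kappa> n)"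
    have "n + of_nat k *\<^sub>R m \<in> dual_monoid N \<sigma>" if n: "n \<in> Poly_Mapping.keys a" for n
    proof -
      have "\<kappa> n \<le> k" unfolding k_def using n by (intro member_le_sum) auto
      then have "n + of_nat k *\<^sub>R m = (n + of_nat (\<kappa> n) *\<^sub>R m) + of_nat (k - \<kappa> n) *\<^sub>R m"
        by (simp add: of_nat_diff algebra_simps)
      then show ?thesis using dual_monoid_add[OF \<kappa>[OF n] dual_monoid_scale[OF m(1)]] by metis
    qed
    then have "Poly_Mapping.keys (a * chi m ^ k) \<subseteq> dual_monoid N \<sigma>"
      using keys_mult[of a "chi m ^ k"] by (auto simp: chi_power keys_chi)
    then show ?thesis unfolding Rg_def monoid_algebra_def by auto
  qed
  moreover have "Rg \<sigma> \<subseteq> Rg \<tau>" using assms by (intro Rg_antimono face_of_imp_subset)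
  ultimately have "domain_localization (Rg \<tau>) (Rg \<sigma>) (chi m) (chi (- m))"
    using m(1,2) domain_subring_Rg
    by (intro domain_localization.intro domain_localization_axioms.intro)
       (auto simp: chi_add[symmetric] chi_zero Rg_def chi_mem_iff)
  then show thesis by (rule that)
qed

section \<open>Points and topology of the glued space\<close>

definition cls :: "'a set \<times> ('a \<Rightarrow>\<^sub>0 complex) set \<Rightarrow> ('a set \<times> ('a \<Rightarrow>\<^sub>0 complex) set) set" where
  "cls = glue_class \<Sigma> (\<lambda>\<tau> \<sigma>. \<tau> face_of \<sigma>) (\<lambda>\<sigma>. Spec (chart_ring N \<sigma>))
     (\<lambda>\<tau> \<sigma>. Spec_map (chart_ring N \<sigma>) (\<lambda>g. g))"

definition part :: "'a set \<Rightarrow> ('a set \<times> ('a \<Rightarrow>\<^sub>0 complex) set) set set \<Rightarrow> ('a \<Rightarrow>\<^sub>0 complex) set set" where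
  "part = glue_part \<Sigma> (\<lambda>\<tau> \<sigma>. \<tau> face_of \<sigma>) (\<lambda>\<sigma>. Spec (chart_ring N \<sigma>))
     (\<lambda>\<tau> \<sigma>. Spec_map (chart_ring N \<sigma>) (\<lambda>g. g))"

definition step :: "(('a set \<times> ('a \<Rightarrow>\<^sub>0 complex) set) \<times> ('a set \<times> ('a \<Rightarrow>\<^sub>0 complex) set)) set" where
  "step = {((\<tau>, q), (\<sigma>, q \<inter> Rg \<sigma>)) | \<tau> \<sigma> q. \<tau> \<in> \<Sigma> \<and> \<sigma> \<in> \<Sigma> \<and> \<tau> face_of \<sigma> \<and> prm \<tau> q}"

lemma carr_chart: "carr (Spec (chart_ring N \<sigma>)) = {p. prm \<sigma> p}"
  unfolding chart_ring_eq by (rule Rg.carr_Spec)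

lemma Spec_map_chart: "Spec_map (chart_ring N \<sigma>) (\<lambda>g. g) q = q \<inter> Rg \<sigma>"
  by (auto simp: Spec_map_def chart_ring_eq)

lemma cls_eq_Image: "cls z = (step \<union> step\<inverse>)\<^sup>* `` {z}"
proof -
  have "{((i, x), (j, Spec_map (chart_ring N j) (\<lambda>g. g) x)) | i j x. i \<in> \<Sigma> \<and> j \<in> \<Sigma> \<and> i face_of j \<and>
      x \<in> carr (Spec (chart_ring N i))} = step"
    unfolding step_def carr_chart Spec_map_chart by blast
  then show ?thesis unfolding cls_def glue_class_def by (simp add: Let_def)
qed

lemma cls_eq_iff: "cls z = cls w \<longleftrightarrow> (z, w) \<in> (step \<union> step\<inverse>)\<^sup>*"
proof -
  have "sym ((step \<union> step\<inverse>)\<^sup>*)" by (intro sym_rtrancl) (auto simp: sym_def)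
  then show ?thesis unfolding cls_eq_Image
    by (auto intro: rtrancl_trans dest: symD)
qed

lemma cls_step: "\<lbrakk>\<tau> \<in> \<Sigma>; \<sigma> \<in> \<Sigma>; \<tau> face_of \<sigma>; prm \<tau> q\<rbrakk> \<Longrightarrow> cls (\<tau>, q) = cls (\<sigma>, q \<inter> Rg \<sigma>)"
  unfolding cls_eq_iff step_def by (intro r_into_rtrancl) blast

lemma step_prm: "((\<tau>, q), (\<sigma>, p)) \<in> step \<Longrightarrow> prm \<sigma> p \<and> prm \<tau> q \<and> \<sigma> \<in> \<Sigma> \<and> \<tau> \<in> \<Sigma>"
proof -
  assume "((\<tau>, q), (\<sigma>, p)) \<in> step"
  then have *: "\<tau> \<in> \<Sigma>" "\<sigma> \<in> \<Sigma>" "\<tau> face_of \<sigma>" "prm \<tau> q" "p = q \<inter> Rg \<sigma>" by (auto simp: step_def)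
  obtain m where "domain_localization (Rg \<tau>) (Rg \<sigma>) (chi m) (chi (- m))"
    using face_domain_localization[OF *(2,1,3)] .
  then show ?thesis using domain_localization.contract_prime * unfolding chart_ring_eq by blast
qed

text \<open>Two representatives of a point are joined by a zigzag of contractions, and each of them
  preserves regularity in both directions by \<open>gfrac_contract_nonempty\<close>. Regularity is
  thus a property of points of the variety.\<close>

lemma cls_regat:
  assumes "cls (\<sigma>, p) = cls (\<tau>, q)" "regat \<sigma> p f g"
  shows "regat \<tau> q f g"
proof -
  have "((\<sigma>, p), (\<tau>, q)) \<in> (step \<union> step\<inverse>)\<^sup>*" using assms(1) cls_eq_iff by auto
  then show ?thesis
  proof (induction "(\<tau>, q)" arbitrary: \<tau> q rule: rtrancl_induct)
    case base then show ?case using assms by auto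
  next
    case (step z)
    obtain \<gamma> r where z: "z = (\<gamma>, r)" by force
    have "regat \<gamma> r f g" using step z by auto
    moreover have *: "regat \<gamma>' r' f g \<longleftrightarrow> regat \<tau>' q' f g"
      if "((\<gamma>', r'), (\<tau>', q')) \<in> toric_fan.step N \<Sigma>" for \<gamma>' r' \<tau>' q'
    proof -
      have "\<gamma>' \<in> \<Sigma>" "\<tau>' \<in> \<Sigma>" "\<gamma>' face_of \<tau>'" "prm \<gamma>' r'" "q' = r' \<inter> Rg \<tau>'"
        using that by (auto simp: step_def)
      then show ?thesis
        using domain_localization.gfrac_contract_nonempty face_domain_localization[of \<tau>' \<gamma>']
        unfolding chart_ring_eq by metis
    qed
    ultimately show ?case using step(2) z by blast
  qed
qed

abbreviation zar :: "'a set \<Rightarrow> ('a \<Rightarrow>\<^sub>0 complex) set topology" where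
  "zar \<sigma> \<equiv> zariski (chart_ring N \<sigma>)"

text \<open>Neighbourhoods are carried along the zigzag that joins two representatives: with the
  gluing map because contraction is open, against it because contraction is continuous. This makes
  the charts open in the quotient topology.\<close>

lemma cls_open:
  assumes "cls (\<sigma>, p) = cls (\<tau>, q)" "openin (zar \<sigma>) W" "p \<in> W"
  shows "\<exists>W'. openin (zar \<tau>) W' \<and> q \<in> W' \<and> (\<forall>q'\<in>W'. \<exists>p'\<in>W. cls (\<sigma>, p') = cls (\<tau>, q'))"
proof -
  have "((\<sigma>, p), (\<tau>, q)) \<in> (step \<union> step\<inverse>)\<^sup>*" using assms(1) cls_eq_iff by auto
  then show ?thesis
  proof (induction "(\<tau>, q)" arbitrary: \<tau> q rule: rtrancl_induct)
    case base then show ?case using assms by blast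
  next
    case (step z)
    obtain \<gamma> r where z: "z = (\<gamma>, r)" by force
    obtain V where V: "openin (zar \<gamma>) V" "r \<in> V" "\<And>r'. r' \<in> V \<Longrightarrow> \<exists>p'\<in>W. cls (\<sigma>, p') = cls (\<gamma>, r')"
      using step(3)[OF z] by blast
    have "(z, (\<tau>, q)) \<in> toric_fan.step N \<Sigma> \<or> ((\<tau>, q), z) \<in> toric_fan.step N \<Sigma>" using step(2) by auto
    then show ?case
    proof
      assume "(z, (\<tau>, q)) \<in> toric_fan.step N \<Sigma>"
      then have *: "\<gamma> \<in> \<Sigma>" "\<tau> \<in> \<Sigma>" "\<gamma> face_of \<tau>" "prm \<gamma> r" "q = r \<inter> Rg \<tau>" by (auto simp: step_def z)
      obtain m where loc: "domain_localization (Rg \<gamma>) (Rg \<tau>) (chi m) (chi (- m))"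
        using face_domain_localization[OF *(2,1,3)] .
      let ?W = "(\<lambda>r. r \<inter> Rg \<tau>) ` V"
      have "openin (zar \<tau>) ?W"
        using domain_localization.openin_contract_image[OF loc] V unfolding chart_ring_eq by blast
      moreover have "\<exists>p'\<in>W. cls (\<sigma>, p') = cls (\<tau>, q')" if q': "q' \<in> ?W" for q'
      proof -
        obtain r' where r': "r' \<in> V" "q' = r' \<inter> Rg \<tau>" using q' by auto
        then have "prm \<gamma> r'" using Rg.openin_zariski_prime V(1) unfolding chart_ring_eq by blast
        then have "cls (\<gamma>, r') = cls (\<tau>, q')" using cls_step * r' by auto
        then show ?thesis using V(3)[OF r'(1)] by simp
      qed
      ultimately show ?thesis using V(2) * by blast
    next
      assume "((\<tau>, q), z) \<in> toric_fan.step N \<Sigma>"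
      then have *: "\<gamma> \<in> \<Sigma>" "\<tau> \<in> \<Sigma>" "\<tau> face_of \<gamma>" "prm \<tau> q" "r = q \<inter> Rg \<gamma>" by (auto simp: step_def z)
      obtain m where loc: "domain_localization (Rg \<tau>) (Rg \<gamma>) (chi m) (chi (- m))"
        using face_domain_localization[OF *(1,2,3)] .
      let ?W = "{q. prm \<tau> q \<and> q \<inter> Rg \<gamma> \<in> V}"
      have "openin (zar \<tau>) ?W"
        using domain_localization.openin_contract_vimage[OF loc] V unfolding chart_ring_eq by blast
      moreover have "\<exists>p'\<in>W. cls (\<sigma>, p') = cls (\<tau>, q')" if q': "q' \<in> ?W" for q'
        using V(3) cls_step[OF *(2,1,3)] q' by auto
      ultimately show ?thesis using V(2) * by blast
    qed
  qed
qed

abbreviation X where "X \<equiv> toric_variety N \<Sigma>"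

lemma pts_X: "pts X = glue_topology \<Sigma> (\<lambda>\<tau> \<sigma>. \<tau> face_of \<sigma>) (\<lambda>\<sigma>. Spec (chart_ring N \<sigma>))
     (\<lambda>\<tau> \<sigma>. Spec_map (chart_ring N \<sigma>) (\<lambda>g. g))"
  by (simp add: toric_variety_def rspace.defs rspace_over.defs glue_def)

lemma part_eq: "part \<sigma> U = {p. prm \<sigma> p \<and> cls (\<sigma>, p) \<in> U}"
  unfolding part_def glue_part_def cls_def[symmetric] carr_chart by auto

lemma openin_X: "openin (pts X) U \<longleftrightarrow>
  U \<subseteq> {cls (\<sigma>, p) | \<sigma> p. \<sigma> \<in> \<Sigma> \<and> prm \<sigma> p} \<and> (\<forall>\<sigma>\<in>\<Sigma>. openin (zar \<sigma>) (part \<sigma> U))"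
  unfolding pts_X openin_glue_topology cls_def[symmetric] part_def[symmetric] carr_chart
  by (simp add: Spec_def)

lemma openin_chart_image:
  assumes "\<sigma> \<in> \<Sigma>" "openin (zar \<sigma>) W"
  shows "openin (pts X) ((\<lambda>p. cls (\<sigma>, p)) ` W)"
proof -
  have pW: "prm \<sigma> p" if "p \<in> W" for p
    using Rg.openin_zariski_prime assms(2) that unfolding chart_ring_eq by blast
  have "openin (zar \<tau>) (part \<tau> ((\<lambda>p. cls (\<sigma>, p)) ` W))" for \<tau>
  proof (subst openin_subopen, rule ballI)
    fix q assume "q \<in> part \<tau> ((\<lambda>p. cls (\<sigma>, p)) ` W)"
    then obtain p where p: "prm \<tau> q" "cls (\<sigma>, p) = cls (\<tau>, q)" "p \<in> W" by (auto simp: part_eq)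
    obtain W' where W': "openin (zar \<tau>) W'" "q \<in> W'" "\<forall>q'\<in>W'. \<exists>p'\<in>W. cls (\<sigma>, p') = cls (\<tau>, q')"
      using cls_open[OF p(2) assms(2) p(3)] by blast
    have "prm \<tau> q'" if "q' \<in> W'" for q'
      using Rg.openin_zariski_prime W'(1) that unfolding chart_ring_eq by blast
    then have "W' \<subseteq> part \<tau> ((\<lambda>p. cls (\<sigma>, p)) ` W)" using W'(3) by (force simp: part_eq)
    then show "\<exists>T. openin (zar \<tau>) T \<and> q \<in> T \<and> T \<subseteq> part \<tau> ((\<lambda>p. cls (\<sigma>, p)) ` W)" using W' by blast
  qed
  then show ?thesis unfolding openin_X using pW assms by blast
qed

text \<open>A basic open set of a chart, seen in the glued space; \<open>Dop \<sigma> 1\<close> is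
  the whole chart.\<close>

definition Dop :: "'a set \<Rightarrow> ('a \<Rightarrow>\<^sub>0 complex) \<Rightarrow> ('a set \<times> ('a \<Rightarrow>\<^sub>0 complex) set) set set" where
  "Dop \<sigma> f = (\<lambda>p. cls (\<sigma>, p)) ` basic_open (Rg \<sigma>) f"

lemma openin_Dop: "\<lbrakk>\<sigma> \<in> \<Sigma>; f \<in> Rg \<sigma>\<rbrakk> \<Longrightarrow> openin (pts X) (Dop \<sigma> f)"
  unfolding Dop_def using Rg.openin_basic_open by (intro openin_chart_image) (auto simp: chart_ring_eq)

lemma Dop_mono: "\<lbrakk>f \<in> Rg \<sigma>; h \<in> Rg \<sigma>\<rbrakk> \<Longrightarrow> Dop \<sigma> (f * h) \<subseteq> Dop \<sigma> f"
  using Rg.primeidealD(6)[of _ \<sigma> h f] unfolding Dop_def basic_open_def by blast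

lemma Dop_one: "Dop \<sigma> 1 = {cls (\<sigma>, p) | p. prm \<sigma> p}"
  using Rg.primeidealD(3) unfolding Dop_def basic_open_def chart_ring_eq by blast

lemma Dop_subset_one: "Dop \<sigma> f \<subseteq> Dop \<sigma> 1"
  unfolding Dop_one unfolding Dop_def basic_open_def chart_ring_eq by blast

lemma carr_X: "carr X = {cls (\<sigma>, p) | \<sigma> p. \<sigma> \<in> \<Sigma> \<and> prm \<sigma> p}"
proof -
  have 1: "openin (pts X) (\<Union>\<sigma>\<in>\<Sigma>. Dop \<sigma> 1)" using Rg.one_mem openin_Dop by blast
  have 2: "(\<Union>\<sigma>\<in>\<Sigma>. Dop \<sigma> 1) = {cls (\<sigma>, p) | \<sigma> p. \<sigma> \<in> \<Sigma> \<and> prm \<sigma> p}" unfolding Dop_one by blast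
  have 3: "carr X \<subseteq> {cls (\<sigma>, p) | \<sigma> p. \<sigma> \<in> \<Sigma> \<and> prm \<sigma> p}"
    using openin_topspace[of "pts X"] unfolding openin_X by (rule conjunct1)
  show ?thesis using 3 openin_subset[OF 1] unfolding 2 by (rule subset_antisym)
qed

lemma Dop_face:
  assumes "\<sigma> \<in> \<Sigma>" "\<tau> \<in> \<Sigma>" "\<tau> face_of \<sigma>"
  shows "Dop \<tau> 1 \<subseteq> Dop \<sigma> 1"
proof
  fix x assume "x \<in> Dop \<tau> 1"
  then obtain q where q: "prm \<tau> q" "x = cls (\<tau>, q)" by (auto simp: Dop_one)
  then have "((\<tau>, q), (\<sigma>, q \<inter> Rg \<sigma>)) \<in> step" using assms by (auto simp: step_def)
  then have "prm \<sigma> (q \<inter> Rg \<sigma>)" using step_prm by blast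
  then show "x \<in> Dop \<sigma> 1" unfolding Dop_one q(2) cls_step[OF assms(2,1,3) q(1)] by blast
qed

text \<open>The generic point of the variety. It is represented by the zero ideal in every chart
  (\<open>cls_zero\<close>) and lies in every nonempty open set (\<open>eta_mem\<close>).\<close>

definition eta :: "('a set \<times> ('a \<Rightarrow>\<^sub>0 complex) set) set" where "eta = cls ({0}, {0})"

lemma prm_zero: "prm \<sigma> {0}"
  unfolding chart_ring_eq by (rule Rg.primeideal_zero)

lemma cls_zero: "\<sigma> \<in> \<Sigma> \<Longrightarrow> cls (\<sigma>, {0}) = eta"
  using cls_step[OF origin_mem _ origin_face prm_zero, of \<sigma>] Rg.zero_mem[of \<sigma>]
  unfolding eta_def by (simp add: insert_absorb Int_insert_left)

lemma eta_mem:
  assumes "openin (pts X) V" "V \<noteq> {}"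
  shows "eta \<in> V"
proof -
  obtain \<sigma> p where p: "\<sigma> \<in> \<Sigma>" "prm \<sigma> p" "cls (\<sigma>, p) \<in> V" using assms unfolding openin_X by blast
  then have "p \<in> part \<sigma> V" "openin (zar \<sigma>) (part \<sigma> V)" using assms by (auto simp: part_eq openin_X)
  then have "{0} \<in> part \<sigma> V" using Rg.zero_mem_openin unfolding chart_ring_eq by blast
  then show ?thesis using cls_zero p by (auto simp: part_eq)
qed

lemma eta_mem_Dop: "\<lbrakk>\<sigma> \<in> \<Sigma>; f \<noteq> 0\<rbrakk> \<Longrightarrow> eta \<in> Dop \<sigma> f"
  using cls_zero prm_zero unfolding Dop_def basic_open_def chart_ring_eq by force

section \<open>Sections of the structure sheaf as single fractions\<close>

definition sect where
  "sect V f g = (\<lambda>\<sigma>\<in>\<Sigma>. \<lambda>p\<in>part \<sigma> V. gfrac (Rg \<sigma>) p f g)"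

text \<open>The family \<open>sect V f g\<close> takes the empty set as its value where the fraction
  has a pole; \<open>regular\<close> excludes this, and exactly then \<open>sect V f g\<close>
  stands for a genuine function.\<close>

definition regular where
  "regular V f g \<longleftrightarrow> g \<noteq> 0 \<and> (\<forall>\<sigma>\<in>\<Sigma>. \<forall>p\<in>part \<sigma> V. regat \<sigma> p f g)"

lemma sec_X: "sec X U = (let R = \<lambda>i. sec (Spec (chart_ring N i)) (part i U) in \<lparr>
       carrier = {s \<in> (\<Pi>\<^sub>E i\<in>\<Sigma>. carrier (R i)).
         \<forall>i\<in>\<Sigma>. \<forall>j\<in>\<Sigma>. i face_of j \<longrightarrow> s i =
           Spec_pullback (chart_ring N j) (chart_ring N i) (\<lambda>g. g) (part j U) (s j)},
       mult = (\<lambda>s t. \<lambda>i\<in>\<Sigma>. s i \<otimes>\<^bsub>R i\<^esub> t i),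
       one = (\<lambda>i\<in>\<Sigma>. \<one>\<^bsub>R i\<^esub>),
       zero = (\<lambda>i\<in>\<Sigma>. \<zero>\<^bsub>R i\<^esub>),
       add = (\<lambda>s t. \<lambda>i\<in>\<Sigma>. s i \<oplus>\<^bsub>R i\<^esub> t i)\<rparr>)"
  by (simp add: toric_variety_def rspace.defs rspace_over.defs glue_def part_def)

lemma part_prm: "p \<in> part \<sigma> V \<Longrightarrow> primeideal p (Rg.R \<sigma>)"
  by (simp add: part_eq chart_ring_eq)

lemma openin_part: "\<lbrakk>openin (pts X) V; \<sigma> \<in> \<Sigma>\<rbrakk> \<Longrightarrow> openin (zariski (Rg.R \<sigma>)) (part \<sigma> V)"
  by (simp add: openin_X chart_ring_eq)

lemma pullback_gfrac:
  assumes V: "openin (pts X) V" and "\<tau> \<in> \<Sigma>" "\<sigma> \<in> \<Sigma>" "\<tau> face_of \<sigma>"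
    and reg: "regular V f g"
    and s: "\<And>p. p \<in> part \<sigma> V \<Longrightarrow> s p = gfrac (Rg \<sigma>) p f g"
  shows "Spec_pullback (chart_ring N \<sigma>) (chart_ring N \<tau>) (\<lambda>g. g) (part \<sigma> V) s =
    (\<lambda>q\<in>part \<tau> V. gfrac (Rg \<tau>) q f g)"
proof -
  have pre: "preim (Spec (chart_ring N \<tau>)) (Spec_map (chart_ring N \<sigma>) (\<lambda>g. g)) (part \<sigma> V) = part \<tau> V"
  proof -
    have "q \<inter> Rg \<sigma> \<in> part \<sigma> V \<longleftrightarrow> cls (\<tau>, q) \<in> V" if q: "prm \<tau> q" for q
    proof -
      have "((\<tau>, q), (\<sigma>, q \<inter> Rg \<sigma>)) \<in> step" using assms q by (auto simp: step_def)
      then have "prm \<sigma> (q \<inter> Rg \<sigma>)" using step_prm by blast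
      then show ?thesis unfolding cls_step[OF assms(2-4) q] by (simp add: part_eq)
    qed
    then show ?thesis unfolding preim_def carr_chart Spec_map_chart by (auto simp: part_eq)
  qed
  have sub: "Rg \<sigma> \<subseteq> Rg \<tau>" using Rg_antimono face_of_imp_subset assms by auto
  have "(\<Union>(a, b)\<in>s (q \<inter> Rg \<sigma>). fraction (chart_ring N \<tau>) q a b) = gfrac (Rg \<tau>) q f g"
    if q: "q \<in> part \<tau> V" for q
  proof -
    have qs: "q \<inter> Rg \<sigma> \<in> part \<sigma> V" using q pre by (auto simp: preim_def Spec_map_chart)
    have prm: "primeideal q (Rg.R \<tau>)" "primeideal (q \<inter> Rg \<sigma>) (Rg.R \<sigma>)" using q qs part_prm by auto
    have ne: "gfrac (Rg \<sigma>) (q \<inter> Rg \<sigma>) f g \<noteq> {}" and g: "g \<noteq> 0" using reg qs assms by (auto simp: regular_def)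
    have "fraction (chart_ring N \<tau>) q a b = gfrac (Rg \<tau>) q f g"
      if ab: "(a, b) \<in> gfrac (Rg \<sigma>) (q \<inter> Rg \<sigma>) f g" for a b
    proof -
      note 1 = Rg.gfrac_memD[OF ab prm(2)]
      have "fraction (Rg.R \<tau>) q a b = gfrac (Rg \<tau>) q a b"
        using 1 sub prm by (intro Rg.fraction_eq_gfrac) auto
      also have "\<dots> = gfrac (Rg \<tau>) q f g" using 1 g by (intro Rg.gfrac_cong) auto
      finally show ?thesis by (simp add: chart_ring_eq)
    qed
    then have "(\<Union>(a, b)\<in>s (q \<inter> Rg \<sigma>). fraction (chart_ring N \<tau>) q a b) =
        (\<Union>z\<in>gfrac (Rg \<sigma>) (q \<inter> Rg \<sigma>) f g. gfrac (Rg \<tau>) q f g)"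
      unfolding s[OF qs] by (intro SUP_cong) auto
    then show ?thesis using ne by auto
  qed
  then show ?thesis
    unfolding Spec_pullback_def pre Spec_map_chart by (auto simp: restrict_def fun_eq_iff)
qed

lemma sect_in_carrier:
  assumes V: "openin (pts X) V" and reg: "regular V f g"
  shows "sect V f g \<in> carrier (sec X V)"
proof -
  have "sect V f g \<in> (\<Pi>\<^sub>E i\<in>\<Sigma>. carrier (sec (Spec (chart_ring N i)) (part i V)))"
    unfolding sect_def
  proof (rule restrict_PiE_iff[THEN iffD2], rule ballI)
    fix \<sigma> assume "\<sigma> \<in> \<Sigma>"
    then show "(\<lambda>p\<in>part \<sigma> V. gfrac (Rg \<sigma>) p f g) \<in> carrier (sec (Spec (chart_ring N \<sigma>)) (part \<sigma> V))"
      using Rg.Spec_sectionI[OF openin_part[OF V]] reg unfolding chart_ring_eq regular_def by blast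
  qed
  moreover have "sect V f g i = Spec_pullback (chart_ring N j) (chart_ring N i) (\<lambda>g. g) (part j V) (sect V f g j)"
    if "i \<in> \<Sigma>" "j \<in> \<Sigma>" "i face_of j" for i j
    using pullback_gfrac[OF V that reg, of "sect V f g j"] that by (simp add: sect_def)
  ultimately show ?thesis by (simp add: sec_X Let_def)
qed

text \<open>The fraction is read off on the torus chart. Compatibility along the face
  \<open>{0}\<close>, evaluated at the generic point, forces the fraction found on any other chart
  to agree with it by cross-multiplication. Over the empty set there is only one family, written as
  0/1.\<close>

lemma sectionE:
  assumes V: "openin (pts X) V" and s: "s \<in> carrier (sec X V)"
  obtains f g where "regular V f g" "s = sect V f g"
proof (cases "V = {}")
  case True
  then have p: "part \<sigma> V = {}" for \<sigma> by (auto simp: part_eq)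
  have "s \<in> (\<Pi>\<^sub>E i\<in>\<Sigma>. carrier (sec (Spec (chart_ring N i)) (part i V)))" using s by (simp add: sec_X Let_def)
  then have "s = sect V 0 1"
    by (auto simp: PiE_def Pi_def extensional_def sect_def Spec_def p fun_eq_iff restrict_def)
  then show thesis using that[of 0 1] by (simp add: regular_def p)
next
  case False
  have z: "{0} \<in> part \<sigma> V" if "\<sigma> \<in> \<Sigma>" for \<sigma>
    using eta_mem[OF V False] cls_zero[OF that] prm_zero by (simp add: part_eq)
  have sP: "s \<in> (\<Pi>\<^sub>E i\<in>\<Sigma>. carrier (sec (Spec (chart_ring N i)) (part i V)))"
    and comp: "\<And>i j. \<lbrakk>i \<in> \<Sigma>; j \<in> \<Sigma>; i face_of j\<rbrakk> \<Longrightarrow>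
       s i = Spec_pullback (chart_ring N j) (chart_ring N i) (\<lambda>g. g) (part j V) (s j)"
    using s by (simp_all add: sec_X Let_def)
  have ex: "\<exists>f g. g \<noteq> 0 \<and> (\<forall>p\<in>part \<sigma> V. s \<sigma> p = gfrac (Rg \<sigma>) p f g \<and> regat \<sigma> p f g) \<and>
      s \<sigma> = (\<lambda>p\<in>part \<sigma> V. gfrac (Rg \<sigma>) p f g)" if "\<sigma> \<in> \<Sigma>" for \<sigma>
  proof -
    have "s \<sigma> \<in> carrier (sec (Spec (Rg.R \<sigma>)) (part \<sigma> V))"
      using sP that unfolding chart_ring_eq by auto
    then show ?thesis
      using Rg.Spec_sections[OF openin_part[OF V that]] z[OF that] by (metis empty_iff)
  qed
  obtain f g where fg: "g \<noteq> 0" "\<And>p. p \<in> part {0} V \<Longrightarrow> s {0} p = gfrac (Rg {0}) p f g"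
      "\<And>p. p \<in> part {0} V \<Longrightarrow> regat {0} p f g"
    using ex[OF origin_mem] by blast
  have main: "s \<sigma> = (\<lambda>p\<in>part \<sigma> V. gfrac (Rg \<sigma>) p f g) \<and> (\<forall>p\<in>part \<sigma> V. regat \<sigma> p f g)" if \<sigma>: "\<sigma> \<in> \<Sigma>" for \<sigma>
  proof -
    obtain a b where ab: "b \<noteq> 0" "\<And>p. p \<in> part \<sigma> V \<Longrightarrow> s \<sigma> p = gfrac (Rg \<sigma>) p a b"
       "\<And>p. p \<in> part \<sigma> V \<Longrightarrow> regat \<sigma> p a b" "s \<sigma> = (\<lambda>p\<in>part \<sigma> V. gfrac (Rg \<sigma>) p a b)"
      using ex[OF \<sigma>] by blast
    let ?z = "{0} :: ('a \<Rightarrow>\<^sub>0 complex) set"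
    have "s {0} ?z = (\<Union>(c, d)\<in>s \<sigma> ?z. fraction (chart_ring N {0}) ?z c d)"
    proof -
      have "?z \<in> preim (Spec (chart_ring N {0})) (Spec_map (chart_ring N \<sigma>) (\<lambda>g. g)) (part \<sigma> V)"
        "Spec_map (chart_ring N \<sigma>) (\<lambda>g. g) ?z = ?z"
        using z[OF \<sigma>] Rg.zero_mem[of \<sigma>] prm_zero unfolding preim_def carr_chart Spec_map_chart
        by (auto simp: Int_insert_left)
      then show ?thesis
        using comp[OF origin_mem \<sigma> origin_face[OF \<sigma>]] unfolding Spec_pullback_def by simp
    qed
    moreover obtain c d where cd: "(c, d) \<in> gfrac (Rg \<sigma>) ?z a b" using ab(3)[OF z[OF \<sigma>]] by auto
    ultimately have sub: "fraction (chart_ring N {0}) ?z c d \<subseteq> gfrac (Rg {0}) ?z f g"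
      using fg(2)[OF z[OF origin_mem]] ab(2)[OF z[OF \<sigma>]] by auto
    have "Rg \<sigma> \<subseteq> Rg {0}" using Rg_antimono face_of_imp_subset origin_face[OF \<sigma>] by auto
    note 1 = Rg.gfrac_memD[OF cd Rg.primeideal_zero]
    then have cd0: "c \<in> Rg {0}" "d \<in> Rg {0}" "d \<noteq> 0" using \<open>Rg \<sigma> \<subseteq> Rg {0}\<close> by auto
    then have "(c, d) \<in> fraction (chart_ring N {0}) ?z c d"
      unfolding chart_ring_eq using Rg.fraction_eq_gfrac[OF Rg.primeideal_zero] Rg.gfrac_self_mem by auto
    then have "(c, d) \<in> gfrac (Rg {0}) ?z f g" using sub by blast
    then have "f * d = c * g" by (rule Rg.gfrac_memD(4)[OF _ Rg.primeideal_zero])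
    have "(f * b) * d = (f * d) * b" by (simp add: ac_simps)
    also have "\<dots> = (c * b) * g" unfolding \<open>f * d = c * g\<close> by (simp add: ac_simps)
    also have "\<dots> = (a * g) * d" unfolding 1(4)[symmetric] by (simp add: ac_simps)
    finally have "(f * b) * d = (a * g) * d" .
    then have "f * b = a * g" by (rule Rg.mult_cancel[OF cd0(3)])
    then have "gfrac (Rg \<sigma>) p a b = gfrac (Rg \<sigma>) p f g" for p
      by (intro Rg.gfrac_cong[OF _ ab(1) fg(1)]) simp
    then show ?thesis using ab(3,4) by simp
  qed
  show thesis
  proof (rule that)
    show "regular V f g" using fg(1) main by (auto simp: regular_def)
    have "s \<sigma> = sect V f g \<sigma>" for \<sigma>
    proof (cases "\<sigma> \<in> \<Sigma>")
      case True then show ?thesis using main by (simp add: sect_def)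
    next
      case False then show ?thesis using sP PiE_arb by (simp add: sect_def) blast
    qed
    then show "s = sect V f g" by blast
  qed
qed

lemma sect_cong:
  assumes "f * g' = f' * g" "g \<noteq> 0" "g' \<noteq> 0"
  shows "sect V f g = sect V f' g'"
  unfolding sect_def using Rg.gfrac_cong[OF assms] by (auto simp: restrict_def fun_eq_iff)

lemma regular_cong:
  assumes "f * g' = f' * g" "g' \<noteq> 0" "regular V f g"
  shows "regular V f' g'"
  using Rg.gfrac_cong[OF assms(1)] assms(2,3) unfolding regular_def by metis

lemma sect_empty: "sect {} f g = sect {} f' g'"
  by (auto simp: sect_def part_eq restrict_def fun_eq_iff)

lemma sect_eq_iff:
  assumes "openin (pts X) V" "V \<noteq> {}" "regular V f g" "regular V f' g'"
  shows "sect V f g = sect V f' g' \<longleftrightarrow> f * g' = f' * g"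
proof
  have z: "{0} \<in> part {0} V" using eta_mem[OF assms(1,2)] prm_zero by (simp add: part_eq eta_def)
  assume "sect V f g = sect V f' g'"
  then have "sect V f g {0} {0} = sect V f' g' {0} {0}" by simp
  then have "gfrac (Rg {0}) {0} f g = gfrac (Rg {0}) {0} f' g'" using z origin_mem by (simp add: sect_def)
  then show "f * g' = f' * g"
    using Rg.gfrac_eq_iff[OF Rg.primeideal_zero] assms(3,4) z origin_mem unfolding regular_def by blast
next
  assume "f * g' = f' * g"
  then show "sect V f g = sect V f' g'" by (rule sect_cong) (use assms in \<open>auto simp: regular_def\<close>)
qed

lemma regular_mult: "\<lbrakk>regular V f g; regular V f' g'\<rbrakk> \<Longrightarrow> regular V (f * f') (g * g')"
  unfolding regular_def using Rg.mult_nonzero Rg.gfrac_mult_nonempty[OF part_prm] by blast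

lemma regular_add: "\<lbrakk>regular V f g; regular V f' g'\<rbrakk> \<Longrightarrow> regular V (f * g' + f' * g) (g * g')"
  unfolding regular_def using Rg.mult_nonzero Rg.gfrac_add_nonempty[OF part_prm] by blast

lemma regular_uminus: "regular V f g \<Longrightarrow> regular V (- f) g"
  unfolding regular_def using Rg.gfrac_uminus_nonempty by blast

lemma regular_const: "(\<And>\<sigma>. \<sigma> \<in> \<Sigma> \<Longrightarrow> f \<in> Rg \<sigma>) \<Longrightarrow> regular V f 1"
  unfolding regular_def using Rg.gfrac_mem_nonempty part_prm by (metis one_neq_zero)

lemma part_mono: "W \<subseteq> V \<Longrightarrow> part \<sigma> W \<subseteq> part \<sigma> V"
  by (auto simp: part_eq)

lemma regular_subset: "\<lbrakk>regular V f g; W \<subseteq> V\<rbrakk> \<Longrightarrow> regular W f g"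
  unfolding regular_def using part_mono by blast

lemma regular_Union: "\<lbrakk>g \<noteq> 0; \<And>U. U \<in> \<U> \<Longrightarrow> regular U f g\<rbrakk> \<Longrightarrow> regular (\<Union>\<U>) f g"
  unfolding regular_def part_eq by blast

lemma regular_Dop:
  assumes "\<sigma> \<in> \<Sigma>" "g \<noteq> 0" "\<And>p. p \<in> basic_open (Rg \<sigma>) h \<Longrightarrow> regat \<sigma> p f g"
  shows "regular (Dop \<sigma> h) f g"
  unfolding regular_def
proof (intro conjI ballI)
  fix \<tau> q assume "\<tau> \<in> \<Sigma>" "q \<in> part \<tau> (Dop \<sigma> h)"
  then obtain p where "p \<in> basic_open (Rg \<sigma>) h" "cls (\<sigma>, p) = cls (\<tau>, q)" by (auto simp: part_eq Dop_def)
  then show "regat \<tau> q f g" using cls_regat assms(3) by blast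
qed fact

lemma regular_Dop_power:
  assumes "\<sigma> \<in> \<Sigma>" "h \<in> Rg \<sigma>" "h \<noteq> 0" "r \<in> Rg \<sigma>"
  shows "regular (Dop \<sigma> h) r (h ^ n)"
proof (rule regular_Dop[OF assms(1)])
  show "h ^ n \<noteq> 0" using Rg.power_nonzero assms by auto
  fix p assume "p \<in> basic_open (Rg \<sigma>) h"
  then have "primeideal p (Rg.R \<sigma>)" "h \<notin> p" by (auto simp: basic_open_def)
  then have "h ^ n \<notin> p" using Rg.primeideal_power_notin assms by blast
  then show "regat \<sigma> p r (h ^ n)" using Rg.gfrac_self_mem[of r \<sigma> "h ^ n" p] assms Rg.power_mem by blast
qed

text \<open>The denominators of \<open>f/g\<close> in the chart ring form an ideal \<open>I\<close>.
  If it contained no power of \<open>h\<close>, some prime over \<open>I\<close> would avoid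
  \<open>h\<close>, and this would be a point of the basic open set at which \<open>f/g\<close> has
  a pole.\<close>

lemma regular_Dop_cases:
  assumes "\<sigma> \<in> \<Sigma>" "h \<in> Rg \<sigma>" "regular (Dop \<sigma> h) f g"
  obtains n r where "r \<in> Rg \<sigma>" "f * h ^ n = r * g"
proof (rule ccontr)
  assume no: "\<not> thesis"
  define I where "I = {d \<in> Rg \<sigma>. \<exists>r\<in>Rg \<sigma>. f * d = r * g}"
  have "\<exists>p. primeideal p (Rg.R \<sigma>) \<and> I \<subseteq> p \<and> h \<notin> p"
  proof (rule Rg.primeideal_avoiding_powers[of I \<sigma> h])
    show "I \<subseteq> Rg \<sigma>" by (auto simp: I_def)
    show "0 \<in> I" using Rg.zero_mem by (auto simp: I_def intro!: bexI[of _ 0])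
    fix a b assume "a \<in> I" "b \<in> I"
    then obtain r s where "f * a = r * g" "f * b = s * g" "r \<in> Rg \<sigma>" "s \<in> Rg \<sigma>" "a \<in> Rg \<sigma>" "b \<in> Rg \<sigma>"
      by (auto simp: I_def)
    then have "f * (a + b) = (r + s) * g" "r + s \<in> Rg \<sigma>" "a + b \<in> Rg \<sigma>"
      using Rg.add_mem by (auto simp: algebra_simps)
    then show "a + b \<in> I" by (auto simp: I_def)
  next
    fix a b assume "a \<in> Rg \<sigma>" "b \<in> I"
    then obtain s where "f * b = s * g" "s \<in> Rg \<sigma>" "a \<in> Rg \<sigma>" "b \<in> Rg \<sigma>" by (auto simp: I_def)
    then have "f * (a * b) = (a * s) * g" "a * s \<in> Rg \<sigma>" "a * b \<in> Rg \<sigma>"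
      using Rg.mult_mem by (auto simp: ac_simps)
    then show "a * b \<in> I" by (auto simp: I_def)
  next
    fix n show "h ^ n \<notin> I" using no that by (auto simp: I_def)
  qed (use assms in blast)+
  then obtain p where p: "primeideal p (Rg.R \<sigma>)" "I \<subseteq> p" "h \<notin> p" by blast
  then have "p \<in> part \<sigma> (Dop \<sigma> h)" by (auto simp: part_eq Dop_def basic_open_def chart_ring_eq)
  then obtain b t where bt: "(b, t) \<in> gfrac (Rg \<sigma>) p f g" using assms by (fastforce simp: regular_def)
  then have "t \<in> I" "t \<notin> p" using Rg.gfrac_memD[OF bt p(1)] by (auto simp: I_def)
  then show False using p by auto
qed

lemma sect_mult:
  assumes "regular V f g" "regular V f' g'"
  shows "sect V f g \<otimes>\<^bsub>sec X V\<^esub> sect V f' g' = sect V (f * f') (g * g')"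
  using assms Rg.localization_mult[OF part_prm]
  by (auto simp: sec_X Let_def sect_def regular_def Spec_def chart_ring_eq restrict_def fun_eq_iff)

lemma sect_add:
  assumes "regular V f g" "regular V f' g'"
  shows "sect V f g \<oplus>\<^bsub>sec X V\<^esub> sect V f' g' = sect V (f * g' + f' * g) (g * g')"
  using assms Rg.localization_add[OF part_prm]
  by (auto simp: sec_X Let_def sect_def regular_def Spec_def chart_ring_eq restrict_def fun_eq_iff)

lemma sect_one: "\<one>\<^bsub>sec X V\<^esub> = sect V 1 1"
  using Rg.localization_one_zero(1)[OF part_prm]
  by (auto simp: sec_X Let_def sect_def Spec_def chart_ring_eq restrict_def fun_eq_iff)

lemma sect_zero: "\<zero>\<^bsub>sec X V\<^esub> = sect V 0 1"
  using Rg.localization_one_zero(2)[OF part_prm]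
  by (auto simp: sec_X Let_def sect_def Spec_def chart_ring_eq restrict_def fun_eq_iff)

lemma regular_one_zero: "regular V 1 1" "regular V 0 1"
  by (auto intro!: regular_const Rg.one_mem Rg.zero_mem)

lemma res_X_eq: "res X V W s = (\<lambda>i\<in>\<Sigma>. res (Spec (chart_ring N i)) (part i V) (part i W) (s i))"
  by (simp add: toric_variety_def rspace.defs rspace_over.defs glue_def part_def)

lemma res_X: "W \<subseteq> V \<Longrightarrow> res X V W (sect V f g) = sect W f g"
  using part_mono[of W V]
  by (auto simp: res_X_eq sect_def Spec_def restrict_def fun_eq_iff)

lemma str_X: "str X c = sect (carr X) (Poly_Mapping.single 0 c) 1"
proof -
  have "part \<sigma> (carr X) = {p. prm \<sigma> p}" if "\<sigma> \<in> \<Sigma>" for \<sigma> using that by (auto simp: part_eq carr_X)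
  moreover have "Poly_Mapping.single 0 c \<in> Rg \<sigma>" for \<sigma>
    using dual_monoid_zero by (auto simp: Rg_def monoid_algebra_def)
  ultimately show ?thesis
    using Rg.fraction_eq_gfrac[OF _ _ Rg.one_mem]
    by (auto simp: toric_variety_def rspace.defs rspace_over.defs sect_def carr_chart[unfolded chart_ring_eq]
      chart_ring_eq restrict_def fun_eq_iff)
qed

section \<open>The ring and sheaf axioms for the toric variety\<close>

lemma cring_X:
  assumes V: "openin (pts X) V"
  shows "cring (sec X V)"
proof (rule cringI)
  note S = sect_mult sect_add sect_one sect_zero regular_mult regular_add regular_one_zero
  have nz: "regular V f g \<Longrightarrow> g \<noteq> 0" for f g by (simp add: regular_def)
  show "abelian_group (sec X V)"
  proof (rule abelian_groupI)
    fix x y z assume "x \<in> carrier (sec X V)" "y \<in> carrier (sec X V)" "z \<in> carrier (sec X V)"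
    then obtain f g f' g' f'' g'' where *: "regular V f g" "x = sect V f g" "regular V f' g'" "y = sect V f' g'"
       "regular V f'' g''" "z = sect V f'' g''" using sectionE[OF V] by metis
    show "x \<oplus>\<^bsub>sec X V\<^esub> y \<oplus>\<^bsub>sec X V\<^esub> z = x \<oplus>\<^bsub>sec X V\<^esub> (y \<oplus>\<^bsub>sec X V\<^esub> z)"
      using * by (simp add: S) (intro sect_cong Rg.mult_nonzero; simp add: nz algebra_simps)
  next
    fix x y assume "x \<in> carrier (sec X V)" "y \<in> carrier (sec X V)"
    then obtain f g f' g' where *: "regular V f g" "x = sect V f g" "regular V f' g'" "y = sect V f' g'"
      using sectionE[OF V] by metis
    show "x \<oplus>\<^bsub>sec X V\<^esub> y \<in> carrier (sec X V)" using * by (simp add: S sect_in_carrier[OF V])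
    show "x \<oplus>\<^bsub>sec X V\<^esub> y = y \<oplus>\<^bsub>sec X V\<^esub> x"
      using * by (simp add: S add.commute mult.commute)
  next
    fix x assume "x \<in> carrier (sec X V)"
    then obtain f g where *: "regular V f g" "x = sect V f g" using sectionE[OF V] by metis
    show "\<zero>\<^bsub>sec X V\<^esub> \<oplus>\<^bsub>sec X V\<^esub> x = x" using * by (simp add: S)
    have "sect V (- f) g \<oplus>\<^bsub>sec X V\<^esub> x = \<zero>\<^bsub>sec X V\<^esub>"
      using * regular_uminus[of V f g] nz by (simp add: S) (intro sect_cong Rg.mult_nonzero; simp)
    moreover have "sect V (- f) g \<in> carrier (sec X V)" using * regular_uminus by (simp add: sect_in_carrier[OF V])
    ultimately show "\<exists>y\<in>carrier (sec X V). y \<oplus>\<^bsub>sec X V\<^esub> x = \<zero>\<^bsub>sec X V\<^esub>" by blast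
  qed (auto simp: S sect_in_carrier[OF V])
  show "comm_monoid (sec X V)"
  proof (rule comm_monoidI)
    fix x y z assume "x \<in> carrier (sec X V)" "y \<in> carrier (sec X V)" "z \<in> carrier (sec X V)"
    then obtain f g f' g' f'' g'' where *: "regular V f g" "x = sect V f g" "regular V f' g'" "y = sect V f' g'"
       "regular V f'' g''" "z = sect V f'' g''" using sectionE[OF V] by metis
    show "x \<otimes>\<^bsub>sec X V\<^esub> y \<otimes>\<^bsub>sec X V\<^esub> z = x \<otimes>\<^bsub>sec X V\<^esub> (y \<otimes>\<^bsub>sec X V\<^esub> z)"
      using * by (simp add: S mult.assoc)
  next
    fix x y assume "x \<in> carrier (sec X V)" "y \<in> carrier (sec X V)"
    then obtain f g f' g' where *: "regular V f g" "x = sect V f g" "regular V f' g'" "y = sect V f' g'"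
      using sectionE[OF V] by metis
    show "x \<otimes>\<^bsub>sec X V\<^esub> y \<in> carrier (sec X V)" using * by (simp add: S sect_in_carrier[OF V])
    show "x \<otimes>\<^bsub>sec X V\<^esub> y = y \<otimes>\<^bsub>sec X V\<^esub> x" using * by (simp add: S mult.commute)
  next
    fix x assume "x \<in> carrier (sec X V)"
    then obtain f g where *: "regular V f g" "x = sect V f g" using sectionE[OF V] by metis
    show "\<one>\<^bsub>sec X V\<^esub> \<otimes>\<^bsub>sec X V\<^esub> x = x" using * by (simp add: S)
  qed (auto simp: S sect_in_carrier[OF V])
  fix x y z assume "x \<in> carrier (sec X V)" "y \<in> carrier (sec X V)" "z \<in> carrier (sec X V)"
  then obtain f g f' g' f'' g'' where *: "regular V f g" "x = sect V f g" "regular V f' g'" "y = sect V f' g'"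
     "regular V f'' g''" "z = sect V f'' g''" using sectionE[OF V] by metis
  show "(x \<oplus>\<^bsub>sec X V\<^esub> y) \<otimes>\<^bsub>sec X V\<^esub> z = x \<otimes>\<^bsub>sec X V\<^esub> z \<oplus>\<^bsub>sec X V\<^esub> y \<otimes>\<^bsub>sec X V\<^esub> z"
    using * by (simp add: S) (intro sect_cong Rg.mult_nonzero; simp add: nz algebra_simps)
qed

lemma ringed_space_X: "ringed_space X"
  unfolding ringed_space_def
proof (intro conjI allI impI ballI)
  fix U assume "openin (pts X) U" then show "cring (sec X U)" by (rule cring_X)
next
  fix U V assume *: "openin (pts X) U \<and> openin (pts X) V \<and> V \<subseteq> U"
  then have V: "openin (pts X) U" "openin (pts X) V" "V \<subseteq> U" by auto
  show "res X U V \<in> ring_hom (sec X U) (sec X V)"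
  proof (rule ring_hom_memI)
    fix x y assume "x \<in> carrier (sec X U)" "y \<in> carrier (sec X U)"
    then obtain f g f' g' where s: "regular U f g" "x = sect U f g" "regular U f' g'" "y = sect U f' g'"
      using sectionE[OF V(1)] by metis
    then have r: "regular V f g" "regular V f' g'" using regular_subset V by auto
    show "res X U V x \<in> carrier (sec X V)" using s r V by (auto simp: res_X sect_in_carrier)
    show "res X U V (x \<otimes>\<^bsub>sec X U\<^esub> y) = res X U V x \<otimes>\<^bsub>sec X V\<^esub> res X U V y"
      using s r V by (simp add: sect_mult res_X)
    show "res X U V (x \<oplus>\<^bsub>sec X U\<^esub> y) = res X U V x \<oplus>\<^bsub>sec X V\<^esub> res X U V y"
      using s r V by (simp add: sect_add res_X)
  qed (use V in \<open>simp add: sect_one res_X\<close>)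
next
  fix U s assume "openin (pts X) U" "s \<in> carrier (sec X U)"
  then show "res X U U s = s" using sectionE res_X by (metis order_refl)
next
  fix U V W s assume *: "openin (pts X) U \<and> openin (pts X) V \<and> openin (pts X) W \<and> W \<subseteq> V \<and> V \<subseteq> U"
    and s: "s \<in> carrier (sec X U)"
  obtain f g where "s = sect U f g" using sectionE s * by metis
  then show "res X V W (res X U V s) = res X U W s" using * by (auto simp: res_X)
next
  fix \<U> and t
  assume "(\<forall>U\<in>\<U>. openin (pts X) U \<and> t U \<in> carrier (sec X U)) \<and>
        (\<forall>U\<in>\<U>. \<forall>V\<in>\<U>. res X U (U \<inter> V) (t U) = res X V (U \<inter> V) (t V))"
  then have op: "\<And>U. U \<in> \<U> \<Longrightarrow> openin (pts X) U" and t: "\<And>U. U \<in> \<U> \<Longrightarrow> t U \<in> carrier (sec X U)"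
    and comp: "\<And>U V. \<lbrakk>U \<in> \<U>; V \<in> \<U>\<rbrakk> \<Longrightarrow> res X U (U \<inter> V) (t U) = res X V (U \<inter> V) (t V)" by auto
  have opU: "openin (pts X) (\<Union>\<U>)" using op by blast
  show "\<exists>!s. s \<in> carrier (sec X (\<Union>\<U>)) \<and> (\<forall>U\<in>\<U>. res X (\<Union>\<U>) U s = t U)"
  proof (cases "\<Union>\<U> = {}")
    case True
    then have em: "U = {}" if "U \<in> \<U>" for U using that by auto
    have "carrier (sec X {}) = {sect {} 0 1}"
    proof (intro equalityI subsetI)
      fix s assume "s \<in> carrier (sec X {})"
      then show "s \<in> {sect {} 0 1}" using sectionE[OF openin_empty] sect_empty by (metis singletonI)
    qed (auto intro: sect_in_carrier regular_one_zero)
    moreover have "res X {} {} (sect {} 0 1) = sect {} 0 1" by (simp add: res_X)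
    moreover have "U = {} \<and> t U = sect {} 0 1" if "U \<in> \<U>" for U
      using t[OF that] em[OF that] calculation(1) by simp
    ultimately show ?thesis unfolding True by (intro ex1I[of _ "sect {} 0 1"]) auto
  next
    case False
    then obtain U0 where U0: "U0 \<in> \<U>" "U0 \<noteq> {}" by auto
    obtain f g where fg: "regular U0 f g" "t U0 = sect U0 f g" using sectionE[OF op t] U0 by metis
    \<comment> \<open>Any two nonempty open sets meet in \<open>eta\<close>, so the fraction of the
      one member \<open>U0\<close> represents the sections over all members; the cover needs no
      further gluing.\<close>
    have main: "regular U f g \<and> t U = sect U f g" if U: "U \<in> \<U>" for U
    proof (cases "U = {}")
      case True
      then show ?thesis using sectionE[OF op[OF U] t[OF U]] sect_empty fg
        by (metis (no_types, lifting) empty_subsetI regular_subset)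
    next
      case ne: False
      obtain f' g' where fg': "regular U f' g'" "t U = sect U f' g'" using sectionE[OF op t] U by metis
      have "eta \<in> U \<inter> U0" using eta_mem op U U0 ne by auto
      then have ne': "U \<inter> U0 \<noteq> {}" "openin (pts X) (U \<inter> U0)" using op U U0 by auto
      have "sect (U \<inter> U0) f' g' = sect (U \<inter> U0) f g"
        using comp[OF U U0(1)] fg fg' by (simp add: res_X)
      then have "f' * g = f * g'"
        using sect_eq_iff[OF ne'(2,1) regular_subset[OF fg'(1)] regular_subset[OF fg(1)]] by simp
      moreover have "g \<noteq> 0" "g' \<noteq> 0" using fg fg' by (auto simp: regular_def)
      ultimately show ?thesis
        using fg' regular_cong[of f' g f g' U] sect_cong[of f' g f g' U] by simp
    qed
    then have reg: "regular (\<Union>\<U>) f g" using fg by (intro regular_Union) (auto simp: regular_def)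
    show ?thesis
    proof (rule ex1I[of _ "sect (\<Union>\<U>) f g"])
      show "sect (\<Union>\<U>) f g \<in> carrier (sec X (\<Union>\<U>)) \<and> (\<forall>U\<in>\<U>. res X (\<Union>\<U>) U (sect (\<Union>\<U>) f g) = t U)"
        using reg opU main by (auto simp: sect_in_carrier res_X Sup_upper)
      fix s assume s: "s \<in> carrier (sec X (\<Union>\<U>)) \<and> (\<forall>U\<in>\<U>. res X (\<Union>\<U>) U s = t U)"
      then obtain f' g' where fg': "regular (\<Union>\<U>) f' g'" "s = sect (\<Union>\<U>) f' g'" using sectionE[OF opU] by metis
      have "U0 \<subseteq> \<Union>\<U>" using U0 by auto
      have "res X (\<Union>\<U>) U0 s = sect U0 f g" using s U0(1) fg(2) by (simp only:)
      then have "sect U0 f' g' = sect U0 f g" unfolding fg'(2) res_X[OF \<open>U0 \<subseteq> _\<close>] .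
      then have "f' * g = f * g'"
        using sect_eq_iff[OF op[OF U0(1)] U0(2) regular_subset[OF fg'(1) \<open>U0 \<subseteq> _\<close>] fg(1)] by (simp only:)
      then show "s = sect (\<Union>\<U>) f g" unfolding fg'(2)
        by (rule sect_cong) (use fg'(1) fg(1) in \<open>simp_all add: regular_def\<close>)
    qed
  qed
qed

end

section \<open>Square-zero thickenings\<close>

lemma (in abelian_group) minus_eq_zero_iff:
  assumes "x \<in> carrier G" "y \<in> carrier G"
  shows "x \<ominus> y = \<zero> \<longleftrightarrow> x = y"
  using assms by (metis a_minus_def add.inv_closed minus_equality minus_minus r_neg)

locale ringed =
  fixes Y :: "('p, 's, 'z) rspace_scheme"
  assumes ringed: "ringed_space Y"
begin

abbreviation op where "op V \<equiv> openin (pts Y) V"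
abbreviation Oc where "Oc V \<equiv> carrier (sec Y V)"

lemma cring_sec: "op V \<Longrightarrow> cring (sec Y V)"
  using ringed unfolding ringed_space_def by (elim conjE) blast

lemma ring_hom_cring_res:
  assumes "op V" "op W" "W \<subseteq> V"
  shows "ring_hom_cring (sec Y V) (sec Y W) (res Y V W)"
proof -
  have "res Y V W \<in> ring_hom (sec Y V) (sec Y W)"
    using ringed assms unfolding ringed_space_def by (elim conjE) blast
  then show ?thesis
    using cring_sec assms by (intro ring_hom_cring.intro ring_hom_cring_axioms.intro)
qed

lemma res_id: "\<lbrakk>op V; s \<in> Oc V\<rbrakk> \<Longrightarrow> res Y V V s = s"
  using ringed unfolding ringed_space_def by (elim conjE) blast

lemma res_res:
  "\<lbrakk>op U; op V; op W; W \<subseteq> V; V \<subseteq> U; s \<in> Oc U\<rbrakk> \<Longrightarrow> res Y V W (res Y U V s) = res Y U W s"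
proof -
  have "\<forall>U V W. op U \<and> op V \<and> op W \<and> W \<subseteq> V \<and> V \<subseteq> U \<longrightarrow> (\<forall>s\<in>Oc U. res Y V W (res Y U V s) = res Y U W s)"
    using ringed unfolding ringed_space_def by (elim conjE)
  then show "\<lbrakk>op U; op V; op W; W \<subseteq> V; V \<subseteq> U; s \<in> Oc U\<rbrakk> \<Longrightarrow> res Y V W (res Y U V s) = res Y U W s"
    by blast
qed

lemma glue_ex1:
  assumes "\<And>U. U \<in> \<U> \<Longrightarrow> op U" "\<And>U. U \<in> \<U> \<Longrightarrow> t U \<in> Oc U"
    "\<And>U V. \<lbrakk>U \<in> \<U>; V \<in> \<U>\<rbrakk> \<Longrightarrow> res Y U (U \<inter> V) (t U) = res Y V (U \<inter> V) (t V)"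
  shows "\<exists>!s. s \<in> Oc (\<Union>\<U>) \<and> (\<forall>U\<in>\<U>. res Y (\<Union>\<U>) U s = t U)"
proof -
  have "\<forall>\<U> t. (\<forall>U\<in>\<U>. op U \<and> t U \<in> Oc U) \<and>
        (\<forall>U\<in>\<U>. \<forall>V\<in>\<U>. res Y U (U \<inter> V) (t U) = res Y V (U \<inter> V) (t V)) \<longrightarrow>
        (\<exists>!s. s \<in> Oc (\<Union>\<U>) \<and> (\<forall>U\<in>\<U>. res Y (\<Union>\<U>) U s = t U))"
    using ringed unfolding ringed_space_def by (elim conjE)
  then have "(\<forall>U\<in>\<U>. op U \<and> t U \<in> Oc U) \<and>
        (\<forall>U\<in>\<U>. \<forall>V\<in>\<U>. res Y U (U \<inter> V) (t U) = res Y V (U \<inter> V) (t V)) \<longrightarrow>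
        (\<exists>!s. s \<in> Oc (\<Union>\<U>) \<and> (\<forall>U\<in>\<U>. res Y (\<Union>\<U>) U s = t U))" by (elim allE)
  then show ?thesis by (rule mp) (intro conjI ballI, (rule assms; assumption)+)
qed

context
  fixes V W assumes *: "op V" "op W" "W \<subseteq> V"
begin

interpretation ring_hom_cring "sec Y V" "sec Y W" "res Y V W"
  by (rule ring_hom_cring_res[OF *])

lemma res_closed: "s \<in> Oc V \<Longrightarrow> res Y V W s \<in> Oc W" by simp
lemma res_mult: "\<lbrakk>s \<in> Oc V; t \<in> Oc V\<rbrakk> \<Longrightarrow> res Y V W (s \<otimes>\<^bsub>sec Y V\<^esub> t) = res Y V W s \<otimes>\<^bsub>sec Y W\<^esub> res Y V W t" by simp
lemma res_add: "\<lbrakk>s \<in> Oc V; t \<in> Oc V\<rbrakk> \<Longrightarrow> res Y V W (s \<oplus>\<^bsub>sec Y V\<^esub> t) = res Y V W s \<oplus>\<^bsub>sec Y W\<^esub> res Y V W t" by simp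
lemma res_minus: "\<lbrakk>s \<in> Oc V; t \<in> Oc V\<rbrakk> \<Longrightarrow> res Y V W (s \<ominus>\<^bsub>sec Y V\<^esub> t) = res Y V W s \<ominus>\<^bsub>sec Y W\<^esub> res Y V W t"
  by (simp add: a_minus_def)
lemma res_one: "res Y V W \<one>\<^bsub>sec Y V\<^esub> = \<one>\<^bsub>sec Y W\<^esub>" by simp
lemma res_zero: "res Y V W \<zero>\<^bsub>sec Y V\<^esub> = \<zero>\<^bsub>sec Y W\<^esub>" by simp

end

lemma separated:
  assumes "op V" "s \<in> Oc V" "s' \<in> Oc V"
    and loc: "\<And>x. x \<in> V \<Longrightarrow> \<exists>W. op W \<and> x \<in> W \<and> W \<subseteq> V \<and> res Y V W s = res Y V W s'"
  shows "s = s'"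
proof -
  define \<U> where "\<U> = {W. op W \<and> W \<subseteq> V \<and> res Y V W s = res Y V W s'}"
  have V: "\<Union>\<U> = V" using loc by (auto simp: \<U>_def)
  have "\<exists>!u. u \<in> Oc (\<Union>\<U>) \<and> (\<forall>U\<in>\<U>. res Y (\<Union>\<U>) U u = res Y V U s)"
  proof (rule glue_ex1)
    fix U W assume "U \<in> \<U>" "W \<in> \<U>"
    then have "op U" "op W" "U \<subseteq> V" "W \<subseteq> V" by (auto simp: \<U>_def)
    then show "res Y U (U \<inter> W) (res Y V U s) = res Y W (U \<inter> W) (res Y V W s)"
      using assms(1,2) by (subst (1 2) res_res) auto
  qed (use assms res_closed in \<open>auto simp: \<U>_def\<close>)
  then show ?thesis unfolding V using assms by (auto simp: \<U>_def)
qed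

text \<open>The form in which gluing is used throughout: a property that sections have locally, and
  that determines them on overlaps, determines a section over the union.\<close>

lemma glue_pred:
  assumes V: "op V"
    and loc: "\<And>x. x \<in> V \<Longrightarrow> \<exists>W s. op W \<and> x \<in> W \<and> W \<subseteq> V \<and> s \<in> Oc W \<and> Q W s"
    and uniq: "\<And>W s W' s'. \<lbrakk>op W; W \<subseteq> V; s \<in> Oc W; Q W s; op W'; W' \<subseteq> V; s' \<in> Oc W'; Q W' s'\<rbrakk>
      \<Longrightarrow> res Y W (W \<inter> W') s = res Y W' (W \<inter> W') s'"
  obtains s where "s \<in> Oc V" "\<And>W s'. \<lbrakk>op W; W \<subseteq> V; s' \<in> Oc W; Q W s'\<rbrakk> \<Longrightarrow> res Y V W s = s'"
proof -
  define \<U> where "\<U> = {W. op W \<and> W \<subseteq> V \<and> (\<exists>s\<in>Oc W. Q W s)}"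
  define t where "t W = (SOME s. s \<in> Oc W \<and> Q W s)" for W
  have t: "t W \<in> Oc W \<and> Q W (t W)" if "W \<in> \<U>" for W
  proof -
    have "\<exists>s. s \<in> Oc W \<and> Q W s" using that by (auto simp: \<U>_def)
    then show ?thesis unfolding t_def by (rule someI_ex)
  qed
  have U: "op W \<and> W \<subseteq> V" if "W \<in> \<U>" for W using that by (auto simp: \<U>_def)
  have VU: "\<Union>\<U> = V" using loc by (fastforce simp: \<U>_def)
  have "\<exists>!s. s \<in> Oc (\<Union>\<U>) \<and> (\<forall>W\<in>\<U>. res Y (\<Union>\<U>) W s = t W)"
  proof (rule glue_ex1)
    fix W W' assume "W \<in> \<U>" "W' \<in> \<U>"
    then show "res Y W (W \<inter> W') (t W) = res Y W' (W \<inter> W') (t W')"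
      using uniq[of W "t W" W' "t W'"] t U by blast
  qed (use t U in auto)
  then obtain s where s: "s \<in> Oc V" "\<And>W. W \<in> \<U> \<Longrightarrow> res Y V W s = t W" unfolding VU by blast
  show thesis
  proof (rule that[OF s(1)])
    fix W s' assume *: "op W" "W \<subseteq> V" "s' \<in> Oc W" "Q W s'"
    then have "W \<in> \<U>" by (auto simp: \<U>_def)
    then have "t W = s'" using uniq[of W "t W" W s'] t[of W] * by (simp add: res_id)
    then show "res Y V W s = s'" using s(2) \<open>W \<in> \<U>\<close> by simp
  qed
qed

section \<open>Germs and stalks\<close>

lemma germ_eq_iff:
  assumes "op U" "x \<in> U" "s \<in> Oc U" "op V" "x \<in> V" "t \<in> Oc V"
  shows "germ Y x U s = germ Y x V t \<longleftrightarrow>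
    (\<exists>W. op W \<and> x \<in> W \<and> W \<subseteq> U \<inter> V \<and> res Y U W s = res Y V W t)" (is "_ \<longleftrightarrow> ?R")
proof
  assume "germ Y x U s = germ Y x V t"
  moreover have "(V, t) \<in> germ Y x V t" using assms by (auto simp: germ_def)
  ultimately have "(V, t) \<in> germ Y x U s" by simp
  then show ?R by (auto simp: germ_def)
next
  assume ?R
  then obtain W where W: "op W" "x \<in> W" "W \<subseteq> U \<inter> V" "res Y U W s = res Y V W t" by blast
  have "\<exists>W'. op W' \<and> x \<in> W' \<and> W' \<subseteq> V' \<inter> Z \<and> res Y V' W' t' = res Y Z W' z"
    if *: "\<exists>W'. op W' \<and> x \<in> W' \<and> W' \<subseteq> U' \<inter> Z \<and> res Y U' W' s' = res Y Z W' z"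
      and Z: "op Z" "z \<in> Oc Z"
      and UV: "op U'" "s' \<in> Oc U'" "op V'" "t' \<in> Oc V'" "W \<subseteq> U' \<inter> V'" "res Y U' W s' = res Y V' W t'"
    for Z z U' V' s' t'
  proof -
    obtain W' where W': "op W'" "x \<in> W'" "W' \<subseteq> U' \<inter> Z" "res Y U' W' s' = res Y Z W' z" using * by blast
    have o: "op (W \<inter> W')" using W W' by auto
    have "res Y V' (W \<inter> W') t' = res Y W (W \<inter> W') (res Y V' W t')"
      using UV W o by (subst res_res) auto
    also have "\<dots> = res Y U' (W \<inter> W') s'"
      unfolding UV(6)[symmetric] using UV W o by (subst res_res) auto
    also have "\<dots> = res Y W' (W \<inter> W') (res Y U' W' s')" using UV W' o by (subst res_res) auto
    also have "\<dots> = res Y Z (W \<inter> W') z" unfolding W'(4) using Z W' o by (subst res_res) auto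
    finally show ?thesis using o W W' UV by (intro exI[of _ "W \<inter> W'"]) auto
  qed
  note * = this
  show "germ Y x U s = germ Y x V t"
  proof (intro equalityI subsetI)
    fix p assume "p \<in> germ Y x U s"
    then obtain Z z where Z: "p = (Z, z)" "op Z" "x \<in> Z" "z \<in> Oc Z"
      "\<exists>W'. op W' \<and> x \<in> W' \<and> W' \<subseteq> U \<inter> Z \<and> res Y U W' s = res Y Z W' z" by (auto simp: germ_def)
    show "p \<in> germ Y x V t" using *[OF Z(5,2,4), of V t] assms W Z by (auto simp: germ_def)
  next
    fix p assume "p \<in> germ Y x V t"
    then obtain Z z where Z: "p = (Z, z)" "op Z" "x \<in> Z" "z \<in> Oc Z"
      "\<exists>W'. op W' \<and> x \<in> W' \<and> W' \<subseteq> V \<inter> Z \<and> res Y V W' t = res Y Z W' z" by (auto simp: germ_def)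
    show "p \<in> germ Y x U s" using *[OF Z(5,2,4), of U s] assms W Z by (auto simp: germ_def)
  qed
qed

lemma germ_mem: "\<lbrakk>op U; x \<in> U; s \<in> Oc U\<rbrakk> \<Longrightarrow> (U, s) \<in> germ Y x U s"
  by (auto simp: germ_def)

lemma germ_memD:
  assumes "(V, t) \<in> germ Y x U s" "op U" "x \<in> U" "s \<in> Oc U"
  shows "op V" "x \<in> V" "t \<in> Oc V" "germ Y x V t = germ Y x U s"
  using assms germ_eq_iff[of V x t U s] by (auto simp: germ_def)

lemma germ_res: "\<lbrakk>op U; op W; x \<in> W; W \<subseteq> U; s \<in> Oc U\<rbrakk> \<Longrightarrow> germ Y x W (res Y U W s) = germ Y x U s"
  by (subst germ_eq_iff) (auto simp: res_closed res_id intro!: exI[of _ W])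

text \<open>All representatives agree with \<open>s\<close> and \<open>t\<close> on a small
  neighbourhood, and \<open>F\<close> commutes with restriction, so every member of the double union
  is the same germ. \<open>F\<close> will be the addition or the multiplication.\<close>

lemma germ_bin:
  assumes F: "\<And>V s t. \<lbrakk>op V; s \<in> Oc V; t \<in> Oc V\<rbrakk> \<Longrightarrow> F V s t \<in> Oc V"
    and Fr: "\<And>V W s t. \<lbrakk>op V; op W; W \<subseteq> V; s \<in> Oc V; t \<in> Oc V\<rbrakk> \<Longrightarrow> res Y V W (F V s t) = F W (res Y V W s) (res Y V W t)"
    and W: "op W" "x \<in> W" "s \<in> Oc W" "t \<in> Oc W"
  shows "(\<Union>(U, s)\<in>germ Y x W s. \<Union>(V, t)\<in>germ Y x W t. germ Y x (U \<inter> V) (F (U \<inter> V) (res Y U (U \<inter> V) s) (res Y V (U \<inter> V) t)))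
    = germ Y x W (F W s t)"
proof (rule UN2_const)
  show "germ Y x W s \<noteq> {}" "germ Y x W t \<noteq> {}" using germ_mem W by blast+
  fix U s' V t' assume *: "(U, s') \<in> germ Y x W s" "(V, t') \<in> germ Y x W t"
  note 1 = germ_memD[OF *(1) W(1-3)] and 2 = germ_memD[OF *(2) W(1,2,4)]
  obtain W1 where W1: "op W1" "x \<in> W1" "W1 \<subseteq> U \<inter> W" "res Y U W1 s' = res Y W W1 s"
    using 1 W germ_eq_iff by metis
  obtain W2 where W2: "op W2" "x \<in> W2" "W2 \<subseteq> V \<inter> W" "res Y V W2 t' = res Y W W2 t"
    using 2 W germ_eq_iff by metis
  let ?Z = "W1 \<inter> W2"
  have Z: "op ?Z" "x \<in> ?Z" "?Z \<subseteq> U" "?Z \<subseteq> V" "?Z \<subseteq> W" "?Z \<subseteq> U \<inter> V" "op (U \<inter> V)" using W1 W2 1 2 by auto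
  have s: "res Y U ?Z s' = res Y W ?Z s"
  proof -
    have "res Y U ?Z s' = res Y W1 ?Z (res Y U W1 s')" using W1 Z 1 by (subst res_res) auto
    also have "\<dots> = res Y W ?Z s" unfolding W1(4) using W1 Z W by (subst res_res) auto
    finally show ?thesis .
  qed
  have t: "res Y V ?Z t' = res Y W ?Z t"
  proof -
    have "res Y V ?Z t' = res Y W2 ?Z (res Y V W2 t')" using W2 Z 2 by (subst res_res) auto
    also have "\<dots> = res Y W ?Z t" unfolding W2(4) using W2 Z W by (subst res_res) auto
    finally show ?thesis .
  qed
  have "res Y (U \<inter> V) ?Z (F (U \<inter> V) (res Y U (U \<inter> V) s') (res Y V (U \<inter> V) t')) = F ?Z (res Y U ?Z s') (res Y V ?Z t')"
    using Z 1 2 by (subst Fr) (auto simp: res_closed res_res)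
  also have "\<dots> = res Y W ?Z (F W s t)" unfolding s t using Z W by (subst Fr) auto
  finally show "germ Y x (U \<inter> V) (F (U \<inter> V) (res Y U (U \<inter> V) s') (res Y V (U \<inter> V) t')) = germ Y x W (F W s t)"
    using Z 1 2 W by (subst germ_eq_iff) (auto simp: res_closed F intro!: exI[of _ ?Z])
qed

lemma stalk_mult:
  assumes "op W" "x \<in> W" "s \<in> Oc W" "t \<in> Oc W"
  shows "germ Y x W s \<otimes>\<^bsub>stalk Y x\<^esub> germ Y x W t = germ Y x W (s \<otimes>\<^bsub>sec Y W\<^esub> t)"
proof -
  have "s \<otimes>\<^bsub>sec Y V\<^esub> t \<in> Oc V" if "op V" "s \<in> Oc V" "t \<in> Oc V" for V s t
    using cring_sec[OF that(1)] that by (simp add: cring.cring_simprules)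
  then show ?thesis
    using germ_bin[where F="\<lambda>V s t. s \<otimes>\<^bsub>sec Y V\<^esub> t", OF _ _ assms] res_mult by (simp add: stalk_def)
qed

lemma stalk_add:
  assumes "op W" "x \<in> W" "s \<in> Oc W" "t \<in> Oc W"
  shows "germ Y x W s \<oplus>\<^bsub>stalk Y x\<^esub> germ Y x W t = germ Y x W (s \<oplus>\<^bsub>sec Y W\<^esub> t)"
proof -
  have "s \<oplus>\<^bsub>sec Y V\<^esub> t \<in> Oc V" if "op V" "s \<in> Oc V" "t \<in> Oc V" for V s t
    using cring_sec[OF that(1)] that by (simp add: cring.cring_simprules)
  then show ?thesis
    using germ_bin[where F="\<lambda>V s t. s \<oplus>\<^bsub>sec Y V\<^esub> t", OF _ _ assms] res_add by (simp add: stalk_def)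
qed

lemma op_carr: "op (carr Y)"
  by simp

lemma stalk_one_zero:
  assumes "op W" "x \<in> W"
  shows "\<one>\<^bsub>stalk Y x\<^esub> = germ Y x W \<one>\<^bsub>sec Y W\<^esub>" "\<zero>\<^bsub>stalk Y x\<^esub> = germ Y x W \<zero>\<^bsub>sec Y W\<^esub>"
proof -
  have W: "W \<subseteq> carr Y" using assms openin_subset by auto
  interpret C: cring "sec Y (carr Y)" by (rule cring_sec[OF op_carr])
  show "\<one>\<^bsub>stalk Y x\<^esub> = germ Y x W \<one>\<^bsub>sec Y W\<^esub>"
    using germ_res[OF op_carr assms W C.one_closed] by (simp add: stalk_def res_one[OF op_carr assms(1) W])
  show "\<zero>\<^bsub>stalk Y x\<^esub> = germ Y x W \<zero>\<^bsub>sec Y W\<^esub>"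
    using germ_res[OF op_carr assms W C.zero_closed] by (simp add: stalk_def res_zero[OF op_carr assms(1) W])
qed

lemma stalk_carrier: "carrier (stalk Y x) = {germ Y x U s | U s. op U \<and> x \<in> U \<and> s \<in> Oc U}"
  by (simp add: stalk_def)

lemma stalk_closed: "\<lbrakk>op U; x \<in> U; s \<in> Oc U\<rbrakk> \<Longrightarrow> germ Y x U s \<in> carrier (stalk Y x)"
  by (auto simp: stalk_carrier)

lemma stalk3:
  assumes "a \<in> carrier (stalk Y x)" "b \<in> carrier (stalk Y x)" "c \<in> carrier (stalk Y x)"
  obtains W s t u where "op W" "x \<in> W" "s \<in> Oc W" "t \<in> Oc W" "u \<in> Oc W"
    "a = germ Y x W s" "b = germ Y x W t" "c = germ Y x W u"
proof -
  obtain U1 s1 U2 s2 U3 s3 where *: "op U1" "x \<in> U1" "s1 \<in> Oc U1" "a = germ Y x U1 s1"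
    "op U2" "x \<in> U2" "s2 \<in> Oc U2" "b = germ Y x U2 s2" "op U3" "x \<in> U3" "s3 \<in> Oc U3" "c = germ Y x U3 s3"
    using assms unfolding stalk_carrier by blast
  let ?W = "U1 \<inter> U2 \<inter> U3"
  have o: "op ?W" using * by auto
  show thesis
  proof (rule that[of ?W "res Y U1 ?W s1" "res Y U2 ?W s2" "res Y U3 ?W s3"])
    show "res Y U1 ?W s1 \<in> Oc ?W" "res Y U2 ?W s2 \<in> Oc ?W" "res Y U3 ?W s3 \<in> Oc ?W"
      using * o by (auto intro!: res_closed)
    show "a = germ Y x ?W (res Y U1 ?W s1)" "b = germ Y x ?W (res Y U2 ?W s2)" "c = germ Y x ?W (res Y U3 ?W s3)"
      using * o by (subst germ_res; auto)+
  qed (use * o in auto)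
qed

lemma cring_stalk:
  assumes "x \<in> carr Y"
  shows "cring (stalk Y x)"
proof (rule cringI)
  let ?S = "stalk Y x"
  have zero: "\<zero>\<^bsub>?S\<^esub> \<in> carrier ?S" and one: "\<one>\<^bsub>?S\<^esub> \<in> carrier ?S"
    using stalk_one_zero[OF op_carr assms] stalk_closed[OF op_carr assms] cring_sec[OF op_carr]
    by (auto simp: cring.cring_simprules)
  show "abelian_group ?S"
  proof (rule abelian_groupI)
    fix a b c assume *: "a \<in> carrier ?S" "b \<in> carrier ?S" "c \<in> carrier ?S"
    then obtain W s t u where W: "op W" "x \<in> W" "s \<in> Oc W" "t \<in> Oc W" "u \<in> Oc W"
      "a = germ Y x W s" "b = germ Y x W t" "c = germ Y x W u" by (rule stalk3)
    interpret C: cring "sec Y W" by (rule cring_sec[OF W(1)])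
    show "a \<oplus>\<^bsub>?S\<^esub> b \<oplus>\<^bsub>?S\<^esub> c = a \<oplus>\<^bsub>?S\<^esub> (b \<oplus>\<^bsub>?S\<^esub> c)"
      using W by (simp add: stalk_add C.a_assoc)
  next
    fix a b assume *: "a \<in> carrier ?S" "b \<in> carrier ?S"
    from this(1) this obtain W r s t where W: "op W" "x \<in> W" "s \<in> Oc W" "t \<in> Oc W"
      "a = germ Y x W s" "b = germ Y x W t" by (rule stalk3)
    interpret C: cring "sec Y W" by (rule cring_sec[OF W(1)])
    show "a \<oplus>\<^bsub>?S\<^esub> b \<in> carrier ?S" using W by (simp add: stalk_add stalk_closed)
    show "a \<oplus>\<^bsub>?S\<^esub> b = b \<oplus>\<^bsub>?S\<^esub> a" using W by (simp add: stalk_add C.a_comm)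
  next
    fix a assume *: "a \<in> carrier ?S"
    from this this this obtain W s where W: "op W" "x \<in> W" "s \<in> Oc W" "a = germ Y x W s" by (rule stalk3)
    interpret C: cring "sec Y W" by (rule cring_sec[OF W(1)])
    show "\<zero>\<^bsub>?S\<^esub> \<oplus>\<^bsub>?S\<^esub> a = a" using W by (simp add: stalk_one_zero[OF W(1,2)] stalk_add)
    have "germ Y x W (\<ominus>\<^bsub>sec Y W\<^esub> s) \<oplus>\<^bsub>?S\<^esub> a = \<zero>\<^bsub>?S\<^esub>"
      using W by (simp add: stalk_one_zero[OF W(1,2)] stalk_add C.l_neg)
    then show "\<exists>b\<in>carrier ?S. b \<oplus>\<^bsub>?S\<^esub> a = \<zero>\<^bsub>?S\<^esub>" using W stalk_closed by blast
  qed (rule zero)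
  show "comm_monoid ?S"
  proof (rule comm_monoidI)
    fix a b c assume *: "a \<in> carrier ?S" "b \<in> carrier ?S" "c \<in> carrier ?S"
    then obtain W s t u where W: "op W" "x \<in> W" "s \<in> Oc W" "t \<in> Oc W" "u \<in> Oc W"
      "a = germ Y x W s" "b = germ Y x W t" "c = germ Y x W u" by (rule stalk3)
    interpret C: cring "sec Y W" by (rule cring_sec[OF W(1)])
    show "a \<otimes>\<^bsub>?S\<^esub> b \<otimes>\<^bsub>?S\<^esub> c = a \<otimes>\<^bsub>?S\<^esub> (b \<otimes>\<^bsub>?S\<^esub> c)"
      using W by (simp add: stalk_mult C.m_assoc)
  next
    fix a b assume *: "a \<in> carrier ?S" "b \<in> carrier ?S"
    from this(1) this obtain W s t where W: "op W" "x \<in> W" "s \<in> Oc W" "t \<in> Oc W"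
      "a = germ Y x W s" "b = germ Y x W t" by (rule stalk3)
    interpret C: cring "sec Y W" by (rule cring_sec[OF W(1)])
    show "a \<otimes>\<^bsub>?S\<^esub> b \<in> carrier ?S" using W by (simp add: stalk_mult stalk_closed)
    show "a \<otimes>\<^bsub>?S\<^esub> b = b \<otimes>\<^bsub>?S\<^esub> a" using W by (simp add: stalk_mult C.m_comm)
  next
    fix a assume *: "a \<in> carrier ?S"
    from this this this obtain W s where W: "op W" "x \<in> W" "s \<in> Oc W" "a = germ Y x W s" by (rule stalk3)
    interpret C: cring "sec Y W" by (rule cring_sec[OF W(1)])
    show "\<one>\<^bsub>?S\<^esub> \<otimes>\<^bsub>?S\<^esub> a = a" using W by (simp add: stalk_one_zero[OF W(1,2)] stalk_mult)
  qed (rule one)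
  fix a b c assume *: "a \<in> carrier ?S" "b \<in> carrier ?S" "c \<in> carrier ?S"
  then obtain W s t u where W: "op W" "x \<in> W" "s \<in> Oc W" "t \<in> Oc W" "u \<in> Oc W"
    "a = germ Y x W s" "b = germ Y x W t" "c = germ Y x W u" by (rule stalk3)
  interpret C: cring "sec Y W" by (rule cring_sec[OF W(1)])
  show "(a \<oplus>\<^bsub>?S\<^esub> b) \<otimes>\<^bsub>?S\<^esub> c = a \<otimes>\<^bsub>?S\<^esub> c \<oplus>\<^bsub>?S\<^esub> b \<otimes>\<^bsub>?S\<^esub> c"
    using W by (simp add: stalk_mult stalk_add C.l_distr)
qed

end

text \<open>A square-zero thickening \<open>Y\<close> of \<open>X\<close> on the same topological space, whose ideal is generated by
  a global section \<open>t\<close> with annihilator equal to this ideal.\<close>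

locale thickening = X: ringed X + Y: ringed Y
  for X :: "('p, 's, 'z) rspace_scheme" and Y :: "('p, 't, 'y) rspace_scheme" +
  fixes pi :: "'p set \<Rightarrow> 't \<Rightarrow> 's" and t :: 't
  assumes pts_eq: "pts Y = pts X"
    and pi_hom: "X.op V \<Longrightarrow> pi V \<in> ring_hom (sec Y V) (sec X V)"
    and pi_res: "\<lbrakk>X.op V; X.op W; W \<subseteq> V; s \<in> Y.Oc V\<rbrakk> \<Longrightarrow> pi W (res Y V W s) = res X V W (pi V s)"
    and t_mem: "t \<in> Y.Oc (carr X)"
    and t_square: "t \<otimes>\<^bsub>sec Y (carr X)\<^esub> t = \<zero>\<^bsub>sec Y (carr X)\<^esub>"
    and pi_t: "pi (carr X) t = \<zero>\<^bsub>sec X (carr X)\<^esub>"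
    and local_lift: "\<lbrakk>X.op V; b \<in> X.Oc V; x \<in> V\<rbrakk> \<Longrightarrow>
      \<exists>W s. X.op W \<and> x \<in> W \<and> W \<subseteq> V \<and> s \<in> Y.Oc W \<and> pi W s = res X V W b"
    and local_kernel: "\<lbrakk>X.op V; s \<in> Y.Oc V; pi V s = \<zero>\<^bsub>sec X V\<^esub>; x \<in> V\<rbrakk> \<Longrightarrow>
      \<exists>W u. X.op W \<and> x \<in> W \<and> W \<subseteq> V \<and> u \<in> Y.Oc W \<and> res Y V W s = res Y (carr X) W t \<otimes>\<^bsub>sec Y W\<^esub> u"
    and local_annihilator: "\<lbrakk>X.op V; s \<in> Y.Oc V; res Y (carr X) V t \<otimes>\<^bsub>sec Y V\<^esub> s = \<zero>\<^bsub>sec Y V\<^esub>; x \<in> V\<rbrakk> \<Longrightarrow>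
      \<exists>W u. X.op W \<and> x \<in> W \<and> W \<subseteq> V \<and> u \<in> Y.Oc W \<and> res Y V W s = res Y (carr X) W t \<otimes>\<^bsub>sec Y W\<^esub> u"
begin

lemma opY: "Y.op V \<longleftrightarrow> X.op V"
  by (simp add: pts_eq)

abbreviation tau where "tau V \<equiv> res Y (carr X) V t"

lemma sub_carr: "X.op V \<Longrightarrow> V \<subseteq> carr X"
  by (rule openin_subset)

lemma op_carrX: "X.op (carr X)"
  by simp

lemma cringX: "X.op V \<Longrightarrow> cring (sec X V)" by (rule X.cring_sec)
lemma cringY: "X.op V \<Longrightarrow> cring (sec Y V)" by (rule Y.cring_sec) (simp add: opY)

lemmas YresC = Y.res_closed[unfolded opY] and Yres_mult = Y.res_mult[unfolded opY]
  and Yres_add = Y.res_add[unfolded opY] and Yres_minus = Y.res_minus[unfolded opY]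
  and Yres_one = Y.res_one[unfolded opY] and Yres_zero = Y.res_zero[unfolded opY]
  and Yres_res = Y.res_res[unfolded opY] and Yres_id = Y.res_id[unfolded opY]
  and Yseparated = Y.separated[unfolded opY]

lemma local_liftE:
  assumes "X.op V" "b \<in> X.Oc V" "x \<in> V"
  obtains W u where "X.op W" "x \<in> W" "W \<subseteq> V" "u \<in> Y.Oc W" "pi W u = res X V W b"
  using local_lift[OF assms] by (elim exE conjE) (rule that)

lemma local_kernelE:
  assumes "X.op V" "s \<in> Y.Oc V" "pi V s = \<zero>\<^bsub>sec X V\<^esub>" "x \<in> V"
  obtains W u where "X.op W" "x \<in> W" "W \<subseteq> V" "u \<in> Y.Oc W"
    "res Y V W s = tau W \<otimes>\<^bsub>sec Y W\<^esub> u"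
  using local_kernel[OF assms] by (elim exE conjE) (rule that)

lemma local_annihilatorE:
  assumes "X.op V" "s \<in> Y.Oc V" "tau V \<otimes>\<^bsub>sec Y V\<^esub> s = \<zero>\<^bsub>sec Y V\<^esub>" "x \<in> V"
  obtains W u where "X.op W" "x \<in> W" "W \<subseteq> V" "u \<in> Y.Oc W"
    "res Y V W s = tau W \<otimes>\<^bsub>sec Y W\<^esub> u"
  using local_annihilator[OF assms] by (elim exE conjE) (rule that)

text \<open>Equality of sections of \<open>Y\<close> may be tested on the open sets over which two
  given sections of \<open>X\<close> lift; there the ideal is described by multiplying the lifts
  with \<open>tau\<close>.\<close>

lemma Yseparated_lift:
  assumes V: "X.op V" and s: "s \<in> Y.Oc V" "s' \<in> Y.Oc V" and b: "b \<in> X.Oc V" "c \<in> X.Oc V"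
    and loc: "\<And>W u v. \<lbrakk>X.op W; W \<subseteq> V; u \<in> Y.Oc W; pi W u = res X V W b; v \<in> Y.Oc W; pi W v = res X V W c\<rbrakk>
      \<Longrightarrow> res Y V W s = res Y V W s'"
  shows "s = s'"
proof (rule Yseparated[OF V s])
  fix x assume x: "x \<in> V"
  obtain W' u' where W': "X.op W'" "x \<in> W'" "W' \<subseteq> V" "u' \<in> Y.Oc W'" "pi W' u' = res X V W' b"
    by (rule local_liftE[OF V b(1) x])
  have c': "res X V W' c \<in> X.Oc W'" by (rule X.res_closed[OF V W'(1,3) b(2)])
  obtain W v where W: "X.op W" "x \<in> W" "W \<subseteq> W'" "v \<in> Y.Oc W" "pi W v = res X W' W (res X V W' c)"
    by (rule local_liftE[OF W'(1) c' W'(2)])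
  have "res Y V W s = res Y V W s'"
  proof (rule loc)
    show "W \<subseteq> V" using W W' by auto
    show "res Y W' W u' \<in> Y.Oc W" by (rule YresC[OF W'(1) W(1,3) W'(4)])
    show "pi W (res Y W' W u') = res X V W b"
      unfolding pi_res[OF W'(1) W(1,3) W'(4)] W'(5) by (rule X.res_res[OF V W'(1) W(1,3) W'(3) b(1)])
    show "pi W v = res X V W c"
      unfolding W(5) by (rule X.res_res[OF V W'(1) W(1,3) W'(3) b(2)])
  qed (rule W)+
  then show "\<exists>W. X.op W \<and> x \<in> W \<and> W \<subseteq> V \<and> res Y V W s = res Y V W s'"
    using W W' by (intro exI[of _ W]) auto
qed

lemma tau_closed: "X.op V \<Longrightarrow> tau V \<in> Y.Oc V"
  using YresC[OF op_carrX _ sub_carr t_mem] by auto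

lemma tau_res: "\<lbrakk>X.op V; X.op W; W \<subseteq> V\<rbrakk> \<Longrightarrow> res Y V W (tau V) = tau W"
  using Yres_res[OF op_carrX _ _ _ sub_carr t_mem] by auto

lemma tau_square: "X.op V \<Longrightarrow> tau V \<otimes>\<^bsub>sec Y V\<^esub> tau V = \<zero>\<^bsub>sec Y V\<^esub>"
  using Yres_mult[OF op_carrX _ sub_carr t_mem t_mem, of V] Yres_zero[OF op_carrX _ sub_carr, of V] t_square by simp

lemma pi_ring_hom_cring: "X.op V \<Longrightarrow> ring_hom_cring (sec Y V) (sec X V) (pi V)"
  using cringX cringY pi_hom by (intro ring_hom_cring.intro ring_hom_cring_axioms.intro)

context
  fixes V assumes *: "X.op V"
begin

interpretation ring_hom_cring "sec Y V" "sec X V" "pi V"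
  by (rule pi_ring_hom_cring[OF *])

lemma pi_closed: "s \<in> Y.Oc V \<Longrightarrow> pi V s \<in> X.Oc V" by simp
lemma pi_mult: "\<lbrakk>s \<in> Y.Oc V; u \<in> Y.Oc V\<rbrakk> \<Longrightarrow> pi V (s \<otimes>\<^bsub>sec Y V\<^esub> u) = pi V s \<otimes>\<^bsub>sec X V\<^esub> pi V u" by simp
lemma pi_add: "\<lbrakk>s \<in> Y.Oc V; u \<in> Y.Oc V\<rbrakk> \<Longrightarrow> pi V (s \<oplus>\<^bsub>sec Y V\<^esub> u) = pi V s \<oplus>\<^bsub>sec X V\<^esub> pi V u" by simp
lemma pi_minus: "\<lbrakk>s \<in> Y.Oc V; u \<in> Y.Oc V\<rbrakk> \<Longrightarrow> pi V (s \<ominus>\<^bsub>sec Y V\<^esub> u) = pi V s \<ominus>\<^bsub>sec X V\<^esub> pi V u"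
  by (simp add: a_minus_def)
lemma pi_one: "pi V \<one>\<^bsub>sec Y V\<^esub> = \<one>\<^bsub>sec X V\<^esub>" by simp
lemma pi_zero: "pi V \<zero>\<^bsub>sec Y V\<^esub> = \<zero>\<^bsub>sec X V\<^esub>" by simp

end

lemma pi_tau: "X.op V \<Longrightarrow> pi V (tau V) = \<zero>\<^bsub>sec X V\<^esub>"
  using pi_res[OF op_carrX _ sub_carr t_mem, of V] pi_t X.res_zero[OF op_carrX _ sub_carr, of V] by simp

text \<open>Locally both conditions mean that \<open>s\<close> is a multiple of \<open>tau\<close>:
  for the annihilator this is what flatness provides, for the kernel it is the description of the
  fibre. The converses hold because \<open>tau\<close> squares to zero and maps to zero.\<close>

lemma tau_mult_eq_zero_iff:
  assumes V: "X.op V" and s: "s \<in> Y.Oc V"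
  shows "tau V \<otimes>\<^bsub>sec Y V\<^esub> s = \<zero>\<^bsub>sec Y V\<^esub> \<longleftrightarrow> pi V s = \<zero>\<^bsub>sec X V\<^esub>"
proof
  interpret Y': cring "sec Y V" by (rule cringY[OF V])
  interpret X': cring "sec X V" by (rule cringX[OF V])
  {
    assume 0: "tau V \<otimes>\<^bsub>sec Y V\<^esub> s = \<zero>\<^bsub>sec Y V\<^esub>"
    show "pi V s = \<zero>\<^bsub>sec X V\<^esub>"
    proof (rule X.separated[OF V pi_closed[OF V s] X'.zero_closed])
      fix x assume "x \<in> V"
      then obtain W u where W: "X.op W" "x \<in> W" "W \<subseteq> V" "u \<in> Y.Oc W" "res Y V W s = tau W \<otimes>\<^bsub>sec Y W\<^esub> u"
        by (rule local_annihilatorE[OF V s 0])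
      interpret XW: cring "sec X W" by (rule cringX[OF W(1)])
      have "res X V W (pi V s) = pi W (tau W \<otimes>\<^bsub>sec Y W\<^esub> u)" using pi_res[OF V W(1,3) s] W by simp
      also have "\<dots> = \<zero>\<^bsub>sec X W\<^esub>" using W tau_closed by (simp add: pi_mult pi_tau pi_closed)
      finally show "\<exists>W. X.op W \<and> x \<in> W \<and> W \<subseteq> V \<and> res X V W (pi V s) = res X V W \<zero>\<^bsub>sec X V\<^esub>"
        using W X.res_zero[OF V W(1,3)] by (intro exI[of _ W]) simp
    qed
  }
  {
    assume 0: "pi V s = \<zero>\<^bsub>sec X V\<^esub>"
    show "tau V \<otimes>\<^bsub>sec Y V\<^esub> s = \<zero>\<^bsub>sec Y V\<^esub>"
    proof (rule Yseparated[OF V _ Y'.zero_closed])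
      show "tau V \<otimes>\<^bsub>sec Y V\<^esub> s \<in> Y.Oc V" using tau_closed[OF V] s by simp
      fix x assume "x \<in> V"
      then obtain W u where W: "X.op W" "x \<in> W" "W \<subseteq> V" "u \<in> Y.Oc W" "res Y V W s = tau W \<otimes>\<^bsub>sec Y W\<^esub> u"
        by (rule local_kernelE[OF V s 0])
      interpret YW: cring "sec Y W" by (rule cringY[OF W(1)])
      have "res Y V W (tau V \<otimes>\<^bsub>sec Y V\<^esub> s) = tau W \<otimes>\<^bsub>sec Y W\<^esub> (tau W \<otimes>\<^bsub>sec Y W\<^esub> u)"
        using W V s tau_closed by (simp add: Yres_mult tau_res)
      also have "\<dots> = \<zero>\<^bsub>sec Y W\<^esub>"
        using W tau_closed by (simp add: YW.m_assoc[symmetric] tau_square)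
      finally show "\<exists>W. X.op W \<and> x \<in> W \<and> W \<subseteq> V \<and> res Y V W (tau V \<otimes>\<^bsub>sec Y V\<^esub> s) = res Y V W \<zero>\<^bsub>sec Y V\<^esub>"
        using W Yres_zero[OF V W(1,3)] by (intro exI[of _ W]) simp
    qed
  }
qed

lemma tau_mult_cong:
  assumes V: "X.op V" and s: "s \<in> Y.Oc V" "s' \<in> Y.Oc V"
  shows "tau V \<otimes>\<^bsub>sec Y V\<^esub> s = tau V \<otimes>\<^bsub>sec Y V\<^esub> s' \<longleftrightarrow> pi V s = pi V s'"
proof -
  interpret Y': cring "sec Y V" by (rule cringY[OF V])
  interpret X': cring "sec X V" by (rule cringX[OF V])
  have tc: "tau V \<in> Y.Oc V" using tau_closed V by auto
  have "tau V \<otimes>\<^bsub>sec Y V\<^esub> (s \<ominus>\<^bsub>sec Y V\<^esub> s') = tau V \<otimes>\<^bsub>sec Y V\<^esub> s \<ominus>\<^bsub>sec Y V\<^esub> tau V \<otimes>\<^bsub>sec Y V\<^esub> s'"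
    using s tc by (simp add: Y'.r_minus Y'.r_distr a_minus_def)
  then have "tau V \<otimes>\<^bsub>sec Y V\<^esub> s = tau V \<otimes>\<^bsub>sec Y V\<^esub> s' \<longleftrightarrow> tau V \<otimes>\<^bsub>sec Y V\<^esub> (s \<ominus>\<^bsub>sec Y V\<^esub> s') = \<zero>\<^bsub>sec Y V\<^esub>"
    using s tc Y'.minus_eq_zero_iff by auto
  also have "\<dots> \<longleftrightarrow> pi V (s \<ominus>\<^bsub>sec Y V\<^esub> s') = \<zero>\<^bsub>sec X V\<^esub>"
    using s by (intro tau_mult_eq_zero_iff[OF V]) auto
  also have "\<dots> \<longleftrightarrow> pi V s = pi V s'"
    using s V by (simp add: pi_minus pi_closed X'.minus_eq_zero_iff)
  finally show ?thesis .
qed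

text \<open>The isomorphism of the structure sheaf of \<open>X\<close> with the ideal of the thickening.\<close>

definition lam where
  "lam V b = (SOME s. s \<in> Y.Oc V \<and> (\<forall>W u. X.op W \<and> W \<subseteq> V \<and> u \<in> Y.Oc W \<and> pi W u = res X V W b \<longrightarrow>
     res Y V W s = tau W \<otimes>\<^bsub>sec Y W\<^esub> u))"

text \<open>By \<open>tau_mult_cong\<close> the product of \<open>tau\<close> with a lift of
  \<open>b\<close> depends only on \<open>b\<close>, so the products formed with local lifts glue,
  although the lifts themselves need not.\<close>

lemma lam_spec:
  assumes V: "X.op V" and b: "b \<in> X.Oc V"
  shows "lam V b \<in> Y.Oc V \<and> (\<forall>W u. X.op W \<and> W \<subseteq> V \<and> u \<in> Y.Oc W \<and> pi W u = res X V W b \<longrightarrow>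
     res Y V W (lam V b) = tau W \<otimes>\<^bsub>sec Y W\<^esub> u)"
proof -
  have mc: "tau W \<otimes>\<^bsub>sec Y W\<^esub> u \<in> Y.Oc W" if "X.op W" "u \<in> Y.Oc W" for W u
    using tau_closed that cringY[OF that(1)] by (simp add: cring.cring_simprules)
  obtain s where s: "s \<in> Y.Oc V" "\<And>W s'. \<lbrakk>Y.op W; W \<subseteq> V; s' \<in> Y.Oc W;
     \<exists>u\<in>Y.Oc W. pi W u = res X V W b \<and> s' = tau W \<otimes>\<^bsub>sec Y W\<^esub> u\<rbrakk> \<Longrightarrow> res Y V W s = s'"
  proof (rule Y.glue_pred[where V=V and Q="\<lambda>W s. \<exists>u\<in>Y.Oc W. pi W u = res X V W b \<and> s = tau W \<otimes>\<^bsub>sec Y W\<^esub> u"])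
    fix x assume "x \<in> V"
    then obtain W u where "X.op W" "x \<in> W" "W \<subseteq> V" "u \<in> Y.Oc W" "pi W u = res X V W b"
      by (rule local_liftE[OF V b])
    then show "\<exists>W s. Y.op W \<and> x \<in> W \<and> W \<subseteq> V \<and> s \<in> Y.Oc W \<and> (\<exists>u\<in>Y.Oc W. pi W u = res X V W b \<and> s = tau W \<otimes>\<^bsub>sec Y W\<^esub> u)"
      using mc by (intro exI[of _ W] exI[of _ "tau W \<otimes>\<^bsub>sec Y W\<^esub> u"]) (auto simp: opY)
  next
    fix W s W' s' assume "Y.op W" "W \<subseteq> V" "Y.op W'" "W' \<subseteq> V"
      and ex: "\<exists>u\<in>Y.Oc W. pi W u = res X V W b \<and> s = tau W \<otimes>\<^bsub>sec Y W\<^esub> u"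
              "\<exists>u\<in>Y.Oc W'. pi W' u = res X V W' b \<and> s' = tau W' \<otimes>\<^bsub>sec Y W'\<^esub> u"
    then have W: "X.op W" "W \<subseteq> V" "X.op W'" "W' \<subseteq> V" by (auto simp: opY)
    let ?Z = "W \<inter> W'"
    have Z: "X.op ?Z" "?Z \<subseteq> W" "?Z \<subseteq> W'" using W by auto
    from ex obtain u u' where u: "u \<in> Y.Oc W" "pi W u = res X V W b" "s = tau W \<otimes>\<^bsub>sec Y W\<^esub> u"
      "u' \<in> Y.Oc W'" "pi W' u' = res X V W' b" "s' = tau W' \<otimes>\<^bsub>sec Y W'\<^esub> u'" by blast
    have "pi ?Z (res Y W ?Z u) = pi ?Z (res Y W' ?Z u')"
      using u W Z b V by (simp add: pi_res X.res_res)
    then have "tau ?Z \<otimes>\<^bsub>sec Y ?Z\<^esub> res Y W ?Z u = tau ?Z \<otimes>\<^bsub>sec Y ?Z\<^esub> res Y W' ?Z u'"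
      using tau_mult_cong Z W u YresC by simp
    then show "res Y W ?Z s = res Y W' ?Z s'"
      unfolding u(3,6) using u W Z by (simp add: Yres_mult tau_closed tau_res)
  qed (use V in \<open>auto simp: opY\<close>)
  have "s \<in> Y.Oc V \<and> (\<forall>W u. X.op W \<and> W \<subseteq> V \<and> u \<in> Y.Oc W \<and> pi W u = res X V W b \<longrightarrow>
     res Y V W s = tau W \<otimes>\<^bsub>sec Y W\<^esub> u)"
    using s mc unfolding opY by blast
  then show ?thesis unfolding lam_def by (rule someI)
qed

lemma lam_closed: "\<lbrakk>X.op V; b \<in> X.Oc V\<rbrakk> \<Longrightarrow> lam V b \<in> Y.Oc V"
  using lam_spec by blast

lemma lam_char: "\<lbrakk>X.op V; b \<in> X.Oc V; X.op W; W \<subseteq> V; u \<in> Y.Oc W; pi W u = res X V W b\<rbrakk> \<Longrightarrow>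
    res Y V W (lam V b) = tau W \<otimes>\<^bsub>sec Y W\<^esub> u"
  using lam_spec by blast

lemma lam_eqI:
  assumes V: "X.op V" "b \<in> X.Oc V" "s \<in> Y.Oc V"
    and loc: "\<And>W u. \<lbrakk>X.op W; W \<subseteq> V; u \<in> Y.Oc W; pi W u = res X V W b\<rbrakk> \<Longrightarrow> res Y V W s = tau W \<otimes>\<^bsub>sec Y W\<^esub> u"
  shows "lam V b = s"
proof (rule Yseparated_lift[OF V(1) lam_closed[OF V(1,2)] V(3,2,2)])
  fix W u assume W: "X.op W" "W \<subseteq> V" "u \<in> Y.Oc W" "pi W u = res X V W b"
  show "res Y V W (lam V b) = res Y V W s"
    unfolding lam_char[OF V(1,2) W] loc[OF W] ..
qed

lemma lam_res:
  assumes V: "X.op V" "b \<in> X.Oc V" "X.op W" "W \<subseteq> V"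
  shows "res Y V W (lam V b) = lam W (res X V W b)"
proof (rule lam_eqI[symmetric])
  show "res X V W b \<in> X.Oc W" "res Y V W (lam V b) \<in> Y.Oc W"
    using V X.res_closed YresC lam_closed by auto
  fix Z u assume Z: "X.op Z" "Z \<subseteq> W" "u \<in> Y.Oc Z" "pi Z u = res X W Z (res X V W b)"
  then have "pi Z u = res X V Z b" using X.res_res V by simp
  then show "res Y W Z (res Y V W (lam V b)) = tau Z \<otimes>\<^bsub>sec Y Z\<^esub> u"
    using lam_char[OF V(1,2) Z(1) _ Z(3)] Z V lam_closed by (simp add: Yres_res)
qed (rule V)

lemma tau_mult_eq_lam:
  assumes V: "X.op V" "u \<in> Y.Oc V"
  shows "tau V \<otimes>\<^bsub>sec Y V\<^esub> u = lam V (pi V u)"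
  using lam_char[OF V(1) pi_closed[OF V] V(1) order_refl V(2)] X.res_id[OF V(1) pi_closed[OF V]]
    Yres_id[OF V(1) lam_closed[OF V(1) pi_closed[OF V]]] by simp

text \<open>\<open>Y\<close> acts on the ideal through its quotient \<open>X\<close>, since lifts
  with equal image have equal products with \<open>tau\<close>.\<close>

lemma lam_smult:
  assumes V: "X.op V" "s \<in> Y.Oc V" "b \<in> X.Oc V"
  shows "s \<otimes>\<^bsub>sec Y V\<^esub> lam V b = lam V (pi V s \<otimes>\<^bsub>sec X V\<^esub> b)"
proof -
  interpret Y': cring "sec Y V" by (rule cringY[OF V(1)])
  interpret X': cring "sec X V" by (rule cringX[OF V(1)])
  have pc: "pi V s \<otimes>\<^bsub>sec X V\<^esub> b \<in> X.Oc V" using V pi_closed by simp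
  have c: "s \<otimes>\<^bsub>sec Y V\<^esub> lam V b \<in> Y.Oc V" "lam V (pi V s \<otimes>\<^bsub>sec X V\<^esub> b) \<in> Y.Oc V"
    using V lam_closed pi_closed by auto
  show ?thesis
  proof (rule Yseparated_lift[OF V(1) c V(3,3)])
    fix W u assume W: "X.op W" "W \<subseteq> V" "u \<in> Y.Oc W" "pi W u = res X V W b"
    interpret YW: cring "sec Y W" by (rule cringY[OF W(1)])
    have sW: "res Y V W s \<in> Y.Oc W" "tau W \<in> Y.Oc W" by (rule YresC[OF V(1) W(1,2) V(2)], rule tau_closed[OF W(1)])
    have "pi W (res Y V W s \<otimes>\<^bsub>sec Y W\<^esub> u) = res X V W (pi V s \<otimes>\<^bsub>sec X V\<^esub> b)"
      using V W sW by (simp add: pi_mult pi_res X.res_mult pi_closed)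
    then have "res Y V W (lam V (pi V s \<otimes>\<^bsub>sec X V\<^esub> b)) = tau W \<otimes>\<^bsub>sec Y W\<^esub> (res Y V W s \<otimes>\<^bsub>sec Y W\<^esub> u)"
      using sW W by (intro lam_char[OF V(1) pc W(1,2)]) auto
    also have "\<dots> = res Y V W s \<otimes>\<^bsub>sec Y W\<^esub> (tau W \<otimes>\<^bsub>sec Y W\<^esub> u)" using sW W by (simp add: YW.m_lcomm)
    also have "\<dots> = res Y V W (s \<otimes>\<^bsub>sec Y V\<^esub> lam V b)"
      using V W by (simp add: Yres_mult lam_closed lam_char[OF V(1,3) W])
    finally show "res Y V W (s \<otimes>\<^bsub>sec Y V\<^esub> lam V b) = res Y V W (lam V (pi V s \<otimes>\<^bsub>sec X V\<^esub> b))" by (rule sym)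
  qed
qed

lemma lam_add:
  assumes V: "X.op V" "b \<in> X.Oc V" "c \<in> X.Oc V"
  shows "lam V (b \<oplus>\<^bsub>sec X V\<^esub> c) = lam V b \<oplus>\<^bsub>sec Y V\<^esub> lam V c"
proof -
  interpret Y': cring "sec Y V" by (rule cringY[OF V(1)])
  interpret X': cring "sec X V" by (rule cringX[OF V(1)])
  have pc: "b \<oplus>\<^bsub>sec X V\<^esub> c \<in> X.Oc V" using V by simp
  have cl: "lam V b \<oplus>\<^bsub>sec Y V\<^esub> lam V c \<in> Y.Oc V" "lam V (b \<oplus>\<^bsub>sec X V\<^esub> c) \<in> Y.Oc V"
    using V lam_closed by auto
  show ?thesis
  proof (rule Yseparated_lift[OF V(1) cl(2,1) V(2,3)])
    fix W u v assume W: "X.op W" "W \<subseteq> V" "u \<in> Y.Oc W" "pi W u = res X V W b" "v \<in> Y.Oc W" "pi W v = res X V W c"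
    interpret YW: cring "sec Y W" by (rule cringY[OF W(1)])
    have "pi W (u \<oplus>\<^bsub>sec Y W\<^esub> v) = res X V W (b \<oplus>\<^bsub>sec X V\<^esub> c)" using W V by (simp add: pi_add X.res_add)
    then have "res Y V W (lam V (b \<oplus>\<^bsub>sec X V\<^esub> c)) = tau W \<otimes>\<^bsub>sec Y W\<^esub> (u \<oplus>\<^bsub>sec Y W\<^esub> v)"
      using W by (intro lam_char[OF V(1) pc W(1,2)]) auto
    also have "\<dots> = res Y V W (lam V b \<oplus>\<^bsub>sec Y V\<^esub> lam V c)"
      using V W lam_char[OF V(1,2) W(1,2,3,4)] lam_char[OF V(1,3) W(1,2,5,6)] tau_closed
      by (simp add: Yres_add lam_closed YW.r_distr)
    finally show "res Y V W (lam V (b \<oplus>\<^bsub>sec X V\<^esub> c)) = res Y V W (lam V b \<oplus>\<^bsub>sec Y V\<^esub> lam V c)" .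
  qed
qed

lemma lam_zero: "X.op V \<Longrightarrow> lam V \<zero>\<^bsub>sec X V\<^esub> = \<zero>\<^bsub>sec Y V\<^esub>"
proof -
  assume V: "X.op V"
  interpret Y': cring "sec Y V" by (rule cringY[OF V])
  show ?thesis using tau_mult_eq_lam[OF V Y'.zero_closed] pi_zero[OF V] tau_closed[OF V] by simp
qed

lemma pi_lam:
  assumes V: "X.op V" "b \<in> X.Oc V"
  shows "pi V (lam V b) = \<zero>\<^bsub>sec X V\<^esub>"
proof (rule X.separated[OF V(1) pi_closed[OF V(1) lam_closed[OF V]]])
  interpret X': cring "sec X V" by (rule cringX[OF V(1)])
  show "\<zero>\<^bsub>sec X V\<^esub> \<in> X.Oc V" by simp
  fix x assume "x \<in> V"
  then obtain W u where W: "X.op W" "x \<in> W" "W \<subseteq> V" "u \<in> Y.Oc W" "pi W u = res X V W b"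
    by (rule local_liftE[OF V])
  interpret XW: cring "sec X W" by (rule cringX[OF W(1)])
  have "res X V W (pi V (lam V b)) = pi W (tau W \<otimes>\<^bsub>sec Y W\<^esub> u)"
    using V W lam_closed lam_char[OF V W(1,3-5)] by (simp add: pi_res[symmetric])
  also have "\<dots> = \<zero>\<^bsub>sec X W\<^esub>" using W tau_closed X.res_closed[OF V(1) W(1,3) V(2)] by (simp add: pi_mult pi_tau)
  finally show "\<exists>W. X.op W \<and> x \<in> W \<and> W \<subseteq> V \<and> res X V W (pi V (lam V b)) = res X V W \<zero>\<^bsub>sec X V\<^esub>"
    using W X.res_zero[OF V(1) W(1,3)] by (intro exI[of _ W]) simp
qed

lemma lam_inj:
  assumes V: "X.op V" "b \<in> X.Oc V" "c \<in> X.Oc V" and eq: "lam V b = lam V c"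
  shows "b = c"
proof (rule X.separated[OF V])
  fix x assume x: "x \<in> V"
  obtain W' u' where W': "X.op W'" "x \<in> W'" "W' \<subseteq> V" "u' \<in> Y.Oc W'" "pi W' u' = res X V W' b"
    by (rule local_liftE[OF V(1,2) x])
  have c': "res X V W' c \<in> X.Oc W'" by (rule X.res_closed[OF V(1) W'(1,3) V(3)])
  obtain W v where W: "X.op W" "x \<in> W" "W \<subseteq> W'" "v \<in> Y.Oc W" "pi W v = res X W' W (res X V W' c)"
    by (rule local_liftE[OF W'(1) c' W'(2)])
  define u where "u = res Y W' W u'"
  have W2: "W \<subseteq> V" "u \<in> Y.Oc W" "pi W u = res X V W b" "pi W v = res X V W c"
    using W W' V by (auto simp: u_def YresC pi_res X.res_res)
  have "tau W \<otimes>\<^bsub>sec Y W\<^esub> u = tau W \<otimes>\<^bsub>sec Y W\<^esub> v"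
    using lam_char[OF V(1,2) W(1) W2(1,2,3)] lam_char[OF V(1,3) W(1) W2(1) W(4) W2(4)] eq by simp
  then have "pi W u = pi W v" using tau_mult_cong[OF W(1) W2(2) W(4)] by simp
  then show "\<exists>W. X.op W \<and> x \<in> W \<and> W \<subseteq> V \<and> res X V W b = res X V W c"
    using W W2 by (intro exI[of _ W]) simp
qed

text \<open>Locally \<open>s\<close> is \<open>tau\<close> times some \<open>u\<close>, and
  \<open>tau_mult_cong\<close> says that \<open>pi u\<close> is determined by \<open>s\<close>; so
  these images glue over \<open>X\<close>. Together with \<open>pi_lam\<close> this is exactness in
  the middle.\<close>

lemma ker_lam:
  assumes V: "X.op V" "s \<in> Y.Oc V" "pi V s = \<zero>\<^bsub>sec X V\<^esub>"
  obtains b where "b \<in> X.Oc V" "s = lam V b"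
proof -
  obtain b where b: "b \<in> X.Oc V" "\<And>W b'. \<lbrakk>X.op W; W \<subseteq> V; b' \<in> X.Oc W;
     \<exists>u\<in>Y.Oc W. pi W u = b' \<and> res Y V W s = tau W \<otimes>\<^bsub>sec Y W\<^esub> u\<rbrakk> \<Longrightarrow> res X V W b = b'"
  proof (rule X.glue_pred[where V=V and Q="\<lambda>W b. \<exists>u\<in>Y.Oc W. pi W u = b \<and> res Y V W s = tau W \<otimes>\<^bsub>sec Y W\<^esub> u"])
    fix x assume "x \<in> V"
    then obtain W u where "X.op W" "x \<in> W" "W \<subseteq> V" "u \<in> Y.Oc W" "res Y V W s = tau W \<otimes>\<^bsub>sec Y W\<^esub> u"
      by (rule local_kernelE[OF V])
    then show "\<exists>W b. X.op W \<and> x \<in> W \<and> W \<subseteq> V \<and> b \<in> X.Oc W \<and> (\<exists>u\<in>Y.Oc W. pi W u = b \<and> res Y V W s = tau W \<otimes>\<^bsub>sec Y W\<^esub> u)"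
      using pi_closed by (intro exI[of _ W] exI[of _ "pi W u"]) auto
  next
    fix W b W' b' assume W: "X.op W" "W \<subseteq> V" "X.op W'" "W' \<subseteq> V"
      and ex: "\<exists>u\<in>Y.Oc W. pi W u = b \<and> res Y V W s = tau W \<otimes>\<^bsub>sec Y W\<^esub> u"
              "\<exists>u\<in>Y.Oc W'. pi W' u = b' \<and> res Y V W' s = tau W' \<otimes>\<^bsub>sec Y W'\<^esub> u"
    let ?Z = "W \<inter> W'"
    have Z: "X.op ?Z" "?Z \<subseteq> W" "?Z \<subseteq> W'" using W by auto
    from ex obtain u u' where u: "u \<in> Y.Oc W" "pi W u = b" "res Y V W s = tau W \<otimes>\<^bsub>sec Y W\<^esub> u"
      "u' \<in> Y.Oc W'" "pi W' u' = b'" "res Y V W' s = tau W' \<otimes>\<^bsub>sec Y W'\<^esub> u'" by blast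
    have "res Y W ?Z (res Y V W s) = res Y W' ?Z (res Y V W' s)" using W Z V by (simp add: Yres_res)
    then have "tau ?Z \<otimes>\<^bsub>sec Y ?Z\<^esub> res Y W ?Z u = tau ?Z \<otimes>\<^bsub>sec Y ?Z\<^esub> res Y W' ?Z u'"
      unfolding u(3,6) using u W Z by (simp add: Yres_mult tau_closed tau_res)
    then have "pi ?Z (res Y W ?Z u) = pi ?Z (res Y W' ?Z u')" using tau_mult_cong Z W u YresC by simp
    then show "res X W ?Z b = res X W' ?Z b'" using u W Z by (simp add: pi_res)
  qed (use V in auto)
  have "lam V b = s"
  proof (rule Yseparated[OF V(1) lam_closed[OF V(1) b(1)] V(2)])
    fix x assume "x \<in> V"
    then obtain W u where W: "X.op W" "x \<in> W" "W \<subseteq> V" "u \<in> Y.Oc W" "res Y V W s = tau W \<otimes>\<^bsub>sec Y W\<^esub> u"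
      by (rule local_kernelE[OF V])
    then have "res X V W b = pi W u" using b(2)[OF W(1,3) pi_closed[OF W(1,4)]] by auto
    then have "res Y V W (lam V b) = res Y V W s" using lam_char[OF V(1) b(1) W(1,3,4)] W by simp
    then show "\<exists>W. X.op W \<and> x \<in> W \<and> W \<subseteq> V \<and> res Y V W (lam V b) = res Y V W s" using W by blast
  qed
  then show thesis using that b(1) by blast
qed

text \<open>Invertibility modulo a square-zero ideal suffices: a local lift \<open>u\<close> of
  \<open>c\<close> gives \<open>s\<close> times \<open>u\<close> equal to \<open>1 + e\<close> with
  \<open>e\<close> of square zero, whose inverse is \<open>1 - e\<close>. Inverses are unique, so
  the local ones glue.\<close>

lemma unit_lift:
  assumes V: "X.op V" "s \<in> Y.Oc V" "c \<in> X.Oc V" and inv: "pi V s \<otimes>\<^bsub>sec X V\<^esub> c = \<one>\<^bsub>sec X V\<^esub>"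
  obtains s' where "s' \<in> Y.Oc V" "s \<otimes>\<^bsub>sec Y V\<^esub> s' = \<one>\<^bsub>sec Y V\<^esub>"
proof -
  interpret YV: cring "sec Y V" by (rule cringY[OF V(1)])
  have resV: "res Y W Z (res Y V W s) = res Y V Z s" if "X.op W" "W \<subseteq> V" "X.op Z" "Z \<subseteq> W" for W Z
    using that V by (simp add: Yres_res)
  obtain s' where s': "s' \<in> Y.Oc V" "\<And>W u. \<lbrakk>X.op W; W \<subseteq> V; u \<in> Y.Oc W;
     res Y V W s \<otimes>\<^bsub>sec Y W\<^esub> u = \<one>\<^bsub>sec Y W\<^esub>\<rbrakk> \<Longrightarrow> res Y V W s' = u"
    and loc: "\<And>x. x \<in> V \<Longrightarrow> \<exists>W u. X.op W \<and> x \<in> W \<and> W \<subseteq> V \<and> u \<in> Y.Oc W \<and> res Y V W s \<otimes>\<^bsub>sec Y W\<^esub> u = \<one>\<^bsub>sec Y W\<^esub>"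
  proof -
    have loc: "\<exists>W u. X.op W \<and> x \<in> W \<and> W \<subseteq> V \<and> u \<in> Y.Oc W \<and> res Y V W s \<otimes>\<^bsub>sec Y W\<^esub> u = \<one>\<^bsub>sec Y W\<^esub>"
      if "x \<in> V" for x
    proof -
      obtain W u where W: "X.op W" "x \<in> W" "W \<subseteq> V" "u \<in> Y.Oc W" "pi W u = res X V W c"
        by (rule local_liftE[OF V(1,3) \<open>x \<in> V\<close>])
      interpret YW: cring "sec Y W" by (rule cringY[OF W(1)])
      interpret XW: cring "sec X W" by (rule cringX[OF W(1)])
      let ?s = "res Y V W s"
      have sW: "?s \<in> Y.Oc W" using V W YresC by auto
      have "pi W (?s \<otimes>\<^bsub>sec Y W\<^esub> u) = res X V W (pi V s \<otimes>\<^bsub>sec X V\<^esub> c)"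
        using V W sW by (simp add: pi_mult pi_res X.res_mult pi_closed)
      also have "\<dots> = \<one>\<^bsub>sec X W\<^esub>" using inv V W X.res_one by simp
      finally have "pi W (?s \<otimes>\<^bsub>sec Y W\<^esub> u \<ominus>\<^bsub>sec Y W\<^esub> \<one>\<^bsub>sec Y W\<^esub>) = \<zero>\<^bsub>sec X W\<^esub>"
        using sW W by (simp add: pi_minus pi_one XW.minus_eq_zero_iff)
      then obtain e where e: "e \<in> X.Oc W" "?s \<otimes>\<^bsub>sec Y W\<^esub> u \<ominus>\<^bsub>sec Y W\<^esub> \<one>\<^bsub>sec Y W\<^esub> = lam W e"
        using ker_lam[OF W(1)] sW W by (metis YW.minus_closed YW.m_closed YW.one_closed)
      have lc: "lam W e \<in> Y.Oc W" using lam_closed W e by auto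
      have su: "?s \<otimes>\<^bsub>sec Y W\<^esub> u = \<one>\<^bsub>sec Y W\<^esub> \<oplus>\<^bsub>sec Y W\<^esub> lam W e"
        unfolding e(2)[symmetric] using sW W by (simp add: a_minus_def YW.a_ac YW.r_neg2)
      have sq: "lam W e \<otimes>\<^bsub>sec Y W\<^esub> lam W e = \<zero>\<^bsub>sec Y W\<^esub>"
        using lam_smult[OF W(1) lc e(1)] e W by (simp add: pi_lam lam_zero)
      have "?s \<otimes>\<^bsub>sec Y W\<^esub> (u \<otimes>\<^bsub>sec Y W\<^esub> (\<one>\<^bsub>sec Y W\<^esub> \<ominus>\<^bsub>sec Y W\<^esub> lam W e)) =
          (\<one>\<^bsub>sec Y W\<^esub> \<oplus>\<^bsub>sec Y W\<^esub> lam W e) \<otimes>\<^bsub>sec Y W\<^esub> (\<one>\<^bsub>sec Y W\<^esub> \<ominus>\<^bsub>sec Y W\<^esub> lam W e)"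
        using sW W lc by (simp add: YW.m_assoc[symmetric] su)
      also have "\<dots> = \<one>\<^bsub>sec Y W\<^esub>"
        using lc sq by (simp add: a_minus_def YW.l_distr YW.r_distr YW.r_minus YW.a_assoc YW.l_neg YW.r_neg)
      finally show ?thesis using W sW lc
        by (intro exI[of _ W] exI[of _ "u \<otimes>\<^bsub>sec Y W\<^esub> (\<one>\<^bsub>sec Y W\<^esub> \<ominus>\<^bsub>sec Y W\<^esub> lam W e)"]) auto
    qed
    show thesis
    proof (rule Y.glue_pred[where V=V and Q="\<lambda>W u. res Y V W s \<otimes>\<^bsub>sec Y W\<^esub> u = \<one>\<^bsub>sec Y W\<^esub>"])
      fix W u W' u' assume "Y.op W" "W \<subseteq> V" "u \<in> Y.Oc W" "Y.op W'" "W' \<subseteq> V" "u' \<in> Y.Oc W'"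
        and eq: "res Y V W s \<otimes>\<^bsub>sec Y W\<^esub> u = \<one>\<^bsub>sec Y W\<^esub>" "res Y V W' s \<otimes>\<^bsub>sec Y W'\<^esub> u' = \<one>\<^bsub>sec Y W'\<^esub>"
      then have W: "X.op W" "W \<subseteq> V" "u \<in> Y.Oc W" "X.op W'" "W' \<subseteq> V" "u' \<in> Y.Oc W'" by (auto simp: opY)
      let ?Z = "W \<inter> W'"
      have Z: "X.op ?Z" "?Z \<subseteq> W" "?Z \<subseteq> W'" "?Z \<subseteq> V" using W by auto
      interpret YZ: cring "sec Y ?Z" by (rule cringY[OF Z(1)])
      have sW: "res Y V W s \<in> Y.Oc W" "res Y V W' s \<in> Y.Oc W'" "res Y V ?Z s \<in> Y.Oc ?Z"
        "res Y W ?Z u \<in> Y.Oc ?Z" "res Y W' ?Z u' \<in> Y.Oc ?Z" using V W Z YresC by auto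
      have "res Y V ?Z s \<otimes>\<^bsub>sec Y ?Z\<^esub> res Y W ?Z u = res Y W ?Z (res Y V W s \<otimes>\<^bsub>sec Y W\<^esub> u)"
        using W Z sW by (simp add: Yres_mult resV)
      then have 1: "res Y V ?Z s \<otimes>\<^bsub>sec Y ?Z\<^esub> res Y W ?Z u = \<one>\<^bsub>sec Y ?Z\<^esub>" unfolding eq using Yres_one W Z by simp
      have "res Y V ?Z s \<otimes>\<^bsub>sec Y ?Z\<^esub> res Y W' ?Z u' = res Y W' ?Z (res Y V W' s \<otimes>\<^bsub>sec Y W'\<^esub> u')"
        using W Z sW by (simp add: Yres_mult resV)
      then have 2: "res Y V ?Z s \<otimes>\<^bsub>sec Y ?Z\<^esub> res Y W' ?Z u' = \<one>\<^bsub>sec Y ?Z\<^esub>" unfolding eq using Yres_one W Z by simp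
      have "res Y W ?Z u = (res Y V ?Z s \<otimes>\<^bsub>sec Y ?Z\<^esub> res Y W' ?Z u') \<otimes>\<^bsub>sec Y ?Z\<^esub> res Y W ?Z u" using sW 2 by simp
      also have "\<dots> = (res Y V ?Z s \<otimes>\<^bsub>sec Y ?Z\<^esub> res Y W ?Z u) \<otimes>\<^bsub>sec Y ?Z\<^esub> res Y W' ?Z u'"
        using sW(3-5) by (simp only: YZ.m_assoc YZ.m_comm YZ.m_lcomm)
      also have "\<dots> = res Y W' ?Z u'" using sW 1 by simp
      finally show "res Y W ?Z u = res Y W' ?Z u'" .
    qed (use V loc that in \<open>auto simp: opY\<close>)
  qed
  have "s \<otimes>\<^bsub>sec Y V\<^esub> s' = \<one>\<^bsub>sec Y V\<^esub>"
  proof (rule Yseparated[OF V(1)])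
    fix x assume "x \<in> V"
    then obtain W u where W: "X.op W" "x \<in> W" "W \<subseteq> V" "u \<in> Y.Oc W" "res Y V W s \<otimes>\<^bsub>sec Y W\<^esub> u = \<one>\<^bsub>sec Y W\<^esub>"
      using loc by blast
    then have "res Y V W (s \<otimes>\<^bsub>sec Y V\<^esub> s') = res Y V W \<one>\<^bsub>sec Y V\<^esub>"
      using V s' by (simp add: Yres_mult Yres_one)
    then show "\<exists>W. X.op W \<and> x \<in> W \<and> W \<subseteq> V \<and> res Y V W (s \<otimes>\<^bsub>sec Y V\<^esub> s') = res Y V W \<one>\<^bsub>sec Y V\<^esub>" using W by blast
  qed (use V s' in auto)
  then show thesis using that s' by blast
qed

end

section \<open>First-order deformations as thickenings\<close>

lemma complex_dual_numbers_simps [simp]: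
  "carrier complex_dual_numbers = UNIV"
  "(a, b) \<otimes>\<^bsub>complex_dual_numbers\<^esub> (c, d) = (a * c, a * d + b * c)"
  "(a, b) \<oplus>\<^bsub>complex_dual_numbers\<^esub> (c, d) = (a + c, b + d)"
  "\<one>\<^bsub>complex_dual_numbers\<^esub> = (1, 0)" "\<zero>\<^bsub>complex_dual_numbers\<^esub> = (0, 0)"
  by (auto simp: complex_dual_numbers_def dual_numbers_def subring_of_type_def)

lemma cring_complex_dual_numbers: "cring complex_dual_numbers"
proof (rule cringI)
  show "abelian_group complex_dual_numbers"
  proof (rule abelian_groupI)
    fix x :: "complex \<times> complex" obtain a b where "x = (a, b)" by force
    then show "\<exists>y\<in>carrier complex_dual_numbers. y \<oplus>\<^bsub>complex_dual_numbers\<^esub> x = \<zero>\<^bsub>complex_dual_numbers\<^esub>"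
      by (intro bexI[of _ "(- a, - b)"]) auto
  qed (auto simp: algebra_simps)
  show "comm_monoid complex_dual_numbers" by (rule comm_monoidI) (auto simp: algebra_simps)
qed (auto simp: algebra_simps)

text \<open>The equational criterion is applied to the single relation that \<open>(0, 1)\<close>
  kills \<open>m\<close>. It writes \<open>m\<close> with coefficients killed by
  \<open>(0, 1)\<close>; these have first component 0, hence are multiples of \<open>(0, 1)\<close>,
  which can be factored out of the sum.\<close>

lemma flat_annihilator:
  assumes S: "cring S" and flat: "flat_ring_hom complex_dual_numbers S h"
    and m: "m \<in> carrier S" "h (0, 1) \<otimes>\<^bsub>S\<^esub> m = \<zero>\<^bsub>S\<^esub>"
  shows "\<exists>z\<in>carrier S. m = h (0, 1) \<otimes>\<^bsub>S\<^esub> z"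
proof -
  interpret S: cring S by fact
  interpret D: cring complex_dual_numbers by (rule cring_complex_dual_numbers)
  have h: "h \<in> ring_hom complex_dual_numbers S" using flat by (simp add: flat_ring_hom_def)
  have hc: "h r \<in> carrier S" for r using ring_hom_closed[OF h] by simp
  have "(\<Oplus>\<^bsub>S\<^esub>i\<in>{..<1::nat}. h ((\<lambda>_. (0, 1)) i) \<otimes>\<^bsub>S\<^esub> (\<lambda>_. m) i) = \<zero>\<^bsub>S\<^esub>"
    using m hc by (simp add: lessThan_Suc)
  moreover have "(\<lambda>_. (0, 1)) \<in> {..<1::nat} \<rightarrow> carrier complex_dual_numbers" "(\<lambda>_. m) \<in> {..<1::nat} \<rightarrow> carrier S"
    using m by auto
  moreover have "\<forall>(n::nat) r m. r \<in> {..<n} \<rightarrow> carrier complex_dual_numbers \<and> m \<in> {..<n} \<rightarrow> carrier S \<and>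
        (\<Oplus>\<^bsub>S\<^esub>i\<in>{..<n}. h (r i) \<otimes>\<^bsub>S\<^esub> m i) = \<zero>\<^bsub>S\<^esub> \<longrightarrow>
        (\<exists>(k::nat) a y. (\<forall>i<n. \<forall>j<k. a i j \<in> carrier complex_dual_numbers) \<and> y \<in> {..<k} \<rightarrow> carrier S \<and>
           (\<forall>i<n. m i = (\<Oplus>\<^bsub>S\<^esub>j\<in>{..<k}. h (a i j) \<otimes>\<^bsub>S\<^esub> y j)) \<and>
           (\<forall>j<k. (\<Oplus>\<^bsub>complex_dual_numbers\<^esub>i\<in>{..<n}. r i \<otimes>\<^bsub>complex_dual_numbers\<^esub> a i j) = \<zero>\<^bsub>complex_dual_numbers\<^esub>))"
    using flat unfolding flat_ring_hom_def by (rule conjunct2)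
  ultimately have "\<exists>(k::nat) a y. (\<forall>i<1. \<forall>j<k. a i j \<in> carrier complex_dual_numbers) \<and> y \<in> {..<k} \<rightarrow> carrier S \<and>
           (\<forall>i<1::nat. m = (\<Oplus>\<^bsub>S\<^esub>j\<in>{..<k}. h (a i j) \<otimes>\<^bsub>S\<^esub> y j)) \<and>
           (\<forall>j<k. (\<Oplus>\<^bsub>complex_dual_numbers\<^esub>i\<in>{..<1::nat}. (0, 1) \<otimes>\<^bsub>complex_dual_numbers\<^esub> a i j) = \<zero>\<^bsub>complex_dual_numbers\<^esub>)"
    by (elim allE[of _ "1::nat"] allE[of _ "\<lambda>_. (0, 1)"] allE[of _ "\<lambda>_. m"]) (rule mp; simp)
  then obtain k a y where ay: "y \<in> {..<k::nat} \<rightarrow> carrier S"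
    "\<forall>i<1::nat. m = (\<Oplus>\<^bsub>S\<^esub>j\<in>{..<k}. h (a i j) \<otimes>\<^bsub>S\<^esub> y j)"
    "\<forall>j<k. (\<Oplus>\<^bsub>complex_dual_numbers\<^esub>i\<in>{..<1::nat}. (0, 1) \<otimes>\<^bsub>complex_dual_numbers\<^esub> a i j) = \<zero>\<^bsub>complex_dual_numbers\<^esub>"
    by (elim exE conjE) (rule that)
  have a0: "a 0 j = (0, 1) \<otimes>\<^bsub>complex_dual_numbers\<^esub> (snd (a 0 j), 0)" if "j < k" for j
  proof -
    have "(0, 1) \<otimes>\<^bsub>complex_dual_numbers\<^esub> a 0 j = (0, 0)"
      using ay(3) that by (simp add: lessThan_Suc)
    then show ?thesis by (cases "a 0 j") simp
  qed
  define z where "z j = h (snd (a 0 j), 0) \<otimes>\<^bsub>S\<^esub> y j" for j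
  have zc: "z \<in> {..<k} \<rightarrow> carrier S" using ay(1) hc by (auto simp: z_def Pi_iff)
  have "m = (\<Oplus>\<^bsub>S\<^esub>j\<in>{..<k}. h (a 0 j) \<otimes>\<^bsub>S\<^esub> y j)" using ay(2) by simp
  also have "\<dots> = (\<Oplus>\<^bsub>S\<^esub>j\<in>{..<k}. h (0, 1) \<otimes>\<^bsub>S\<^esub> z j)"
  proof (rule S.finsum_cong')
    show "(\<lambda>j. h (0, 1) \<otimes>\<^bsub>S\<^esub> z j) \<in> {..<k} \<rightarrow> carrier S" using zc hc by auto
    fix j assume j: "j \<in> {..<k}"
    have "h (a 0 j) = h ((0, 1) \<otimes>\<^bsub>complex_dual_numbers\<^esub> (snd (a 0 j), 0))" using a0[of j] j by simp
    also have "\<dots> = h (0, 1) \<otimes>\<^bsub>S\<^esub> h (snd (a 0 j), 0)" by (rule ring_hom_mult[OF h]) auto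
    finally show "h (a 0 j) \<otimes>\<^bsub>S\<^esub> y j = h (0, 1) \<otimes>\<^bsub>S\<^esub> z j"
      using ay(1) hc j by (simp add: z_def S.m_assoc Pi_iff)
  qed simp
  also have "\<dots> = h (0, 1) \<otimes>\<^bsub>S\<^esub> (\<Oplus>\<^bsub>S\<^esub>j\<in>{..<k}. z j)"
    using zc hc by (intro S.finsum_rdistr[symmetric]) auto
  finally show ?thesis using S.finsum_closed[OF zc] by blast
qed

text \<open>An equation between germs holds on a neighbourhood: this turns flatness, a condition on
  stalks, into the local condition required of a thickening.\<close>

lemma (in ringed) stalk_annihilator:
  assumes V: "op V" "y \<in> V" "s \<in> Oc V" and u: "u \<in> Oc (carr Y)"
    and z: "z \<in> carrier (stalk Y y)" "germ Y y V s = germ Y y (carr Y) u \<otimes>\<^bsub>stalk Y y\<^esub> z"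
  shows "\<exists>W v. op W \<and> y \<in> W \<and> W \<subseteq> V \<and> v \<in> Oc W \<and> res Y V W s = res Y (carr Y) W u \<otimes>\<^bsub>sec Y W\<^esub> v"
proof -
  obtain U v where U: "op U" "y \<in> U" "v \<in> Oc U" "z = germ Y y U v" using z(1) unfolding stalk_carrier by blast
  interpret YU: cring "sec Y U" by (rule cring_sec[OF U(1)])
  have Uc: "U \<subseteq> carr Y" using U openin_subset by auto
  have uU: "res Y (carr Y) U u \<in> Oc U" using res_closed[OF op_carr U(1) Uc u] .
  have "germ Y y V s = germ Y y U (res Y (carr Y) U u \<otimes>\<^bsub>sec Y U\<^esub> v)"
    unfolding z(2) U(4) germ_res[OF op_carr U(1,2) Uc u, symmetric] using stalk_mult U uU by simp
  then obtain W where W: "op W" "y \<in> W" "W \<subseteq> V \<inter> U" "res Y V W s = res Y U W (res Y (carr Y) U u \<otimes>\<^bsub>sec Y U\<^esub> v)"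
    using germ_eq_iff[OF V U(1,2), of "res Y (carr Y) U u \<otimes>\<^bsub>sec Y U\<^esub> v"] uU U by auto
  have "res Y V W s = res Y (carr Y) W u \<otimes>\<^bsub>sec Y W\<^esub> res Y U W v"
    unfolding W(4) using U W uU u Uc by (subst res_mult) (auto simp: res_res)
  moreover have "res Y U W v \<in> Oc W" using res_closed U W by auto
  ultimately show ?thesis using W by blast
qed

text \<open>A deformation may live on a different space, homeomorphic to that of \<open>X\<close>.
  Pulling its sheaf back along \<open>i\<close> puts it on the space of \<open>X\<close> itself, as
  \<open>thickening\<close> demands.\<close>

definition transport :: "('p, 's, 'z) rspace_scheme \<Rightarrow> ('q, 't, 'y) rspace_scheme \<Rightarrow> ('p \<Rightarrow> 'q) \<Rightarrow> ('p, 't) rspace" where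
  "transport X Y i = \<lparr>pts = pts X, sec = (\<lambda>V. sec Y (i ` V)), res = (\<lambda>V W. res Y (i ` V) (i ` W))\<rparr>"

lemma transport_simps:
  "pts (transport X Y i) = pts X" "sec (transport X Y i) V = sec Y (i ` V)"
  "res (transport X Y i) V W = res Y (i ` V) (i ` W)"
  by (simp_all add: transport_def)

lemma homeomorphic_map_image:
  assumes "homeomorphic_map S T i"
  shows "openin S V \<Longrightarrow> openin T (i ` V)" "i ` topspace S = topspace T" "inj_on i (topspace S)"
    "\<lbrakk>openin T W; W \<subseteq> i ` V; openin S V\<rbrakk> \<Longrightarrow> \<exists>U. openin S U \<and> U \<subseteq> V \<and> W = i ` U"
proof -
  show 1: "openin S V \<Longrightarrow> openin T (i ` V)"
    using homeomorphic_map_openness_eq[OF assms] openin_subset by metis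
  show 2: "i ` topspace S = topspace T" using assms homeomorphic_imp_surjective_map by blast
  show 3: "inj_on i (topspace S)" using assms homeomorphic_imp_injective_map by blast
  assume W: "openin T W" "W \<subseteq> i ` V" "openin S V"
  have "openin S {x \<in> topspace S. i x \<in> W}"
    using W(1) homeomorphic_imp_continuous_map[OF assms] openin_continuous_map_preimage by blast
  moreover have "{x \<in> topspace S. i x \<in> W} \<subseteq> V" using W 3 openin_subset[OF W(3)] by (auto simp: inj_on_def)
  moreover have "W = i ` {x \<in> topspace S. i x \<in> W}" using 2 openin_subset[OF W(1)] by auto
  ultimately show "\<exists>U. openin S U \<and> U \<subseteq> V \<and> W = i ` U" by blast
qed

lemma ringed_transport:
  assumes Y: "ringed_space Y" and i: "homeomorphic_map (pts X) (pts Y) i"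
  shows "ringed_space (transport X Y i)"
proof -
  interpret Y: ringed Y by standard (rule Y)
  note im = homeomorphic_map_image[OF i]
  have op: "Y.op (i ` V)" if "openin (pts X) V" for V using im(1) that .
  show ?thesis
    unfolding ringed_space_def transport_simps
  proof (intro conjI allI impI ballI)
    fix U assume "openin (pts X) U" then show "cring (sec Y (i ` U))" by (intro Y.cring_sec op)
  next
    fix U V assume "openin (pts X) U \<and> openin (pts X) V \<and> V \<subseteq> U"
    then show "res Y (i ` U) (i ` V) \<in> ring_hom (sec Y (i ` U)) (sec Y (i ` V))"
      by (intro ring_hom_cring.homh Y.ring_hom_cring_res op image_mono) auto
  next
    fix U s assume "openin (pts X) U" "s \<in> Y.Oc (i ` U)"
    then show "res Y (i ` U) (i ` U) s = s" by (intro Y.res_id op)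
  next
    fix U V W s assume "openin (pts X) U \<and> openin (pts X) V \<and> openin (pts X) W \<and> W \<subseteq> V \<and> V \<subseteq> U" "s \<in> Y.Oc (i ` U)"
    then show "res Y (i ` V) (i ` W) (res Y (i ` U) (i ` V) s) = res Y (i ` U) (i ` W) s"
      by (intro Y.res_res op image_mono) auto
  next
    fix \<U> and t
    assume "(\<forall>U\<in>\<U>. openin (pts X) U \<and> t U \<in> Y.Oc (i ` U)) \<and>
      (\<forall>U\<in>\<U>. \<forall>V\<in>\<U>. res Y (i ` U) (i ` (U \<inter> V)) (t U) = res Y (i ` V) (i ` (U \<inter> V)) (t V))"
    then have o: "\<And>U. U \<in> \<U> \<Longrightarrow> openin (pts X) U" and tc: "\<And>U. U \<in> \<U> \<Longrightarrow> t U \<in> Y.Oc (i ` U)"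
      and comp: "\<And>U V. \<lbrakk>U \<in> \<U>; V \<in> \<U>\<rbrakk> \<Longrightarrow> res Y (i ` U) (i ` (U \<inter> V)) (t U) = res Y (i ` V) (i ` (U \<inter> V)) (t V)"
      by auto
    have sub: "U \<subseteq> topspace (pts X)" if "U \<in> \<U>" for U using o[OF that] openin_subset by auto
    \<comment> \<open>The given sections are indexed by open sets of \<open>X\<close>; since a set
      is determined by its image under \<open>i\<close>, the family can be indexed by the images
      instead.\<close>
    have inj: "inj_on ((`) i) \<U>"
      using sub by (intro inj_onI) (metis im(3) inj_on_image_eq_iff)
    define u where "u V = t (the_inv_into \<U> ((`) i) V)" for V
    have u: "u (i ` U) = t U" if "U \<in> \<U>" for U
      unfolding u_def using the_inv_into_f_f[OF inj that] by simp
    have "\<exists>!s. s \<in> Y.Oc (\<Union>((`) i ` \<U>)) \<and> (\<forall>V\<in>(`) i ` \<U>. res Y (\<Union>((`) i ` \<U>)) V s = u V)"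
    proof (rule Y.glue_ex1)
      fix V W assume "V \<in> (`) i ` \<U>" "W \<in> (`) i ` \<U>"
      then obtain U U' where UU: "V = i ` U" "W = i ` U'" "U \<in> \<U>" "U' \<in> \<U>" by auto
      have "V \<inter> W = i ` (U \<inter> U')" unfolding UU(1,2)
        using inj_on_image_Int[OF im(3) sub[OF UU(3)] sub[OF UU(4)]] by simp
      then show "res Y V (V \<inter> W) (u V) = res Y W (V \<inter> W) (u W)"
        using comp[OF UU(3,4)] u UU by simp
    qed (use u tc o op in auto)
    then show "\<exists>!s. s \<in> Y.Oc (i ` \<Union>\<U>) \<and> (\<forall>U\<in>\<U>. res Y (i ` \<Union>\<U>) (i ` U) s = t U)"
      using u by (simp add: image_Union ball_simps cong: ball_cong)
  qed
qed

locale deformation =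
  fixes X :: "(complex, 'p, 's) rspace_over" and Y :: "(complex \<times> complex, 'q, 't) rspace_over" and i ic
  assumes X: "ringed_space X" and strX: "str X \<in> UNIV \<rightarrow> carrier (sec X (carr X))" "str X 0 = \<zero>\<^bsub>sec X (carr X)\<^esub>"
    and def: "first_order_deformation X Y i ic"
begin

lemmas def' = def[unfolded first_order_deformation_def]

lemmas schY = def'[THEN conjunct1]
  and str = def'[THEN conjunct2, THEN conjunct1]
  and flat = def'[THEN conjunct2, THEN conjunct2, THEN conjunct1]
  and mor = def'[THEN conjunct2, THEN conjunct2, THEN conjunct2, THEN conjunct1]
  and icstr = def'[THEN conjunct2, THEN conjunct2, THEN conjunct2, THEN conjunct2, THEN conjunct1]
  and hom = def'[THEN conjunct2, THEN conjunct2, THEN conjunct2, THEN conjunct2, THEN conjunct2, THEN conjunct1]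
  and lsurj = def'[THEN conjunct2, THEN conjunct2, THEN conjunct2, THEN conjunct2, THEN conjunct2, THEN conjunct2, THEN conjunct1]
  and ker = def'[THEN conjunct2, THEN conjunct2, THEN conjunct2, THEN conjunct2, THEN conjunct2, THEN conjunct2, THEN conjunct2]

lemma ringedY: "ringed_space Y"
  using schY by (simp add: scheme_def)

sublocale RX: ringed X by standard (rule X)
sublocale RY: ringed Y by standard (rule ringedY)

abbreviation Y' where "Y' \<equiv> transport X Y i"

lemmas im = homeomorphic_map_image[OF hom]

lemma preim_image: "V \<subseteq> carr X \<Longrightarrow> preim X i (i ` V) = V"
  using im(3) by (auto simp: preim_def inj_on_def)

lemma preim_image_open: "openin (pts X) V \<Longrightarrow> preim X i (i ` V) = V"
  using preim_image openin_subset by blast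

context
  notes transport_simps [simp]
begin

text \<open>The last three axioms of a thickening come from local surjectivity, from the description
  of the kernel, and from flatness at the stalks, in this order.\<close>

lemma thickening_transport: "thickening X Y' (\<lambda>V. ic (i ` V)) (str Y (0, 1))"
proof
  show "ringed_space Y'" by (rule ringed_transport[OF ringedY hom])
  show "pts Y' = pts X" by simp
next
  fix V assume V: "openin (pts X) V"
  have "ic (i ` V) \<in> ring_hom (sec Y (i ` V)) (sec X (preim X i (i ` V)))"
    using mor im(1)[OF V] unfolding rs_morphism_def by blast
  then show "ic (i ` V) \<in> ring_hom (sec Y' V) (sec X V)" by (simp add: preim_image_open[OF V])
next
  fix V W s assume *: "openin (pts X) V" "openin (pts X) W" "W \<subseteq> V" "s \<in> carrier (sec Y' V)"
  have "\<forall>V W. openin (pts Y) V \<and> openin (pts Y) W \<and> W \<subseteq> V \<longrightarrow>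
        (\<forall>s\<in>carrier (sec Y V). ic W (res Y V W s) = res X (preim X i V) (preim X i W) (ic V s))"
    using mor unfolding rs_morphism_def by (elim conjE)
  then have "ic (i ` W) (res Y (i ` V) (i ` W) s) = res X (preim X i (i ` V)) (preim X i (i ` W)) (ic (i ` V) s)"
    using im(1)[OF *(1)] im(1)[OF *(2)] image_mono[OF *(3), of i] *(4) by simp
  then show "ic (i ` W) (res Y' V W s) = res X V W (ic (i ` V) s)"
    using * by (simp add: preim_image_open)
next
  have t: "str Y (0, 1) \<in> carrier (sec Y (carr Y))" using ring_hom_closed[OF str] by simp
  then show "str Y (0, 1) \<in> carrier (sec Y' (carr X))" by (simp add: im(2))
  interpret D: ring_hom_cring complex_dual_numbers "sec Y (carr Y)" "str Y"
    using str cring_complex_dual_numbers RY.cring_sec[OF RY.op_carr]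
    by (intro ring_hom_cring.intro ring_hom_cring_axioms.intro)
  have "str Y (0, 1) \<otimes>\<^bsub>sec Y (carr Y)\<^esub> str Y (0, 1) = str Y (0, 0)"
    using D.hom_mult[of "(0, 1)" "(0, 1)"] by simp
  also have "\<dots> = \<zero>\<^bsub>sec Y (carr Y)\<^esub>" using D.hom_zero by simp
  finally show "str Y (0, 1) \<otimes>\<^bsub>sec Y' (carr X)\<^esub> str Y (0, 1) = \<zero>\<^bsub>sec Y' (carr X)\<^esub>" by (simp add: im(2))
  show "ic (i ` carr X) (str Y (0, 1)) = \<zero>\<^bsub>sec X (carr X)\<^esub>"
    using icstr strX by (simp add: im(2))
next
  fix V b x assume *: "openin (pts X) V" "b \<in> carrier (sec X V)" "x \<in> V"
  then have "openin (pts Y) (i ` V)" "b \<in> carrier (sec X (preim X i (i ` V)))" "i x \<in> i ` V"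
    using im(1) by (auto simp: preim_image_open)
  from lsurj[rule_format, OF this] obtain W where W: "openin (pts Y) W" "i x \<in> W" "W \<subseteq> i ` V"
     "res X (preim X i (i ` V)) (preim X i W) b \<in> ic W ` carrier (sec Y W)" by (elim exE conjE) (rule that)
  then obtain U where U: "openin (pts X) U" "U \<subseteq> V" "W = i ` U" using im(4) * by blast
  have "x \<in> U" using W(2) U im(3) * openin_subset[OF *(1)] openin_subset[OF U(1)]
    by (auto simp: inj_on_def)
  then show "\<exists>W s. openin (pts X) W \<and> x \<in> W \<and> W \<subseteq> V \<and> s \<in> carrier (sec Y' W) \<and> ic (i ` W) s = res X V W b"
    using U W(4) preim_image_open[OF U(1)] preim_image_open[OF *(1)]
    by (intro exI[of _ U]) (auto simp: image_iff)
next
  fix V s x assume *: "openin (pts X) V" "s \<in> carrier (sec Y' V)" "ic (i ` V) s = \<zero>\<^bsub>sec X V\<^esub>" "x \<in> V"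
  then have "openin (pts Y) (i ` V)" "s \<in> carrier (sec Y (i ` V))" "i x \<in> i ` V"
     "ic (i ` V) s = \<zero>\<^bsub>sec X (preim X i (i ` V))\<^esub>"
    using im(1) by (auto simp: preim_image_open)
  then have "\<forall>y\<in>i ` V. \<exists>W. openin (pts Y) W \<and> y \<in> W \<and> W \<subseteq> i ` V \<and>
      (\<exists>u\<in>carrier (sec Y W). res Y (i ` V) W s = res Y (carr Y) W (str Y (0, 1)) \<otimes>\<^bsub>sec Y W\<^esub> u)"
    using ker[rule_format, of "i ` V" s] by (simp only:)
  from bspec[OF this \<open>i x \<in> i ` V\<close>]
  obtain W u where W: "openin (pts Y) W" "i x \<in> W" "W \<subseteq> i ` V" "u \<in> carrier (sec Y W)"
     "res Y (i ` V) W s = res Y (carr Y) W (str Y (0, 1)) \<otimes>\<^bsub>sec Y W\<^esub> u"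
    by (elim exE conjE bexE) (rule that)
  then obtain U where U: "openin (pts X) U" "U \<subseteq> V" "W = i ` U" using im(4) * by blast
  have "x \<in> U" using W(2) U im(3) * openin_subset[OF *(1)] openin_subset[OF U(1)]
    by (auto simp: inj_on_def)
  then show "\<exists>W u. openin (pts X) W \<and> x \<in> W \<and> W \<subseteq> V \<and> u \<in> carrier (sec Y' W) \<and>
      res Y' V W s = res Y' (carr X) W (str Y (0, 1)) \<otimes>\<^bsub>sec Y' W\<^esub> u"
    using U W by (intro exI[of _ U] exI[of _ u]) (auto simp: im(2))
next
  fix V s x assume *: "openin (pts X) V" "s \<in> carrier (sec Y' V)" "x \<in> V"
    "res Y' (carr X) V (str Y (0, 1)) \<otimes>\<^bsub>sec Y' V\<^esub> s = \<zero>\<^bsub>sec Y' V\<^esub>"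
  let ?y = "i x" and ?V = "i ` V" and ?t = "str Y (0, 1)"
  have V: "openin (pts Y) ?V" "?y \<in> ?V" "s \<in> carrier (sec Y ?V)" "?V \<subseteq> carr Y"
    "res Y (carr Y) ?V ?t \<otimes>\<^bsub>sec Y ?V\<^esub> s = \<zero>\<^bsub>sec Y ?V\<^esub>"
    using im(1)[OF *(1)] * openin_subset[OF im(1)[OF *(1)]] by (auto simp: im(2))
  have t: "?t \<in> carrier (sec Y (carr Y))" using ring_hom_closed[OF str] by simp
  have y: "?y \<in> carr Y" using V by auto
  have "germ Y ?y (carr Y) ?t \<otimes>\<^bsub>stalk Y ?y\<^esub> germ Y ?y ?V s = \<zero>\<^bsub>stalk Y ?y\<^esub>"
    unfolding RY.germ_res[OF RY.op_carr V(1,2,4) t, symmetric] RY.stalk_one_zero(2)[OF V(1,2)]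
    using RY.stalk_mult[OF V(1,2) RY.res_closed[OF RY.op_carr V(1,4) t] V(3)] V(5) by simp
  then obtain z where z: "z \<in> carrier (stalk Y ?y)" "germ Y ?y ?V s = germ Y ?y (carr Y) ?t \<otimes>\<^bsub>stalk Y ?y\<^esub> z"
    using flat_annihilator[OF RY.cring_stalk[OF y] bspec[OF flat y] RY.stalk_closed[OF V(1-3)]] by blast
  obtain W u where W: "openin (pts Y) W" "i x \<in> W" "W \<subseteq> i ` V" "u \<in> carrier (sec Y W)"
     "res Y (i ` V) W s = res Y (carr Y) W ?t \<otimes>\<^bsub>sec Y W\<^esub> u"
    using RY.stalk_annihilator[OF V(1-3) t z] by blast
  then obtain U where U: "openin (pts X) U" "U \<subseteq> V" "W = i ` U" using im(4) * by blast
  have "x \<in> U" using W(2) U im(3) * openin_subset[OF *(1)] openin_subset[OF U(1)]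
    by (auto simp: inj_on_def)
  then show "\<exists>W u. openin (pts X) W \<and> x \<in> W \<and> W \<subseteq> V \<and> u \<in> carrier (sec Y' W) \<and>
      res Y' V W s = res Y' (carr X) W (str Y (0, 1)) \<otimes>\<^bsub>sec Y' W\<^esub> u"
    using U W by (intro exI[of _ U] exI[of _ u]) (auto simp: im(2))
qed

end

sublocale T: thickening X Y' "\<lambda>V. ic (i ` V)" "str Y (0, 1)"
  by (rule thickening_transport)

text \<open>A splitting \<open>\<Psi>\<close> of the projection by ring homomorphisms makes
  \<open>Y\<close> the trivial extension: the pair \<open>(a, b)\<close> goes to
  \<open>\<Psi> a\<close> plus \<open>t\<close> times \<open>\<Psi> b\<close>. The map on points is
  the inverse of \<open>i\<close>. Triviality of a deformation is thereby reduced to finding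
  \<open>\<Psi>\<close>.\<close>

lemma deformation_isoI:
  assumes \<Psi>: "\<And>V. openin (pts X) V \<Longrightarrow> \<Psi> V \<in> ring_hom (sec X V) (sec Y' V)"
    and \<Psi>_res: "\<And>V W b. \<lbrakk>openin (pts X) V; openin (pts X) W; W \<subseteq> V; b \<in> carrier (sec X V)\<rbrakk> \<Longrightarrow>
      \<Psi> W (res X V W b) = res Y' V W (\<Psi> V b)"
    and pi_\<Psi>: "\<And>V b. \<lbrakk>openin (pts X) V; b \<in> carrier (sec X V)\<rbrakk> \<Longrightarrow> ic (i ` V) (\<Psi> V b) = b"
    and \<Psi>_str: "\<And>c. \<Psi> (carr X) (str X c) = str Y (c, 0)"
  shows "deformation_iso X Y i ic (trivial_deformation X) (\<lambda>x. x) (\<lambda>_. fst)"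
proof -
  obtain g where g: "homeomorphic_maps (pts X) (pts Y) i g" using hom homeomorphic_map_maps by blast
  have gh: "homeomorphic_map (pts Y) (pts X) g" and gi: "\<And>x. x \<in> carr X \<Longrightarrow> g (i x) = x"
    and ig: "\<And>y. y \<in> carr Y \<Longrightarrow> i (g y) = y"
    using g homeomorphic_maps_map homeomorphic_maps_sym unfolding homeomorphic_maps_def by blast+
  have pre: "preim Y g V = i ` V" if "openin (pts X) V" for V
  proof -
    have "V \<subseteq> carr X" using openin_subset[OF that] .
    then show ?thesis using gi ig im(2) unfolding preim_def by force
  qed
  define \<tau> where "\<tau> V = res Y' (carr X) V (str Y (0, 1))" for V
  define fs where "fs V = (\<lambda>(a, b). \<Psi> V a \<oplus>\<^bsub>sec Y' V\<^esub> \<tau> V \<otimes>\<^bsub>sec Y' V\<^esub> \<Psi> V b)" for V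
  have fsr: "fs V \<in> ring_hom (dual_numbers (sec X V)) (sec Y' V)"
    and fsb: "bij_betw (fs V) (carrier (dual_numbers (sec X V))) (carrier (sec Y' V))"
    and fsp: "\<And>a b. \<lbrakk>a \<in> carrier (sec X V); b \<in> carrier (sec X V)\<rbrakk> \<Longrightarrow> ic (i ` V) (fs V (a, b)) = a"
    if V: "openin (pts X) V" for V
  proof -
    interpret P: ring_hom_cring "sec X V" "sec Y' V" "\<Psi> V"
      using T.cringX[OF V] T.cringY[OF V] \<Psi>[OF V] by (intro ring_hom_cring.intro ring_hom_cring_axioms.intro)
    have \<tau>: "\<tau> V \<in> carrier (sec Y' V)" "\<tau> V \<otimes>\<^bsub>sec Y' V\<^esub> \<tau> V = \<zero>\<^bsub>sec Y' V\<^esub>"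
      unfolding \<tau>_def by (rule T.tau_closed[OF V], rule T.tau_square[OF V])
    have \<tau>2: "\<tau> V \<otimes>\<^bsub>sec Y' V\<^esub> (\<tau> V \<otimes>\<^bsub>sec Y' V\<^esub> x) = \<zero>\<^bsub>sec Y' V\<^esub>" if "x \<in> carrier (sec Y' V)" for x
      using \<tau> that by (simp add: P.S.m_assoc[symmetric])
    show "fs V \<in> ring_hom (dual_numbers (sec X V)) (sec Y' V)"
    proof (rule ring_hom_memI)
      fix x y assume "x \<in> carrier (dual_numbers (sec X V))" "y \<in> carrier (dual_numbers (sec X V))"
      then obtain a b c d where xy: "x = (a, b)" "y = (c, d)" "a \<in> carrier (sec X V)" "b \<in> carrier (sec X V)"
         "c \<in> carrier (sec X V)" "d \<in> carrier (sec X V)" by (auto simp: dual_numbers_def)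
      have cl: "\<Psi> V a \<in> carrier (sec Y' V)" "\<Psi> V b \<in> carrier (sec Y' V)"
        "\<Psi> V c \<in> carrier (sec Y' V)" "\<Psi> V d \<in> carrier (sec Y' V)" using xy by simp_all
      show "fs V x \<in> carrier (sec Y' V)" using xy cl \<tau> by (simp add: fs_def)
      show "fs V (x \<oplus>\<^bsub>dual_numbers (sec X V)\<^esub> y) = fs V x \<oplus>\<^bsub>sec Y' V\<^esub> fs V y"
        using xy cl \<tau> by (simp add: fs_def dual_numbers_def P.S.r_distr P.S.a_ac)
      show "fs V (x \<otimes>\<^bsub>dual_numbers (sec X V)\<^esub> y) = fs V x \<otimes>\<^bsub>sec Y' V\<^esub> fs V y"
        using xy cl \<tau>(1) by (simp add: fs_def dual_numbers_def P.S.r_distr P.S.l_distr P.S.a_ac P.S.m_ac \<tau>2)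
    next
      show "fs V \<one>\<^bsub>dual_numbers (sec X V)\<^esub> = \<one>\<^bsub>sec Y' V\<^esub>"
        using \<tau> by (simp add: fs_def dual_numbers_def)
    qed
    show p: "ic (i ` V) (fs V (a, b)) = a" if "a \<in> carrier (sec X V)" "b \<in> carrier (sec X V)" for a b
    proof -
      have "ic (i ` V) (fs V (a, b)) = ic (i ` V) (\<Psi> V a) \<oplus>\<^bsub>sec X V\<^esub> (ic (i ` V) (\<tau> V) \<otimes>\<^bsub>sec X V\<^esub> ic (i ` V) (\<Psi> V b))"
        using that \<tau> by (simp add: fs_def T.pi_add[OF V] T.pi_mult[OF V])
      also have "\<dots> = a" using that pi_\<Psi>[OF V] T.pi_tau[OF V] by (simp add: \<tau>_def)
      finally show ?thesis .
    qed
    show "bij_betw (fs V) (carrier (dual_numbers (sec X V))) (carrier (sec Y' V))"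
      unfolding bij_betw_def
    proof
      show "inj_on (fs V) (carrier (dual_numbers (sec X V)))"
      proof (rule inj_onI)
        fix x y assume "x \<in> carrier (dual_numbers (sec X V))" "y \<in> carrier (dual_numbers (sec X V))"
          and eq: "fs V x = fs V y"
        then obtain a b c d where xy: "x = (a, b)" "y = (c, d)" "a \<in> carrier (sec X V)" "b \<in> carrier (sec X V)"
           "c \<in> carrier (sec X V)" "d \<in> carrier (sec X V)" by (auto simp: dual_numbers_def)
        have "a = c" using eq xy p by metis
        moreover have cl: "\<Psi> V a \<in> carrier (sec Y' V)" "\<Psi> V b \<in> carrier (sec Y' V)" "\<Psi> V d \<in> carrier (sec Y' V)"
          using xy by simp_all
        ultimately have "\<tau> V \<otimes>\<^bsub>sec Y' V\<^esub> \<Psi> V b = \<tau> V \<otimes>\<^bsub>sec Y' V\<^esub> \<Psi> V d"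
          using eq xy \<tau> cl
            P.S.add.right_cancel[of "\<tau> V \<otimes>\<^bsub>sec Y' V\<^esub> \<Psi> V b" "\<tau> V \<otimes>\<^bsub>sec Y' V\<^esub> \<Psi> V d" "\<Psi> V c"]
          by (simp add: fs_def P.S.a_comm[of "\<Psi> V c"])
        then have "b = d" using T.tau_mult_cong[OF V cl(2,3)] pi_\<Psi>[OF V] xy by (simp add: \<tau>_def)
        then show "x = y" using \<open>a = c\<close> xy by simp
      qed
      \<comment> \<open>Surjectivity: what remains of \<open>s\<close> after subtracting
        \<open>\<Psi>\<close> of its image in \<open>X\<close> lies in the ideal, so it is
        \<open>t\<close> times \<open>\<Psi> b\<close> for some \<open>b\<close>.\<close>
      have "s \<in> fs V ` carrier (dual_numbers (sec X V))" if s: "s \<in> carrier (sec Y' V)" for s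
      proof -
        define a where "a = ic (i ` V) s"
        have a: "a \<in> carrier (sec X V)" "\<Psi> V a \<in> carrier (sec Y' V)"
          using T.pi_closed[OF V s] by (simp_all add: a_def)
        have "ic (i ` V) (s \<ominus>\<^bsub>sec Y' V\<^esub> \<Psi> V a) = \<zero>\<^bsub>sec X V\<^esub>"
          using T.pi_minus[OF V s a(2)] pi_\<Psi>[OF V a(1)] a P.R.minus_eq_zero_iff by (simp add: a_def)
        moreover have "s \<ominus>\<^bsub>sec Y' V\<^esub> \<Psi> V a \<in> carrier (sec Y' V)" using s a by simp
        ultimately obtain b where b: "b \<in> carrier (sec X V)" "s \<ominus>\<^bsub>sec Y' V\<^esub> \<Psi> V a = T.lam V b"
          using T.ker_lam[OF V] by metis
        have "T.lam V b = \<tau> V \<otimes>\<^bsub>sec Y' V\<^esub> \<Psi> V b"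
          using T.tau_mult_eq_lam[OF V, of "\<Psi> V b"] pi_\<Psi>[OF V b(1)] b by (simp add: \<tau>_def)
        then have "fs V (a, b) = \<Psi> V a \<oplus>\<^bsub>sec Y' V\<^esub> (s \<ominus>\<^bsub>sec Y' V\<^esub> \<Psi> V a)" unfolding b(2) fs_def by simp
        also have "\<dots> = s" using s a
          by (simp add: a_minus_def P.S.a_lcomm[of _ s] P.S.r_neg)
        finally show ?thesis using a b by (auto simp: dual_numbers_def image_iff intro!: bexI[of _ "(a, b)"])
      qed
      then show "fs V ` carrier (dual_numbers (sec X V)) = carrier (sec Y' V)"
        using ring_hom_closed[OF \<open>fs V \<in> ring_hom (dual_numbers (sec X V)) (sec Y' V)\<close>] by blast
    qed
  qed
  have fs_res: "fs W (res (trivial_deformation X) V W x) = res Y' V W (fs V x)"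
    if VW: "openin (pts X) V" "openin (pts X) W" "W \<subseteq> V" and x: "x \<in> carrier (dual_numbers (sec X V))" for V W x
  proof -
    interpret Y: cring "sec Y' V" by (rule T.cringY[OF VW(1)])
    obtain a b where ab: "x = (a, b)" "a \<in> carrier (sec X V)" "b \<in> carrier (sec X V)"
      using x by (auto simp: dual_numbers_def)
    have cl: "\<Psi> V a \<in> carrier (sec Y' V)" "\<Psi> V b \<in> carrier (sec Y' V)" "\<tau> V \<in> carrier (sec Y' V)"
      using ab ring_hom_closed[OF \<Psi>[OF VW(1)]] T.tau_closed[OF VW(1)] by (simp_all add: \<tau>_def)
    have "res Y' V W (\<tau> V) = \<tau> W" unfolding \<tau>_def by (rule T.tau_res[OF VW])
    then show ?thesis
      using ab cl VW \<Psi>_res[OF VW] by (simp add: fs_def trivial_deformation_def T.Yres_add T.Yres_mult)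
  qed
  have iso: "rs_iso Y (trivial_deformation X) g fs"
    unfolding rs_iso_def rs_morphism_def
  proof (intro conjI allI impI ballI)
    show "continuous_map (pts Y) (pts (trivial_deformation X)) g" "homeomorphic_map (pts Y) (pts (trivial_deformation X)) g"
      using gh homeomorphic_imp_continuous_map by (auto simp: trivial_deformation_def)
  next
    fix V assume V: "openin (pts (trivial_deformation X)) V"
    then have V': "openin (pts X) V" by (simp add: trivial_deformation_def)
    show "fs V \<in> ring_hom (sec (trivial_deformation X) V) (sec Y (preim Y g V))"
      using fsr[OF V'] pre[OF V'] by (simp add: trivial_deformation_def transport_simps)
    show "bij_betw (fs V) (carrier (sec (trivial_deformation X) V)) (carrier (sec Y (preim Y g V)))"
      using fsb[OF V'] pre[OF V'] by (simp add: trivial_deformation_def transport_simps)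
  next
    fix V W s assume *: "openin (pts (trivial_deformation X)) V \<and> openin (pts (trivial_deformation X)) W \<and> W \<subseteq> V"
      "s \<in> carrier (sec (trivial_deformation X) V)"
    then have "openin (pts X) V" "openin (pts X) W" "W \<subseteq> V" "s \<in> carrier (dual_numbers (sec X V))"
      by (auto simp: trivial_deformation_def)
    then show "fs W (res (trivial_deformation X) V W s) = res Y (preim Y g V) (preim Y g W) (fs V s)"
      using fs_res pre by (simp add: transport_simps)
  qed
  interpret D: ring_hom_cring complex_dual_numbers "sec Y (carr Y)" "str Y"
    using str cring_complex_dual_numbers RY.cring_sec[OF RY.op_carr]
    by (intro ring_hom_cring.intro ring_hom_cring_axioms.intro)
  have st: "fs (carr (trivial_deformation X)) (str (trivial_deformation X) r) = str Y r" for r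
  proof -
    obtain a b where r: "r = (a, b)" by force
    have "\<tau> (carr X) = str Y (0, 1)"
      using T.Yres_id[OF T.op_carrX T.t_mem] by (simp add: \<tau>_def)
    then have "fs (carr X) (str X a, str X b) = str Y (a, 0) \<oplus>\<^bsub>sec Y (carr Y)\<^esub> str Y (0, 1) \<otimes>\<^bsub>sec Y (carr Y)\<^esub> str Y (b, 0)"
      by (simp add: fs_def \<Psi>_str im(2) transport_simps)
    also have "\<dots> = str Y ((a, 0) \<oplus>\<^bsub>complex_dual_numbers\<^esub> ((0, 1) \<otimes>\<^bsub>complex_dual_numbers\<^esub> (b, 0)))"
      using D.hom_add[of "(a, 0)" "(0, b)"] D.hom_mult[of "(0, 1)" "(b, 0)"]
      by (simp del: D.hom_add D.hom_mult)
    finally show ?thesis by (simp add: r trivial_deformation_def)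
  qed
  have "ic (preim Y g V) (fs V s) = fst s" if "openin (pts X) V" "s \<in> carrier (dual_numbers (sec X V))" for V s
    using fsp[OF that(1)] that pre[OF that(1)] by (auto simp: dual_numbers_def)
  then show ?thesis
    unfolding deformation_iso_def using iso st gi
    by (intro exI[of _ g] exI[of _ fs]) (auto simp: trivial_deformation_def)
qed

end

section \<open>Lifting sections over affine charts\<close>

text \<open>Quasi-compactness of the spectrum: if 1 were no finite combination of the
  \<open>g i\<close>, the ideal \<open>K\<close> of these combinations would lie in a prime, at
  which all \<open>g i\<close> vanish.\<close>

lemma (in domain_subring) unit_ideal_finite:
  assumes g: "\<And>i. i \<in> I \<Longrightarrow> g i \<in> A" and cov: "\<And>p. primeideal p R \<Longrightarrow> \<exists>i\<in>I. g i \<notin> p"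
  obtains J a where "finite J" "J \<subseteq> I" "\<And>i. i \<in> J \<Longrightarrow> a i \<in> A" "(\<Sum>i\<in>J. a i * g i) = 1"
proof -
  define K where "K = {\<Sum>i\<in>J. a i * g i | J a. finite J \<and> J \<subseteq> I \<and> (\<forall>i\<in>J. a i \<in> A)}"
  have "\<exists>n. 1 ^ n \<in> K"
  proof (rule ccontr)
    assume no: "\<not> ?thesis"
    obtain p where p: "primeideal p R" "K \<subseteq> p" "1 \<notin> p"
    proof (rule primeideal_avoiding_powers[of K 1])
      show "K \<subseteq> A" using g by (auto simp: K_def intro!: sum_mem mult_mem)
      show "0 \<in> K" unfolding K_def by (intro CollectI exI[of _ "{}"]) auto
      show "1 \<in> A" by (rule one_mem)
      show "1 ^ n \<notin> K" for n using no by blast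
    next
      fix x y assume "x \<in> K" "y \<in> K"
      then obtain J a J' a' where *: "x = (\<Sum>i\<in>J. a i * g i)" "finite J" "J \<subseteq> I" "\<forall>i\<in>J. a i \<in> A"
        "y = (\<Sum>i\<in>J'. a' i * g i)" "finite J'" "J' \<subseteq> I" "\<forall>i\<in>J'. a' i \<in> A"
        unfolding K_def by blast
      define b where "b i = (if i \<in> J then a i else 0) + (if i \<in> J' then a' i else 0)" for i
      have "x = (\<Sum>i\<in>J \<union> J'. (if i \<in> J then a i else 0) * g i)"
        unfolding *(1) using * by (intro sum.mono_neutral_cong_left) auto
      moreover have "y = (\<Sum>i\<in>J \<union> J'. (if i \<in> J' then a' i else 0) * g i)"
        unfolding *(5) using * by (intro sum.mono_neutral_cong_left) auto
      ultimately have "x + y = (\<Sum>i\<in>J \<union> J'. b i * g i)"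
        by (simp add: b_def distrib_right sum.distrib)
      moreover have "\<forall>i\<in>J \<union> J'. b i \<in> A" using * by (auto simp: b_def zero_mem intro!: add_mem)
      ultimately show "x + y \<in> K" unfolding K_def using * by (intro CollectI exI[of _ "J \<union> J'"] exI[of _ b]) auto
    next
      fix x y assume "x \<in> A" "y \<in> K"
      then obtain J a where *: "y = (\<Sum>i\<in>J. a i * g i)" "finite J" "J \<subseteq> I" "\<forall>i\<in>J. a i \<in> A"
        unfolding K_def by blast
      then have "x * y = (\<Sum>i\<in>J. (x * a i) * g i)" by (simp add: sum_distrib_left mult.assoc)
      then show "x * y \<in> K" unfolding K_def using * \<open>x \<in> A\<close> mult_mem
        by (intro CollectI exI[of _ J] exI[of _ "\<lambda>i. x * a i"]) auto
    qed
    obtain i where i: "i \<in> I" "g i \<notin> p" using cov[OF p(1)] by blast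
    have "g i \<in> K" unfolding K_def using i one_mem
      by (intro CollectI exI[of _ "{i}"] exI[of _ "\<lambda>_. 1"]) auto
    then show False using i p by blast
  qed
  then have "1 \<in> K" by simp
  then obtain J a where "1 = (\<Sum>i\<in>J. a i * g i)" "finite J" "J \<subseteq> I" "\<forall>i\<in>J. a i \<in> A" unfolding K_def by blast
  then show thesis using that[of J a] by auto
qed

lemma (in domain_subring) primeideal_sum:
  "\<lbrakk>primeideal p R; \<And>i. i \<in> I \<Longrightarrow> f i \<in> p\<rbrakk> \<Longrightarrow> sum f I \<in> p"
  by (induction I rule: infinite_finite_induct) (auto simp: primeidealD(2,4))

text \<open>A prime that contains a power of \<open>f\<close> contains \<open>f\<close>, so the
  powers have no common zero either. Coefficients outside the finite set \<open>J\<close> are set to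
  0.\<close>

lemma (in domain_subring) unit_ideal_power:
  assumes F: "finite F" "F \<subseteq> A" and a: "\<And>f. f \<in> F \<Longrightarrow> a f \<in> A" "(\<Sum>f\<in>F. a f * f) = 1"
  obtains b where "\<And>f. f \<in> F \<Longrightarrow> b f \<in> A" "(\<Sum>f\<in>F. b f * f ^ n) = 1"
proof -
  have cov: "\<exists>f\<in>F. f ^ n \<notin> p" if p: "primeideal p R" for p
  proof -
    have "\<exists>f\<in>F. f \<notin> p"
    proof (rule ccontr)
      assume "\<not> ?thesis"
      then have "a f * f \<in> p" if "f \<in> F" for f using primeidealD(5)[OF p] a(1) that by auto
      then have "(\<Sum>f\<in>F. a f * f) \<in> p" by (rule primeideal_sum[OF p])
      then show False using a(2) primeidealD(3)[OF p] by simp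
    qed
    then show ?thesis using primeideal_power_notin[OF p] F by blast
  qed
  obtain J b where J: "finite J" "J \<subseteq> F" "\<And>f. f \<in> J \<Longrightarrow> b f \<in> A" "(\<Sum>f\<in>J. b f * f ^ n) = 1"
    by (rule unit_ideal_finite[of F "\<lambda>f. f ^ n", OF _ cov]) (use F power_mem in auto)
  have "(\<Sum>f\<in>F. (if f \<in> J then b f else 0) * f ^ n) = (\<Sum>f\<in>J. b f * f ^ n)"
    using F J by (intro sum.mono_neutral_cong_right) auto
  then show thesis using J zero_mem by (intro that[of "\<lambda>f. if f \<in> J then b f else 0"]) auto
qed

locale toric_thickening = toric_fan N \<Sigma> + T: thickening "toric_variety N \<Sigma>" Y pi t
  for N :: "'a::euclidean_space set" and \<Sigma> and Y :: "(_, 't, 'y) rspace_scheme" and pi t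
begin

abbreviation "opn V \<equiv> openin (pts X) V"
abbreviation "A V \<equiv> carrier (sec Y V)"

lemma res_X_inj:
  assumes "opn V" "opn W" "W \<subseteq> V" "W \<noteq> {}" "b \<in> carrier (sec X V)" "c \<in> carrier (sec X V)"
    "res X V W b = res X V W c"
  shows "b = c"
proof -
  obtain f g f' g' where *: "regular V f g" "b = sect V f g" "regular V f' g'" "c = sect V f' g'"
    using sectionE[OF assms(1)] assms(5,6) by metis
  have "sect W f g = sect W f' g'" using assms(7) * by (simp add: res_X[OF assms(3)])
  then have "f * g' = f' * g"
    using sect_eq_iff[OF assms(2,4)] regular_subset[OF _ assms(3)] * by blast
  moreover have "g \<noteq> 0" "g' \<noteq> 0" using * by (auto simp: regular_def)
  ultimately show ?thesis using * sect_cong by metis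
qed

text \<open>Injectivity on \<open>X\<close> is used twice: first for the image of the difference in
  \<open>X\<close>, and, once this image is zero, for the function that \<open>lam\<close> maps to
  the difference.\<close>

lemma res_Y_inj:
  assumes V: "opn V" "opn W" "W \<subseteq> V" "W \<noteq> {}" and s: "s \<in> A V" "s' \<in> A V"
    and eq: "res Y V W s = res Y V W s'"
  shows "s = s'"
proof -
  interpret YV: cring "sec Y V" by (rule T.cringY[OF V(1)])
  interpret XV: cring "sec X V" by (rule T.cringX[OF V(1)])
  interpret YW: cring "sec Y W" by (rule T.cringY[OF V(2)])
  interpret XW: cring "sec X W" by (rule T.cringX[OF V(2)])
  let ?d = "s \<ominus>\<^bsub>sec Y V\<^esub> s'"
  have d: "?d \<in> A V" "res Y V W ?d = \<zero>\<^bsub>sec Y W\<^esub>"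
    using s V eq T.YresC[OF V(1-3)] by (simp_all add: T.Yres_minus YW.minus_eq_zero_iff)
  have "res X V W (pi V ?d) = res X V W \<zero>\<^bsub>sec X V\<^esub>"
    using d V by (simp add: T.pi_res[symmetric] T.pi_zero T.X.res_zero)
  then have "pi V ?d = \<zero>\<^bsub>sec X V\<^esub>"
    using res_X_inj[OF V T.pi_closed[OF V(1) d(1)] XV.zero_closed] by blast
  then obtain b where b: "b \<in> carrier (sec X V)" "?d = T.lam V b" using T.ker_lam[OF V(1) d(1)] by blast
  have "T.lam W (res X V W b) = T.lam W \<zero>\<^bsub>sec X W\<^esub>"
    using d b V by (simp add: T.lam_res[symmetric] T.lam_zero)
  then have "res X V W b = \<zero>\<^bsub>sec X W\<^esub>"
    using T.lam_inj[OF V(2) T.X.res_closed[OF V(1-3) b(1)] XW.zero_closed] by blast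
  then have "b = \<zero>\<^bsub>sec X V\<^esub>"
    using res_X_inj[OF V b(1) XV.zero_closed] T.X.res_zero[OF V(1-3)] by simp
  then show ?thesis using b(2) T.lam_zero[OF V(1)] YV.minus_eq_zero_iff[OF s] by simp
qed

lemma sect_section: "\<lbrakk>opn V; regular V f g\<rbrakk> \<Longrightarrow> sect V f g \<in> carrier (sec X V)"
  by (rule sect_in_carrier)

lemma regular_chart: "\<lbrakk>\<sigma> \<in> \<Sigma>; r \<in> Rg \<sigma>\<rbrakk> \<Longrightarrow> regular (Dop \<sigma> 1) r 1"
  using regular_Dop_power[of \<sigma> 1 r 0] Rg.one_mem by simp

lemma opn_chart: "\<sigma> \<in> \<Sigma> \<Longrightarrow> opn (Dop \<sigma> 1)"
  using openin_Dop Rg.one_mem by blast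

text \<open>Vanishing of the first cohomology of the structure sheaf on an affine chart, in the form needed
  here.  Local lifts \<open>s f\<close> over the sets \<open>D(f)\<close>, \<open>f \<in> F\<close>, of a covering differ by fractions
  \<open>\<rho> f h / (f h)\<^sup>n\<close>, and a partition of unity \<open>\<Sum>h. a h * h\<^sup>n = 1\<close> yields the corrections
  \<open>(\<Sum>h. a h * \<rho> f h) / f\<^sup>n\<close>.\<close>

lemma affine_lift:
  assumes \<sigma>: "\<sigma> \<in> \<Sigma>" and r: "r \<in> Rg \<sigma>"
  obtains s where "s \<in> A (Dop \<sigma> 1)" "pi (Dop \<sigma> 1) s = sect (Dop \<sigma> 1) r 1"
proof -
  let ?U = "Dop \<sigma> 1"
  have U: "opn ?U" by (rule opn_chart[OF \<sigma>])
  have rU: "regular ?U r 1" by (rule regular_chart[OF \<sigma> r])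
  define I where "I = {f \<in> Rg \<sigma>. f \<noteq> 0 \<and> (\<exists>s\<in>A (Dop \<sigma> f). pi (Dop \<sigma> f) s = sect (Dop \<sigma> f) r 1)}"
  have D: "opn (Dop \<sigma> f)" "Dop \<sigma> f \<subseteq> ?U" if "f \<in> Rg \<sigma>" for f
    using openin_Dop[OF \<sigma> that] Dop_subset_one by auto
  have cov: "\<exists>f\<in>I. f \<notin> p" if p: "primeideal p (Rg.R \<sigma>)" for p
  proof -
    have x: "cls (\<sigma>, p) \<in> ?U" using p by (auto simp: Dop_one chart_ring_eq)
    obtain W s where W: "opn W" "cls (\<sigma>, p) \<in> W" "W \<subseteq> ?U" "s \<in> A W" "pi W s = res X ?U W (sect ?U r 1)"
      by (rule T.local_liftE[OF U sect_section[OF U rU] x])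
    have "p \<in> part \<sigma> W" "openin (zariski (Rg.R \<sigma>)) (part \<sigma> W)"
      using W p openin_part[OF W(1) \<sigma>] by (auto simp: part_eq chart_ring_eq)
    then obtain f where f: "f \<in> Rg \<sigma>" "p \<in> basic_open (Rg \<sigma>) f" "basic_open (Rg \<sigma>) f \<subseteq> part \<sigma> W"
      unfolding Rg.openin_zariski by blast
    then have fW: "Dop \<sigma> f \<subseteq> W" by (auto simp: Dop_def part_eq)
    have "f \<notin> p" using f by (auto simp: basic_open_def)
    moreover have "f \<noteq> 0" using \<open>f \<notin> p\<close> Rg.primeidealD(2)[OF p] by auto
    moreover have "pi (Dop \<sigma> f) (res Y W (Dop \<sigma> f) s) = sect (Dop \<sigma> f) r 1"
      using W D[OF f(1)] fW by (simp add: T.pi_res res_X)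
    moreover have "res Y W (Dop \<sigma> f) s \<in> A (Dop \<sigma> f)" using W D[OF f(1)] fW by (intro T.YresC) auto
    ultimately show ?thesis using f(1) by (auto simp: I_def)
  qed
  obtain F a0 where F: "finite F" "F \<subseteq> I" and a0: "\<And>f. f \<in> F \<Longrightarrow> a0 f \<in> Rg \<sigma>" "(\<Sum>f\<in>F. a0 f * f) = 1"
    by (rule Rg.unit_ideal_finite[of I "\<lambda>f. f" \<sigma>, OF _ cov]) (auto simp: I_def)
  have FR: "f \<in> Rg \<sigma>" "f \<noteq> 0" if "f \<in> F" for f using F that by (auto simp: I_def)
  define s where "s f = (SOME s. s \<in> A (Dop \<sigma> f) \<and> pi (Dop \<sigma> f) s = sect (Dop \<sigma> f) r 1)" for f
  have s: "s f \<in> A (Dop \<sigma> f)" "pi (Dop \<sigma> f) (s f) = sect (Dop \<sigma> f) r 1" if "f \<in> F" for f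
  proof -
    have "\<exists>s. s \<in> A (Dop \<sigma> f) \<and> pi (Dop \<sigma> f) s = sect (Dop \<sigma> f) r 1" using that F by (auto simp: I_def)
    from someI_ex[OF this] show "s f \<in> A (Dop \<sigma> f)" "pi (Dop \<sigma> f) (s f) = sect (Dop \<sigma> f) r 1"
      unfolding s_def by auto
  qed
  \<comment> \<open>The set of the product \<open>P\<close> lies in every
    \<open>Dop \<sigma> f\<close>, and restriction to it is injective, so identities between local
    lifts need only be checked there.\<close>
  define P where "P = \<Prod>F"
  have P: "P \<in> Rg \<sigma>" "P \<noteq> 0" unfolding P_def using FR Rg.prod_nonzero[of F "\<lambda>x. x"] by (auto intro: Rg.prod_mem)
  define Z where "Z = Dop \<sigma> P"
  have Z: "opn Z" "Z \<noteq> {}" unfolding Z_def using D[OF P(1)] eta_mem_Dop[OF \<sigma> P(2)] by auto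
  have ZD: "Z \<subseteq> Dop \<sigma> f" if "f \<in> F" for f
  proof -
    have "P = f * \<Prod>(F - {f})" unfolding P_def using F that by (simp add: prod.remove)
    then show ?thesis unfolding Z_def using Dop_mono[of f \<sigma> "\<Prod>(F - {f})"] FR that
      by (auto intro: Rg.prod_mem)
  qed
  interpret YZ: cring "sec Y Z" by (rule T.cringY[OF Z(1)])
  interpret XZ: cring "sec X Z" by (rule T.cringX[OF Z(1)])
  define sZ where "sZ f = res Y (Dop \<sigma> f) Z (s f)" for f
  have sZ: "sZ f \<in> A Z" "pi Z (sZ f) = sect Z r 1" if "f \<in> F" for f
    using s[OF that] D[OF FR(1)[OF that]] Z ZD[OF that] T.YresC by (auto simp: sZ_def T.pi_res res_X)
  have ex: "\<exists>n \<rho>. \<rho> \<in> Rg \<sigma> \<and> sZ f \<ominus>\<^bsub>sec Y Z\<^esub> sZ h = T.lam Z (sect Z \<rho> ((f * h) ^ n))"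
    if fh: "f \<in> F" "h \<in> F" for f h
  proof -
    let ?D = "Dop \<sigma> (f * h)"
    have fhR: "f * h \<in> Rg \<sigma>" "f * h \<noteq> 0" using FR fh Rg.mult_mem Rg.mult_nonzero by auto
    have Ds: "opn ?D" "?D \<subseteq> Dop \<sigma> f" "?D \<subseteq> Dop \<sigma> h"
      using D fhR Dop_mono[of f \<sigma> h] Dop_mono[of h \<sigma> f] FR fh by (auto simp: mult.commute)
    have ZD': "Z \<subseteq> ?D"
    proof
      fix x assume "x \<in> Z"
      then obtain p where p: "p \<in> basic_open (Rg \<sigma>) P" "x = cls (\<sigma>, p)" by (auto simp: Z_def Dop_def)
      then have pp: "primeideal p (Rg.R \<sigma>)" "P \<notin> p" by (auto simp: basic_open_def)
      have "f' \<notin> p" if "f' \<in> F" for f'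
      proof
        assume "f' \<in> p"
        moreover have "P = f' * \<Prod>(F - {f'})" unfolding P_def using F that by (simp add: prod.remove)
        moreover have "\<Prod>(F - {f'}) \<in> Rg \<sigma>" using FR by (auto intro: Rg.prod_mem)
        ultimately show False using pp Rg.primeidealD(6)[OF pp(1)] by metis
      qed
      then have "f * h \<notin> p" using Rg.primeidealD(7)[OF pp(1)] FR fh by blast
      then show "x \<in> ?D" using p pp by (auto simp: Dop_def basic_open_def)
    qed
    interpret YD: cring "sec Y ?D" by (rule T.cringY[OF Ds(1)])
    interpret XD: cring "sec X ?D" by (rule T.cringX[OF Ds(1)])
    let ?f = "res Y (Dop \<sigma> f) ?D (s f)" and ?h = "res Y (Dop \<sigma> h) ?D (s h)"
    have c: "?f \<in> A ?D" "?h \<in> A ?D" using s fh Ds D FR by (auto intro!: T.YresC)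
    have "pi ?D ?f = sect ?D r 1" "pi ?D ?h = sect ?D r 1"
      using s fh Ds D FR by (auto simp: T.pi_res res_X)
    then have "pi ?D (?f \<ominus>\<^bsub>sec Y ?D\<^esub> ?h) = \<zero>\<^bsub>sec X ?D\<^esub>"
      using T.pi_closed[OF Ds(1) c(1)] by (simp add: T.pi_minus[OF Ds(1) c] XD.minus_eq_zero_iff)
    then obtain b where b: "b \<in> carrier (sec X ?D)" "?f \<ominus>\<^bsub>sec Y ?D\<^esub> ?h = T.lam ?D b"
      using T.ker_lam[OF Ds(1) YD.minus_closed[OF c]] by blast
    obtain u v where uv: "regular ?D u v" "b = sect ?D u v" using sectionE[OF Ds(1) b(1)] .
    obtain n \<rho> where n: "\<rho> \<in> Rg \<sigma>" "u * (f * h) ^ n = \<rho> * v" using regular_Dop_cases[OF \<sigma> fhR(1) uv(1)] .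
    have b_eq: "b = sect ?D \<rho> ((f * h) ^ n)"
      unfolding uv(2) using n uv fhR(2) by (intro sect_cong Rg.power_nonzero) (auto simp: regular_def)
    have "sZ f \<ominus>\<^bsub>sec Y Z\<^esub> sZ h = T.lam Z (sect Z \<rho> ((f * h) ^ n))"
    proof -
      have "sZ f \<ominus>\<^bsub>sec Y Z\<^esub> sZ h = res Y ?D Z (?f \<ominus>\<^bsub>sec Y ?D\<^esub> ?h)"
        using c Ds Z ZD' s fh D FR by (simp add: sZ_def T.Yres_minus T.Yres_res)
      also have "\<dots> = T.lam Z (res X ?D Z b)" unfolding b(2) by (rule T.lam_res[OF Ds(1) b(1) Z(1) ZD'])
      finally show ?thesis using b_eq by (simp add: res_X[OF ZD'])
    qed
    then show ?thesis using n(1) by blast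
  qed
  define \<nu> where "\<nu> f h = (SOME n. \<exists>\<rho>. \<rho> \<in> Rg \<sigma> \<and> sZ f \<ominus>\<^bsub>sec Y Z\<^esub> sZ h = T.lam Z (sect Z \<rho> ((f * h) ^ n)))" for f h
  \<comment> \<open>One exponent for all pairs: \<open>n\<close> is at least every
    \<open>\<nu> f h\<close>, and a fraction is expanded by the missing power of
    \<open>f * h\<close>.\<close>
  define n where "n = (\<Sum>f\<in>F. \<Sum>h\<in>F. \<nu> f h)"
  have regZ: "regular Z \<rho> (f ^ k)" if "\<rho> \<in> Rg \<sigma>" "f \<in> F" for \<rho> f k
    using regular_subset[OF regular_Dop_power[OF \<sigma> FR[OF that(2)] that(1)] ZD[OF that(2)]] .
  have regZ2: "regular Z \<rho> ((f * h) ^ k)" if "\<rho> \<in> Rg \<sigma>" "f \<in> F" "h \<in> F" for \<rho> f h k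
    using regular_mult[OF regZ[OF that(1,2), of k] regZ[OF Rg.one_mem that(3), of k]]
    by (simp add: power_mult_distrib)
  have "\<exists>\<rho>. \<rho> \<in> Rg \<sigma> \<and> sZ f \<ominus>\<^bsub>sec Y Z\<^esub> sZ h = T.lam Z (sect Z \<rho> ((f * h) ^ n))" if fh: "f \<in> F" "h \<in> F" for f h
  proof -
    obtain \<rho> where \<rho>: "\<rho> \<in> Rg \<sigma>" "sZ f \<ominus>\<^bsub>sec Y Z\<^esub> sZ h = T.lam Z (sect Z \<rho> ((f * h) ^ \<nu> f h))"
      using someI_ex[OF ex[OF fh]] unfolding \<nu>_def by blast
    have "\<nu> f h \<le> (\<Sum>h\<in>F. \<nu> f h)" using F fh by (intro member_le_sum) auto
    also have "\<dots> \<le> n" unfolding n_def using F fh by (intro member_le_sum) auto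
    finally have le: "\<nu> f h \<le> n" .
    have fhR: "f * h \<in> Rg \<sigma>" "f * h \<noteq> 0" using FR fh Rg.mult_mem Rg.mult_nonzero by auto
    have "sect Z \<rho> ((f * h) ^ \<nu> f h) = sect Z (\<rho> * (f * h) ^ (n - \<nu> f h)) ((f * h) ^ n)"
      using le fhR(2)
      by (intro sect_cong Rg.power_nonzero) (auto simp: mult.assoc power_add[symmetric])
    then show ?thesis using \<rho> fhR by (intro exI[of _ "\<rho> * (f * h) ^ (n - \<nu> f h)"]) (auto intro!: Rg.mult_mem Rg.power_mem)
  qed
  then obtain \<rho> where \<rho>: "\<And>f h. \<lbrakk>f \<in> F; h \<in> F\<rbrakk> \<Longrightarrow> \<rho> f h \<in> Rg \<sigma>"
    "\<And>f h. \<lbrakk>f \<in> F; h \<in> F\<rbrakk> \<Longrightarrow> sZ f \<ominus>\<^bsub>sec Y Z\<^esub> sZ h = T.lam Z (sect Z (\<rho> f h) ((f * h) ^ n))"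
    by metis
  obtain a where a: "\<And>f. f \<in> F \<Longrightarrow> a f \<in> Rg \<sigma>" "(\<Sum>f\<in>F. a f * f ^ n) = 1"
    using Rg.unit_ideal_power[OF F(1), of \<sigma> a0 n] FR a0 by blast
  have cocycle: "\<rho> f h * g ^ n = \<rho> f g * h ^ n + \<rho> g h * f ^ n" if fgh: "f \<in> F" "g \<in> F" "h \<in> F" for f g h
  proof -
    have c: "sect Z (\<rho> f h) ((f * h) ^ n) \<in> carrier (sec X Z)" "sect Z (\<rho> f g) ((f * g) ^ n) \<in> carrier (sec X Z)"
      "sect Z (\<rho> g h) ((g * h) ^ n) \<in> carrier (sec X Z)"
      using sect_section[OF Z(1)] regZ2 \<rho>(1) fgh by auto
    have "T.lam Z (sect Z (\<rho> f h) ((f * h) ^ n)) =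
       T.lam Z (sect Z (\<rho> f g) ((f * g) ^ n) \<oplus>\<^bsub>sec X Z\<^esub> sect Z (\<rho> g h) ((g * h) ^ n))"
      using sZ fgh unfolding T.lam_add[OF Z(1) c(2,3)] \<rho>(2)[OF fgh(1,3), symmetric]
        \<rho>(2)[OF fgh(1,2), symmetric] \<rho>(2)[OF fgh(2,3), symmetric]
      by (simp add: a_minus_def YZ.a_ac YZ.r_neg YZ.r_neg1 YZ.r_neg2)
    then have "sect Z (\<rho> f h) ((f * h) ^ n) = sect Z (\<rho> f g) ((f * g) ^ n) \<oplus>\<^bsub>sec X Z\<^esub> sect Z (\<rho> g h) ((g * h) ^ n)"
      using T.lam_inj[OF Z(1) c(1) XZ.a_closed[OF c(2,3)]] by blast
    also have "\<dots> = sect Z (\<rho> f g * (g * h) ^ n + \<rho> g h * (f * g) ^ n) ((f * g) ^ n * (g * h) ^ n)"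
      by (intro sect_add regZ2 \<rho> fgh)
    finally have "\<rho> f h * ((f * g) ^ n * (g * h) ^ n) = (\<rho> f g * (g * h) ^ n + \<rho> g h * (f * g) ^ n) * (f * h) ^ n"
      by (simp only: sect_eq_iff[OF Z regZ2[OF \<rho>(1)[OF fgh(1,3)] fgh(1,3)]
        regular_add[OF regZ2[OF \<rho>(1)[OF fgh(1,2)] fgh(1,2)] regZ2[OF \<rho>(1)[OF fgh(2,3)] fgh(2,3)]]])
    then have "(\<rho> f h * g ^ n) * (f ^ n * g ^ n * h ^ n) = (\<rho> f g * h ^ n + \<rho> g h * f ^ n) * (f ^ n * g ^ n * h ^ n)"
      by (simp add: power_mult_distrib algebra_simps)
    moreover have "f ^ n * g ^ n * h ^ n \<noteq> 0" using FR fgh by (intro Rg.mult_nonzero Rg.power_nonzero) auto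
    ultimately show ?thesis by (rule Rg.mult_cancel[rotated])
  qed
  define H where "H f = (\<Sum>h\<in>F. a h * \<rho> f h)" for f
  have HR: "H f \<in> Rg \<sigma>" if "f \<in> F" for f
    unfolding H_def using a \<rho>(1) that by (auto intro!: Rg.sum_mem Rg.mult_mem)
  have H: "H f * g ^ n = \<rho> f g + H g * f ^ n" if fg: "f \<in> F" "g \<in> F" for f g
  proof -
    have "H f * g ^ n = (\<Sum>h\<in>F. a h * (\<rho> f h * g ^ n))" by (simp add: H_def sum_distrib_right mult.assoc)
    also have "\<dots> = (\<Sum>h\<in>F. \<rho> f g * (a h * h ^ n) + a h * \<rho> g h * f ^ n)"
    proof (rule sum.cong[OF refl])
      fix h assume h: "h \<in> F"
      show "a h * (\<rho> f h * g ^ n) = \<rho> f g * (a h * h ^ n) + a h * \<rho> g h * f ^ n"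
        unfolding cocycle[OF fg h] by (simp add: algebra_simps)
    qed
    also have "\<dots> = \<rho> f g + H g * f ^ n"
      by (simp add: sum.distrib sum_distrib_left[symmetric] sum_distrib_right[symmetric] a H_def)
    finally show ?thesis .
  qed
  define s' where "s' f = s f \<ominus>\<^bsub>sec Y (Dop \<sigma> f)\<^esub> T.lam (Dop \<sigma> f) (sect (Dop \<sigma> f) (H f) (f ^ n))" for f
  have s': "s' f \<in> A (Dop \<sigma> f) \<and> pi (Dop \<sigma> f) (s' f) = sect (Dop \<sigma> f) r 1 \<and>
      res Y (Dop \<sigma> f) Z (s' f) = sZ f \<ominus>\<^bsub>sec Y Z\<^esub> T.lam Z (sect Z (H f) (f ^ n))" if f: "f \<in> F" for f
  proof -
    let ?D = "Dop \<sigma> f"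
    have Ds: "opn ?D" using D FR f by auto
    interpret YD: cring "sec Y ?D" by (rule T.cringY[OF Ds(1)])
    interpret XD: cring "sec X ?D" by (rule T.cringX[OF Ds(1)])
    have b: "sect ?D (H f) (f ^ n) \<in> carrier (sec X ?D)"
      by (intro sect_section[OF Ds] regular_Dop_power[OF \<sigma> FR[OF f] HR[OF f]])
    have l: "T.lam ?D (sect ?D (H f) (f ^ n)) \<in> A ?D" by (rule T.lam_closed[OF Ds b])
    have "pi ?D (s' f) = sect ?D r 1 \<ominus>\<^bsub>sec X ?D\<^esub> \<zero>\<^bsub>sec X ?D\<^esub>"
      unfolding s'_def T.pi_minus[OF Ds s(1)[OF f] l] T.pi_lam[OF Ds b] s(2)[OF f] ..
    moreover have "sect ?D r 1 \<in> carrier (sec X ?D)"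
      using T.pi_closed[OF Ds s(1)[OF f]] s(2)[OF f] by simp
    moreover have "res Y ?D Z (s' f) = sZ f \<ominus>\<^bsub>sec Y Z\<^esub> T.lam Z (sect Z (H f) (f ^ n))"
      unfolding s'_def sZ_def T.Yres_minus[OF Ds Z(1) ZD[OF f] s(1)[OF f] l] T.lam_res[OF Ds b Z(1) ZD[OF f]]
        res_X[OF ZD[OF f]] ..
    ultimately show ?thesis using s(1)[OF f] l by (simp add: s'_def a_minus_def)
  qed
  have agree: "res Y (Dop \<sigma> f) Z (s' f) = res Y (Dop \<sigma> g) Z (s' g)" if fg: "f \<in> F" "g \<in> F" for f g
  proof -
    have c: "sect Z (H f) (f ^ n) \<in> carrier (sec X Z)" "sect Z (H g) (g ^ n) \<in> carrier (sec X Z)"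
      "sect Z (\<rho> f g) ((f * g) ^ n) \<in> carrier (sec X Z)"
      using sect_section[OF Z(1)] regZ regZ2 \<rho>(1) HR fg by auto
    have "sect Z (\<rho> f g) ((f * g) ^ n) \<oplus>\<^bsub>sec X Z\<^esub> sect Z (H g) (g ^ n) =
        sect Z (\<rho> f g * g ^ n + H g * (f * g) ^ n) ((f * g) ^ n * g ^ n)"
      by (intro sect_add regZ2 regZ \<rho> HR fg)
    also have "\<dots> = sect Z (H f) (f ^ n)"
    proof (rule sect_cong)
      have "(\<rho> f g * g ^ n + H g * (f * g) ^ n) * f ^ n = (\<rho> f g + H g * f ^ n) * (f ^ n * g ^ n)"
        by (simp add: power_mult_distrib algebra_simps)
      also have "\<dots> = H f * ((f * g) ^ n * g ^ n)" unfolding H[OF fg, symmetric]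
        by (simp add: power_mult_distrib algebra_simps)
      finally show "(\<rho> f g * g ^ n + H g * (f * g) ^ n) * f ^ n = H f * ((f * g) ^ n * g ^ n)" .
    qed (intro Rg.mult_nonzero Rg.power_nonzero FR fg)+
    finally have "T.lam Z (sect Z (H f) (f ^ n)) =
        (sZ f \<ominus>\<^bsub>sec Y Z\<^esub> sZ g) \<oplus>\<^bsub>sec Y Z\<^esub> T.lam Z (sect Z (H g) (g ^ n))"
      using T.lam_add[OF Z(1) c(3,2)] \<rho>(2)[OF fg] by simp
    then have "sZ f \<ominus>\<^bsub>sec Y Z\<^esub> T.lam Z (sect Z (H f) (f ^ n)) = sZ g \<ominus>\<^bsub>sec Y Z\<^esub> T.lam Z (sect Z (H g) (g ^ n))"
      using sZ fg T.lam_closed[OF Z(1) c(2)]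
      by (simp add: a_minus_def YZ.minus_add YZ.a_assoc YZ.r_neg2)
    then show ?thesis using s' fg by simp
  qed
  have UF: "?U = (\<Union>f\<in>F. Dop \<sigma> f)"
  proof (intro equalityI subsetI)
    fix x assume "x \<in> ?U"
    then obtain p where p: "primeideal p (Rg.R \<sigma>)" "x = cls (\<sigma>, p)" by (auto simp: Dop_one chart_ring_eq)
    have "\<exists>f\<in>F. f \<notin> p"
    proof (rule ccontr)
      assume "\<not> ?thesis"
      then have "a0 f * f \<in> p" if "f \<in> F" for f using Rg.primeidealD(5)[OF p(1)] a0(1) that by auto
      then have "(\<Sum>f\<in>F. a0 f * f) \<in> p" by (rule Rg.primeideal_sum[OF p(1)])
      then show False using a0(2) Rg.primeidealD(3)[OF p(1)] by simp
    qed
    then show "x \<in> (\<Union>f\<in>F. Dop \<sigma> f)" using p by (auto simp: Dop_def basic_open_def)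
  qed (use D FR in blast)
  obtain u where u: "u \<in> A ?U" "\<And>W w. \<lbrakk>T.Y.op W; W \<subseteq> ?U; w \<in> A W; \<exists>f\<in>F. W = Dop \<sigma> f \<and> w = s' f\<rbrakk> \<Longrightarrow> res Y ?U W u = w"
  proof (rule T.Y.glue_pred[where V="?U" and Q="\<lambda>W w. \<exists>f\<in>F. W = Dop \<sigma> f \<and> w = s' f"])
    show "T.Y.op ?U" using U by (simp add: T.opY)
    fix x assume "x \<in> ?U"
    then obtain f where "f \<in> F" "x \<in> Dop \<sigma> f" unfolding UF by blast
    then show "\<exists>W s. T.Y.op W \<and> x \<in> W \<and> W \<subseteq> ?U \<and> s \<in> A W \<and> (\<exists>f\<in>F. W = Dop \<sigma> f \<and> s = s' f)"
      using D[OF FR(1)] s' by (intro exI[of _ "Dop \<sigma> f"] exI[of _ "s' f"]) (auto simp: T.opY)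
  next
    fix W w W' w' assume ex: "\<exists>f\<in>F. W = Dop \<sigma> f \<and> w = s' f" "\<exists>f\<in>F. W' = Dop \<sigma> f \<and> w' = s' f"
    then obtain f g where fg: "f \<in> F" "g \<in> F" "W = Dop \<sigma> f" "w = s' f" "W' = Dop \<sigma> g" "w' = s' g" by blast
    have o: "opn W" "opn W'" "opn (W \<inter> W')" using D FR fg by auto
    have ZW: "Z \<subseteq> W \<inter> W'" using ZD fg by auto
    have w: "w \<in> A W" "w' \<in> A W'" using s' fg by auto
    have ww: "res Y W (W \<inter> W') w \<in> A (W \<inter> W')" "res Y W' (W \<inter> W') w' \<in> A (W \<inter> W')"
      using w o by (auto intro!: T.YresC)
    have "res Y (W \<inter> W') Z (res Y W (W \<inter> W') w) = res Y (W \<inter> W') Z (res Y W' (W \<inter> W') w')"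
      using agree[OF fg(1,2)] fg(3-6) w o Z ZW by (simp add: T.Yres_res)
    then show "res Y W (W \<inter> W') w = res Y W' (W \<inter> W') w'"
      using res_Y_inj[OF o(3) Z(1) ZW Z(2) ww] by blast
  qed auto
  have "pi ?U u = sect ?U r 1"
  proof (rule T.X.separated[OF U T.pi_closed[OF U u(1)] sect_section[OF U rU]])
    fix x assume "x \<in> ?U"
    then obtain f where f: "f \<in> F" "x \<in> Dop \<sigma> f" unfolding UF by blast
    have Df: "opn (Dop \<sigma> f)" "Dop \<sigma> f \<subseteq> ?U" using D FR f by auto
    have "res Y ?U (Dop \<sigma> f) u = s' f" using u(2)[of "Dop \<sigma> f" "s' f"] Df s'[OF f(1)] f by (auto simp: T.opY)
    then have "res X ?U (Dop \<sigma> f) (pi ?U u) = res X ?U (Dop \<sigma> f) (sect ?U r 1)"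
      using T.pi_res[OF U Df u(1)] s'[OF f(1)] res_X[OF Df(2)] by simp
    then show "\<exists>W. opn W \<and> x \<in> W \<and> W \<subseteq> ?U \<and> res X ?U W (pi ?U u) = res X ?U W (sect ?U r 1)"
      using Df f by (intro exI[of _ "Dop \<sigma> f"]) simp
  qed
  then show thesis using that u(1) by blast
qed

end

section \<open>Multiplicative lifts of characters\<close>

text \<open>The functional that is 1 at \<open>b\<close> and 0 at the other members of
  \<open>B\<close> is represented by a vector; its orthogonal projection to the span of
  \<open>B\<close> keeps these values and is the dual basis vector.\<close>

lemma dual_basis_exists:
  fixes B :: "'a::euclidean_space set"
  assumes "independent B"
  obtains \<beta> where "\<And>b. b \<in> B \<Longrightarrow> \<beta> b \<in> span B" "\<And>b c. \<lbrakk>b \<in> B; c \<in> B\<rbrakk> \<Longrightarrow> \<beta> b \<bullet> c = (if b = c then 1 else 0)"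
proof -
  have "\<exists>w. w \<in> span B \<and> (\<forall>c\<in>B. w \<bullet> c = (if b = c then 1 else 0))" for b
  proof -
    obtain g where g: "linear g" "\<forall>c\<in>B. g c = (if b = c then 1 else (0::real))"
      using linear_independent_extend[OF assms, of "\<lambda>c. if b = c then 1 else 0"] by auto
    obtain y z where yz: "y \<in> span B" "\<And>w. w \<in> span B \<Longrightarrow> orthogonal z w" "adjoint g 1 = y + z"
      using orthogonal_subspace_decomp_exists[of B "adjoint g 1"] by blast
    have "y \<bullet> c = g c" if "c \<in> B" for c
    proof -
      have "z \<bullet> c = 0" using yz(2)[of c] that by (auto simp: orthogonal_def span_base)
      then have "y \<bullet> c = adjoint g 1 \<bullet> c" by (simp add: yz(3) inner_add_left)
      also have "\<dots> = g c" using adjoint_works[OF g(1), of c 1] by (simp add: inner_commute)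
      finally show ?thesis .
    qed
    then show ?thesis using yz(1) g(2) by auto
  qed
  then show thesis using that by metis
qed

lemma lattice_basis_span:
  assumes "lattice_basis N B"
  shows "B \<subseteq> N" "span N = span B" "independent B" "finite B"
proof -
  show i: "independent B" using assms by (simp add: lattice_basis_def)
  then show f: "finite B" using independent_bound by blast
  have N: "N = {\<Sum>b\<in>B. real_of_int (c b) *\<^sub>R b | c. True}" using assms by (simp add: lattice_basis_def)
  show BN: "B \<subseteq> N"
  proof
    fix b assume "b \<in> B"
    then have "b = (\<Sum>c\<in>B. real_of_int (if c = b then 1 else 0) *\<^sub>R c)"
      using f by (simp add: if_distrib[of real_of_int] if_distrib[of "\<lambda>u. u *\<^sub>R _"] sum.delta cong: if_cong)
    then have "\<exists>c. b = (\<Sum>d\<in>B. real_of_int (c d) *\<^sub>R d)" by (rule exI[of _ "\<lambda>c. if c = b then 1 else 0"])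
    then show "b \<in> N" unfolding N by simp
  qed
  have "N \<subseteq> span B" unfolding N by (clarify, intro span_sum span_scale span_base)
  then show "span N = span B" using BN by (metis span_mono span_span subset_antisym)
qed

lemma dual_basis_expand:
  fixes B :: "'a::euclidean_space set"
  assumes B: "finite B" and \<beta>: "\<And>b. b \<in> B \<Longrightarrow> \<beta> b \<in> span B"
    "\<And>b c. \<lbrakk>b \<in> B; c \<in> B\<rbrakk> \<Longrightarrow> \<beta> b \<bullet> c = (if b = c then 1 else 0)"
    and m: "m \<in> span B"
  shows "m = (\<Sum>b\<in>B. (m \<bullet> b) *\<^sub>R \<beta> b)" "m = (\<Sum>b\<in>B. (\<beta> b \<bullet> m) *\<^sub>R b)"
proof -
  let ?d = "m - (\<Sum>b\<in>B. (m \<bullet> b) *\<^sub>R \<beta> b)"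
  have "?d \<bullet> c = 0" if "c \<in> B" for c
  proof -
    have "(\<Sum>b\<in>B. (m \<bullet> b) * (\<beta> b \<bullet> c)) = (\<Sum>b\<in>B. if b = c then m \<bullet> b else 0)"
      using \<beta>(2) that by (intro sum.cong) auto
    then show ?thesis using that B by (simp add: inner_diff_left inner_sum_left)
  qed
  moreover have "?d \<in> span B" using m \<beta>(1) by (intro span_diff span_sum span_scale) auto
  ultimately have "?d \<bullet> ?d = 0"
    using orthogonal_to_span[of ?d B ?d] by (simp add: orthogonal_def)
  then show "m = (\<Sum>b\<in>B. (m \<bullet> b) *\<^sub>R \<beta> b)" by simp
  obtain u where u: "m = (\<Sum>c\<in>B. u c *\<^sub>R c)" using m unfolding span_finite[OF B] by auto
  have "\<beta> b \<bullet> m = u b" if "b \<in> B" for b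
  proof -
    have "\<beta> b \<bullet> m = (\<Sum>c\<in>B. if c = b then u c else 0)"
      unfolding u inner_sum_right using \<beta>(2)[OF that] by (intro sum.cong) auto
    then show ?thesis using that B by simp
  qed
  then show "m = (\<Sum>b\<in>B. (\<beta> b \<bullet> m) *\<^sub>R b)" using u by simp
qed

lemma lattice_dual_basis:
  assumes B: "lattice_basis N B"
  obtains \<beta> where "\<And>b. b \<in> B \<Longrightarrow> \<beta> b \<in> dual_lattice N"
    "\<And>b c. \<lbrakk>b \<in> B; c \<in> B\<rbrakk> \<Longrightarrow> \<beta> b \<bullet> c = (if b = c then 1 else 0)"
    "\<And>m. m \<in> span N \<Longrightarrow> m = (\<Sum>b\<in>B. (m \<bullet> b) *\<^sub>R \<beta> b)"
    "\<And>m. m \<in> span N \<Longrightarrow> m = (\<Sum>b\<in>B. (\<beta> b \<bullet> m) *\<^sub>R b)"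
proof -
  note sp = lattice_basis_span[OF B]
  obtain \<beta> where \<beta>: "\<And>b. b \<in> B \<Longrightarrow> \<beta> b \<in> span B"
    "\<And>b c. \<lbrakk>b \<in> B; c \<in> B\<rbrakk> \<Longrightarrow> \<beta> b \<bullet> c = (if b = c then 1 else 0)"
    using dual_basis_exists[OF sp(3)] by blast
  have "\<beta> b \<bullet> u \<in> \<int>" if b: "b \<in> B" and u: "u \<in> N" for b u
  proof -
    obtain c where c: "u = (\<Sum>b\<in>B. real_of_int (c b) *\<^sub>R b)" using B u unfolding lattice_basis_def by blast
    have "\<beta> b \<bullet> u = (\<Sum>d\<in>B. if d = b then real_of_int (c d) else 0)"
      unfolding c inner_sum_right using \<beta>(2)[OF b] by (intro sum.cong) auto
    then show ?thesis using sp(4) b by simp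
  qed
  then have "\<beta> b \<in> dual_lattice N" if "b \<in> B" for b
    using that \<beta>(1) by (simp add: dual_lattice_def sp(2))
  then show thesis
    using dual_basis_expand[OF sp(4) \<beta>] \<beta>(2) that unfolding sp(2) by blast
qed

lemma dual_lattice_zero: "0 \<in> dual_lattice N"
  and dual_lattice_add: "\<lbrakk>m \<in> dual_lattice N; n \<in> dual_lattice N\<rbrakk> \<Longrightarrow> m + n \<in> dual_lattice N"
  and dual_lattice_uminus: "m \<in> dual_lattice N \<Longrightarrow> - m \<in> dual_lattice N"
  by (auto simp: dual_lattice_def span_zero span_add span_neg inner_add_left)

lemma dual_lattice_scale: "m \<in> dual_lattice N \<Longrightarrow> real_of_int k *\<^sub>R m \<in> dual_lattice N"
  by (auto simp: dual_lattice_def span_scale)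

lemma dual_lattice_sum: "(\<And>i. i \<in> I \<Longrightarrow> f i \<in> dual_lattice N) \<Longrightarrow> sum f I \<in> dual_lattice N"
  by (induction I rule: infinite_finite_induct) (auto simp: dual_lattice_zero dual_lattice_add)

text \<open>Additivity gives linearity over the integers, and the dual basis generates the dual
  lattice with the integral coefficients \<open>m \<bullet> b\<close>. In this way a graded part of
  a derivation becomes a single vector in the span of \<open>N\<close>.\<close>

lemma additive_dual_lattice:
  fixes g :: "'a::euclidean_space \<Rightarrow> real"
  assumes g: "\<And>m n. \<lbrakk>m \<in> dual_lattice N; n \<in> dual_lattice N\<rbrakk> \<Longrightarrow> g (m + n) = g m + g n"
    and B: "lattice_basis N B"
    and \<beta>: "\<And>b. b \<in> B \<Longrightarrow> \<beta> b \<in> dual_lattice N" "\<And>m. m \<in> span N \<Longrightarrow> m = (\<Sum>b\<in>B. (m \<bullet> b) *\<^sub>R \<beta> b)"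
    and m: "m \<in> dual_lattice N"
  shows "g m = m \<bullet> (\<Sum>b\<in>B. g (\<beta> b) *\<^sub>R b)"
proof -
  have g0: "g 0 = 0" using g[OF dual_lattice_zero dual_lattice_zero] by simp
  have gneg: "g (- n) = - g n" if "n \<in> dual_lattice N" for n
    using g[OF that dual_lattice_uminus[OF that]] g0 by simp
  have gnat: "g (of_nat k *\<^sub>R n) = of_nat k * g n" if n: "n \<in> dual_lattice N" for k n
  proof (induction k)
    case (Suc k)
    have "of_nat k *\<^sub>R n \<in> dual_lattice N" using dual_lattice_scale[OF n, of "int k"] by simp
    then show ?case using g[OF n] Suc by (simp add: scaleR_left_distrib distrib_right)
  qed (simp add: g0)
  have gint: "g (real_of_int k *\<^sub>R n) = real_of_int k * g n" if n: "n \<in> dual_lattice N" for k n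
  proof (cases "k \<ge> 0")
    case True then show ?thesis using gnat[OF n, of "nat k"] by simp
  next
    case False
    define x where "x = of_nat (nat (- k)) *\<^sub>R n"
    have "x \<in> dual_lattice N" unfolding x_def using dual_lattice_scale[OF n, of "- k"] False by simp
    moreover have "real_of_int k *\<^sub>R n = - x" unfolding x_def using False by simp
    ultimately have "g (real_of_int k *\<^sub>R n) = - g x" by (simp only: gneg)
    then show ?thesis unfolding x_def gnat[OF n] using False by simp
  qed
  have gsum: "g (\<Sum>b\<in>C. f b) = (\<Sum>b\<in>C. g (f b))" if "finite C" "\<And>b. b \<in> C \<Longrightarrow> f b \<in> dual_lattice N" for C f
    using that by (induction C rule: finite_induct) (auto simp: g0 g dual_lattice_sum)
  have i: "m \<bullet> b = real_of_int \<lfloor>m \<bullet> b\<rfloor>" if "b \<in> B" for b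
    using m lattice_basis_span(1)[OF B] that by (auto simp: dual_lattice_def)
  have "m = (\<Sum>b\<in>B. real_of_int \<lfloor>m \<bullet> b\<rfloor> *\<^sub>R \<beta> b)"
    using \<beta>(2)[of m] m i by (simp add: dual_lattice_def)
  then have "g m = (\<Sum>b\<in>B. g (real_of_int \<lfloor>m \<bullet> b\<rfloor> *\<^sub>R \<beta> b))"
    using gsum[OF lattice_basis_span(4)[OF B], of "\<lambda>b. real_of_int \<lfloor>m \<bullet> b\<rfloor> *\<^sub>R \<beta> b"] dual_lattice_scale[OF \<beta>(1)]
    by simp
  also have "\<dots> = (\<Sum>b\<in>B. (m \<bullet> b) * g (\<beta> b))"
  proof (rule sum.cong[OF refl])
    fix b assume b: "b \<in> B"
    show "g (real_of_int \<lfloor>m \<bullet> b\<rfloor> *\<^sub>R \<beta> b) = (m \<bullet> b) * g (\<beta> b)"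
      by (simp only: gint[OF \<beta>(1)[OF b]]) (simp only: i[OF b, symmetric])
  qed
  finally show ?thesis by (simp add: inner_sum_right mult.commute)
qed

lemma lookup_chi_mult: "Poly_Mapping.lookup (chi m * f) k = Poly_Mapping.lookup f (k - m)"
proof -
  have "(k = l + q) = (q = k - l)" for l q :: 'a by (auto simp: algebra_simps)
  then have "Poly_Mapping.lookup (chi m * f) k = (\<Sum>l. Poly_Mapping.lookup (chi m) l * Poly_Mapping.lookup f (k - l))"
    by (simp add: lookup_mult)
  also have "\<dots> = (\<Sum>l. Poly_Mapping.lookup f (k - l) when l = m)"
    by (rule Sum_any.cong) (auto simp: chi_def lookup_single when_def)
  finally show ?thesis by simp
qed

section \<open>Compatibility along rays and the algebraic splitting problem\<close>

definition ray :: "'a::real_vector \<Rightarrow> 'a set" where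
  "ray v = convex_cone hull {v}"

text \<open>\<open>compat q v d a\<close>: the derivation \<open>\<chi>\<^sup>q (d - a)\<close> is regular along the divisor of the ray of \<open>v\<close>.\<close>

definition compat :: "'a::real_inner \<Rightarrow> 'a \<Rightarrow> 'a \<Rightarrow> 'a \<Rightarrow> bool" where
  "compat q v d a \<longleftrightarrow> (q \<bullet> v \<le> -2 \<longrightarrow> d = a) \<and> (q \<bullet> v = -1 \<longrightarrow> (\<exists>c. d - a = c *\<^sub>R v))"

text \<open>A fan with ray generators \<open>V\<close>, whose cones in the set \<open>S\<close> are smooth.  The last assumption says
  that the first cohomology of the tangent sheaf of the open toric subvariety given by \<open>S\<close> vanishes.\<close>

locale rigid_fan = toric_fan N \<Sigma> for N :: "'a::euclidean_space set" and \<Sigma> +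
  fixes V :: "'a set" and Vs :: "'a set \<Rightarrow> 'a set" and S :: "'a set set"
  assumes finite_V: "finite V" and V_N: "V \<subseteq> N"
    and S_sub: "S \<subseteq> \<Sigma>" and origin_S: "{0} \<in> S" and ray_S: "v \<in> V \<Longrightarrow> ray v \<in> S"
    and Vs_V: "\<sigma> \<in> \<Sigma> \<Longrightarrow> Vs \<sigma> \<subseteq> V" and Vs_ray: "v \<in> V \<Longrightarrow> Vs (ray v) = {v}"
    and ray_face: "\<lbrakk>\<sigma> \<in> \<Sigma>; v \<in> Vs \<sigma>\<rbrakk> \<Longrightarrow> ray v face_of \<sigma>"
    and dual_monoid_Vs: "\<sigma> \<in> \<Sigma> \<Longrightarrow> dual_monoid N \<sigma> = {m \<in> dual_lattice N. \<forall>v\<in>Vs \<sigma>. 0 \<le> m \<bullet> v}"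
    and smooth_S: "\<sigma> \<in> S \<Longrightarrow> \<exists>B. lattice_basis N B \<and> Vs \<sigma> \<subseteq> B"
    and extend_compat: "\<lbrakk>q \<in> dual_lattice N; \<And>\<sigma>. \<sigma> \<in> S \<Longrightarrow> a \<sigma> \<in> span N;
        \<And>\<sigma> v. \<lbrakk>\<sigma> \<in> S; v \<in> Vs \<sigma>\<rbrakk> \<Longrightarrow> compat q v (a \<sigma>) (a (ray v))\<rbrakk>
      \<Longrightarrow> \<exists>d\<in>span N. \<forall>v\<in>V. compat q v d (a (ray v))"

text \<open>The deformation over the torus in purely algebraic terms: \<open>E\<close> is a
  square-zero extension of the Laurent ring \<open>Rg {0}\<close> by itself, with projection
  \<open>\<pi>\<close> and ideal given by \<open>lam\<close>. \<open>Asub \<sigma>\<close> stands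
  for the elements of \<open>E\<close> that extend to the chart of \<open>\<sigma>\<close>, and
  \<open>\<kappa>\<close> embeds the constants. Every chart has lifts of its single functions
  (\<open>Asub_lift\<close>); the problem is to choose them as a ring homomorphism, on all charts at
  once.\<close>

locale splitting_problem = rigid_fan N \<Sigma> V Vs S + E: cring E
  for N :: "'a::euclidean_space set" and \<Sigma> V Vs S and E :: "('e, 'm) ring_scheme" (structure) +
  fixes \<pi> :: "'e \<Rightarrow> ('a \<Rightarrow>\<^sub>0 complex)" and lam :: "('a \<Rightarrow>\<^sub>0 complex) \<Rightarrow> 'e"
    and Asub :: "'a set \<Rightarrow> 'e set" and \<kappa> :: "complex \<Rightarrow> 'e"
  assumes pi_closed: "s \<in> carrier E \<Longrightarrow> \<pi> s \<in> Rg {0}"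
    and pi_mult: "\<lbrakk>s \<in> carrier E; u \<in> carrier E\<rbrakk> \<Longrightarrow> \<pi> (s \<otimes> u) = \<pi> s * \<pi> u"
    and pi_add: "\<lbrakk>s \<in> carrier E; u \<in> carrier E\<rbrakk> \<Longrightarrow> \<pi> (s \<oplus> u) = \<pi> s + \<pi> u"
    and pi_one: "\<pi> \<one> = 1"
    and lam_closed: "f \<in> Rg {0} \<Longrightarrow> lam f \<in> carrier E"
    and lam_add: "\<lbrakk>f \<in> Rg {0}; g \<in> Rg {0}\<rbrakk> \<Longrightarrow> lam (f + g) = lam f \<oplus> lam g"
    and lam_inj: "\<lbrakk>f \<in> Rg {0}; g \<in> Rg {0}; lam f = lam g\<rbrakk> \<Longrightarrow> f = g"
    and pi_lam: "f \<in> Rg {0} \<Longrightarrow> \<pi> (lam f) = 0"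
    and lam_smult: "\<lbrakk>s \<in> carrier E; f \<in> Rg {0}\<rbrakk> \<Longrightarrow> s \<otimes> lam f = lam (\<pi> s * f)"
    and ker_lam: "\<lbrakk>s \<in> carrier E; \<pi> s = 0\<rbrakk> \<Longrightarrow> \<exists>f\<in>Rg {0}. s = lam f"
    and Asub_sub: "\<sigma> \<in> \<Sigma> \<Longrightarrow> Asub \<sigma> \<subseteq> carrier E"
    and Asub_one: "\<sigma> \<in> \<Sigma> \<Longrightarrow> \<one> \<in> Asub \<sigma>"
    and Asub_mult: "\<lbrakk>\<sigma> \<in> \<Sigma>; s \<in> Asub \<sigma>; u \<in> Asub \<sigma>\<rbrakk> \<Longrightarrow> s \<otimes> u \<in> Asub \<sigma>"
    and Asub_minus: "\<lbrakk>\<sigma> \<in> \<Sigma>; s \<in> Asub \<sigma>; u \<in> Asub \<sigma>\<rbrakk> \<Longrightarrow> s \<ominus> u \<in> Asub \<sigma>"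
    and Asub_face: "\<lbrakk>\<sigma> \<in> \<Sigma>; \<tau> \<in> \<Sigma>; \<tau> face_of \<sigma>\<rbrakk> \<Longrightarrow> Asub \<sigma> \<subseteq> Asub \<tau>"
    and Asub_pi: "\<lbrakk>\<sigma> \<in> \<Sigma>; s \<in> Asub \<sigma>\<rbrakk> \<Longrightarrow> \<pi> s \<in> Rg \<sigma>"
    and Asub_lift: "\<lbrakk>\<sigma> \<in> \<Sigma>; f \<in> Rg \<sigma>\<rbrakk> \<Longrightarrow> \<exists>s\<in>Asub \<sigma>. \<pi> s = f"
    and Asub_lam: "\<lbrakk>\<sigma> \<in> \<Sigma>; f \<in> Rg {0}\<rbrakk> \<Longrightarrow> lam f \<in> Asub \<sigma> \<longleftrightarrow> f \<in> Rg \<sigma>"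
    and \<kappa>_add: "\<kappa> (c + d) = \<kappa> c \<oplus> \<kappa> d" and \<kappa>_mult: "\<kappa> (c * d) = \<kappa> c \<otimes> \<kappa> d"
    and \<kappa>_one: "\<kappa> 1 = \<one>" and \<kappa>_Asub: "\<sigma> \<in> \<Sigma> \<Longrightarrow> \<kappa> c \<in> Asub \<sigma>"
    and pi_\<kappa>: "\<pi> (\<kappa> c) = Poly_Mapping.single 0 c"
begin

abbreviation M where "M \<equiv> dual_lattice N"
abbreviation lk where "lk \<equiv> Poly_Mapping.lookup"

lemma dual_monoid_M: "dual_monoid N \<sigma> \<subseteq> M"
  by (auto simp: dual_monoid_def)

lemma dual_monoid_origin: "dual_monoid N {0} = M"
  by (auto simp: dual_monoid_def)

lemma chi_Rg: "m \<in> dual_monoid N \<sigma> \<Longrightarrow> chi m \<in> Rg \<sigma>"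
  by (simp add: Rg_def chi_mem_iff)

lemma chi_Rg0: "m \<in> M \<Longrightarrow> chi m \<in> Rg {0}"
  by (simp add: chi_Rg dual_monoid_origin)

lemma Rg_sub0: "\<sigma> \<in> \<Sigma> \<Longrightarrow> Rg \<sigma> \<subseteq> Rg {0}"
  using Rg_antimono face_of_imp_subset origin_face by blast

lemma chi_cancel: "chi (- m) * (chi m * f) = f"
  by (simp add: mult.assoc[symmetric] chi_add[symmetric] chi_zero)

lemma chi_cancel': "chi m * (chi (- m) * f) = f"
  by (simp add: mult.assoc[symmetric] chi_add[symmetric] chi_zero)

lemma lam_zero: "lam 0 = \<zero>"
  using lam_smult[OF E.zero_closed Rg.zero_mem] lam_closed[OF Rg.zero_mem] by simp

lemma lam_uminus: "f \<in> Rg {0} \<Longrightarrow> lam (- f) = \<ominus> lam f"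
  using lam_add[of "- f" f] lam_zero Rg.uminus_mem lam_closed by (intro E.minus_equality[symmetric]) auto

lemma lam_diff: "\<lbrakk>f \<in> Rg {0}; g \<in> Rg {0}\<rbrakk> \<Longrightarrow> lam (f - g) = lam f \<ominus> lam g"
  using lam_add[of f "- g"] by (simp add: lam_uminus Rg.uminus_mem a_minus_def)

lemma lam_lam: "\<lbrakk>f \<in> Rg {0}; g \<in> Rg {0}\<rbrakk> \<Longrightarrow> lam f \<otimes> lam g = \<zero>"
  using lam_smult[OF lam_closed] by (simp add: pi_lam lam_zero)

lemma pi_zero: "\<pi> \<zero> = 0"
  using pi_lam[OF Rg.zero_mem] lam_zero by simp

lemma pi_minus: "\<lbrakk>s \<in> carrier E; u \<in> carrier E\<rbrakk> \<Longrightarrow> \<pi> (s \<ominus> u) = \<pi> s - \<pi> u"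
proof -
  assume su: "s \<in> carrier E" "u \<in> carrier E"
  have "\<pi> (\<ominus> u) + \<pi> u = 0" using pi_add[of "\<ominus> u" u] su pi_zero by (simp add: E.l_neg)
  then show ?thesis using su by (simp add: a_minus_def pi_add eq_neg_iff_add_eq_0[symmetric])
qed

lemma Asub_closed: "\<lbrakk>\<sigma> \<in> \<Sigma>; s \<in> Asub \<sigma>\<rbrakk> \<Longrightarrow> s \<in> carrier E"
  using Asub_sub by blast

lemma Asub_zero: "\<sigma> \<in> \<Sigma> \<Longrightarrow> \<zero> \<in> Asub \<sigma>"
  using Asub_minus[OF _ Asub_one Asub_one] by (simp add: E.r_neg a_minus_def)

lemma Asub_add: "\<lbrakk>\<sigma> \<in> \<Sigma>; s \<in> Asub \<sigma>; u \<in> Asub \<sigma>\<rbrakk> \<Longrightarrow> s \<oplus> u \<in> Asub \<sigma>"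
proof -
  assume *: "\<sigma> \<in> \<Sigma>" "s \<in> Asub \<sigma>" "u \<in> Asub \<sigma>"
  then have "s \<ominus> (\<zero> \<ominus> u) \<in> Asub \<sigma>" using Asub_minus Asub_zero by blast
  then show ?thesis using * Asub_closed by (simp add: a_minus_def)
qed

lemma ker_lam_diff:
  assumes "s \<in> carrier E" "u \<in> carrier E" "\<pi> s = \<pi> u"
  obtains f where "f \<in> Rg {0}" "s = u \<oplus> lam f"
proof -
  have "\<pi> (s \<ominus> u) = 0" using assms by (simp add: pi_minus)
  then obtain f where f: "f \<in> Rg {0}" "s \<ominus> u = lam f" using ker_lam assms by blast
  have "s = u \<oplus> (s \<ominus> u)" using assms by (simp add: a_minus_def E.a_lcomm[of u s] E.r_neg)
  then show thesis using that f by simp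
qed

text \<open>If \<open>u\<close> lifts the inverse character, \<open>s \<otimes> u\<close> is
  \<open>\<one> \<oplus> lam f\<close>, with inverse \<open>\<one> \<ominus> lam f\<close>. Since
  \<open>lam f\<close> equals \<open>s \<otimes> u \<ominus> \<one>\<close>, the inverse remains on
  the chart.\<close>

lemma Asub_unit:
  assumes \<sigma>: "\<sigma> \<in> \<Sigma>" and s: "s \<in> Asub \<sigma>" "\<pi> s = chi m" and m: "- m \<in> dual_monoid N \<sigma>"
  obtains s' where "s' \<in> Asub \<sigma>" "s \<otimes> s' = \<one>" "\<pi> s' = chi (- m)"
proof -
  obtain u where u: "u \<in> Asub \<sigma>" "\<pi> u = chi (- m)" using Asub_lift[OF \<sigma> chi_Rg[OF m]] by blast
  have c: "s \<in> carrier E" "u \<in> carrier E" using Asub_closed \<sigma> s u by auto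
  have "\<pi> (s \<otimes> u) = \<pi> \<one>"
    using c s u by (simp add: pi_mult pi_one chi_add[symmetric] chi_zero)
  then obtain f where f: "f \<in> Rg {0}" "s \<otimes> u = \<one> \<oplus> lam f"
    using ker_lam_diff[of "s \<otimes> u" "\<one>"] c by auto
  have lc: "lam f \<in> carrier E" using lam_closed f by auto
  have "lam f = s \<otimes> u \<ominus> \<one>" unfolding f(2) using lc
    by (simp add: a_minus_def E.a_assoc E.a_lcomm[of "\<one>" "lam f"] E.r_neg)
  also have "\<dots> \<in> Asub \<sigma>" using Asub_minus Asub_mult Asub_one \<sigma> s u by blast
  finally have lA: "lam f \<in> Asub \<sigma>" .
  define s' where "s' = u \<otimes> (\<one> \<ominus> lam f)"
  have "s' \<in> Asub \<sigma>" unfolding s'_def using Asub_minus Asub_mult Asub_one \<sigma> u lA by blast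
  moreover have "s \<otimes> s' = (\<one> \<oplus> lam f) \<otimes> (\<one> \<ominus> lam f)"
    unfolding s'_def f(2)[symmetric] using c lc by (simp add: E.m_assoc)
  then have "s \<otimes> s' = \<one>"
    using lc lam_lam[OF f(1) f(1)] by (simp add: a_minus_def E.l_distr E.r_distr E.r_minus E.a_assoc E.r_neg)
  moreover have "\<pi> s' = chi (- m)"
    unfolding s'_def using c lc u f by (simp add: pi_mult pi_minus pi_one pi_lam)
  ultimately show thesis by (rule that)
qed

section \<open>Multiplicative lifts on smooth charts and their differences\<close>

definition splits :: "'a set \<Rightarrow> ('a \<Rightarrow> 'e) \<Rightarrow> bool" where
  "splits \<sigma> s \<longleftrightarrow> (\<forall>m\<in>M. s m \<in> Units E \<and> \<pi> (s m) = chi m) \<and>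
     (\<forall>m\<in>M. \<forall>n\<in>M. s (m + n) = s m \<otimes> s n) \<and> (\<forall>m\<in>dual_monoid N \<sigma>. s m \<in> Asub \<sigma>)"

text \<open>Negative powers need an inverse of the lift. It is taken on the chart itself if
  \<open>- n\<close> belongs to the monoid, and otherwise only on the torus; one family
  \<open>P\<close> thus serves the dual basis vectors of both kinds in
  \<open>splits_exists\<close>.\<close>

lemma int_powers:
  assumes \<sigma>: "\<sigma> \<in> \<Sigma>" and n: "n \<in> dual_monoid N \<sigma>"
  shows "\<exists>P. (\<forall>k::int. P k \<in> Units E \<and> \<pi> (P k) = chi (real_of_int k *\<^sub>R n)) \<and>
    (\<forall>k l. P (k + l) = P k \<otimes> P l) \<and> (\<forall>k. k \<ge> 0 \<or> - n \<in> dual_monoid N \<sigma> \<longrightarrow> P k \<in> Asub \<sigma>)"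
proof -
  obtain y where y: "y \<in> Asub \<sigma>" "\<pi> y = chi n" using Asub_lift[OF \<sigma> chi_Rg[OF n]] by blast
  have nM: "- n \<in> dual_monoid N {0}"
    using n dual_monoid_M dual_lattice_uminus unfolding dual_monoid_origin by blast
  have yE: "y \<in> carrier E" using Asub_closed \<sigma> y by auto
  have y0: "y \<in> Asub {0}" using Asub_face[OF \<sigma> origin_mem origin_face[OF \<sigma>]] y by auto
  have "\<exists>y'. y' \<in> Asub {0} \<and> y \<otimes> y' = \<one> \<and> \<pi> y' = chi (- n) \<and> (- n \<in> dual_monoid N \<sigma> \<longrightarrow> y' \<in> Asub \<sigma>)"
  proof (cases "- n \<in> dual_monoid N \<sigma>")
    case True
    obtain y' where "y' \<in> Asub \<sigma>" "y \<otimes> y' = \<one>" "\<pi> y' = chi (- n)" using Asub_unit[OF \<sigma> y True] .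
    then show ?thesis using Asub_face[OF \<sigma> origin_mem origin_face[OF \<sigma>]] by blast
  next
    case False
    then show ?thesis using Asub_unit[OF origin_mem y0 y(2) nM] by metis
  qed
  then obtain y' where y': "y' \<in> Asub {0}" "y \<otimes> y' = \<one>" "\<pi> y' = chi (- n)"
    "- n \<in> dual_monoid N \<sigma> \<Longrightarrow> y' \<in> Asub \<sigma>" by blast
  have y'E: "y' \<in> carrier E" using Asub_closed[OF origin_mem y'(1)] .
  have yU: "y \<in> Units E" "y' \<in> Units E"
    using y'(2) yE y'E E.m_comm[OF yE y'E] unfolding Units_def by auto
  have inv: "inv\<^bsub>E\<^esub> y = y'" using y'(2) yE y'E E.m_comm[OF yE y'E] by (metis E.inv_unique' E.comm_inv_char)
  interpret U: comm_group "units_of E" by (rule E.units_comm_group)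
  have pw: "z [^]\<^bsub>units_of E\<^esub> (k::nat) \<in> Units E \<and> \<pi> (z [^]\<^bsub>units_of E\<^esub> k) = chi (of_nat k *\<^sub>R w) \<and>
      (z \<in> Asub \<sigma> \<longrightarrow> z [^]\<^bsub>units_of E\<^esub> k \<in> Asub \<sigma>)"
    if z: "z \<in> Units E" "\<pi> z = chi w" for z w k
  proof (induction k)
    case 0 show ?case by (simp add: units_of_one pi_one chi_zero Asub_one[OF \<sigma>])
  next
    case (Suc k)
    have "z [^]\<^bsub>units_of E\<^esub> Suc k = z [^]\<^bsub>units_of E\<^esub> k \<otimes> z" by (simp add: units_of_mult)
    then show ?case using Suc z Asub_mult[OF \<sigma>]
      by (simp add: pi_mult chi_add[symmetric] scaleR_left_distrib add.commute E.Units_closed)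
  qed
  define P where "P k = y [^]\<^bsub>units_of E\<^esub> (k::int)" for k
  have Pnat: "P k = y [^]\<^bsub>units_of E\<^esub> nat k" if "k \<ge> 0" for k
    unfolding P_def using that by (metis int_nat_eq int_pow_int)
  have Pneg: "P k = y' [^]\<^bsub>units_of E\<^esub> nat (- k)" if "k < 0" for k
  proof -
    have yu: "y \<in> carrier (units_of E)" using yU by (simp add: units_of_carrier)
    have "P k = inv\<^bsub>units_of E\<^esub> (y [^]\<^bsub>units_of E\<^esub> nat (- k))"
      unfolding P_def by (subst int_pow_def2, subst if_P[OF that], rule refl)
    also have "\<dots> = (inv\<^bsub>units_of E\<^esub> y) [^]\<^bsub>units_of E\<^esub> nat (- k)" using U.nat_pow_inv yu by simp
    also have "inv\<^bsub>units_of E\<^esub> y = y'" using E.units_of_inv[OF yU(1)] inv by simp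
    finally show ?thesis .
  qed
  show ?thesis
  proof (intro exI[of _ P] conjI allI impI)
    fix k l :: int
    show "P (k + l) = P k \<otimes> P l"
      unfolding P_def using U.int_pow_mult[of y k l] yU by (simp add: units_of_carrier units_of_mult)
    have "P k \<in> Units E \<and> \<pi> (P k) = chi (real_of_int k *\<^sub>R n) \<and> (k \<ge> 0 \<or> - n \<in> dual_monoid N \<sigma> \<longrightarrow> P k \<in> Asub \<sigma>)"
    proof (cases "k \<ge> 0")
      case True
      then have "chi (of_nat (nat k) *\<^sub>R n) = chi (real_of_int k *\<^sub>R n)" by simp
      then show ?thesis unfolding Pnat[OF True] using pw[OF yU(1) y(2), of "nat k"] y(1) by metis
    next
      case False
      then have k: "k < 0" by simp
      then have "chi (of_nat (nat (- k)) *\<^sub>R - n) = chi (real_of_int k *\<^sub>R n)" by simp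
      then show ?thesis unfolding Pneg[OF k] using pw[OF yU(2) y'(3), of "nat (- k)"] y'(4) False by metis
    qed
    then show "P k \<in> Units E" "\<pi> (P k) = chi (real_of_int k *\<^sub>R n)"
      "k \<ge> 0 \<or> - n \<in> dual_monoid N \<sigma> \<Longrightarrow> P k \<in> Asub \<sigma>" by blast+
  qed
qed

text \<open>For a smooth cone the characters are freely generated by the dual basis, so the lift of
  \<open>m\<close> is defined as the product over \<open>b\<close> of the powers with exponent
  \<open>m \<bullet> b\<close> of a lift of the character \<open>\<beta> b\<close>. The induction
  over \<open>C\<close> takes in one basis vector at a time.\<close>

lemma splits_exists:
  assumes \<sigma>: "\<sigma> \<in> S"
  shows "\<exists>s. splits \<sigma> s"
proof -
  have \<sigma>': "\<sigma> \<in> \<Sigma>" using \<sigma> S_sub by auto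
  obtain B where B: "lattice_basis N B" "Vs \<sigma> \<subseteq> B" using smooth_S[OF \<sigma>] by blast
  note sp = lattice_basis_span[OF B(1)]
  obtain \<beta> where \<beta>: "\<And>b. b \<in> B \<Longrightarrow> \<beta> b \<in> M"
    "\<And>b c. \<lbrakk>b \<in> B; c \<in> B\<rbrakk> \<Longrightarrow> \<beta> b \<bullet> c = (if b = c then 1 else 0)"
    "\<And>m. m \<in> span N \<Longrightarrow> m = (\<Sum>b\<in>B. (m \<bullet> b) *\<^sub>R \<beta> b)"
    "\<And>m. m \<in> span N \<Longrightarrow> m = (\<Sum>b\<in>B. (\<beta> b \<bullet> m) *\<^sub>R b)"
    by (rule lattice_dual_basis[OF B(1)]) (rule that)
  have S\<beta>: "\<beta> b \<in> dual_monoid N \<sigma>" if "b \<in> B" for b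
    using \<beta>(1,2)[OF that] B(2) by (auto simp: dual_monoid_Vs[OF \<sigma>'])
  have S\<beta>': "- \<beta> b \<in> dual_monoid N \<sigma>" if "b \<in> B" "b \<notin> Vs \<sigma>" for b
    using \<beta>(1,2)[OF that(1)] B(2) that dual_lattice_uminus[OF \<beta>(1)[OF that(1)]]
    by (auto simp: dual_monoid_Vs[OF \<sigma>'] subset_iff)
  have fl: "m \<bullet> b = real_of_int \<lfloor>m \<bullet> b\<rfloor>" if "m \<in> M" "b \<in> B" for m b
    using that sp(1) by (auto simp: dual_lattice_def)
  have "\<exists>s. (\<forall>m\<in>M. s m \<in> Units E \<and> \<pi> (s m) = chi (\<Sum>b\<in>C. (m \<bullet> b) *\<^sub>R \<beta> b)) \<and>
     (\<forall>m\<in>M. \<forall>n\<in>M. s (m + n) = s m \<otimes> s n) \<and> (\<forall>m\<in>dual_monoid N \<sigma>. s m \<in> Asub \<sigma>)"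
    if "finite C" "C \<subseteq> B" for C
    using that
  proof (induction C rule: finite_induct)
    case empty
    show ?case by (rule exI[of _ "\<lambda>_. \<one>"]) (auto simp: pi_one chi_zero Asub_one[OF \<sigma>'])
  next
    case (insert b C)
    then obtain s where s': "\<forall>m\<in>M. s m \<in> Units E \<and> \<pi> (s m) = chi (\<Sum>b\<in>C. (m \<bullet> b) *\<^sub>R \<beta> b)"
     "\<forall>m\<in>M. \<forall>n\<in>M. s (m + n) = s m \<otimes> s n" "\<forall>m\<in>dual_monoid N \<sigma>. s m \<in> Asub \<sigma>"
      by auto
    note s = bspec[OF s'(1)] bspec[OF bspec[OF s'(2)]] bspec[OF s'(3)]
    have b: "b \<in> B" using insert by auto
    obtain P where P: "\<And>k::int. P k \<in> Units E \<and> \<pi> (P k) = chi (real_of_int k *\<^sub>R \<beta> b)"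
      "\<And>k l. P (k + l) = P k \<otimes> P l" "\<And>k. k \<ge> 0 \<or> - \<beta> b \<in> dual_monoid N \<sigma> \<Longrightarrow> P k \<in> Asub \<sigma>"
      using int_powers[OF \<sigma>' S\<beta>[OF b]] by metis
    show ?case
    proof (intro exI[of _ "\<lambda>m. s m \<otimes> P \<lfloor>m \<bullet> b\<rfloor>"] conjI ballI)
      fix m assume m: "m \<in> M"
      show "s m \<otimes> P \<lfloor>m \<bullet> b\<rfloor> \<in> Units E" using s(1)[OF m] P(1) by auto
      show "\<pi> (s m \<otimes> P \<lfloor>m \<bullet> b\<rfloor>) = chi (\<Sum>b\<in>insert b C. (m \<bullet> b) *\<^sub>R \<beta> b)"
      proof -
        have "\<pi> (s m \<otimes> P \<lfloor>m \<bullet> b\<rfloor>) = chi (\<Sum>b\<in>C. (m \<bullet> b) *\<^sub>R \<beta> b) * chi (real_of_int \<lfloor>m \<bullet> b\<rfloor> *\<^sub>R \<beta> b)"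
          using s(1)[OF m] P(1) by (simp add: pi_mult E.Units_closed)
        also have "\<dots> = chi ((\<Sum>b\<in>C. (m \<bullet> b) *\<^sub>R \<beta> b) + (m \<bullet> b) *\<^sub>R \<beta> b)"
          unfolding fl[OF m b, symmetric] chi_add ..
        finally show ?thesis using insert.hyps by (simp add: add.commute)
      qed
      fix n assume n: "n \<in> M"
      have "real_of_int \<lfloor>(m + n) \<bullet> b\<rfloor> = real_of_int (\<lfloor>m \<bullet> b\<rfloor> + \<lfloor>n \<bullet> b\<rfloor>)"
        using fl[OF m b] fl[OF n b] fl[OF dual_lattice_add[OF m n] b] by (simp add: inner_add_left)
      then have "\<lfloor>(m + n) \<bullet> b\<rfloor> = \<lfloor>m \<bullet> b\<rfloor> + \<lfloor>n \<bullet> b\<rfloor>" by linarith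
      then show "s (m + n) \<otimes> P \<lfloor>(m + n) \<bullet> b\<rfloor> = s m \<otimes> P \<lfloor>m \<bullet> b\<rfloor> \<otimes> (s n \<otimes> P \<lfloor>n \<bullet> b\<rfloor>)"
        using s(1,2) m n P(1,2) by (simp add: E.m_ac E.Units_closed)
    next
      fix m assume m: "m \<in> dual_monoid N \<sigma>"
      \<comment> \<open>If \<open>b\<close> is a ray of \<open>\<sigma>\<close> the exponent is
        nonnegative; if not, \<open>\<beta> b\<close> is invertible on the chart. Either way the
        power stays regular.\<close>
      have "\<lfloor>m \<bullet> b\<rfloor> \<ge> 0 \<or> b \<notin> Vs \<sigma>" using m by (auto simp: dual_monoid_Vs[OF \<sigma>'])
      then have "P \<lfloor>m \<bullet> b\<rfloor> \<in> Asub \<sigma>" using P(3) S\<beta>'[OF b] by blast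
      then show "s m \<otimes> P \<lfloor>m \<bullet> b\<rfloor> \<in> Asub \<sigma>" using s(3)[OF m] Asub_mult[OF \<sigma>'] by blast
    qed
  qed
  from this[OF sp(4) order_refl] obtain s where
    s: "\<forall>m\<in>M. s m \<in> Units E \<and> \<pi> (s m) = chi (\<Sum>b\<in>B. (m \<bullet> b) *\<^sub>R \<beta> b)"
     "\<forall>m\<in>M. \<forall>n\<in>M. s (m + n) = s m \<otimes> s n" "\<forall>m\<in>dual_monoid N \<sigma>. s m \<in> Asub \<sigma>"
    by auto
  moreover have "(\<Sum>b\<in>B. (m \<bullet> b) *\<^sub>R \<beta> b) = m" if "m \<in> M" for m
    using \<beta>(3)[of m] that by (simp add: dual_lattice_def)
  ultimately show ?thesis unfolding splits_def by auto
qed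

definition sp :: "'a set \<Rightarrow> 'a \<Rightarrow> 'e" where "sp \<sigma> = (SOME s. splits \<sigma> s)"

lemma splits_sp: "\<sigma> \<in> S \<Longrightarrow> splits \<sigma> (sp \<sigma>)"
  unfolding sp_def using someI_ex[OF splits_exists] .

text \<open>The difference of two splittings divided by the character, hence a logarithmic
  derivative: it is additive in \<open>m\<close> (\<open>Dv_add\<close>), so each of its
  coefficients is the pairing of \<open>m\<close> with a fixed vector.\<close>

definition Dv :: "'a set \<Rightarrow> 'a \<Rightarrow> ('a \<Rightarrow>\<^sub>0 complex)" where
  "Dv \<sigma> m = (SOME f. f \<in> Rg {0} \<and> sp \<sigma> m = sp {0} m \<oplus> lam (chi m * f))"

lemma sp_closed: "\<lbrakk>\<sigma> \<in> S; m \<in> M\<rbrakk> \<Longrightarrow> sp \<sigma> m \<in> carrier E \<and> \<pi> (sp \<sigma> m) = chi m"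
  using splits_sp[of \<sigma>] by (auto simp: splits_def)

lemma Dv: "\<lbrakk>\<sigma> \<in> S; m \<in> M\<rbrakk> \<Longrightarrow> Dv \<sigma> m \<in> Rg {0} \<and> sp \<sigma> m = sp {0} m \<oplus> lam (chi m * Dv \<sigma> m)"
proof -
  assume *: "\<sigma> \<in> S" "m \<in> M"
  obtain g where g: "g \<in> Rg {0}" "sp \<sigma> m = sp {0} m \<oplus> lam g"
    using ker_lam_diff[of "sp \<sigma> m" "sp {0} m"] sp_closed[OF *] sp_closed[OF origin_S *(2)] by metis
  then have "chi (- m) * g \<in> Rg {0} \<and> sp \<sigma> m = sp {0} m \<oplus> lam (chi m * (chi (- m) * g))"
    using chi_Rg0[OF dual_lattice_uminus[OF *(2)]] by (simp add: chi_cancel' Rg.mult_mem)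
  then show ?thesis unfolding Dv_def by (rule someI)
qed

text \<open>The second-order term vanishes by \<open>lam_lam\<close>. With the character split off
  from each perturbation, the remaining factors add up, as logarithmic derivatives do.\<close>

lemma perturb_mult:
  assumes m: "m \<in> M" "n \<in> M" and f: "f \<in> Rg {0}" "g \<in> Rg {0}"
  shows "(sp {0} m \<oplus> lam (chi m * f)) \<otimes> (sp {0} n \<oplus> lam (chi n * g)) =
     sp {0} (m + n) \<oplus> lam (chi (m + n) * (f + g))"
proof -
  have s: "sp {0} (m + n) = sp {0} m \<otimes> sp {0} n"
    using splits_sp[OF origin_S] m by (auto simp: splits_def)
  note c = sp_closed[OF origin_S m(1)] sp_closed[OF origin_S m(2)]
  have cf: "chi m * f \<in> Rg {0}" "chi n * g \<in> Rg {0}" using chi_Rg0 m f Rg.mult_mem by auto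
  have l: "lam (chi m * f) \<in> carrier E" "lam (chi n * g) \<in> carrier E" using cf lam_closed by auto
  have 1: "sp {0} m \<otimes> lam (chi n * g) = lam (chi (m + n) * g)"
    using lam_smult[OF _ cf(2)] c by (simp add: chi_add mult.assoc)
  have 2: "lam (chi m * f) \<otimes> sp {0} n = lam (chi (m + n) * f)"
  proof -
    have "lam (chi m * f) \<otimes> sp {0} n = lam (chi n * (chi m * f))"
      using lam_smult[OF _ cf(1)] c l E.m_comm by metis
    also have "chi n * (chi m * f) = chi (m + n) * f" by (simp add: chi_add ac_simps)
    finally show ?thesis .
  qed
  have r: "chi (m + n) * f \<in> Rg {0}" "chi (m + n) * g \<in> Rg {0}"
    using chi_Rg0[OF dual_lattice_add[OF m]] f Rg.mult_mem by auto
  have lr: "lam (chi (m + n) * f) \<in> carrier E" "lam (chi (m + n) * g) \<in> carrier E" using r lam_closed by auto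
  have "(sp {0} m \<oplus> lam (chi m * f)) \<otimes> (sp {0} n \<oplus> lam (chi n * g)) =
      (sp {0} m \<otimes> sp {0} n \<oplus> lam (chi (m + n) * f)) \<oplus> lam (chi (m + n) * g)"
    using c l lr by (simp add: E.l_distr E.r_distr 1 2 lam_lam[OF cf] E.a_ac)
  also have "\<dots> = sp {0} (m + n) \<oplus> lam (chi (m + n) * (f + g))"
    using c lr by (simp add: s distrib_left lam_add[OF r] E.a_assoc)
  finally show ?thesis .
qed

lemma Dv_add:
  assumes \<sigma>: "\<sigma> \<in> S" and m: "m \<in> M" "n \<in> M"
  shows "Dv \<sigma> (m + n) = Dv \<sigma> m + Dv \<sigma> n"
proof -
  have mn: "m + n \<in> M" using m dual_lattice_add by auto
  note D = Dv[OF \<sigma> m(1)] Dv[OF \<sigma> m(2)] Dv[OF \<sigma> mn]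
  have "sp \<sigma> (m + n) = sp \<sigma> m \<otimes> sp \<sigma> n" using splits_sp[OF \<sigma>] m by (auto simp: splits_def)
  then have eq: "sp {0} (m + n) \<oplus> lam (chi (m + n) * Dv \<sigma> (m + n)) =
     sp {0} (m + n) \<oplus> lam (chi (m + n) * (Dv \<sigma> m + Dv \<sigma> n))"
    using D perturb_mult[OF m, of "Dv \<sigma> m" "Dv \<sigma> n"] by simp
  have r: "chi (m + n) * Dv \<sigma> (m + n) \<in> Rg {0}" "chi (m + n) * (Dv \<sigma> m + Dv \<sigma> n) \<in> Rg {0}"
    using chi_Rg0[OF mn] D Rg.mult_mem Rg.add_mem by auto
  have "lam (chi (m + n) * Dv \<sigma> (m + n)) = lam (chi (m + n) * (Dv \<sigma> m + Dv \<sigma> n))"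
    using eq lam_closed[OF r(1)] lam_closed[OF r(2)] sp_closed[OF origin_S mn]
      E.add.right_cancel[of "lam (chi (m + n) * Dv \<sigma> (m + n))" "lam (chi (m + n) * (Dv \<sigma> m + Dv \<sigma> n))" "sp {0} (m + n)"]
    by (simp add: E.a_comm[of "sp {0} (m + n)"])
  then have "chi (m + n) * Dv \<sigma> (m + n) = chi (m + n) * (Dv \<sigma> m + Dv \<sigma> n)" using lam_inj[OF r] by blast
  then show ?thesis by (metis chi_cancel)
qed

lemma chi_mult_mem_Rg:
  assumes f: "f \<in> Rg {0}" and m: "m \<in> M"
  shows "chi m * f \<in> Rg \<sigma> \<longleftrightarrow> (\<forall>q. lk f q \<noteq> 0 \<longrightarrow> m + q \<in> dual_monoid N \<sigma>)"
proof -
  have "chi m * f \<in> Rg \<sigma> \<longleftrightarrow> (\<forall>k. lk f (k - m) \<noteq> 0 \<longrightarrow> k \<in> dual_monoid N \<sigma>)"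
    by (auto simp: Rg_def monoid_algebra_def in_keys_iff lookup_chi_mult)
  also have "\<dots> \<longleftrightarrow> (\<forall>q. lk f q \<noteq> 0 \<longrightarrow> m + q \<in> dual_monoid N \<sigma>)"
    by (metis add_diff_cancel_left' add.commute diff_add_cancel)
  finally show ?thesis .
qed

lemma dual_monoid_ray: "v \<in> V \<Longrightarrow> dual_monoid N (ray v) = {m \<in> M. 0 \<le> m \<bullet> v}"
  using dual_monoid_Vs[of "ray v"] Vs_ray ray_S S_sub by auto

lemma Rg0_key: "\<lbrakk>f \<in> Rg {0}; lk f q \<noteq> 0\<rbrakk> \<Longrightarrow> q \<in> M"
  by (auto simp: Rg_def monoid_algebra_def in_keys_iff dual_monoid_origin)

text \<open>The lifts \<open>sp \<sigma> m\<close> and \<open>sp (ray v) m\<close> are both regular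
  on the chart of the ray, so their difference is; by \<open>Asub_lam\<close> its monomial in degree
  \<open>m + q\<close> must not have a pole along \<open>v\<close>.\<close>

lemma Dv_regular:
  assumes \<sigma>: "\<sigma> \<in> S" "v \<in> Vs \<sigma>" and m: "m \<in> dual_monoid N \<sigma>" and neg: "(m + q) \<bullet> v < 0"
  shows "lk (Dv \<sigma> m) q = lk (Dv (ray v) m) q"
proof (rule ccontr)
  assume ne: "lk (Dv \<sigma> m) q \<noteq> lk (Dv (ray v) m) q"
  have \<sigma>': "\<sigma> \<in> \<Sigma>" using \<sigma> S_sub by auto
  have v: "v \<in> V" using Vs_V \<sigma>' \<sigma> by auto
  have r: "ray v \<in> S" "ray v \<in> \<Sigma>" "ray v face_of \<sigma>" using ray_S v S_sub ray_face \<sigma>' \<sigma> by auto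
  have mM: "m \<in> M" using m dual_monoid_M by auto
  have mr: "m \<in> dual_monoid N (ray v)" using m dual_monoid_antimono[OF face_of_imp_subset[OF r(3)]] by auto
  have 1: "sp \<sigma> m \<in> Asub (ray v)" using splits_sp[OF \<sigma>(1)] m Asub_face[OF \<sigma>' r(2,3)] by (auto simp: splits_def)
  have 2: "sp (ray v) m \<in> Asub (ray v)" using splits_sp[OF r(1)] mr by (auto simp: splits_def)
  note D = Dv[OF \<sigma>(1) mM] Dv[OF r(1) mM]
  have c: "chi m * Dv \<sigma> m \<in> Rg {0}" "chi m * Dv (ray v) m \<in> Rg {0}" using D chi_Rg0[OF mM] Rg.mult_mem by auto
  have "lam (chi m * (Dv \<sigma> m - Dv (ray v) m)) = sp \<sigma> m \<ominus> sp (ray v) m"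
  proof -
    have s: "sp {0} m \<in> carrier E" using sp_closed[OF origin_S mM] by simp
    have "sp \<sigma> m \<ominus> sp (ray v) m =
      (sp {0} m \<oplus> lam (chi m * Dv \<sigma> m)) \<ominus> (sp {0} m \<oplus> lam (chi m * Dv (ray v) m))"
      using D by metis
    also have "\<dots> = lam (chi m * Dv \<sigma> m) \<ominus> lam (chi m * Dv (ray v) m)"
      using lam_closed[OF c(1)] lam_closed[OF c(2)] s
      by (simp add: a_minus_def E.minus_add E.a_ac E.r_neg1 E.r_neg2)
    finally show ?thesis using lam_diff[OF c] by (simp add: right_diff_distrib)
  qed
  also have "\<dots> \<in> Asub (ray v)" using 1 2 Asub_minus r by auto
  finally have "chi m * (Dv \<sigma> m - Dv (ray v) m) \<in> Rg (ray v)"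
    using Asub_lam[OF r(2)] c Rg.diff_mem by (simp add: right_diff_distrib)
  moreover have "Dv \<sigma> m - Dv (ray v) m \<in> Rg {0}" using D Rg.diff_mem by blast
  ultimately have "m + q \<in> dual_monoid N (ray v)"
    using chi_mult_mem_Rg[OF _ mM] ne by (auto simp: lookup_minus)
  then show False using neg dual_monoid_ray[OF v] by auto
qed

text \<open>Tested with the dual basis of a smooth cone: \<open>\<beta> b \<bullet> v\<close> is 1
  for \<open>b = v\<close> and 0 otherwise. For \<open>q \<bullet> v \<le> -2\<close> all
  \<open>\<beta> b\<close> satisfy the condition in \<open>reg\<close>, so all coordinates of
  \<open>d - a\<close> vanish; for \<open>q \<bullet> v = -1\<close> all but
  \<open>\<beta> v\<close> do, which leaves a multiple of \<open>v\<close>.\<close>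

lemma compat_of_regular:
  assumes \<sigma>: "\<sigma> \<in> S" "v \<in> Vs \<sigma>" and q: "q \<in> M" and \<delta>: "d \<in> span N" "a \<in> span N"
    and reg: "\<And>m. \<lbrakk>m \<in> dual_monoid N \<sigma>; (m + q) \<bullet> v < 0\<rbrakk> \<Longrightarrow> m \<bullet> d = m \<bullet> a"
  shows "compat q v d a"
proof -
  have \<sigma>': "\<sigma> \<in> \<Sigma>" using \<sigma> S_sub by auto
  obtain B where B: "lattice_basis N B" "Vs \<sigma> \<subseteq> B" using smooth_S[OF \<sigma>(1)] by blast
  note sp = lattice_basis_span[OF B(1)]
  obtain \<beta> where \<beta>: "\<And>b. b \<in> B \<Longrightarrow> \<beta> b \<in> M"
    "\<And>b c. \<lbrakk>b \<in> B; c \<in> B\<rbrakk> \<Longrightarrow> \<beta> b \<bullet> c = (if b = c then 1 else 0)"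
    "\<And>m. m \<in> span N \<Longrightarrow> m = (\<Sum>b\<in>B. (m \<bullet> b) *\<^sub>R \<beta> b)"
    "\<And>m. m \<in> span N \<Longrightarrow> m = (\<Sum>b\<in>B. (\<beta> b \<bullet> m) *\<^sub>R b)"
    by (rule lattice_dual_basis[OF B(1)]) (rule that)
  have S\<beta>: "\<beta> b \<in> dual_monoid N \<sigma>" if "b \<in> B" for b
    using \<beta>(1,2)[OF that] B(2) by (auto simp: dual_monoid_Vs[OF \<sigma>'])
  have vB: "v \<in> B" using \<sigma> B by auto
  have ex: "d - a = (\<Sum>b\<in>B. (\<beta> b \<bullet> (d - a)) *\<^sub>R b)" using \<beta>(4)[OF span_diff[OF \<delta>]] .
  show ?thesis
    unfolding compat_def
  proof (intro conjI impI)
    assume "q \<bullet> v \<le> - 2"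
    then have "\<beta> b \<bullet> (d - a) = 0" if "b \<in> B" for b
      using reg[OF S\<beta>[OF that]] \<beta>(2)[OF that vB] by (simp add: inner_add_left inner_diff_right split: if_splits)
    then have "d - a = 0" using ex by simp
    then show "d = a" by simp
  next
    assume "q \<bullet> v = - 1"
    then have "\<beta> b \<bullet> (d - a) = 0" if "b \<in> B" "b \<noteq> v" for b
      using reg[OF S\<beta>[OF that(1)]] \<beta>(2)[OF that(1) vB] that(2) by (simp add: inner_add_left inner_diff_right)
    then have "(\<Sum>b\<in>B. (\<beta> b \<bullet> (d - a)) *\<^sub>R b) = (\<Sum>b\<in>B. if b = v then (\<beta> v \<bullet> (d - a)) *\<^sub>R v else 0)"
      by (intro sum.cong) auto
    then show "\<exists>c. d - a = c *\<^sub>R v" using ex vB sp(4) by auto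
  qed
qed

text \<open>The condition \<open>extend_compat\<close> is applied degree by degree, to the real and
  the imaginary part of the coefficients separately, because the vectors of the fan are real. The
  result is one derivation that corrects the torus splitting along every ray.\<close>

lemma ex_derivation:
  obtains d where "\<And>m. m \<in> M \<Longrightarrow> d m \<in> Rg {0}" "\<And>m n. \<lbrakk>m \<in> M; n \<in> M\<rbrakk> \<Longrightarrow> d (m + n) = d m + d n"
    "\<And>v m. \<lbrakk>v \<in> V; m \<in> M; 0 \<le> m \<bullet> v\<rbrakk> \<Longrightarrow> chi m * (d m - Dv (ray v) m) \<in> Rg (ray v)"
proof -
  obtain B where B: "lattice_basis N B" using smooth_S[OF origin_S] by blast
  note bsp = lattice_basis_span[OF B]
  obtain \<beta> where \<beta>: "\<And>b. b \<in> B \<Longrightarrow> \<beta> b \<in> M" "\<And>m. m \<in> span N \<Longrightarrow> m = (\<Sum>b\<in>B. (m \<bullet> b) *\<^sub>R \<beta> b)"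
    using lattice_dual_basis[OF B] by metis
  define aR where "aR q \<sigma> = (\<Sum>b\<in>B. Re (lk (Dv \<sigma> (\<beta> b)) q) *\<^sub>R b)" for q \<sigma>
  define aI where "aI q \<sigma> = (\<Sum>b\<in>B. Im (lk (Dv \<sigma> (\<beta> b)) q) *\<^sub>R b)" for q \<sigma>
  have asp: "aR q \<sigma> \<in> span N" "aI q \<sigma> \<in> span N" for q \<sigma>
    unfolding aR_def aI_def bsp(2) by (intro span_sum span_scale span_base; assumption)+
  have a: "Re (lk (Dv \<sigma> m) q) = m \<bullet> aR q \<sigma>" "Im (lk (Dv \<sigma> m) q) = m \<bullet> aI q \<sigma>"
    if "\<sigma> \<in> S" "m \<in> M" for \<sigma> m q
    unfolding aR_def aI_def
    using additive_dual_lattice[of N "\<lambda>m. Re (lk (Dv \<sigma> m) q)", OF _ B \<beta> that(2)]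
      additive_dual_lattice[of N "\<lambda>m. Im (lk (Dv \<sigma> m) q)", OF _ B \<beta> that(2)] Dv_add[OF that(1)]
    by (simp_all add: lookup_add)
  have comp: "compat q v (aR q \<sigma>) (aR q (ray v)) \<and> compat q v (aI q \<sigma>) (aI q (ray v))"
    if \<sigma>: "\<sigma> \<in> S" "v \<in> Vs \<sigma>" and q: "q \<in> M" for \<sigma> v q
  proof -
    have v: "ray v \<in> S" using that Vs_V S_sub ray_S by blast
    have "m \<bullet> aR q \<sigma> = m \<bullet> aR q (ray v) \<and> m \<bullet> aI q \<sigma> = m \<bullet> aI q (ray v)"
      if m: "m \<in> dual_monoid N \<sigma>" "(m + q) \<bullet> v < 0" for m
      using Dv_regular[OF \<sigma> m] a[OF \<sigma>(1), of m q] a[OF v, of m q] m dual_monoid_M by (metis subsetD)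
    then show ?thesis using compat_of_regular[OF \<sigma> q] asp by blast
  qed
  \<comment> \<open>The degrees in which something has to be corrected. They occur among the
    finitely many keys of the values at a basis; elsewhere the zero vector is compatible, so
    \<open>D m\<close> below is a finite sum.\<close>
  define Q where "Q = {q \<in> M. \<exists>v\<in>V. aR q (ray v) \<noteq> 0 \<or> aI q (ray v) \<noteq> 0}"
  have "Q \<subseteq> (\<Union>v\<in>V. \<Union>b\<in>B. Poly_Mapping.keys (Dv (ray v) (\<beta> b)))"
  proof
    fix q assume "q \<in> Q"
    then obtain v where v: "v \<in> V" "aR q (ray v) \<noteq> 0 \<or> aI q (ray v) \<noteq> 0" by (auto simp: Q_def)
    have "\<exists>b\<in>B. lk (Dv (ray v) (\<beta> b)) q \<noteq> 0"
    proof (rule ccontr)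
      assume "\<not> ?thesis"
      then have "aR q (ray v) = 0" "aI q (ray v) = 0" by (simp_all add: aR_def aI_def)
      then show False using v by simp
    qed
    then show "q \<in> (\<Union>v\<in>V. \<Union>b\<in>B. Poly_Mapping.keys (Dv (ray v) (\<beta> b)))" using v by (auto simp: in_keys_iff)
  qed
  then have finQ: "finite Q" by (rule finite_subset) (use finite_V bsp(4) in auto)
  have "\<exists>dR dI. \<forall>v\<in>V. compat q v dR (aR q (ray v)) \<and> compat q v dI (aI q (ray v))" if "q \<in> M" for q
    using extend_compat[OF that, of "aR q"] extend_compat[OF that, of "aI q"] asp comp[OF _ _ that] by blast
  then obtain eR eI where e: "\<And>q v. \<lbrakk>q \<in> M; v \<in> V\<rbrakk> \<Longrightarrow> compat q v (eR q) (aR q (ray v)) \<and> compat q v (eI q) (aI q (ray v))"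
    by metis
  define dR where "dR q = (if q \<in> Q then eR q else 0)" for q
  define dI where "dI q = (if q \<in> Q then eI q else 0)" for q
  have d: "compat q v (dR q) (aR q (ray v)) \<and> compat q v (dI q) (aI q (ray v))" if "q \<in> M" "v \<in> V" for q v
  proof (cases "q \<in> Q")
    case True then show ?thesis using e that by (simp add: dR_def dI_def)
  next
    case False
    then have "aR q (ray v) = 0" "aI q (ray v) = 0" using that by (auto simp: Q_def)
    then show ?thesis using False by (auto simp: dR_def dI_def compat_def intro: exI[of _ 0])
  qed
  define D where "D m = (\<Sum>q\<in>Q. Poly_Mapping.single q (Complex (m \<bullet> dR q) (m \<bullet> dI q)))" for m
  have lkD: "lk (D m) q = Complex (m \<bullet> dR q) (m \<bullet> dI q)" for m q
  proof -
    have "lk (D m) q = (\<Sum>p\<in>Q. if p = q then Complex (m \<bullet> dR p) (m \<bullet> dI p) else 0)"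
      unfolding D_def lookup_sum by (intro sum.cong) (auto simp: lookup_single when_def)
    also have "\<dots> = Complex (m \<bullet> dR q) (m \<bullet> dI q)"
      using finQ by (simp add: dR_def dI_def complex_eq_iff)
    finally show ?thesis .
  qed
  show thesis
  proof (rule that)
    fix m assume m: "m \<in> M"
    show DR: "D m \<in> Rg {0}"
      unfolding D_def
    proof (rule Rg.sum_mem)
      fix q assume "q \<in> Q"
      then show "Poly_Mapping.single q (Complex (m \<bullet> dR q) (m \<bullet> dI q)) \<in> Rg {0}"
        by (auto simp: Rg_def monoid_algebra_def dual_monoid_origin Q_def)
    qed
    fix n assume "n \<in> M"
    show "D (m + n) = D m + D n"
      by (rule poly_mapping_eqI) (simp add: lkD lookup_add inner_add_left complex_eq_iff)
  next
    fix v m assume v: "v \<in> V" and m: "m \<in> M" "0 \<le> m \<bullet> v"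
    have DR: "D m \<in> Rg {0}"
      unfolding D_def
    proof (rule Rg.sum_mem)
      fix q assume "q \<in> Q"
      then show "Poly_Mapping.single q (Complex (m \<bullet> dR q) (m \<bullet> dI q)) \<in> Rg {0}"
        by (auto simp: Rg_def monoid_algebra_def dual_monoid_origin Q_def)
    qed
    have r: "ray v \<in> S" using ray_S v by auto
    have diff: "D m - Dv (ray v) m \<in> Rg {0}" using DR Dv[OF r m(1)] Rg.diff_mem by blast
    have "m + q \<in> dual_monoid N (ray v)" if nz: "lk (D m - Dv (ray v) m) q \<noteq> 0" for q
    proof (rule ccontr)
      have q: "q \<in> M" using Rg0_key[OF diff nz] .
      assume "m + q \<notin> dual_monoid N (ray v)"
      then have neg: "(m + q) \<bullet> v < 0"
        using dual_lattice_add[OF m(1) q] by (auto simp: dual_monoid_ray[OF v])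
      have int: "m \<bullet> v \<in> \<int>" "q \<bullet> v \<in> \<int>" using m q v V_N by (auto simp: dual_lattice_def)
      obtain i j where ij: "m \<bullet> v = real_of_int i" "q \<bullet> v = real_of_int j" using int by (auto elim!: Ints_cases)
      have "real_of_int i + real_of_int j < 0" "0 \<le> real_of_int i"
        using neg m(2) ij by (auto simp: inner_add_left)
      \<comment> \<open>Integrality turns a pole along \<open>v\<close> into one of the two cases of
        \<open>compat\<close>: in degree -1 it can occur only at \<open>m \<bullet> v = 0\<close>,
        where a multiple of \<open>v\<close> does not contribute.\<close>
      then have "j \<le> -2 \<or> j = -1 \<and> i = 0" by linarith
      then have "q \<bullet> v \<le> -2 \<or> q \<bullet> v = -1 \<and> m \<bullet> v = 0" using ij by auto
      then have "m \<bullet> dR q = m \<bullet> aR q (ray v) \<and> m \<bullet> dI q = m \<bullet> aI q (ray v)"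
      proof
        assume "q \<bullet> v \<le> -2"
        then show ?thesis using d[OF q v] by (simp add: compat_def)
      next
        assume *: "q \<bullet> v = -1 \<and> m \<bullet> v = 0"
        then obtain c c' where "dR q - aR q (ray v) = c *\<^sub>R v" "dI q - aI q (ray v) = c' *\<^sub>R v"
          using d[OF q v] by (auto simp: compat_def)
        then have "m \<bullet> (dR q - aR q (ray v)) = 0" "m \<bullet> (dI q - aI q (ray v)) = 0" using * by simp_all
        then show ?thesis by (simp add: inner_diff_right)
      qed
      then show False using nz a[OF r m(1), of q] by (simp add: lookup_minus lkD complex_eq_iff)
    qed
    then show "chi m * (D m - Dv (ray v) m) \<in> Rg (ray v)" using chi_mult_mem_Rg[OF diff m(1)] by blast
  qed
qed

text \<open>The torus splitting is corrected by the derivation \<open>d\<close>. Along a ray it then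
  differs from the splitting of that ray by a regular term, and regularity along the rays carries
  over to all charts, including those of cones that are not simplicial.\<close>

lemma ex_global_splitting:
  obtains s where "\<And>m. m \<in> M \<Longrightarrow> s m \<in> carrier E \<and> \<pi> (s m) = chi m" "s 0 = \<one>"
    "\<And>m n. \<lbrakk>m \<in> M; n \<in> M\<rbrakk> \<Longrightarrow> s (m + n) = s m \<otimes> s n"
    "\<And>\<sigma> m. \<lbrakk>\<sigma> \<in> \<Sigma>; m \<in> dual_monoid N \<sigma>\<rbrakk> \<Longrightarrow> s m \<in> Asub \<sigma>"
proof -
  obtain d where d: "\<And>m. m \<in> M \<Longrightarrow> d m \<in> Rg {0}" "\<And>m n. \<lbrakk>m \<in> M; n \<in> M\<rbrakk> \<Longrightarrow> d (m + n) = d m + d n"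
    "\<And>v m. \<lbrakk>v \<in> V; m \<in> M; 0 \<le> m \<bullet> v\<rbrakk> \<Longrightarrow> chi m * (d m - Dv (ray v) m) \<in> Rg (ray v)"
    using ex_derivation by metis
  define s where "s m = sp {0} m \<oplus> lam (chi m * d m)" for m
  have cd: "chi m * d m \<in> Rg {0}" if "m \<in> M" for m using d(1) chi_Rg0 that Rg.mult_mem by blast
  have s1: "s m \<in> carrier E" "\<pi> (s m) = chi m" if "m \<in> M" for m
    using sp_closed[OF origin_S that] lam_closed[OF cd[OF that]] pi_lam[OF cd[OF that]]
    by (simp_all add: s_def pi_add)
  have s2: "s (m + n) = s m \<otimes> s n" if "m \<in> M" "n \<in> M" for m n
    unfolding s_def using perturb_mult[OF that d(1)[OF that(1)] d(1)[OF that(2)]] d(2)[OF that] by simp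
  have s3: "s m \<in> Asub (ray v)" if v: "v \<in> V" and m: "m \<in> M" "0 \<le> m \<bullet> v" for v m
  proof -
    have r: "ray v \<in> S" "ray v \<in> \<Sigma>" using ray_S v S_sub by auto
    note D = Dv[OF r(1) m(1)]
    have mr: "m \<in> dual_monoid N (ray v)" using m dual_monoid_ray[OF v] by auto
    have cD: "chi m * Dv (ray v) m \<in> Rg {0}" using D chi_Rg0[OF m(1)] Rg.mult_mem by auto
    have df: "chi m * (d m - Dv (ray v) m) \<in> Rg {0}" using d(3)[OF v m] Rg_sub0[OF r(2)] by auto
    have "sp (ray v) m \<oplus> lam (chi m * (d m - Dv (ray v) m)) =
      sp {0} m \<oplus> (lam (chi m * Dv (ray v) m) \<oplus> lam (chi m * (d m - Dv (ray v) m)))"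
      using D sp_closed[OF origin_S m(1)] lam_closed[OF cD] lam_closed[OF df] by (metis E.a_assoc)
    also have "\<dots> = s m" unfolding lam_add[OF cD df, symmetric] s_def by (simp add: algebra_simps)
    finally have "s m = sp (ray v) m \<oplus> lam (chi m * (d m - Dv (ray v) m))" by simp
    moreover have "sp (ray v) m \<in> Asub (ray v)" using splits_sp[OF r(1)] mr by (auto simp: splits_def)
    ultimately show ?thesis using Asub_add[OF r(2)] Asub_lam[OF r(2) df] d(3)[OF v m] by simp
  qed
  \<comment> \<open>On the chart some lift \<open>z\<close> of the character exists, multiplicative
    or not. It differs from \<open>s m\<close> by \<open>lam g\<close> with \<open>g\<close> regular
    along every ray of \<open>\<sigma>\<close>, hence in the chart ring, as the dual monoid is cut
    out by the rays.\<close>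
  have s4: "s m \<in> Asub \<sigma>" if \<sigma>: "\<sigma> \<in> \<Sigma>" and m: "m \<in> dual_monoid N \<sigma>" for \<sigma> m
  proof -
    have mM: "m \<in> M" using m dual_monoid_M by auto
    obtain z where z: "z \<in> Asub \<sigma>" "\<pi> z = chi m" using Asub_lift[OF \<sigma> chi_Rg[OF m]] by blast
    have zE: "z \<in> carrier E" using Asub_closed \<sigma> z by auto
    obtain g where g: "g \<in> Rg {0}" "z = s m \<oplus> lam g"
      using ker_lam_diff[OF zE s1(1)[OF mM]] z(2) s1(2)[OF mM] by auto
    have lg: "lam g \<in> carrier E" using lam_closed g by auto
    have gray: "g \<in> Rg (ray v)" if v: "v \<in> Vs \<sigma>" for v
    proof -
      have vV: "v \<in> V" and r: "ray v \<in> \<Sigma>" "ray v face_of \<sigma>"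
        using v Vs_V \<sigma> ray_S S_sub ray_face by blast+
      have "0 \<le> m \<bullet> v" using m v by (auto simp: dual_monoid_Vs[OF \<sigma>])
      then have "s m \<in> Asub (ray v)" "z \<in> Asub (ray v)" using s3[OF vV mM] Asub_face[OF \<sigma> r] z by auto
      then have "z \<ominus> s m \<in> Asub (ray v)" using Asub_minus r by auto
      moreover have "z \<ominus> s m = lam g"
        unfolding g(2) using lg s1(1)[OF mM] by (simp add: a_minus_def E.a_ac E.r_neg1 E.r_neg2 E.r_neg)
      ultimately show ?thesis using Asub_lam[OF r(1) g(1)] by simp
    qed
    have "k \<in> dual_monoid N \<sigma>" if "lk g k \<noteq> 0" for k
    proof -
      have "0 \<le> k \<bullet> v" if v: "v \<in> Vs \<sigma>" for v
      proof -
        have "k \<in> dual_monoid N (ray v)"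
          using gray[OF v] \<open>lk g k \<noteq> 0\<close> by (auto simp: Rg_def monoid_algebra_def in_keys_iff)
        then show ?thesis using dual_monoid_ray Vs_V[OF \<sigma>] v by auto
      qed
      then show ?thesis using Rg0_key[OF g(1) that] by (auto simp: dual_monoid_Vs[OF \<sigma>])
    qed
    then have "g \<in> Rg \<sigma>" by (auto simp: Rg_def monoid_algebra_def in_keys_iff)
    then have "lam g \<in> Asub \<sigma>" using Asub_lam[OF \<sigma> g(1)] by simp
    then have "z \<ominus> lam g \<in> Asub \<sigma>" using Asub_minus \<sigma> z by blast
    moreover have "z \<ominus> lam g = s m"
      unfolding g(2) using lg s1(1)[OF mM] by (simp add: a_minus_def E.a_assoc E.r_neg)
    ultimately show ?thesis by simp
  qed
  have "s 0 = \<one>"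
  proof -
    have d0: "d 0 = 0" using d(2)[OF dual_lattice_zero dual_lattice_zero] by simp
    have u: "sp {0} 0 \<in> Units E" using splits_sp[OF origin_S] dual_lattice_zero[of N] by (simp add: splits_def)
    have "sp {0} (0 + 0) = sp {0} 0 \<otimes> sp {0} 0"
      using splits_sp[OF origin_S] dual_lattice_zero[of N] unfolding splits_def by blast
    then have "sp {0} 0 \<otimes> sp {0} 0 = sp {0} 0 \<otimes> \<one>" using u E.Units_closed by simp
    then have "sp {0} 0 = \<one>" using u E.Units_l_cancel E.Units_closed E.one_closed by blast
    then show ?thesis by (simp add: s_def d0 lam_zero)
  qed
  then show thesis using that[of s] s1 s2 s4 by blast
qed

text \<open>The characters form a basis of the Laurent ring over the constants, so \<open>s\<close>
  extends linearly by means of \<open>\<kappa>\<close>, and multiplicativity has to be checked on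
  monomials only.\<close>

theorem ex_ring_splitting:
  obtains \<psi> where "\<psi> \<in> ring_hom (subring_of_type (Rg {0})) E" "\<And>f. f \<in> Rg {0} \<Longrightarrow> \<pi> (\<psi> f) = f"
    "\<And>\<sigma> f. \<lbrakk>\<sigma> \<in> \<Sigma>; f \<in> Rg \<sigma>\<rbrakk> \<Longrightarrow> \<psi> f \<in> Asub \<sigma>" "\<And>c. \<psi> (Poly_Mapping.single 0 c) = \<kappa> c"
proof -
  obtain s where s1: "\<And>m. m \<in> M \<Longrightarrow> s m \<in> carrier E \<and> \<pi> (s m) = chi m" and s0: "s 0 = \<one>"
    and s2: "\<And>m n. \<lbrakk>m \<in> M; n \<in> M\<rbrakk> \<Longrightarrow> s (m + n) = s m \<otimes> s n"
    and s3: "\<And>\<sigma> m. \<lbrakk>\<sigma> \<in> \<Sigma>; m \<in> dual_monoid N \<sigma>\<rbrakk> \<Longrightarrow> s m \<in> Asub \<sigma>"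
    using ex_global_splitting by metis
  have \<kappa>c: "\<kappa> c \<in> carrier E" for c using \<kappa>_Asub[OF origin_mem] Asub_closed[OF origin_mem] by blast
  have \<kappa>0: "\<kappa> 0 = \<zero>"
  proof -
    have "\<kappa> 0 \<oplus> \<kappa> 0 = \<kappa> 0" using \<kappa>_add[of 0 0] by simp
    then show ?thesis using \<kappa>c[of 0] by (metis E.add.r_cancel_one)
  qed
  define \<psi> where "\<psi> f = (\<Oplus>m\<in>Poly_Mapping.keys f. \<kappa> (lk f m) \<otimes> s m)" for f
  have keyM: "m \<in> M" if "f \<in> Rg {0}" "m \<in> Poly_Mapping.keys f" for f m
    using Rg0_key[OF that(1)] that(2) by (simp add: in_keys_iff)
  have \<psi>_sup: "\<psi> f = (\<Oplus>m\<in>K. \<kappa> (lk f m) \<otimes> s m)"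
    if f: "f \<in> Rg {0}" "finite K" "Poly_Mapping.keys f \<subseteq> K" "K \<subseteq> M" for f K
    unfolding \<psi>_def
  proof (rule E.add.finprod_mono_neutral_cong_left)
    show "\<And>m. m \<in> K - Poly_Mapping.keys f \<Longrightarrow> \<kappa> (lk f m) \<otimes> s m = \<zero>"
      using f(4) s1 by (auto simp: in_keys_iff \<kappa>0)
  qed (use f s1 \<kappa>c in auto)
  have term_closed: "\<kappa> c \<otimes> s m \<in> carrier E" if "m \<in> M" for c m using s1[OF that] \<kappa>c by simp
  have \<psi>_closed: "\<psi> f \<in> carrier E" if "f \<in> Rg {0}" for f
    unfolding \<psi>_def using keyM[OF that] term_closed by (intro E.finsum_closed) auto
  have \<psi>_add: "\<psi> (f + g) = \<psi> f \<oplus> \<psi> g" if fg: "f \<in> Rg {0}" "g \<in> Rg {0}" for f g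
  proof -
    let ?K = "Poly_Mapping.keys f \<union> Poly_Mapping.keys g"
    have K: "finite ?K" "?K \<subseteq> M" using keyM fg by auto
    have "\<psi> (f + g) = (\<Oplus>m\<in>?K. \<kappa> (lk (f + g) m) \<otimes> s m)"
      using K Rg.add_mem[OF fg] keys_add[of f g] by (intro \<psi>_sup) auto
    also have "\<dots> = (\<Oplus>m\<in>?K. \<kappa> (lk f m) \<otimes> s m \<oplus> \<kappa> (lk g m) \<otimes> s m)"
      using K s1 \<kappa>c by (intro E.finsum_cong') (auto simp: lookup_add \<kappa>_add E.l_distr subset_iff)
    also have "\<dots> = (\<Oplus>m\<in>?K. \<kappa> (lk f m) \<otimes> s m) \<oplus> (\<Oplus>m\<in>?K. \<kappa> (lk g m) \<otimes> s m)"
      using K term_closed by (intro E.finsum_addf) auto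
    also have "\<dots> = \<psi> f \<oplus> \<psi> g"
      using \<psi>_sup[OF fg(1) K(1) _ K(2)] \<psi>_sup[OF fg(2) K(1) _ K(2)] by simp
    finally show ?thesis .
  qed
  have single_Rg: "Poly_Mapping.single m c \<in> Rg {0}" if "m \<in> M" for m c
    using that by (auto simp: Rg_def monoid_algebra_def dual_monoid_origin)
  have \<psi>_single: "\<psi> (Poly_Mapping.single m c) = \<kappa> c \<otimes> s m" if "m \<in> M" for m c
    using \<psi>_sup[OF single_Rg[OF that], of "{m}" c] that s1[OF that] \<kappa>c by (auto simp: lookup_single)
  have Rg_induct: "P f" if f: "f \<in> Rg {0}" and P: "\<And>m c. m \<in> M \<Longrightarrow> P (Poly_Mapping.single m c)"
    "\<And>f g. \<lbrakk>f \<in> Rg {0}; g \<in> Rg {0}; P f; P g\<rbrakk> \<Longrightarrow> P (f + g)" for P f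
  proof -
    have ind: "P (\<Sum>m\<in>K. Poly_Mapping.single m (lk f m)) \<and> (\<Sum>m\<in>K. Poly_Mapping.single m (lk f m)) \<in> Rg {0}"
      if "finite K" "K \<subseteq> M" for K
      using that
    proof (induction K rule: finite_induct)
      case empty
      show ?case using P(1)[OF dual_lattice_zero, of 0] Rg.zero_mem by simp
    next
      case (insert m K)
      then show ?case using P single_Rg Rg.add_mem by auto
    qed
    have "P (\<Sum>m\<in>Poly_Mapping.keys f. Poly_Mapping.single m (lk f m))"
      using ind[OF finite_keys] keyM[OF f] by blast
    moreover have "(\<Sum>m\<in>Poly_Mapping.keys f. Poly_Mapping.single m (lk f m)) = f"
    proof (rule poly_mapping_eqI)
      fix k
      have "lk (\<Sum>m\<in>Poly_Mapping.keys f. Poly_Mapping.single m (lk f m)) k =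
          (\<Sum>m\<in>Poly_Mapping.keys f. if m = k then lk f m else 0)"
        unfolding lookup_sum by (intro sum.cong) (auto simp: lookup_single when_def)
      then show "lk (\<Sum>m\<in>Poly_Mapping.keys f. Poly_Mapping.single m (lk f m)) k = lk f k"
        by (simp add: in_keys_iff)
    qed
    ultimately show ?thesis by simp
  qed
  have \<psi>_mult: "\<psi> (f * g) = \<psi> f \<otimes> \<psi> g" if fg: "f \<in> Rg {0}" "g \<in> Rg {0}" for f g
  proof (rule Rg_induct[OF fg(1), of "\<lambda>f. \<psi> (f * g) = \<psi> f \<otimes> \<psi> g"])
    fix m c assume m: "m \<in> M"
    show "\<psi> (Poly_Mapping.single m c * g) = \<psi> (Poly_Mapping.single m c) \<otimes> \<psi> g"
    proof (rule Rg_induct[OF fg(2), of "\<lambda>g. \<psi> (Poly_Mapping.single m c * g) = \<psi> (Poly_Mapping.single m c) \<otimes> \<psi> g"])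
      fix n e assume n: "n \<in> M"
      have "\<psi> (Poly_Mapping.single m c * Poly_Mapping.single n e) = \<kappa> (c * e) \<otimes> s (m + n)"
        unfolding mult_single by (rule \<psi>_single[OF dual_lattice_add[OF m n]])
      also have "\<dots> = (\<kappa> c \<otimes> s m) \<otimes> (\<kappa> e \<otimes> s n)"
        using s1 s2 m n \<kappa>c by (simp add: \<kappa>_mult E.m_ac)
      finally show "\<psi> (Poly_Mapping.single m c * Poly_Mapping.single n e) = \<psi> (Poly_Mapping.single m c) \<otimes> \<psi> (Poly_Mapping.single n e)"
        by (simp add: \<psi>_single m n)
    next
      fix g h assume "g \<in> Rg {0}" "h \<in> Rg {0}" "\<psi> (Poly_Mapping.single m c * g) = \<psi> (Poly_Mapping.single m c) \<otimes> \<psi> g"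
        "\<psi> (Poly_Mapping.single m c * h) = \<psi> (Poly_Mapping.single m c) \<otimes> \<psi> h"
      then show "\<psi> (Poly_Mapping.single m c * (g + h)) = \<psi> (Poly_Mapping.single m c) \<otimes> \<psi> (g + h)"
        using single_Rg[OF m] \<psi>_closed Rg.mult_mem by (simp add: distrib_left \<psi>_add E.r_distr)
    qed
  next
    fix f h assume "f \<in> Rg {0}" "h \<in> Rg {0}" "\<psi> (f * g) = \<psi> f \<otimes> \<psi> g" "\<psi> (h * g) = \<psi> h \<otimes> \<psi> g"
    then show "\<psi> ((f + h) * g) = \<psi> (f + h) \<otimes> \<psi> g"
      using fg(2) \<psi>_closed Rg.mult_mem by (simp add: distrib_right \<psi>_add E.l_distr)
  qed
  have \<psi>_const: "\<psi> (Poly_Mapping.single 0 c) = \<kappa> c" for c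
    using \<psi>_single[OF dual_lattice_zero] s0 \<kappa>c by simp
  have "\<psi> \<in> ring_hom (subring_of_type (Rg {0})) E"
  proof (rule ring_hom_memI)
    show "\<psi> \<one>\<^bsub>subring_of_type (Rg {0})\<^esub> = \<one>" using \<psi>_const[of 1] \<kappa>_one by simp
  qed (auto simp: \<psi>_closed \<psi>_mult \<psi>_add)
  moreover have "\<pi> (\<psi> f) = f" if "f \<in> Rg {0}" for f
  proof (rule Rg_induct[OF that, of "\<lambda>f. \<pi> (\<psi> f) = f"])
    fix m c assume "m \<in> M"
    then show "\<pi> (\<psi> (Poly_Mapping.single m c)) = Poly_Mapping.single m c"
      using s1 \<kappa>c by (simp add: \<psi>_single pi_mult pi_\<kappa> chi_def mult_single)
  qed (simp add: \<psi>_add pi_add \<psi>_closed)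
  moreover have "\<psi> f \<in> Asub \<sigma>" if \<sigma>: "\<sigma> \<in> \<Sigma>" and f: "f \<in> Rg \<sigma>" for \<sigma> f
  proof -
    have k: "m \<in> dual_monoid N \<sigma>" if "m \<in> Poly_Mapping.keys f" for m
      using f that by (auto simp: Rg_def monoid_algebra_def)
    have fin: "(\<Oplus>m\<in>K. \<kappa> (lk f m) \<otimes> s m) \<in> Asub \<sigma>" if "finite K" "K \<subseteq> dual_monoid N \<sigma>" for K
      using that
    proof (induction K rule: finite_induct)
      case (insert m K)
      have KM: "insert m K \<subseteq> M" using insert.prems dual_monoid_M by blast
      have "(\<Oplus>m\<in>insert m K. \<kappa> (lk f m) \<otimes> s m) =
         \<kappa> (lk f m) \<otimes> s m \<oplus> (\<Oplus>m\<in>K. \<kappa> (lk f m) \<otimes> s m)"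
        using term_closed KM insert.hyps by (intro E.finsum_insert) auto
      then show ?case using insert Asub_add[OF \<sigma>] Asub_mult[OF \<sigma> \<kappa>_Asub[OF \<sigma>] s3[OF \<sigma>]] by simp
    qed (simp add: Asub_zero \<sigma>)
    show ?thesis unfolding \<psi>_def by (rule fin) (use k in auto)
  qed
  ultimately show thesis using that \<psi>_const by blast
qed

end

section \<open>Triviality of deformations\<close>

text \<open>\<open>\<kappa>0\<close> gives the constants on \<open>Y\<close>. A splitting has to
  respect them in order to be an isomorphism over the dual numbers and not merely one of ringed
  spaces.\<close>

locale rigid_thickening = rigid_fan N \<Sigma> V Vs S + toric_thickening N \<Sigma> Y pi t
  for N :: "'a::euclidean_space set" and \<Sigma> V Vs S and Y :: "(_, 't, 'y) rspace_scheme" and pi t +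
  fixes \<kappa>0 :: "complex \<Rightarrow> 't"
  assumes \<kappa>0_closed: "\<kappa>0 c \<in> carrier (sec Y (carr (toric_variety N \<Sigma>)))"
    and \<kappa>0_add: "\<kappa>0 (c + d) = \<kappa>0 c \<oplus>\<^bsub>sec Y (carr (toric_variety N \<Sigma>))\<^esub> \<kappa>0 d"
    and \<kappa>0_mult: "\<kappa>0 (c * d) = \<kappa>0 c \<otimes>\<^bsub>sec Y (carr (toric_variety N \<Sigma>))\<^esub> \<kappa>0 d"
    and \<kappa>0_one: "\<kappa>0 1 = \<one>\<^bsub>sec Y (carr (toric_variety N \<Sigma>))\<^esub>"
    and pi_\<kappa>0: "pi (carr (toric_variety N \<Sigma>)) (\<kappa>0 c) = str (toric_variety N \<Sigma>) c"
begin

section \<open>Restriction of the thickening to the torus\<close>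

definition torus where "torus = Dop {0} 1"
definition proj :: "'t \<Rightarrow> ('a \<Rightarrow>\<^sub>0 complex)" where
  "proj s = (THE f. f \<in> Rg {0} \<and> pi torus s = sect torus f 1)"
definition lamT :: "('a \<Rightarrow>\<^sub>0 complex) \<Rightarrow> 't" where "lamT f = T.lam torus (sect torus f 1)"
definition subA :: "'a set \<Rightarrow> 't set" where "subA \<sigma> = res Y (Dop \<sigma> 1) torus ` A (Dop \<sigma> 1)"
definition \<kappa>T :: "complex \<Rightarrow> 't" where "\<kappa>T c = res Y (carr X) torus (\<kappa>0 c)"

lemma opn_torus: "opn torus" unfolding torus_def by (rule opn_chart[OF origin_mem])
lemma torus_ne: "torus \<noteq> {}" unfolding torus_def using eta_mem_Dop[OF origin_mem, of 1] by auto
lemma torus_sub: "\<sigma> \<in> \<Sigma> \<Longrightarrow> torus \<subseteq> Dop \<sigma> 1"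
  unfolding torus_def by (rule Dop_face[OF _ origin_mem origin_face])

lemma chart_section:
  assumes \<sigma>: "\<sigma> \<in> \<Sigma>" and b: "b \<in> carrier (sec X (Dop \<sigma> 1))"
  obtains r where "r \<in> Rg \<sigma>" "b = sect (Dop \<sigma> 1) r 1"
proof -
  obtain f g where fg: "regular (Dop \<sigma> 1) f g" "b = sect (Dop \<sigma> 1) f g" using sectionE[OF opn_chart[OF \<sigma>] b] .
  obtain n r where r: "r \<in> Rg \<sigma>" "f * 1 ^ n = r * g" using regular_Dop_cases[OF \<sigma> Rg.one_mem fg(1)] .
  have "b = sect (Dop \<sigma> 1) r 1" unfolding fg(2) using r fg(1) by (intro sect_cong) (auto simp: regular_def)
  then show thesis using that r by blast
qed

lemma regular_sub_chart: "\<lbrakk>\<sigma> \<in> \<Sigma>; r \<in> Rg \<sigma>; W \<subseteq> Dop \<sigma> 1\<rbrakk> \<Longrightarrow> regular W r 1"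
  by (rule regular_subset[OF regular_chart])

lemma sect_inj1:
  assumes "opn W" "W \<noteq> {}" "regular W f 1" "regular W g 1" "sect W f 1 = sect W g 1"
  shows "f = g"
  using sect_eq_iff[OF assms(1-4)] assms(5) by simp

lemma proj_eqI: "\<lbrakk>f \<in> Rg {0}; pi torus s = sect torus f 1\<rbrakk> \<Longrightarrow> proj s = f"
  unfolding proj_def
  using sect_inj1[OF opn_torus torus_ne regular_sub_chart[OF origin_mem] regular_sub_chart[OF origin_mem]]
  by (intro the_equality) (auto simp: torus_def)

lemma proj: assumes "s \<in> A torus" shows "proj s \<in> Rg {0} \<and> pi torus s = sect torus (proj s) 1"
proof -
  obtain r where "r \<in> Rg {0}" "pi torus s = sect torus r 1"
    using chart_section[OF origin_mem] T.pi_closed[OF opn_torus assms] unfolding torus_def by blast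
  then show ?thesis using proj_eqI by metis
qed

lemma regT: "f \<in> Rg {0} \<Longrightarrow> regular torus f 1"
  by (rule regular_sub_chart[OF origin_mem]) (auto simp: torus_def)

lemma secT: "f \<in> Rg {0} \<Longrightarrow> sect torus f 1 \<in> carrier (sec X torus)"
  by (rule sect_section[OF opn_torus regT])

lemma sectT_mult: "\<lbrakk>f \<in> Rg {0}; g \<in> Rg {0}\<rbrakk> \<Longrightarrow> sect torus f 1 \<otimes>\<^bsub>sec X torus\<^esub> sect torus g 1 = sect torus (f * g) 1"
  using sect_mult[OF regT regT] by simp

lemma sectT_add: "\<lbrakk>f \<in> Rg {0}; g \<in> Rg {0}\<rbrakk> \<Longrightarrow> sect torus f 1 \<oplus>\<^bsub>sec X torus\<^esub> sect torus g 1 = sect torus (f + g) 1"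
  using sect_add[OF regT regT] by simp

lemma res_torus: "\<lbrakk>\<sigma> \<in> \<Sigma>; u \<in> A (Dop \<sigma> 1)\<rbrakk> \<Longrightarrow> res Y (Dop \<sigma> 1) torus u \<in> A torus"
  by (rule T.YresC[OF opn_chart opn_torus torus_sub])

lemma proj_res:
  assumes \<sigma>: "\<sigma> \<in> \<Sigma>" and u: "u \<in> A (Dop \<sigma> 1)" and r: "r \<in> Rg \<sigma>" "pi (Dop \<sigma> 1) u = sect (Dop \<sigma> 1) r 1"
  shows "proj (res Y (Dop \<sigma> 1) torus u) = r"
proof (rule proj_eqI)
  show "r \<in> Rg {0}" using r Rg_antimono face_of_imp_subset origin_face[OF \<sigma>] by blast
  show "pi torus (res Y (Dop \<sigma> 1) torus u) = sect torus r 1"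
    unfolding T.pi_res[OF opn_chart[OF \<sigma>] opn_torus torus_sub[OF \<sigma>] u] r(2) by (rule res_X[OF torus_sub[OF \<sigma>]])
qed

text \<open>If \<open>lamT f\<close> extends to the chart, the image of the extension in
  \<open>X\<close> vanishes on the torus and hence on the chart. The extension therefore lies in the
  ideal and is \<open>lam\<close> of a regular function, which restricts to
  \<open>f\<close>.\<close>

lemma lamT_mem_iff:
  assumes \<sigma>: "\<sigma> \<in> \<Sigma>" and f: "f \<in> Rg {0}"
  shows "lamT f \<in> subA \<sigma> \<longleftrightarrow> f \<in> Rg \<sigma>"
proof
  let ?U = "Dop \<sigma> 1"
  note U = opn_chart[OF \<sigma>] and TU = torus_sub[OF \<sigma>]
  {
    assume "f \<in> Rg \<sigma>"
    then have s: "sect ?U f 1 \<in> carrier (sec X ?U)" by (intro sect_section U regular_chart \<sigma>)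
    have "lamT f = res Y ?U torus (T.lam ?U (sect ?U f 1))"
      unfolding lamT_def T.lam_res[OF U s opn_torus TU] res_X[OF TU] ..
    then show "lamT f \<in> subA \<sigma>" unfolding subA_def using T.lam_closed[OF U s] by blast
  }
  assume "lamT f \<in> subA \<sigma>"
  then obtain u where u: "u \<in> A ?U" "lamT f = res Y ?U torus u" unfolding subA_def by blast
  interpret XU: cring "sec X ?U" by (rule T.cringX[OF U])
  have "res X ?U torus (pi ?U u) = res X ?U torus \<zero>\<^bsub>sec X ?U\<^esub>"
    unfolding T.pi_res[OF U opn_torus TU u(1), symmetric] u(2)[symmetric] lamT_def T.pi_lam[OF opn_torus secT[OF f]]
      T.X.res_zero[OF U opn_torus TU] ..
  then have "pi ?U u = \<zero>\<^bsub>sec X ?U\<^esub>"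
    by (rule res_X_inj[OF U opn_torus TU torus_ne T.pi_closed[OF U u(1)] XU.zero_closed])
  then obtain b where b: "b \<in> carrier (sec X ?U)" "u = T.lam ?U b" using T.ker_lam[OF U u(1)] by blast
  obtain r where r: "r \<in> Rg \<sigma>" "b = sect ?U r 1" using chart_section[OF \<sigma> b(1)] .
  have r0: "r \<in> Rg {0}" using r Rg_antimono face_of_imp_subset origin_face[OF \<sigma>] by blast
  have rb: "res X ?U torus b = sect torus r 1" unfolding r(2) by (rule res_X[OF TU])
  have "T.lam torus (sect torus f 1) = res Y ?U torus (T.lam ?U b)" using u(2) unfolding lamT_def b(2) .
  also have "\<dots> = T.lam torus (sect torus r 1)" unfolding T.lam_res[OF U b(1) opn_torus TU] rb ..
  finally have "T.lam torus (sect torus f 1) = T.lam torus (sect torus r 1)" .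
  then have "sect torus f 1 = sect torus r 1" by (rule T.lam_inj[OF opn_torus secT[OF f] secT[OF r0]])
  then have "f = r" by (rule sect_inj1[OF opn_torus torus_ne regT[OF f] regT[OF r0]])
  then show "f \<in> Rg \<sigma>" using r by simp
qed

text \<open>The axiom of substance is \<open>Asub_lift\<close>, which says that each regular
  function on a chart lifts to \<open>Y\<close> over the whole chart; it is
  \<open>affine_lift\<close>. The remaining ones are restrictions of identities.\<close>

lemma splitting_problem_torus: "splitting_problem N \<Sigma> V Vs S (sec Y torus) proj lamT subA \<kappa>T"
proof -
  interpret E: cring "sec Y torus" by (rule T.cringY[OF opn_torus])
  have cX: "carr X \<subseteq> carr X" "opn (carr X)" by auto
  have Tc: "torus \<subseteq> carr X" by (rule openin_subset[OF opn_torus])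
  show ?thesis
  proof (unfold_locales)
    fix s u assume su: "s \<in> A torus" "u \<in> A torus"
    show "proj (s \<otimes>\<^bsub>sec Y torus\<^esub> u) = proj s * proj u"
      using proj[OF su(1)] proj[OF su(2)]
      by (intro proj_eqI) (auto simp: T.pi_mult[OF opn_torus su] sectT_mult Rg.mult_mem)
    show "proj (s \<oplus>\<^bsub>sec Y torus\<^esub> u) = proj s + proj u"
      using proj[OF su(1)] proj[OF su(2)]
      by (intro proj_eqI) (auto simp: T.pi_add[OF opn_torus su] sectT_add Rg.add_mem)
  next
    fix s assume s: "s \<in> A torus"
    show "proj s \<in> Rg {0}" using proj[OF s] by blast
    fix f assume f: "f \<in> Rg {0}"
    show "s \<otimes>\<^bsub>sec Y torus\<^esub> lamT f = lamT (proj s * f)"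
      unfolding lamT_def T.lam_smult[OF opn_torus s secT[OF f]] using proj[OF s] f by (simp add: sectT_mult)
  next
    show "proj \<one>\<^bsub>sec Y torus\<^esub> = 1"
      by (rule proj_eqI[OF Rg.one_mem]) (simp add: T.pi_one[OF opn_torus] sect_one)
  next
    fix f assume f: "f \<in> Rg {0}"
    show "lamT f \<in> A torus" unfolding lamT_def by (rule T.lam_closed[OF opn_torus secT[OF f]])
    show "proj (lamT f) = 0"
      by (rule proj_eqI[OF Rg.zero_mem]) (simp add: lamT_def T.pi_lam[OF opn_torus secT[OF f]] sect_zero)
    fix g assume g: "g \<in> Rg {0}"
    show "lamT (f + g) = lamT f \<oplus>\<^bsub>sec Y torus\<^esub> lamT g"
      unfolding lamT_def sectT_add[OF f g, symmetric] by (rule T.lam_add[OF opn_torus secT[OF f] secT[OF g]])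
    assume "lamT f = lamT g"
    then have "sect torus f 1 = sect torus g 1"
      unfolding lamT_def by (rule T.lam_inj[OF opn_torus secT[OF f] secT[OF g]])
    then show "f = g" by (rule sect_inj1[OF opn_torus torus_ne regT[OF f] regT[OF g]])
  next
    fix s assume s: "s \<in> A torus" "proj s = 0"
    then have "pi torus s = \<zero>\<^bsub>sec X torus\<^esub>" using proj[OF s(1)] by (simp add: sect_zero)
    then obtain b where b: "b \<in> carrier (sec X torus)" "s = T.lam torus b" using T.ker_lam[OF opn_torus s(1)] by blast
    obtain r where "r \<in> Rg {0}" "b = sect torus r 1"
      using chart_section[OF origin_mem] b(1) unfolding torus_def by blast
    then show "\<exists>f\<in>Rg {0}. s = lamT f" using b by (auto simp: lamT_def)
  next
    fix \<sigma> assume \<sigma>: "\<sigma> \<in> \<Sigma>"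
    let ?U = "Dop \<sigma> 1"
    note U = opn_chart[OF \<sigma>] and TU = torus_sub[OF \<sigma>]
    interpret YU: cring "sec Y ?U" by (rule T.cringY[OF U])
    show "subA \<sigma> \<subseteq> A torus" unfolding subA_def using res_torus[OF \<sigma>] by blast
    show "\<one>\<^bsub>sec Y torus\<^esub> \<in> subA \<sigma>"
      unfolding subA_def T.Yres_one[OF U opn_torus TU, symmetric] using YU.one_closed by blast
    {
      fix s u assume "s \<in> subA \<sigma>" "u \<in> subA \<sigma>"
      then obtain s' u' where su: "s' \<in> A ?U" "u' \<in> A ?U" "s = res Y ?U torus s'" "u = res Y ?U torus u'"
        unfolding subA_def by blast
      show "s \<otimes>\<^bsub>sec Y torus\<^esub> u \<in> subA \<sigma>"
        unfolding su(3,4) T.Yres_mult[OF U opn_torus TU su(1,2), symmetric] subA_def using su(1,2) by blast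
      show "s \<ominus>\<^bsub>sec Y torus\<^esub> u \<in> subA \<sigma>"
        unfolding su(3,4) T.Yres_minus[OF U opn_torus TU su(1,2), symmetric] subA_def using su(1,2) by blast
    }
    {
      fix s assume "s \<in> subA \<sigma>"
      then obtain s' where s: "s' \<in> A ?U" "s = res Y ?U torus s'" unfolding subA_def by blast
      obtain r where r: "r \<in> Rg \<sigma>" "pi ?U s' = sect ?U r 1" using chart_section[OF \<sigma> T.pi_closed[OF U s(1)]] .
      show "proj s \<in> Rg \<sigma>" unfolding s(2) using proj_res[OF \<sigma> s(1) r] r by simp
    }
    {
      fix f assume f: "f \<in> Rg \<sigma>"
      obtain u where "u \<in> A ?U" "pi ?U u = sect ?U f 1" using affine_lift[OF \<sigma> f] .
      then show "\<exists>s\<in>subA \<sigma>. proj s = f" using proj_res[OF \<sigma> _ f] unfolding subA_def by blast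
    }
    {
      fix f assume "f \<in> Rg {0}"
      then show "lamT f \<in> subA \<sigma> \<longleftrightarrow> f \<in> Rg \<sigma>" by (rule lamT_mem_iff[OF \<sigma>])
    }
    {
      fix \<tau> assume \<tau>: "\<tau> \<in> \<Sigma>" "\<tau> face_of \<sigma>"
      have "res Y ?U torus u \<in> subA \<tau>" if u: "u \<in> A ?U" for u
      proof -
        note V = opn_chart[OF \<tau>(1)] Dop_face[OF \<sigma> \<tau>]
        have "res Y ?U torus u = res Y (Dop \<tau> 1) torus (res Y ?U (Dop \<tau> 1) u)"
          by (rule T.Yres_res[OF U V(1) opn_torus torus_sub[OF \<tau>(1)] V(2) u, symmetric])
        then show ?thesis unfolding subA_def using T.YresC[OF U V u] by blast
      qed
      then show "subA \<sigma> \<subseteq> subA \<tau>" unfolding subA_def by blast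
    }
    fix c
    have Uc: "?U \<subseteq> carr X" by (rule openin_subset[OF U])
    have "\<kappa>T c = res Y ?U torus (res Y (carr X) ?U (\<kappa>0 c))"
      unfolding \<kappa>T_def by (rule T.Yres_res[OF cX(2) U opn_torus TU Uc \<kappa>0_closed, symmetric])
    then show "\<kappa>T c \<in> subA \<sigma>" unfolding subA_def using T.YresC[OF cX(2) U Uc \<kappa>0_closed] by blast
  next
    fix c d
    show "\<kappa>T (c + d) = \<kappa>T c \<oplus>\<^bsub>sec Y torus\<^esub> \<kappa>T d"
      unfolding \<kappa>T_def \<kappa>0_add by (rule T.Yres_add[OF cX(2) opn_torus Tc \<kappa>0_closed \<kappa>0_closed])
    show "\<kappa>T (c * d) = \<kappa>T c \<otimes>\<^bsub>sec Y torus\<^esub> \<kappa>T d"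
      unfolding \<kappa>T_def \<kappa>0_mult by (rule T.Yres_mult[OF cX(2) opn_torus Tc \<kappa>0_closed \<kappa>0_closed])
  next
    show "\<kappa>T 1 = \<one>\<^bsub>sec Y torus\<^esub>" unfolding \<kappa>T_def \<kappa>0_one by (rule T.Yres_one[OF cX(2) opn_torus Tc])
  next
    fix c
    have "Poly_Mapping.single 0 c \<in> Rg {0}" using dual_monoid_zero by (auto simp: Rg_def monoid_algebra_def)
    moreover have "pi torus (\<kappa>T c) = sect torus (Poly_Mapping.single 0 c) 1"
      unfolding \<kappa>T_def T.pi_res[OF cX(2) opn_torus Tc \<kappa>0_closed] pi_\<kappa>0 str_X by (rule res_X[OF Tc])
    ultimately show "proj (\<kappa>T c) = Poly_Mapping.single 0 c" by (rule proj_eqI)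
  qed
qed

sublocale P: splitting_problem N \<Sigma> V Vs S "sec Y torus" proj lamT subA \<kappa>T
  by (rule splitting_problem_torus)

section \<open>Extension of the splitting from the torus to the structure sheaf\<close>

definition \<psi> where
  "\<psi> = (SOME \<psi>. \<psi> \<in> ring_hom (subring_of_type (Rg {0})) (sec Y torus) \<and> (\<forall>f\<in>Rg {0}. proj (\<psi> f) = f) \<and>
    (\<forall>\<sigma>\<in>\<Sigma>. \<forall>f\<in>Rg \<sigma>. \<psi> f \<in> subA \<sigma>) \<and> (\<forall>c. \<psi> (Poly_Mapping.single 0 c) = \<kappa>T c))"

lemma \<psi>_spec: "\<psi> \<in> ring_hom (subring_of_type (Rg {0})) (sec Y torus) \<and> (\<forall>f\<in>Rg {0}. proj (\<psi> f) = f) \<and>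
    (\<forall>\<sigma>\<in>\<Sigma>. \<forall>f\<in>Rg \<sigma>. \<psi> f \<in> subA \<sigma>) \<and> (\<forall>c. \<psi> (Poly_Mapping.single 0 c) = \<kappa>T c)"
proof -
  obtain \<psi> where p: "\<psi> \<in> ring_hom (subring_of_type (Rg {0})) (sec Y torus)" "\<And>f. f \<in> Rg {0} \<Longrightarrow> proj (\<psi> f) = f"
    "\<And>\<sigma> f. \<sigma> \<in> \<Sigma> \<Longrightarrow> f \<in> Rg \<sigma> \<Longrightarrow> \<psi> f \<in> subA \<sigma>" "\<And>c. \<psi> (Poly_Mapping.single 0 c) = \<kappa>T c"
    by (rule P.ex_ring_splitting) (rule that)
  have "\<exists>\<psi>. \<psi> \<in> ring_hom (subring_of_type (Rg {0})) (sec Y torus) \<and> (\<forall>f\<in>Rg {0}. proj (\<psi> f) = f) \<and>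
    (\<forall>\<sigma>\<in>\<Sigma>. \<forall>f\<in>Rg \<sigma>. \<psi> f \<in> subA \<sigma>) \<and> (\<forall>c. \<psi> (Poly_Mapping.single 0 c) = \<kappa>T c)"
    by (rule exI[of _ \<psi>]) (simp add: p)
  from someI_ex[OF this] show ?thesis unfolding \<psi>_def .
qed

lemma \<psi>_closed: "f \<in> Rg {0} \<Longrightarrow> \<psi> f \<in> A torus"
  using \<psi>_spec ring_hom_closed[of \<psi> "subring_of_type (Rg {0})"] by auto

lemma \<psi>_mult: "\<lbrakk>f \<in> Rg {0}; g \<in> Rg {0}\<rbrakk> \<Longrightarrow> \<psi> (f * g) = \<psi> f \<otimes>\<^bsub>sec Y torus\<^esub> \<psi> g"
  using \<psi>_spec ring_hom_mult[of \<psi> "subring_of_type (Rg {0})" _ f g] by auto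

lemma \<psi>_add: "\<lbrakk>f \<in> Rg {0}; g \<in> Rg {0}\<rbrakk> \<Longrightarrow> \<psi> (f + g) = \<psi> f \<oplus>\<^bsub>sec Y torus\<^esub> \<psi> g"
  using \<psi>_spec ring_hom_add[of \<psi> "subring_of_type (Rg {0})" _ f g] by auto

lemma \<psi>_one: "\<psi> 1 = \<one>\<^bsub>sec Y torus\<^esub>"
  using \<psi>_spec ring_hom_one[of \<psi> "subring_of_type (Rg {0})"] by auto

lemma pi_\<psi>: "f \<in> Rg {0} \<Longrightarrow> pi torus (\<psi> f) = sect torus f 1"
  using proj[OF \<psi>_closed] \<psi>_spec by metis

lemma \<psi>_lift:
  assumes "\<sigma> \<in> \<Sigma>" "f \<in> Rg \<sigma>"
  obtains u where "u \<in> A (Dop \<sigma> 1)" "res Y (Dop \<sigma> 1) torus u = \<psi> f" "pi (Dop \<sigma> 1) u = sect (Dop \<sigma> 1) f 1"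
proof -
  note U = opn_chart[OF assms(1)] and TU = torus_sub[OF assms(1)]
  have f0: "f \<in> Rg {0}" using assms P.Rg_sub0 by blast
  have "\<psi> f \<in> subA \<sigma>" using \<psi>_spec assms by blast
  then obtain u where u: "u \<in> A (Dop \<sigma> 1)" "res Y (Dop \<sigma> 1) torus u = \<psi> f"
    unfolding subA_def by (elim imageE) (rule that, assumption, rule sym)
  have "res X (Dop \<sigma> 1) torus (pi (Dop \<sigma> 1) u) = res X (Dop \<sigma> 1) torus (sect (Dop \<sigma> 1) f 1)"
    unfolding T.pi_res[OF U opn_torus TU u(1), symmetric] u(2) pi_\<psi>[OF f0] res_X[OF TU] ..
  then have "pi (Dop \<sigma> 1) u = sect (Dop \<sigma> 1) f 1"
    by (rule res_X_inj[OF U opn_torus TU torus_ne T.pi_closed[OF U u(1)] sect_section[OF U regular_chart[OF assms]]])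
  then show thesis using that u by blast
qed

lemma inter_torus: "opn W \<Longrightarrow> opn (W \<inter> torus) \<and> W \<inter> torus \<subseteq> W \<and> W \<inter> torus \<subseteq> torus"
  using opn_torus by auto

abbreviation \<psi>r where "\<psi>r W f \<equiv> res Y torus (W \<inter> torus) (\<psi> f)"
abbreviation rT where "rT W s \<equiv> res Y W (W \<inter> torus) s"

lemma \<psi>r_closed: "\<lbrakk>opn W; f \<in> Rg {0}\<rbrakk> \<Longrightarrow> \<psi>r W f \<in> A (W \<inter> torus)"
  using inter_torus[of W] by (intro T.YresC[OF opn_torus _ _ \<psi>_closed]) auto

lemma rT_closed: "\<lbrakk>opn W; s \<in> A W\<rbrakk> \<Longrightarrow> rT W s \<in> A (W \<inter> torus)"
  using inter_torus[of W] by (intro T.YresC) auto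

lemma \<psi>r_mult: "\<lbrakk>opn W; f \<in> Rg {0}; g \<in> Rg {0}\<rbrakk> \<Longrightarrow> \<psi>r W (f * g) = \<psi>r W f \<otimes>\<^bsub>sec Y (W \<inter> torus)\<^esub> \<psi>r W g"
  using inter_torus[of W] by (simp add: \<psi>_mult T.Yres_mult[OF opn_torus] \<psi>_closed)

lemma \<psi>r_add: "\<lbrakk>opn W; f \<in> Rg {0}; g \<in> Rg {0}\<rbrakk> \<Longrightarrow> \<psi>r W (f + g) = \<psi>r W f \<oplus>\<^bsub>sec Y (W \<inter> torus)\<^esub> \<psi>r W g"
  using inter_torus[of W] by (simp add: \<psi>_add T.Yres_add[OF opn_torus] \<psi>_closed)

lemma A_empty: "\<lbrakk>s \<in> A {}; s' \<in> A {}\<rbrakk> \<Longrightarrow> s = s'"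
  by (rule T.Yseparated) auto

text \<open>On the part of \<open>W\<close> where \<open>d\<close> is invertible,
  \<open>\<psi> d\<close> is a unit by \<open>unit_lift\<close> and can be cancelled. This part is
  nonempty if \<open>W\<close> is, and restriction to it is injective on \<open>Y\<close>.\<close>

lemma \<psi>r_cancel:
  assumes W: "opn W" and s: "s \<in> A W" "s' \<in> A W" and d: "d \<in> Rg {0}" "d \<noteq> 0"
    and eq: "rT W s \<otimes>\<^bsub>sec Y (W \<inter> torus)\<^esub> \<psi>r W d = rT W s' \<otimes>\<^bsub>sec Y (W \<inter> torus)\<^esub> \<psi>r W d"
  shows "s = s'"
proof (cases "W = {}")
  case True then show ?thesis using A_empty s by auto
next
  case False
  let ?Z = "W \<inter> Dop {0} d"
  have Z: "opn ?Z" "?Z \<noteq> {}" "?Z \<subseteq> W" "?Z \<subseteq> W \<inter> torus" "?Z \<subseteq> torus" "?Z \<subseteq> Dop {0} d"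
    using W openin_Dop[OF origin_mem d(1)] eta_mem[OF W False] eta_mem_Dop[OF origin_mem d(2)]
      Dop_subset_one[of "{0}" d] by (auto simp: torus_def)
  note WT = inter_torus[OF W]
  interpret YZ: cring "sec Y ?Z" by (rule T.cringY[OF Z(1)])
  let ?d = "res Y torus ?Z (\<psi> d)"
  have dZ: "?d \<in> A ?Z" by (rule T.YresC[OF opn_torus Z(1) Z(5) \<psi>_closed[OF d(1)]])
  have rd: "regular ?Z 1 d"
    using regular_subset[OF regular_Dop_power[OF origin_mem d Rg.one_mem, of 1] Z(6)] by simp
  have rd': "regular ?Z d 1" by (rule regular_subset[OF regT[OF d(1)] Z(5)])
  have "pi ?Z ?d = sect ?Z d 1"
    unfolding T.pi_res[OF opn_torus Z(1) Z(5) \<psi>_closed[OF d(1)]] pi_\<psi>[OF d(1)] by (rule res_X[OF Z(5)])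
  moreover have "sect ?Z d 1 \<otimes>\<^bsub>sec X ?Z\<^esub> sect ?Z 1 d = \<one>\<^bsub>sec X ?Z\<^esub>"
    unfolding sect_mult[OF rd' rd] sect_one using d by (intro sect_cong) auto
  ultimately obtain e where e: "e \<in> A ?Z" "?d \<otimes>\<^bsub>sec Y ?Z\<^esub> e = \<one>\<^bsub>sec Y ?Z\<^esub>"
    using T.unit_lift[OF Z(1) dZ sect_section[OF Z(1) rd]] by auto
  have r: "res Y (W \<inter> torus) ?Z (rT W u \<otimes>\<^bsub>sec Y (W \<inter> torus)\<^esub> \<psi>r W d) = res Y W ?Z u \<otimes>\<^bsub>sec Y ?Z\<^esub> ?d"
    if u: "u \<in> A W" for u
    using WT Z W u rT_closed[OF W u] \<psi>r_closed[OF W d(1)] \<psi>_closed[OF d(1)] opn_torus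
    by (simp add: T.Yres_mult T.Yres_res)
  have c: "res Y W ?Z s \<in> A ?Z" "res Y W ?Z s' \<in> A ?Z" using T.YresC[OF W Z(1,3)] s by auto
  have "res Y W ?Z s = res Y W ?Z s \<otimes>\<^bsub>sec Y ?Z\<^esub> ?d \<otimes>\<^bsub>sec Y ?Z\<^esub> e" using c e dZ by (simp add: YZ.m_assoc)
  also have "\<dots> = res Y W ?Z s' \<otimes>\<^bsub>sec Y ?Z\<^esub> ?d \<otimes>\<^bsub>sec Y ?Z\<^esub> e" using r[OF s(1)] r[OF s(2)] eq by simp
  also have "\<dots> = res Y W ?Z s'" using c e dZ by (simp add: YZ.m_assoc)
  finally show ?thesis by (rule res_Y_inj[OF W Z(1,3,2) s])
qed

text \<open>The section \<open>s\<close> is the quotient of \<open>\<psi> c\<close> by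
  \<open>\<psi> d\<close>, stated without division because \<open>\<psi> d\<close> need not be
  invertible on the whole of \<open>W \<inter> torus\<close>.\<close>

definition lifts where
  "lifts W c d s \<longleftrightarrow> s \<in> A W \<and> c \<in> Rg {0} \<and> d \<in> Rg {0} \<and> d \<noteq> 0 \<and> regular W c d \<and>
     rT W s \<otimes>\<^bsub>sec Y (W \<inter> torus)\<^esub> \<psi>r W d = \<psi>r W c"

lemma lifts_unique:
  assumes W: "opn W" and l: "lifts W c d s" "lifts W c' d' s'" and eq: "c * d' = c' * d"
  shows "s = s'"
proof -
  note c = l[unfolded lifts_def]
  have dd: "d * d' \<in> Rg {0}" "d * d' \<noteq> 0" using c Rg.mult_mem Rg.mult_nonzero by auto
  interpret C: cring "sec Y (W \<inter> torus)" using inter_torus[OF W] T.cringY by blast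
  have k: "rT W s \<in> A (W \<inter> torus)" "rT W s' \<in> A (W \<inter> torus)" "\<psi>r W d \<in> A (W \<inter> torus)" "\<psi>r W d' \<in> A (W \<inter> torus)"
    using c rT_closed[OF W] \<psi>r_closed[OF W] by auto
  have "rT W s \<otimes>\<^bsub>sec Y (W \<inter> torus)\<^esub> \<psi>r W (d * d') = \<psi>r W c \<otimes>\<^bsub>sec Y (W \<inter> torus)\<^esub> \<psi>r W d'"
    using c k by (simp add: \<psi>r_mult[OF W] C.m_assoc[symmetric])
  also have "\<dots> = \<psi>r W c' \<otimes>\<^bsub>sec Y (W \<inter> torus)\<^esub> \<psi>r W d"
    using c eq by (simp add: \<psi>r_mult[OF W, symmetric])
  also have "\<dots> = rT W s' \<otimes>\<^bsub>sec Y (W \<inter> torus)\<^esub> \<psi>r W d' \<otimes>\<^bsub>sec Y (W \<inter> torus)\<^esub> \<psi>r W d" using c by simp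
  also have "\<dots> = rT W s' \<otimes>\<^bsub>sec Y (W \<inter> torus)\<^esub> \<psi>r W (d * d')"
    unfolding \<psi>r_mult[OF W conjunct1[OF conjunct2[OF conjunct2[OF c(1)]]] conjunct1[OF conjunct2[OF conjunct2[OF c(2)]]]]
      C.m_assoc[OF k(2,4,3)] C.m_comm[OF k(3,4)] ..
  finally show ?thesis using \<psi>r_cancel[OF W _ _ dd] c by blast
qed

lemma lifts_res:
  assumes W: "opn W" "opn Z" "Z \<subseteq> W" and l: "lifts W c d s"
  shows "lifts Z c d (res Y W Z s)"
proof -
  note l' = l[unfolded lifts_def]
  note WT = inter_torus[OF W(1)] and ZT = inter_torus[OF W(2)]
  have ZW: "Z \<inter> torus \<subseteq> W \<inter> torus" using W by auto
  have s: "s \<in> A W" and cd: "c \<in> Rg {0}" "d \<in> Rg {0}" using l' by auto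
  have "res Y (W \<inter> torus) (Z \<inter> torus) (rT W s \<otimes>\<^bsub>sec Y (W \<inter> torus)\<^esub> \<psi>r W d) = res Y (W \<inter> torus) (Z \<inter> torus) (\<psi>r W c)"
    using l' by simp
  then have "rT Z (res Y W Z s) \<otimes>\<^bsub>sec Y (Z \<inter> torus)\<^esub> \<psi>r Z d = \<psi>r Z c"
    using WT ZT ZW W s cd \<psi>_closed rT_closed[OF W(1) s] \<psi>r_closed[OF W(1) cd(2)] opn_torus
    by (simp add: T.Yres_mult T.Yres_res)
  then show ?thesis unfolding lifts_def
    using l' T.YresC[OF W] regular_subset[OF _ W(3)] by blast
qed

text \<open>Near a point of the chart of \<open>\<sigma>\<close> the fraction \<open>c/d\<close>
  equals some \<open>a/b\<close> with \<open>a\<close> and \<open>b\<close> in the chart ring and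
  \<open>b\<close> nonzero at the point. Both \<open>\<psi> a\<close> and \<open>\<psi> b\<close>
  extend to the chart, the latter as a unit near the point, so the quotient exists there; the local
  quotients glue by \<open>lifts_unique\<close>.\<close>

lemma lifts_exists:
  assumes W: "opn W" and cd: "c \<in> Rg {0}" "d \<in> Rg {0}" "d \<noteq> 0" "regular W c d"
  obtains s where "lifts W c d s"
proof -
  have loc: "\<exists>Z s. opn Z \<and> x \<in> Z \<and> Z \<subseteq> W \<and> s \<in> A Z \<and> lifts Z c d s" if x: "x \<in> W" for x
  proof -
    have "x \<in> carr X" using x openin_subset[OF W] by auto
    then obtain \<sigma> p where p: "\<sigma> \<in> \<Sigma>" "prm \<sigma> p" "x = cls (\<sigma>, p)" unfolding carr_X by blast
    have pp: "primeideal p (Rg.R \<sigma>)" using p(2) by (simp add: chart_ring_eq)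
    have "gfrac (Rg \<sigma>) p c d \<noteq> {}" using cd(4) p x unfolding regular_def part_eq by blast
    then obtain a b where ab: "(a, b) \<in> gfrac (Rg \<sigma>) p c d" by auto
    note ab' = Rg.gfrac_memD[OF ab pp]
    let ?Z = "W \<inter> Dop \<sigma> b"
    have Z: "opn ?Z" "x \<in> ?Z" "?Z \<subseteq> W" "?Z \<subseteq> Dop \<sigma> b" "?Z \<subseteq> Dop \<sigma> 1"
      using W openin_Dop[OF p(1) ab'(2)] x p pp ab'(3) Dop_subset_one[of \<sigma> b] by (auto simp: Dop_def basic_open_def)
    note U = opn_chart[OF p(1)] and TU = torus_sub[OF p(1)]
    obtain u where u: "u \<in> A (Dop \<sigma> 1)" "res Y (Dop \<sigma> 1) torus u = \<psi> a" using \<psi>_lift[OF p(1) ab'(1)] by metis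
    obtain v where v: "v \<in> A (Dop \<sigma> 1)" "res Y (Dop \<sigma> 1) torus v = \<psi> b" "pi (Dop \<sigma> 1) v = sect (Dop \<sigma> 1) b 1"
      using \<psi>_lift[OF p(1) ab'(2)] .
    let ?u = "res Y (Dop \<sigma> 1) ?Z u" and ?v = "res Y (Dop \<sigma> 1) ?Z v"
    have uv: "?u \<in> A ?Z" "?v \<in> A ?Z" using T.YresC[OF U Z(1,5)] u v by auto
    have rb: "regular ?Z 1 b"
      using regular_subset[OF regular_Dop_power[OF p(1) ab'(2,5) Rg.one_mem, of 1] Z(4)] by simp
    have rb': "regular ?Z b 1" by (rule regular_sub_chart[OF p(1) ab'(2) Z(5)])
    have "pi ?Z ?v = sect ?Z b 1" unfolding T.pi_res[OF U Z(1,5) v(1)] v(3) by (rule res_X[OF Z(5)])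
    moreover have "sect ?Z b 1 \<otimes>\<^bsub>sec X ?Z\<^esub> sect ?Z 1 b = \<one>\<^bsub>sec X ?Z\<^esub>"
      unfolding sect_mult[OF rb' rb] sect_one using ab'(5) by (intro sect_cong) auto
    ultimately obtain e where e: "e \<in> A ?Z" "?v \<otimes>\<^bsub>sec Y ?Z\<^esub> e = \<one>\<^bsub>sec Y ?Z\<^esub>"
      using T.unit_lift[OF Z(1) uv(2) sect_section[OF Z(1) rb]] by auto
    interpret YZ: cring "sec Y ?Z" by (rule T.cringY[OF Z(1)])
    define s where "s = ?u \<otimes>\<^bsub>sec Y ?Z\<^esub> e"
    have sZ: "s \<in> A ?Z" using uv e by (simp add: s_def)
    have sv: "s \<otimes>\<^bsub>sec Y ?Z\<^esub> ?v = ?u" unfolding s_def using uv e by (simp add: YZ.m_assoc YZ.m_comm[of e])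
    note ZT = inter_torus[OF Z(1)]
    interpret C: cring "sec Y (?Z \<inter> torus)" using ZT T.cringY by blast
    have ab0: "a \<in> Rg {0}" "b \<in> Rg {0}" using ab'(1,2) P.Rg_sub0[OF p(1)] by auto
    have rr: "rT ?Z (res Y (Dop \<sigma> 1) ?Z w) = res Y torus (?Z \<inter> torus) (res Y (Dop \<sigma> 1) torus w)"
      if "w \<in> A (Dop \<sigma> 1)" for w
      using that ZT Z U TU opn_torus by (simp add: T.Yres_res)
    have "rT ?Z (s \<otimes>\<^bsub>sec Y ?Z\<^esub> ?v) = rT ?Z ?u" using sv by simp
    then have sab: "rT ?Z s \<otimes>\<^bsub>sec Y (?Z \<inter> torus)\<^esub> \<psi>r ?Z b = \<psi>r ?Z a"
      using ZT Z sZ uv rr[OF u(1)] rr[OF v(1)] u(2) v(2) by (simp add: T.Yres_mult)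
    have k: "rT ?Z s \<in> A (?Z \<inter> torus)" "\<psi>r ?Z b \<in> A (?Z \<inter> torus)" "\<psi>r ?Z d \<in> A (?Z \<inter> torus)" "\<psi>r ?Z c \<in> A (?Z \<inter> torus)"
      using rT_closed[OF Z(1) sZ] \<psi>r_closed[OF Z(1)] ab0 cd by auto
    have "lifts ?Z a b s" unfolding lifts_def using sZ ab0 ab'(5) sab
      regular_mult[OF regular_sub_chart[OF p(1) ab'(1) Z(5)] rb] by simp
    \<comment> \<open>The relation is known for \<open>a\<close> and \<open>b\<close>. Because
      \<open>c * b = a * d\<close>, it follows for \<open>c\<close> and \<open>d\<close> after
      multiplication by \<open>\<psi> b\<close>, which \<open>\<psi>r_cancel\<close> removes
      again.\<close>
    moreover have "rT ?Z s \<otimes>\<^bsub>sec Y (?Z \<inter> torus)\<^esub> \<psi>r ?Z d = \<psi>r ?Z c"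
    proof -
      obtain s1 where s1: "s1 \<in> A (?Z \<inter> torus)" "s1 = rT ?Z s \<otimes>\<^bsub>sec Y (?Z \<inter> torus)\<^esub> \<psi>r ?Z d" using k by auto
      have oT: "opn (?Z \<inter> torus)" using ZT by auto
      have TT: "(?Z \<inter> torus) \<inter> torus = ?Z \<inter> torus" by auto
      have id: "res Y (?Z \<inter> torus) (?Z \<inter> torus) w = w" if "w \<in> A (?Z \<inter> torus)" for w by (rule T.Yres_id[OF oT that])
      have "s1 = \<psi>r ?Z c"
      proof (rule \<psi>r_cancel[OF oT s1(1) k(4) ab0(2) ab'(5)])
        have "s1 \<otimes>\<^bsub>sec Y (?Z \<inter> torus)\<^esub> \<psi>r ?Z b = (rT ?Z s \<otimes>\<^bsub>sec Y (?Z \<inter> torus)\<^esub> \<psi>r ?Z b) \<otimes>\<^bsub>sec Y (?Z \<inter> torus)\<^esub> \<psi>r ?Z d"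
          unfolding s1(2) using k(1-3) by (simp add: C.m_ac)
        also have "\<dots> = \<psi>r ?Z (a * d)" unfolding sab \<psi>r_mult[OF Z(1) ab0(1) cd(2)] ..
        also have "\<dots> = \<psi>r ?Z c \<otimes>\<^bsub>sec Y (?Z \<inter> torus)\<^esub> \<psi>r ?Z b"
          unfolding ab'(4)[symmetric] \<psi>r_mult[OF Z(1) cd(1) ab0(2)] ..
        finally show "rT (?Z \<inter> torus) s1 \<otimes>\<^bsub>sec Y (?Z \<inter> torus \<inter> torus)\<^esub> \<psi>r (?Z \<inter> torus) b =
            rT (?Z \<inter> torus) (\<psi>r ?Z c) \<otimes>\<^bsub>sec Y (?Z \<inter> torus \<inter> torus)\<^esub> \<psi>r (?Z \<inter> torus) b"
          unfolding TT id[OF s1(1)] id[OF k(4)] .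
      qed
      then show ?thesis using s1 by simp
    qed
    ultimately have "lifts ?Z c d s" unfolding lifts_def using cd regular_subset[OF cd(4) Z(3)] by simp
    then show ?thesis using Z sZ by blast
  qed
  obtain s where s: "s \<in> A W" "\<And>Z u. \<lbrakk>T.Y.op Z; Z \<subseteq> W; u \<in> A Z; lifts Z c d u\<rbrakk> \<Longrightarrow> res Y W Z s = u"
  proof (rule T.Y.glue_pred[where V=W and Q="\<lambda>Z u. lifts Z c d u"])
    fix Z u Z' u' assume "T.Y.op Z" "Z \<subseteq> W" "u \<in> A Z" "lifts Z c d u" "T.Y.op Z'" "Z' \<subseteq> W" "u' \<in> A Z'" "lifts Z' c d u'"
    then have *: "opn Z" "opn Z'" "lifts Z c d u" "lifts Z' c d u'" by (auto simp: T.opY)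
    then have "opn (Z \<inter> Z')" by auto
    then show "res Y Z (Z \<inter> Z') u = res Y Z' (Z \<inter> Z') u'"
      using lifts_unique[OF _ lifts_res[OF *(1) _ _ *(3)] lifts_res[OF *(2) _ _ *(4)]] by auto
  qed (use W loc in \<open>auto simp: T.opY\<close>)
  have "rT W s \<otimes>\<^bsub>sec Y (W \<inter> torus)\<^esub> \<psi>r W d = \<psi>r W c"
  proof (rule T.Yseparated)
    note WT = inter_torus[OF W]
    interpret C: cring "sec Y (W \<inter> torus)" using WT T.cringY by blast
    show "opn (W \<inter> torus)" using WT by auto
    show "rT W s \<otimes>\<^bsub>sec Y (W \<inter> torus)\<^esub> \<psi>r W d \<in> A (W \<inter> torus)" "\<psi>r W c \<in> A (W \<inter> torus)"
      using rT_closed[OF W s(1)] \<psi>r_closed[OF W] cd by auto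
    fix x assume x: "x \<in> W \<inter> torus"
    then obtain Z u where Z: "opn Z" "x \<in> Z" "Z \<subseteq> W" "u \<in> A Z" "lifts Z c d u" using loc by blast
    note ZT = inter_torus[OF Z(1)]
    have ZW: "Z \<inter> torus \<subseteq> W \<inter> torus" using Z by auto
    have ru: "res Y W Z s = u" using s(2) Z by (simp add: T.opY)
    have "res Y (W \<inter> torus) (Z \<inter> torus) (rT W s \<otimes>\<^bsub>sec Y (W \<inter> torus)\<^esub> \<psi>r W d) =
        rT Z (res Y W Z s) \<otimes>\<^bsub>sec Y (Z \<inter> torus)\<^esub> \<psi>r Z d"
      using WT ZT ZW W Z s(1) cd \<psi>_closed rT_closed[OF W s(1)] \<psi>r_closed[OF W cd(2)] opn_torus
      by (simp add: T.Yres_mult T.Yres_res)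
    also have "\<dots> = \<psi>r Z c" unfolding ru using Z(5) by (simp add: lifts_def)
    also have "\<dots> = res Y (W \<inter> torus) (Z \<inter> torus) (\<psi>r W c)"
      using WT ZT ZW cd \<psi>_closed opn_torus by (simp add: T.Yres_res)
    finally show "\<exists>Z. opn Z \<and> x \<in> Z \<and> Z \<subseteq> W \<inter> torus \<and>
      res Y (W \<inter> torus) Z (rT W s \<otimes>\<^bsub>sec Y (W \<inter> torus)\<^esub> \<psi>r W d) = res Y (W \<inter> torus) Z (\<psi>r W c)"
      using ZT ZW x Z by (intro exI[of _ "Z \<inter> torus"]) auto
  qed
  then show thesis using that s(1) cd unfolding lifts_def by blast
qed

text \<open>A nonempty \<open>W\<close> contains the generic point of the torus chart, and
  regularity there provides numerator and denominator in \<open>Rg {0}\<close>, where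
  \<open>\<psi>\<close> behaves as a ring homomorphism.\<close>

lemma sectionE0:
  assumes W: "opn W" and b: "b \<in> carrier (sec X W)"
  obtains c d where "c \<in> Rg {0}" "d \<in> Rg {0}" "d \<noteq> 0" "regular W c d" "b = sect W c d"
proof (cases "W = {}")
  case True
  obtain f g where "b = sect W f g" using sectionE[OF W b] by metis
  then have "b = sect W 0 1" using sect_empty True by metis
  then show thesis using that[of 0 1] Rg.zero_mem Rg.one_mem regular_one_zero by auto
next
  case False
  obtain f g where fg: "regular W f g" "b = sect W f g" using sectionE[OF W b] by metis
  have "{0} \<in> part {0} W" using eta_mem[OF W False] prm_zero by (simp add: part_eq eta_def)
  then have "gfrac (Rg {0}) {0} f g \<noteq> {}" using fg origin_mem unfolding regular_def by blast
  then obtain c d where cd: "(c, d) \<in> gfrac (Rg {0}) {0} f g" by auto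
  note 1 = Rg.gfrac_memD[OF cd Rg.primeideal_zero]
  have "regular W c d" using regular_cong[OF 1(4,5) fg(1)] .
  moreover have "b = sect W c d" unfolding fg(2) using 1 fg(1) by (intro sect_cong) (auto simp: regular_def)
  ultimately show thesis using that 1 by blast
qed

definition \<Psi> where "\<Psi> W b = (SOME s. \<exists>c d. b = sect W c d \<and> lifts W c d s)"

lemma \<Psi>_eqI:
  assumes W: "opn W" and l: "lifts W c d s"
  shows "\<Psi> W (sect W c d) = s"
proof -
  have "\<exists>s c' d'. sect W c d = sect W c' d' \<and> lifts W c' d' s" using l by blast
  from someI_ex[OF this] have "\<exists>c' d'. sect W c d = sect W c' d' \<and> lifts W c' d' (\<Psi> W (sect W c d))"
    unfolding \<Psi>_def .
  then obtain c' d' where c': "sect W c d = sect W c' d'" "lifts W c' d' (\<Psi> W (sect W c d))"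
    by (elim exE conjE)
  show ?thesis
  proof (cases "W = {}")
    case True
    then show ?thesis using A_empty c'(2) l unfolding lifts_def by blast
  next
    case False
    have "c' * d = c * d'"
      using sect_eq_iff[OF W False, of c d c' d'] c' l unfolding lifts_def by metis
    then show ?thesis using lifts_unique[OF W c'(2) l] by blast
  qed
qed

lemma \<Psi>_cases:
  assumes "opn W" "b \<in> carrier (sec X W)"
  obtains c d where "b = sect W c d" "lifts W c d (\<Psi> W b)"
proof -
  obtain c d where cd: "c \<in> Rg {0}" "d \<in> Rg {0}" "d \<noteq> 0" "regular W c d" "b = sect W c d"
    using sectionE0[OF assms] .
  obtain s where s: "lifts W c d s" using lifts_exists[OF assms(1) cd(1-4)] by blast
  show thesis using that[OF cd(5)] s \<Psi>_eqI[OF assms(1) s] cd(5) by simp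
qed

lemma \<Psi>_ring_hom:
  assumes W: "opn W"
  shows "\<Psi> W \<in> ring_hom (sec X W) (sec Y W)"
proof (rule ring_hom_memI)
  note WT = inter_torus[OF W]
  interpret C: cring "sec Y (W \<inter> torus)" using WT T.cringY by blast
  interpret YW: cring "sec Y W" by (rule T.cringY[OF W])
  fix x y assume "x \<in> carrier (sec X W)" "y \<in> carrier (sec X W)"
  then obtain c d c' d' where l: "x = sect W c d" "lifts W c d (\<Psi> W x)" "y = sect W c' d'" "lifts W c' d' (\<Psi> W y)"
    using \<Psi>_cases[OF W] by metis
  define s u where "s = \<Psi> W x" and "u = \<Psi> W y"
  have l': "s \<in> A W" "c \<in> Rg {0}" "d \<in> Rg {0}" "d \<noteq> 0" "regular W c d"
     "rT W s \<otimes>\<^bsub>sec Y (W \<inter> torus)\<^esub> \<psi>r W d = \<psi>r W c"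
     "u \<in> A W" "c' \<in> Rg {0}" "d' \<in> Rg {0}" "d' \<noteq> 0" "regular W c' d'"
     "rT W u \<otimes>\<^bsub>sec Y (W \<inter> torus)\<^esub> \<psi>r W d' = \<psi>r W c'"
    using l(2,4) unfolding lifts_def s_def u_def by blast+
  show "\<Psi> W x \<in> A W" using l'(1) by (simp add: s_def)
  have k: "rT W s \<in> A (W \<inter> torus)" "rT W u \<in> A (W \<inter> torus)" "\<psi>r W d \<in> A (W \<inter> torus)" "\<psi>r W d' \<in> A (W \<inter> torus)"
    using l' rT_closed[OF W] \<psi>r_closed[OF W] by auto
  have dd: "d * d' \<in> Rg {0}" "d * d' \<noteq> 0" using l' Rg.mult_mem Rg.mult_nonzero by auto
  have "rT W (s \<otimes>\<^bsub>sec Y W\<^esub> u) \<otimes>\<^bsub>sec Y (W \<inter> torus)\<^esub> \<psi>r W (d * d') =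
      (rT W s \<otimes>\<^bsub>sec Y (W \<inter> torus)\<^esub> \<psi>r W d) \<otimes>\<^bsub>sec Y (W \<inter> torus)\<^esub> (rT W u \<otimes>\<^bsub>sec Y (W \<inter> torus)\<^esub> \<psi>r W d')"
    unfolding T.Yres_mult[OF W conjunct1[OF WT] conjunct1[OF conjunct2[OF WT]] l'(1,7)] \<psi>r_mult[OF W l'(3,9)]
    using k by (simp add: C.m_ac)
  also have "\<dots> = \<psi>r W (c * c')" using l' by (simp add: \<psi>r_mult[OF W])
  finally have "lifts W (c * c') (d * d') (s \<otimes>\<^bsub>sec Y W\<^esub> u)"
    unfolding lifts_def using l' dd regular_mult Rg.mult_mem by auto
  then show "\<Psi> W (x \<otimes>\<^bsub>sec X W\<^esub> y) = \<Psi> W x \<otimes>\<^bsub>sec Y W\<^esub> \<Psi> W y"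
    unfolding l(1,3) sect_mult[OF l'(5,11)] using \<Psi>_eqI[OF W] by (simp add: s_def u_def l(1,3))
  have "rT W (s \<oplus>\<^bsub>sec Y W\<^esub> u) \<otimes>\<^bsub>sec Y (W \<inter> torus)\<^esub> \<psi>r W (d * d') =
      (rT W s \<otimes>\<^bsub>sec Y (W \<inter> torus)\<^esub> \<psi>r W d) \<otimes>\<^bsub>sec Y (W \<inter> torus)\<^esub> \<psi>r W d' \<oplus>\<^bsub>sec Y (W \<inter> torus)\<^esub>
      (rT W u \<otimes>\<^bsub>sec Y (W \<inter> torus)\<^esub> \<psi>r W d') \<otimes>\<^bsub>sec Y (W \<inter> torus)\<^esub> \<psi>r W d"
    unfolding T.Yres_add[OF W conjunct1[OF WT] conjunct1[OF conjunct2[OF WT]] l'(1,7)] \<psi>r_mult[OF W l'(3,9)]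
    using k by (simp add: C.l_distr C.r_distr C.m_ac)
  also have "\<dots> = \<psi>r W (c * d' + c' * d)" using l' by (simp add: \<psi>r_mult[OF W] \<psi>r_add[OF W] Rg.mult_mem)
  finally have "lifts W (c * d' + c' * d) (d * d') (s \<oplus>\<^bsub>sec Y W\<^esub> u)"
    unfolding lifts_def using l' dd regular_add Rg.mult_mem Rg.add_mem by auto
  then show "\<Psi> W (x \<oplus>\<^bsub>sec X W\<^esub> y) = \<Psi> W x \<oplus>\<^bsub>sec Y W\<^esub> \<Psi> W y"
    unfolding l(1,3) sect_add[OF l'(5,11)] using \<Psi>_eqI[OF W] by (simp add: s_def u_def l(1,3))
next
  note WT = inter_torus[OF W]
  interpret C: cring "sec Y (W \<inter> torus)" using WT T.cringY by blast
  interpret YW: cring "sec Y W" by (rule T.cringY[OF W])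
  have "lifts W 1 1 \<one>\<^bsub>sec Y W\<^esub>"
    unfolding lifts_def using WT W Rg.one_mem regular_one_zero \<psi>r_closed[OF W Rg.one_mem]
    by (simp add: T.Yres_one)
  then show "\<Psi> W \<one>\<^bsub>sec X W\<^esub> = \<one>\<^bsub>sec Y W\<^esub>" unfolding sect_one using \<Psi>_eqI[OF W] by blast
qed

lemma \<Psi>_res:
  assumes W: "opn W" "opn Z" "Z \<subseteq> W" and b: "b \<in> carrier (sec X W)"
  shows "\<Psi> Z (res X W Z b) = res Y W Z (\<Psi> W b)"
proof -
  obtain c d where l: "b = sect W c d" "lifts W c d (\<Psi> W b)" using \<Psi>_cases[OF W(1) b] .
  have "res X W Z b = sect Z c d" unfolding l(1) by (rule res_X[OF W(3)])
  then show ?thesis using \<Psi>_eqI[OF W(2) lifts_res[OF W l(2)]] by simp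
qed

lemma pi_\<Psi>:
  assumes W: "opn W" and b: "b \<in> carrier (sec X W)"
  shows "pi W (\<Psi> W b) = b"
proof (cases "W = {}")
  case True
  have "pi W (\<Psi> W b) \<in> carrier (sec X W)"
    by (rule T.pi_closed[OF W ring_hom_closed[OF \<Psi>_ring_hom[OF W] b]])
  then show ?thesis using True by (intro T.X.separated[OF W _ b]) auto
next
  case False
  note WT = inter_torus[OF W]
  obtain c d where l: "b = sect W c d" "lifts W c d (\<Psi> W b)" using \<Psi>_cases[OF W b] .
  define s where "s = \<Psi> W b"
  have l': "s \<in> A W" "c \<in> Rg {0}" "d \<in> Rg {0}" "d \<noteq> 0" "regular W c d"
     "rT W s \<otimes>\<^bsub>sec Y (W \<inter> torus)\<^esub> \<psi>r W d = \<psi>r W c" using l(2) unfolding lifts_def s_def by blast+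
  obtain f g where fg: "regular W f g" "pi W s = sect W f g" using sectionE[OF W T.pi_closed[OF W l'(1)]] .
  have ne: "W \<inter> torus \<noteq> {}" using eta_mem[OF W False] eta_mem[OF opn_torus torus_ne] by auto
  have p: "pi (W \<inter> torus) (\<psi>r W e) = sect (W \<inter> torus) e 1" if "e \<in> Rg {0}" for e
    using WT that by (simp add: T.pi_res[OF opn_torus _ _ \<psi>_closed] pi_\<psi> res_X)
  have r: "regular (W \<inter> torus) f g" "regular (W \<inter> torus) d 1" "regular (W \<inter> torus) c 1"
    using regular_subset fg regT l' WT by blast+
  have oT: "opn (W \<inter> torus)" using WT by auto
  have "sect (W \<inter> torus) f g \<otimes>\<^bsub>sec X (W \<inter> torus)\<^esub> sect (W \<inter> torus) d 1 = pi (W \<inter> torus) (rT W s \<otimes>\<^bsub>sec Y (W \<inter> torus)\<^esub> \<psi>r W d)"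
    using T.pi_mult[OF oT rT_closed[OF W l'(1)] \<psi>r_closed[OF W l'(3)]] p[OF l'(3)] WT
      T.pi_res[OF W _ _ l'(1), of "W \<inter> torus"] fg(2) res_X[of "W \<inter> torus" W f g] by simp
  also have "\<dots> = sect (W \<inter> torus) c 1" unfolding l'(6) by (rule p[OF l'(2)])
  finally have "sect (W \<inter> torus) (f * d) (g * 1) = sect (W \<inter> torus) c 1" unfolding sect_mult[OF r(1,2)] .
  then have "f * d = c * g" using sect_eq_iff[OF oT ne regular_mult[OF r(1,2)] r(3)] by simp
  then have "sect W f g = sect W c d" using fg l' by (intro sect_cong) (auto simp: regular_def)
  then show ?thesis using fg l(1) by (simp add: s_def)
qed

lemma \<Psi>_str: "\<Psi> (carr X) (str X c) = \<kappa>0 c"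
proof -
  have o: "opn (carr X)" by simp
  have T: "carr X \<inter> torus = torus" using openin_subset[OF opn_torus] by auto
  have Tc: "torus \<subseteq> carr X" using T by auto
  interpret C: cring "sec Y torus" using opn_torus T.cringY by blast
  have cR: "Poly_Mapping.single 0 c \<in> Rg \<sigma>" for \<sigma>
    using dual_monoid_zero by (auto simp: Rg_def monoid_algebra_def)
  have id: "res Y torus torus w = w" if "w \<in> A torus" for w by (rule T.Yres_id[OF opn_torus that])
  have k: "\<kappa>T c \<in> A torus" unfolding \<kappa>T_def by (rule T.YresC[OF o opn_torus Tc \<kappa>0_closed])
  have "lifts (carr X) (Poly_Mapping.single 0 c) 1 (\<kappa>0 c)"
    unfolding lifts_def T
    using \<kappa>0_closed cR Rg.one_mem regular_const[OF cR] \<psi>_spec k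
    by (simp add: id \<psi>_one \<kappa>T_def[symmetric])
  then show ?thesis unfolding str_X by (rule \<Psi>_eqI[OF o])
qed

end

theorem (in rigid_fan) rigid_toric_variety: "rigid TYPE('q) TYPE('t) (toric_variety N \<Sigma>)"
  unfolding rigid_def
proof (intro allI impI)
  fix Y :: "(complex \<times> complex, 'q, 't) rspace_over" and i ic
  assume def: "first_order_deformation X Y i ic"
  interpret D: deformation X Y i ic
  proof
    show "ringed_space X" by (rule ringed_space_X)
    have "Poly_Mapping.single 0 c \<in> Rg \<sigma>" for \<sigma> c
      using dual_monoid_zero by (auto simp: Rg_def monoid_algebra_def)
    then show "str X \<in> UNIV \<rightarrow> carrier (sec X (carr X))"
      unfolding str_X by (auto intro!: sect_in_carrier regular_const)
    show "str X 0 = \<zero>\<^bsub>sec X (carr X)\<^esub>" unfolding str_X by (simp add: sect_zero)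
  qed (rule def)
  interpret Dc: ring_hom_cring complex_dual_numbers "sec Y (carr Y)" "str Y"
    using D.str cring_complex_dual_numbers D.RY.cring_sec[OF D.RY.op_carr]
    by (intro ring_hom_cring.intro ring_hom_cring_axioms.intro)
  interpret R: rigid_thickening N \<Sigma> V Vs S D.Y' "\<lambda>V. ic (i ` V)" "str Y (0, 1)" "\<lambda>c. str Y (c, 0)"
  proof
    fix c d
    have eq: "sec D.Y' (carr X) = sec Y (carr Y)" by (simp add: transport_simps D.im(2))
    show "str Y (c, 0) \<in> carrier (sec D.Y' (carr X))" unfolding eq using ring_hom_closed[OF D.str] by simp
    show "str Y (c + d, 0) = str Y (c, 0) \<oplus>\<^bsub>sec D.Y' (carr X)\<^esub> str Y (d, 0)"
      unfolding eq using ring_hom_add[OF D.str, of "(c, 0)" "(d, 0)"] by simp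
    show "str Y (c * d, 0) = str Y (c, 0) \<otimes>\<^bsub>sec D.Y' (carr X)\<^esub> str Y (d, 0)"
      unfolding eq using ring_hom_mult[OF D.str, of "(c, 0)" "(d, 0)"] by simp
    show "str Y (1, 0) = \<one>\<^bsub>sec D.Y' (carr X)\<^esub>"
      unfolding eq using ring_hom_one[OF D.str] by simp
    show "ic (i ` carr X) (str Y (c, 0)) = str X c" using D.icstr by (simp add: D.im(2))
  qed
  show "deformation_iso X Y i ic (trivial_deformation X) (\<lambda>x. x) (\<lambda>_. fst)"
    by (rule D.deformation_isoI[of R.\<Psi>])
       (use R.\<Psi>_ring_hom R.\<Psi>_res R.pi_\<Psi> R.\<Psi>_str in auto)
qed

section \<open>Edges and vertex figures of polytopes\<close>

text \<open>The vertex sets of faces, for \<open>W\<close> the vertices of a polytope, expressed by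
  minima of linear functionals. \<open>W\<close> itself is included, by the zero functional, and for
  finite \<open>W\<close> so is the empty set.\<close>

definition exposed :: "'a::real_inner set \<Rightarrow> 'a set \<Rightarrow> bool" where
  "exposed W A \<longleftrightarrow> (\<exists>k r. (\<forall>x\<in>W. r \<le> k \<bullet> x) \<and> A = {x \<in> W. k \<bullet> x = r})"

lemma exposedI: "\<lbrakk>\<And>x. x \<in> W \<Longrightarrow> r \<le> k \<bullet> x; A = {x \<in> W. k \<bullet> x = r}\<rbrakk> \<Longrightarrow> exposed W A"
  unfolding exposed_def by blast

lemma exposedE:
  assumes "exposed W A"
  obtains k r where "\<And>x. x \<in> W \<Longrightarrow> r \<le> k \<bullet> x" "A = {x \<in> W. k \<bullet> x = r}"
  using assms unfolding exposed_def by blast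

lemma exposed_subset: "exposed W A \<Longrightarrow> A \<subseteq> W"
  by (auto elim: exposedE)

lemma exposed_restrict:
  assumes "exposed W A" "A \<subseteq> F" "F \<subseteq> W"
  shows "exposed F A"
proof -
  obtain k r where k: "\<And>x. x \<in> W \<Longrightarrow> r \<le> k \<bullet> x" "A = {x \<in> W. k \<bullet> x = r}" using assms(1) exposedE by blast
  then show ?thesis using assms(2,3) by (intro exposedI[of F r k]) auto
qed

lemma exposedE_strict:
  assumes "exposed W A"
  obtains k r where "\<And>x. x \<in> A \<Longrightarrow> k \<bullet> x = r" "\<And>x. x \<in> W - A \<Longrightarrow> r < k \<bullet> x"
proof -
  obtain k r where k: "\<And>x. x \<in> W \<Longrightarrow> r \<le> k \<bullet> x" "A = {x \<in> W. k \<bullet> x = r}" using assms exposedE by blast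
  have "r < k \<bullet> x" if "x \<in> W - A" for x using k(1)[of x] that k(2) by (cases "k \<bullet> x = r") auto
  then show thesis using that[of k r] k(2) by blast
qed

text \<open>A face of a face is a face: a large multiple \<open>K\<close> of the functional of
  \<open>A\<close>, added to that of \<open>B\<close>, decides the comparison outside
  \<open>A\<close>. \<open>K\<close> exceeds each of the finitely many critical ratios because it is
  1 plus their sum.\<close>

lemma exposed_trans:
  assumes fin: "finite W" and A: "exposed W A" and B: "exposed A B"
  shows "exposed W B"
proof -
  obtain k r where k: "\<And>x. x \<in> W \<Longrightarrow> r \<le> k \<bullet> x" "A = {x \<in> W. k \<bullet> x = r}" using A exposedE by blast
  obtain l s where l: "\<And>x. x \<in> A \<Longrightarrow> s \<le> l \<bullet> x" "B = {x \<in> A. l \<bullet> x = s}" using B exposedE by blast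
  define K where "K = 1 + (\<Sum>x\<in>W - A. \<bar>s - l \<bullet> x\<bar> / (k \<bullet> x - r))"
  have pos: "0 < k \<bullet> x - r" if "x \<in> W - A" for x using that k(1)[of x] k(2) by auto
  have big: "s - l \<bullet> x < K * (k \<bullet> x - r)" if x: "x \<in> W - A" for x
  proof -
    have "\<bar>s - l \<bullet> x\<bar> / (k \<bullet> x - r) \<le> (\<Sum>x\<in>W - A. \<bar>s - l \<bullet> x\<bar> / (k \<bullet> x - r))"
      using fin x by (intro member_le_sum) (auto dest: pos intro!: divide_nonneg_nonneg less_imp_le[OF pos])
    then have "\<bar>s - l \<bullet> x\<bar> / (k \<bullet> x - r) < K" unfolding K_def by linarith
    then have "\<bar>s - l \<bullet> x\<bar> < K * (k \<bullet> x - r)" using pos[OF x] by (simp add: divide_less_eq)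
    then show ?thesis by linarith
  qed
  have e: "(K *\<^sub>R k + l) \<bullet> x = K * (k \<bullet> x - r) + l \<bullet> x + K * r" for x by (simp add: inner_add_left algebra_simps)
  have Bx: "x \<in> B \<longleftrightarrow> (K *\<^sub>R k + l) \<bullet> x = K * r + s" and ge: "K * r + s \<le> (K *\<^sub>R k + l) \<bullet> x" if x: "x \<in> W" for x
  proof -
    have *: "(x \<in> B \<longleftrightarrow> (K *\<^sub>R k + l) \<bullet> x = K * r + s) \<and> K * r + s \<le> (K *\<^sub>R k + l) \<bullet> x"
    proof (cases "x \<in> A")
      case True
      then have "k \<bullet> x = r" using k(2) by simp
      then show ?thesis unfolding e using l True by auto
    next
      case False
      then show ?thesis unfolding e using big[of x] x l(2) by auto
    qed
    then show "x \<in> B \<longleftrightarrow> (K *\<^sub>R k + l) \<bullet> x = K * r + s" "K * r + s \<le> (K *\<^sub>R k + l) \<bullet> x" by auto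
  qed
  have "B \<subseteq> W" using k(2) l(2) by auto
  then show ?thesis using Bx ge by (intro exposedI[of W "K * r + s" "K *\<^sub>R k + l"]) auto
qed

text \<open>The supporting functional of \<open>C\<close> is tilted by \<open>c\<close> as far as
  possible: with \<open>m\<close> the least slope of \<open>c\<close> against \<open>k\<close> over
  \<open>C\<close>, the functional \<open>c - m *\<^sub>R k\<close> is minimal exactly on
  \<open>C\<close> and on the points that attain the slope.\<close>

lemma exposed_min_ratio:
  assumes fin: "finite W" and k: "\<And>x. x \<in> W \<Longrightarrow> r \<le> k \<bullet> x" and C: "C = {x \<in> W. k \<bullet> x = r}"
    and c: "\<And>x. x \<in> C \<Longrightarrow> c \<bullet> x = \<gamma>" and ne: "W - C \<noteq> {}"
  obtains m B where "exposed W B" "C \<subset> B" "\<And>x. x \<in> W - C \<Longrightarrow> m \<le> (c \<bullet> x - \<gamma>) / (k \<bullet> x - r)"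
    "\<And>x. x \<in> W - C \<Longrightarrow> x \<in> B \<longleftrightarrow> (c \<bullet> x - \<gamma>) / (k \<bullet> x - r) = m"
proof -
  define f where "f x = (c \<bullet> x - \<gamma>) / (k \<bullet> x - r)" for x
  define m where "m = Min (f ` (W - C))"
  have m: "m \<le> f x" if "x \<in> W - C" for x using fin that unfolding m_def by auto
  have "m \<in> f ` (W - C)" unfolding m_def using fin ne by (intro Min_in) auto
  then obtain x0 where x0: "x0 \<in> W - C" "f x0 = m" by blast
  have pos: "0 < k \<bullet> x - r" if "x \<in> W - C" for x using that k[of x] C by auto
  define B where "B = {x \<in> W. (c - m *\<^sub>R k) \<bullet> x = \<gamma> - m * r}"
  have e: "(c - m *\<^sub>R k) \<bullet> x = \<gamma> - m * r + (c \<bullet> x - \<gamma> - m * (k \<bullet> x - r))" for x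
    by (simp add: inner_diff_left algebra_simps)
  have zero: "c \<bullet> x - \<gamma> - m * (k \<bullet> x - r) = 0" if "x \<in> C" for x using that c C by auto
  have sgn: "(c \<bullet> x - \<gamma> - m * (k \<bullet> x - r) = 0 \<longleftrightarrow> f x = m) \<and> 0 \<le> c \<bullet> x - \<gamma> - m * (k \<bullet> x - r)" if "x \<in> W - C" for x
    using pos[OF that] m[OF that] unfolding f_def by (auto simp: field_simps)
  have "exposed W B"
  proof (rule exposedI[OF _ B_def])
    fix x assume "x \<in> W"
    then show "\<gamma> - m * r \<le> (c - m *\<^sub>R k) \<bullet> x" unfolding e using sgn[of x] zero[of x] by (cases "x \<in> C") auto
  qed
  moreover have iff: "x \<in> B \<longleftrightarrow> f x = m" if "x \<in> W - C" for x
    using sgn[OF that] that unfolding B_def e by auto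
  moreover have "C \<subset> B"
  proof -
    have "C \<subseteq> B" unfolding B_def e using zero C by auto
    then show ?thesis using iff[OF x0(1)] x0 by auto
  qed
  ultimately show thesis using that m unfolding f_def by blast
qed

text \<open>The face of a minimal slope over \<open>C\<close>: geometrically, a face one dimension larger that leaves \<open>C\<close>
  in a descent direction.  It yields both improving edges and paths in vertex figures.\<close>

lemma exposed_descent:
  fixes W :: "'a::euclidean_space set"
  assumes fin: "finite W" and C: "exposed W C" and c: "\<And>x. x \<in> C \<Longrightarrow> c \<bullet> x = \<gamma>"
    and w: "w \<in> W" "c \<bullet> w < \<gamma>"
  obtains B x1 where "exposed W B" "C \<subseteq> B" "x1 \<in> B - C" "B \<subseteq> span (insert x1 C)"
    "\<And>x. x \<in> B - C \<Longrightarrow> c \<bullet> x < \<gamma>"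
proof -
  obtain k r where k: "\<And>x. x \<in> W \<Longrightarrow> r \<le> k \<bullet> x" and Ck: "C = {x \<in> W. k \<bullet> x = r}" using C exposedE by blast
  have pos: "0 < k \<bullet> x - r" if "x \<in> W - C" for x using that k[of x] Ck by auto
  have wC: "w \<in> W - C" using w c[of w] by auto
  have Wne: "W - C \<noteq> {}" using wC by auto
  obtain m B0 where B0: "exposed W B0" "C \<subset> B0" "\<And>x. x \<in> W - C \<Longrightarrow> m \<le> (c \<bullet> x - \<gamma>) / (k \<bullet> x - r)"
    "\<And>x. x \<in> W - C \<Longrightarrow> x \<in> B0 \<longleftrightarrow> (c \<bullet> x - \<gamma>) / (k \<bullet> x - r) = m"
    by (rule exposed_min_ratio[OF fin k Ck c Wne]) (assumption | rule that)+
  have "(c \<bullet> w - \<gamma>) / (k \<bullet> w - r) < 0" using pos[OF wC] w by (simp add: divide_neg_pos)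
  then have m0: "m < 0" using B0(3)[OF wC] by linarith
  have neg: "c \<bullet> x < \<gamma>" if "x \<in> B0 - C" for x
  proof -
    have x: "x \<in> W - C" using that exposed_subset[OF B0(1)] by blast
    have "(c \<bullet> x - \<gamma>) / (k \<bullet> x - r) < 0" using B0(4)[OF x] that m0 by auto
    then show ?thesis using pos[OF x] by (simp add: divide_less_0_iff)
  qed
  \<comment> \<open>A smallest face strictly above \<open>C\<close> inside \<open>B0\<close> is
    spanned by \<open>C\<close> and one further vertex, as shown below.\<close>
  define Q where "Q B \<longleftrightarrow> exposed W B \<and> C \<subset> B \<and> B \<subseteq> B0" for B
  obtain B where B: "Q B" and min: "\<And>B'. Q B' \<Longrightarrow> card B \<le> card B'"
    using ex_has_least_nat[of Q B0 card] B0 unfolding Q_def by blast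
  have BW: "B \<subseteq> W" using B exposed_subset unfolding Q_def by auto
  then have fB: "finite B" using fin finite_subset by auto
  note BW = BW fB
  obtain x1 where x1: "x1 \<in> B - C" using B unfolding Q_def by blast
  have "x2 \<in> span (insert x1 C)" if x2: "x2 \<in> B" for x2
  proof (cases "x2 \<in> C")
    case True
    then show ?thesis by (intro span_base) auto
  next
    case False
    have x12: "x1 \<in> W - C" "x2 \<in> W - C" using x1 x2 False BW by auto
    \<comment> \<open>Points are lifted to height 1, so that linear functionals on pairs are affine
      ones on points. \<open>u x\<close> is the lift of \<open>x\<close>, scaled to distance 1 from
      \<open>C\<close> as measured by \<open>k\<close>. If two such directions in \<open>B\<close>
      differed modulo \<open>C\<close>, an affine functional vanishing on \<open>C\<close> would
      give them different slopes, and the face of least slope would contradict the minimality of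
      \<open>B\<close>.\<close>
    define T where "T = span ((\<lambda>x. (x, 1::real)) ` C)"
    define u where "u x = (1 / (k \<bullet> x - r)) *\<^sub>R (x, 1::real)" for x
    have "u x2 - u x1 \<in> T"
    proof (rule ccontr)
      assume n: "u x2 - u x1 \<notin> T"
      obtain y z where yz: "y \<in> T" "\<And>w. w \<in> T \<Longrightarrow> orthogonal z w" "u x2 - u x1 = y + z"
        by (rule orthogonal_subspace_decomp_exists[of "(\<lambda>x. (x, 1::real)) ` C" "u x2 - u x1", folded T_def])
          (rule that)
      have z0: "z \<noteq> 0" using n yz by auto
      have "z \<bullet> (u x2 - u x1) = z \<bullet> z" unfolding yz(3) using yz(2)[OF yz(1)] by (simp add: inner_add_right orthogonal_def)
      then have ne: "z \<bullet> u x2 \<noteq> z \<bullet> u x1" using z0 by (auto simp: inner_diff_right)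
      have zx: "z \<bullet> (x, 1::real) = fst z \<bullet> x + snd z" for x by (simp add: inner_prod_def)
      have zC: "fst z \<bullet> x = - snd z" if "x \<in> C" for x
      proof -
        have "(x, 1) \<in> T" unfolding T_def using that by (intro span_base) auto
        then have "fst z \<bullet> x + snd z = 0" using yz(2) unfolding orthogonal_def zx[symmetric] by blast
        then show ?thesis by linarith
      qed
      have CB: "C = {x \<in> B. k \<bullet> x = r}" using Ck BW B unfolding Q_def by auto
      have kB: "r \<le> k \<bullet> x" if "x \<in> B" for x using k that BW by auto
      have BC: "B - C \<noteq> {}" using x1 by auto
      obtain m' B1 where B1: "exposed B B1" "C \<subset> B1" "\<And>x. x \<in> B - C \<Longrightarrow> m' \<le> (fst z \<bullet> x - - snd z) / (k \<bullet> x - r)"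
        "\<And>x. x \<in> B - C \<Longrightarrow> x \<in> B1 \<longleftrightarrow> (fst z \<bullet> x - - snd z) / (k \<bullet> x - r) = m'"
        by (rule exposed_min_ratio[OF BW(2) kB CB zC BC]) (assumption | rule that)+
      have zu: "z \<bullet> u x = (fst z \<bullet> x - - snd z) / (k \<bullet> x - r)" for x by (simp add: u_def inner_prod_def add_divide_distrib)
      have "x1 \<notin> B1 \<or> x2 \<notin> B1" using B1(4)[of x1] B1(4)[of x2] x1 x2 False ne unfolding zu[symmetric] by auto
      moreover have B1B: "B1 \<subseteq> B" using exposed_subset[OF B1(1)] .
      ultimately have "B1 \<subset> B" using x1 x2 by auto
      then have "card B1 < card B" using BW(2) by (intro psubset_card_mono) auto
      moreover have "Q B1" using B B1(2) B1B exposed_trans[OF fin _ B1(1)] unfolding Q_def by auto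
      ultimately show False using min by fastforce
    qed
    then have "fst (u x2 - u x1) \<in> fst ` T" by blast
    moreover have "fst ` T = span C" unfolding T_def linear_span_image[OF linear_fst, symmetric] by (simp add: image_image)
    ultimately have 1: "(1 / (k \<bullet> x2 - r)) *\<^sub>R x2 - (1 / (k \<bullet> x1 - r)) *\<^sub>R x1 \<in> span (insert x1 C)"
      using span_mono[of C "insert x1 C"] by (auto simp: u_def)
    have "(1 / (k \<bullet> x1 - r)) *\<^sub>R x1 \<in> span (insert x1 C)" by (intro span_scale span_base) auto
    from span_add[OF 1 this] have "(1 / (k \<bullet> x2 - r)) *\<^sub>R x2 \<in> span (insert x1 C)" by simp
    from span_scale[OF this, of "k \<bullet> x2 - r"] show ?thesis using pos[OF x12(2)] by simp
  qed
  then show thesis using that[of B x1] B x1 neg unfolding Q_def by blast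
qed

text \<open>On an independent set values can be prescribed: 0 on \<open>A\<close> and 1 on the
  rest.\<close>

lemma exposed_independent:
  fixes B :: "'a::euclidean_space set"
  assumes "independent B" "A \<subseteq> B"
  shows "exposed B A"
proof -
  obtain f where f: "linear f" "\<And>x. x \<in> B \<Longrightarrow> f x = (if x \<in> A then 0 else 1 :: real)"
    using linear_independent_extend[OF assms(1), of "\<lambda>x. if x \<in> A then 0 else 1 :: real"] by auto
  have "f x = adjoint f 1 \<bullet> x" for x using adjoint_works[OF f(1), of x 1] by (simp add: inner_commute)
  then have "adjoint f 1 \<bullet> x = (if x \<in> A then 0 else 1)" if "x \<in> B" for x using f(2)[OF that] by simp
  then show ?thesis using assms(2) by (intro exposedI[of B 0 "adjoint f 1"]) (auto split: if_splits)
qed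

text \<open>Connectedness by descent: each point other than \<open>v0\<close> has a lower one with
  the same value of \<open>g\<close>, and in a finite set the descent has to end in
  \<open>v0\<close>.\<close>

lemma finite_descent_eq:
  fixes f :: "'a \<Rightarrow> real"
  assumes fin: "finite W" and step: "\<And>v. \<lbrakk>v \<in> W; v \<noteq> v0\<rbrakk> \<Longrightarrow> \<exists>x\<in>W. f x < f v \<and> g x = g v"
    and v: "v \<in> W"
  shows "g v = g v0"
  using v
proof (induction "card {x \<in> W. f x < f v}" arbitrary: v rule: less_induct)
  case less
  show ?case
  proof (cases "v = v0")
    case False
    then obtain x where x: "x \<in> W" "f x < f v" "g x = g v" using step less.prems by blast
    have "{y \<in> W. f y < f x} \<subset> {y \<in> W. f y < f v}" using x by auto
    then have "card {y \<in> W. f y < f x} < card {y \<in> W. f y < f v}" using fin by (intro psubset_card_mono) auto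
    then show ?thesis using less.hyps[OF _ x(1)] x(3) by simp
  qed simp
qed

text \<open>The axiom \<open>balanced\<close> expresses that the origin is in the relative interior
  of the hull. It makes every nonempty face on which some functional is negative a proper one
  (\<open>negative_proper\<close>), so that \<open>simplicial\<close> applies to it.\<close>

locale simplicial_skeleton =
  fixes V :: "'a::euclidean_space set"
  assumes finite_V: "finite V"
    and vertex: "v \<in> V \<Longrightarrow> exposed V {v}"
    and balanced: "\<lbrakk>\<And>x. x \<in> V \<Longrightarrow> 0 \<le> h \<bullet> x; v \<in> V\<rbrakk> \<Longrightarrow> h \<bullet> v = 0"
    and simplicial: "\<lbrakk>exposed V A; A \<noteq> V; dim A \<le> 3\<rbrakk> \<Longrightarrow> independent A"
begin

lemma negative_proper:
  assumes "A \<noteq> {}" "\<And>x. x \<in> A \<Longrightarrow> q \<bullet> x < 0"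
  shows "A \<noteq> V"
proof
  assume A: "A = V"
  then obtain v where v: "v \<in> V" using assms(1) by blast
  have "(- q) \<bullet> v = 0" using assms(2) A v by (intro balanced) (auto simp: less_imp_le)
  then show False using assms(2)[of v] A v by simp
qed

text \<open>Descent from the vertex \<open>v\<close> produces a face that spans dimension at most 2.
  It is proper because \<open>q\<close> is negative on it, so it is independent and has just the two
  vertices \<open>v\<close> and \<open>x\<close>. This is the step of the simplex method.\<close>

lemma improving_edge:
  assumes F: "exposed V F" and v: "v \<in> F" and w: "w \<in> F" "c \<bullet> w < c \<bullet> v"
    and neg: "\<And>x. \<lbrakk>x \<in> F; x = v \<or> c \<bullet> x < c \<bullet> v\<rbrakk> \<Longrightarrow> q \<bullet> x < 0"
  obtains x where "x \<in> F" "c \<bullet> x < c \<bullet> v" "exposed V {v, x}" "{v, x} \<noteq> V"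
proof -
  have FV: "F \<subseteq> V" "finite F" using exposed_subset[OF F] finite_V finite_subset by auto
  have vF: "exposed F {v}" by (rule exposed_restrict[OF vertex _ FV(1)]) (use v FV in auto)
  obtain B x1 where B: "exposed F B" "{v} \<subseteq> B" "x1 \<in> B - {v}" "B \<subseteq> span (insert x1 {v})"
    "\<And>x. x \<in> B - {v} \<Longrightarrow> c \<bullet> x < c \<bullet> v"
    by (rule exposed_descent[OF FV(2) vF _ w]) (auto intro: that)
  have BF: "B \<subseteq> F" using exposed_subset[OF B(1)] .
  have BV: "exposed V B" using exposed_trans[OF finite_V F B(1)] .
  have ne: "B \<noteq> V" using B BF neg by (intro negative_proper[of B q]) auto
  have d: "dim B \<le> 2"
  proof -
    have "dim B \<le> dim (insert x1 {v})" using dim_subset[OF B(4)] by (simp only: dim_span)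
    also have "\<dots> \<le> card (insert x1 {v})" by (rule dim_le_card') auto
    also have "\<dots> \<le> 2" by (simp add: card_insert_if)
    finally show ?thesis .
  qed
  have "independent B" using simplicial[OF BV ne] d by simp
  then have c2: "card B \<le> 2" using d by (simp add: dim_eq_card_independent)
  have fB: "finite B" using BF FV finite_subset by auto
  have "{v, x1} \<subseteq> B" "card {v, x1} = 2" using B by auto
  then have "{v, x1} = B" using c2 fB card_subset_eq by (metis card_mono le_antisym)
  then show thesis using that[of x1] B BF BV ne by auto
qed

text \<open>A step in the vertex figure of \<open>F\<close> at \<open>v\<close>, from the edge to
  \<open>w\<close> across a triangle to the edge to \<open>x\<close>. Descent from the edge gives a
  face that spans dimension at most 3, hence a triangle, and its side \<open>{v, x}\<close> is a
  face because the triangle is independent.\<close>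

lemma link_step:
  assumes F: "exposed V F" and neg: "\<And>x. x \<in> F \<Longrightarrow> q \<bullet> x < 0"
    and v: "v \<in> F" and w: "w \<in> F" "w \<noteq> v" "exposed V {v, w}"
    and c: "c \<bullet> w = c \<bullet> v" "w0 \<in> F" "c \<bullet> w0 < c \<bullet> v"
  obtains x where "x \<in> F" "x \<noteq> v" "c \<bullet> x < c \<bullet> v" "exposed V {v, x}" "exposed V {v, w, x}" "dim {v, w, x} \<le> 3"
    "{v, w, x} \<noteq> V" "{v, x} \<noteq> V"
proof -
  have FV: "F \<subseteq> V" "finite F" using exposed_subset[OF F] finite_V finite_subset by auto
  have vF: "exposed F {v, w}" by (rule exposed_restrict[OF w(3) _ FV(1)]) (use v w in auto)
  obtain B x1 where B: "exposed F B" "{v, w} \<subseteq> B" "x1 \<in> B - {v, w}" "B \<subseteq> span (insert x1 {v, w})"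
    "\<And>x. x \<in> B - {v, w} \<Longrightarrow> c \<bullet> x < c \<bullet> v"
    by (rule exposed_descent[OF FV(2) vF _ c(2,3)]) (use c(1) in \<open>auto intro: that\<close>)
  have BF: "B \<subseteq> F" using exposed_subset[OF B(1)] .
  have BV: "exposed V B" using exposed_trans[OF finite_V F B(1)] .
  have ne: "B \<noteq> V" using B BF neg by (intro negative_proper[of B q]) auto
  have d: "dim B \<le> 3"
  proof -
    have "dim B \<le> dim (insert x1 {v, w})" using dim_subset[OF B(4)] by (simp only: dim_span)
    also have "\<dots> \<le> card (insert x1 {v, w})" by (rule dim_le_card') auto
    also have "\<dots> \<le> 3" by (simp add: card_insert_if)
    finally show ?thesis .
  qed
  have ind: "independent B" using simplicial[OF BV ne] d by simp
  then have c3: "card B \<le> 3" using d by (simp add: dim_eq_card_independent)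
  have fB: "finite B" using BF FV finite_subset by auto
  have "{v, w, x1} \<subseteq> B" "card {v, w, x1} = 3" using B w(2) by auto
  then have eq: "{v, w, x1} = B" using c3 fB card_subset_eq by (metis card_mono le_antisym)
  have "exposed B {v, x1}" using ind B by (intro exposed_independent) auto
  then have "exposed V {v, x1}" by (rule exposed_trans[OF finite_V BV])
  moreover have "{v, x1} \<noteq> V" using v B BF neg by (intro negative_proper[of _ q]) auto
  ultimately show thesis using that[of x1] B BF BV ne d unfolding eq by auto
qed

text \<open>The conclusion names \<open>d\<close> as 0 or as one of the given vectors, so that it
  inherits any property that these share, such as membership in the span of the lattice.\<close>

theorem ex_compat:
  assumes int: "\<And>v. v \<in> V \<Longrightarrow> q \<bullet> v \<in> \<int>"
    and a: "\<And>A v. \<lbrakk>exposed V A; A \<noteq> V; dim A \<le> 3; v \<in> A\<rbrakk> \<Longrightarrow> compat q v (a A) (a {v})"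
  shows "\<exists>d\<in>insert 0 (a ` {A. exposed V A \<and> A \<noteq> V \<and> A \<noteq> {} \<and> dim A \<le> 3}). \<forall>v\<in>V. compat q v d (a {v})"
proof (cases "\<exists>v\<in>V. q \<bullet> v < 0")
  case False
  then have "compat q v 0 (a {v})" if "v \<in> V" for v using that by (force simp: compat_def)
  then show ?thesis by blast
next
  case True
  have pair: "dim {x, y} \<le> 3" for x y :: 'a
    using dim_le_card'[of "{x, y}"] by (simp add: card_insert_if split: if_splits)
  have int2: "q \<bullet> v \<le> -2 \<or> q \<bullet> v = -1 \<or> 0 \<le> q \<bullet> v" if v: "v \<in> V" for v
  proof -
    obtain z where z: "q \<bullet> v = of_int z" using int[OF v] by (auto elim: Ints_cases)
    have "z \<le> -2 \<or> z = -1 \<or> 0 \<le> z" by linarith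
    then show ?thesis unfolding z by (metis of_int_le_iff of_int_minus of_int_numeral of_int_0_le_iff of_int_1)
  qed
  have single: "exposed V {v} \<and> {v} \<noteq> V \<and> dim {v} \<le> 3" if "v \<in> V" "q \<bullet> v < 0" for v
    using vertex[OF that(1)] negative_proper[of "{v}" q] pair[of v v] that by auto
  have VV: "exposed V V" by (rule exposedI[of V 0 0]) auto
  define \<mu> where "\<mu> = Min ((\<bullet>) q ` V)"
  define F where "F = {x \<in> V. q \<bullet> x = \<mu>}"
  have Vne: "V \<noteq> {}" using True by auto
  have \<mu>: "\<mu> \<le> q \<bullet> x" if "x \<in> V" for x using finite_V that unfolding \<mu>_def by auto
  have F: "exposed V F" by (rule exposedI[OF \<mu> F_def])
  have "\<mu> \<in> (\<bullet>) q ` V" unfolding \<mu>_def using finite_V Vne by (intro Min_in) auto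
  then obtain v0 where v0: "v0 \<in> F" unfolding F_def by auto
  have \<mu>0: "\<mu> < 0" using True \<mu> by fastforce
  have Fneg: "q \<bullet> x < 0" if "x \<in> F" for x using that \<mu>0 unfolding F_def by auto
  have FV: "F \<subseteq> V" "finite F" unfolding F_def using finite_V by auto
  obtain k0 r0 where k0: "\<And>x. x \<in> {v0} \<Longrightarrow> k0 \<bullet> x = r0" "\<And>x. x \<in> V - {v0} \<Longrightarrow> r0 < k0 \<bullet> x"
    by (rule exposedE_strict[OF vertex[of v0]]) (use v0 FV in \<open>auto intro: that\<close>)
  have v0min: "k0 \<bullet> v0 < k0 \<bullet> x" if "x \<in> F" "x \<noteq> v0" for x
    using k0(1)[of v0] k0(2)[of x] that FV by auto
  have edgeF: "\<exists>x\<in>F. k0 \<bullet> x < k0 \<bullet> v \<and> exposed V {v, x} \<and> {v, x} \<noteq> V" if v: "v \<in> F" "v \<noteq> v0" for v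
    by (rule improving_edge[OF F v(1) v0 v0min[OF v], of q]) (use Fneg in blast)+
  show ?thesis
  proof (cases "\<mu> = -1")
    case False
    have \<mu>2: "\<mu> \<le> -2" using int2[of v0] v0 \<mu>0 False unfolding F_def by auto
    have F2: "q \<bullet> x \<le> -2" if "x \<in> F" for x using that \<mu>2 unfolding F_def by auto
    have step: "\<exists>x\<in>F. k0 \<bullet> x < k0 \<bullet> v \<and> a {x} = a {v}" if v: "v \<in> F" "v \<noteq> v0" for v
    proof -
      obtain x where x: "x \<in> F" "k0 \<bullet> x < k0 \<bullet> v" "exposed V {v, x}" "{v, x} \<noteq> V" using edgeF[OF v] by blast
      have "a {v, x} = a {v}" "a {v, x} = a {x}"
        using a[OF x(3,4) pair] F2[OF v(1)] F2[OF x(1)] unfolding compat_def by auto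
      then show ?thesis using x by auto
    qed
    have aF: "a {v} = a {v0}" if "v \<in> F" for v
      using finite_descent_eq[OF FV(2) step that] by simp
    \<comment> \<open>On the face \<open>F\<close> the functional \<open>q\<close> is constant and
      \<open>k0\<close> serves as objective; outside \<open>F\<close> the objective is
      \<open>q\<close> itself. Along each edge with both values at most -2 the vectors at its ends
      agree with that of the edge.\<close>
    define V2 where "V2 = {x \<in> V. q \<bullet> x \<le> -2}"
    have impr: "\<exists>x\<in>V. q \<bullet> x < q \<bullet> v \<and> exposed V {v, x} \<and> {v, x} \<noteq> V" if v: "v \<in> V" "q \<bullet> v < 0" "v \<notin> F" for v
    proof -
      have "q \<bullet> v0 < q \<bullet> v" using v v0 \<mu>[of v] unfolding F_def by auto
      then show ?thesis
        using improving_edge[OF VV v(1), of v0 q q] v0 FV v(2) by (smt (verit) subsetD)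
    qed
    have step2: "\<exists>x\<in>V2. q \<bullet> x < q \<bullet> v \<and> (if x \<in> F then a {v0} else a {x}) = (if v \<in> F then a {v0} else a {v})"
      if v: "v \<in> V2" "v \<notin> F" for v
    proof -
      have "v \<in> V" "q \<bullet> v < 0" using v unfolding V2_def by auto
      from impr[OF this v(2)] obtain x where x: "x \<in> V" "q \<bullet> x < q \<bullet> v" "exposed V {v, x}" "{v, x} \<noteq> V" by blast
      have x2: "q \<bullet> x \<le> -2" "q \<bullet> v \<le> -2" using x v unfolding V2_def by auto
      have "a {v, x} = a {v}" "a {v, x} = a {x}" using a[OF x(3,4) pair] x2 unfolding compat_def by auto
      then have "a {x} = a {v}" by simp
      then show ?thesis using x x2 v(2) aF[of x] unfolding V2_def by (intro bexI[of _ x]) auto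
    qed
    have aV2: "a {v} = a {v0}" if v: "v \<in> V2" for v
      using v
    proof (induction "card {x \<in> V2. q \<bullet> x < q \<bullet> v}" arbitrary: v rule: less_induct)
      case less
      show ?case
      proof (cases "v \<in> F")
        case True
        then show ?thesis by (rule aF)
      next
        case False
        then obtain x where x: "x \<in> V2" "q \<bullet> x < q \<bullet> v"
          "(if x \<in> F then a {v0} else a {x}) = (if v \<in> F then a {v0} else a {v})" using step2[OF less.prems] by blast
        have "{y \<in> V2. q \<bullet> y < q \<bullet> x} \<subset> {y \<in> V2. q \<bullet> y < q \<bullet> v}" using x by auto
        moreover have "finite {y \<in> V2. q \<bullet> y < q \<bullet> v}" using finite_V unfolding V2_def by auto
        ultimately have "card {y \<in> V2. q \<bullet> y < q \<bullet> x} < card {y \<in> V2. q \<bullet> y < q \<bullet> v}" by (intro psubset_card_mono)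
        then have "a {x} = a {v0}" using less.hyps x(1) by blast
        then show ?thesis using x(3) False by (simp split: if_splits)
      qed
    qed
    have "compat q v (a {v0}) (a {v})" if v: "v \<in> V" for v
    proof -
      \<comment> \<open>An improving edge leads from \<open>v\<close> to a vertex with
        \<open>q\<close> at most -2, where the vector of the edge equals \<open>a {v0}\<close>. At
        \<open>v\<close> the edge fixes its vector only up to a multiple of \<open>v\<close>, which
        is all that is required.\<close>
      have "\<exists>c. a {v0} - a {v} = c *\<^sub>R v" if q: "q \<bullet> v = -1"
      proof -
        have "v \<notin> F" using q False unfolding F_def by auto
        then have "\<exists>x\<in>V. q \<bullet> x < q \<bullet> v \<and> exposed V {v, x} \<and> {v, x} \<noteq> V" using q by (intro impr[OF v]) auto
        then obtain x where x: "x \<in> V" "q \<bullet> x < q \<bullet> v" "exposed V {v, x}" "{v, x} \<noteq> V" by blast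
        have x2: "q \<bullet> x \<le> -2" using int2[OF x(1)] x(2) q by auto
        then have "a {v, x} = a {x}" using a[OF x(3,4) pair] unfolding compat_def by auto
        then have "a {v, x} = a {v0}" using aV2[of x] x x2 unfolding V2_def by simp
        then show ?thesis using a[OF x(3,4) pair, of v] q unfolding compat_def by auto
      qed
      then show ?thesis using aV2[of v] v unfolding compat_def V2_def by auto
    qed
    moreover have "a {v0} \<in> a ` {A. exposed V A \<and> A \<noteq> V \<and> A \<noteq> {} \<and> dim A \<le> 3}"
      using single[of v0] v0 FV Fneg by auto
    ultimately show ?thesis by blast
  next
    case True
    have F1: "q \<bullet> x = -1" if "x \<in> F" for x using that True unfolding F_def by auto
    have diff: "\<exists>c. a A - a {v} = c *\<^sub>R v" if "exposed V A" "A \<noteq> V" "dim A \<le> 3" "v \<in> A" "v \<in> F" for A v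
      using a[OF that(1-4)] F1[OF that(5)] unfolding compat_def by auto
    \<comment> \<open>On a common edge the difference of the two vectors is a multiple of
      \<open>v\<close> and also of \<open>w\<close>. Applying \<open>q\<close>, which is -1 at both,
      shows that the two coefficients are equal, and \<open>v \<noteq> w\<close> makes them
      zero.\<close>
    have aeq: "a A = a B" if A: "exposed V A" "A \<noteq> V" "dim A \<le> 3" and B: "exposed V B" "B \<noteq> V" "dim B \<le> 3"
      and vw: "v \<in> A" "w \<in> A" "v \<in> B" "w \<in> B" "v \<in> F" "w \<in> F" "v \<noteq> w" and e: "exposed V {v, w}" for A B v w
    proof -
      obtain c1 c2 c3 c4 where c: "a A - a {v} = c1 *\<^sub>R v" "a A - a {w} = c2 *\<^sub>R w" "a B - a {v} = c3 *\<^sub>R v" "a B - a {w} = c4 *\<^sub>R w"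
        using diff[OF A vw(1,5)] diff[OF A vw(2,6)] diff[OF B vw(3,5)] diff[OF B vw(4,6)] by blast
      have "a A - a B = (c1 - c3) *\<^sub>R v" using c(1,3) by (simp add: algebra_simps)
      moreover have "a A - a B = (c2 - c4) *\<^sub>R w" using c(2,4) by (simp add: algebra_simps)
      ultimately have vw2: "a A - a B = (c1 - c3) *\<^sub>R v" "(c1 - c3) *\<^sub>R v = (c2 - c4) *\<^sub>R w" by auto
      have "q \<bullet> ((c1 - c3) *\<^sub>R v) = q \<bullet> ((c2 - c4) *\<^sub>R w)" using vw2(2) by simp
      then have "c1 - c3 = c2 - c4" using F1[OF vw(5)] F1[OF vw(6)] by simp
      then have "c1 - c3 = 0" using vw2(2) vw(7) by auto
      then show ?thesis using vw2(1) by simp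
    qed
    have link: "a {v, w} = a {v, w0}" if v: "v \<in> F" and w0: "w0 \<in> F" "w0 \<noteq> v" "exposed V {v, w0}"
      and w: "w \<in> F" "w \<noteq> v" "exposed V {v, w}" for v w w0
    proof -
      obtain k r where k: "\<And>x. x \<in> {v, w0} \<Longrightarrow> k \<bullet> x = r" "\<And>x. x \<in> V - {v, w0} \<Longrightarrow> r < k \<bullet> x"
        by (rule exposedE_strict[OF w0(3)]) (rule that)
      obtain e s where e: "\<And>x. x \<in> {v} \<Longrightarrow> e \<bullet> x = s" "\<And>x. x \<in> V - {v} \<Longrightarrow> s < e \<bullet> x"
        by (rule exposedE_strict[OF vertex[of v]]) (use v FV in \<open>auto intro: that\<close>)
      define W where "W = {x \<in> F. x \<noteq> v \<and> exposed V {v, x}}"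
      \<comment> \<open>An objective on the vertex figure at \<open>v\<close>: the slope of
        \<open>k\<close> against \<open>e\<close> depends only on the direction from
        \<open>v\<close>. It is 0 at \<open>w0\<close> and positive at the other vertices of
        \<open>F\<close>, so descent ends at \<open>w0\<close>.\<close>
      define \<rho> where "\<rho> x = (k \<bullet> x - r) / (e \<bullet> x - s)" for x
      have es: "0 < e \<bullet> x - s" if "x \<in> F" "x \<noteq> v" for x using e(2)[of x] that FV by auto
      have kr: "0 < k \<bullet> x - r" if "x \<in> F" "x \<noteq> v" "x \<noteq> w0" for x using k(2)[of x] that FV by auto
      have kv: "k \<bullet> v = r" "k \<bullet> w0 = r" "e \<bullet> v = s" using k(1) e(1) by auto
      have step: "\<exists>x\<in>W. \<rho> x < \<rho> y \<and> a {v, x} = a {v, y}" if y: "y \<in> W" "y \<noteq> w0" for y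
      proof -
        have yF: "y \<in> F" "y \<noteq> v" "exposed V {v, y}" using y unfolding W_def by auto
        have \<rho>0: "0 < \<rho> y" unfolding \<rho>_def using es[OF yF(1,2)] kr[OF yF(1,2) y(2)] by simp
        \<comment> \<open>This functional linearizes the comparison with \<open>y\<close>: for
          \<open>x\<close> in \<open>F\<close> other than \<open>v\<close>,
          \<open>c \<bullet> x < c \<bullet> v\<close> holds exactly if
          \<open>\<rho> x < \<rho> y\<close>.\<close>
        define c where "c = k - \<rho> y *\<^sub>R e"
        have ce: "c \<bullet> x = k \<bullet> x - \<rho> y * (e \<bullet> x)" for x by (simp add: c_def inner_diff_left)
        have c1: "c \<bullet> y = c \<bullet> v"
        proof -
          have "\<rho> y * (e \<bullet> y - s) = k \<bullet> y - r" unfolding \<rho>_def using es[OF yF(1,2)] by simp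
          then show ?thesis unfolding ce kv by (simp add: algebra_simps)
        qed
        have c2: "c \<bullet> w0 < c \<bullet> v" unfolding ce kv using \<rho>0 es[OF w0(1,2)] by (simp add: mult_less_cancel_left)
        obtain x where x: "x \<in> F" "x \<noteq> v" "c \<bullet> x < c \<bullet> v" "exposed V {v, x}" "exposed V {v, y, x}"
          "dim {v, y, x} \<le> 3" "{v, y, x} \<noteq> V" "{v, x} \<noteq> V"
          by (rule link_step[OF F Fneg v yF c1 w0(1) c2]) (assumption | rule that)+
        have "k \<bullet> x - r < \<rho> y * (e \<bullet> x - s)" using x(3) unfolding ce kv by (simp add: algebra_simps)
        then have "\<rho> x < \<rho> y" unfolding \<rho>_def[of x] using es[OF x(1,2)] by (simp add: divide_less_eq)
        moreover have "a {v, x} = a {v, y, x}"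
          using x by (intro aeq[OF x(4,8) pair x(5,7,6), of v x]) (auto simp: v)
        moreover have "a {v, y} = a {v, y, x}"
        proof -
          have "{v, y} \<noteq> V" using Fneg v yF by (intro negative_proper[of _ q]) auto
          then show ?thesis using yF by (intro aeq[OF yF(3) _ pair x(5,7,6), of v y]) (auto simp: v)
        qed
        ultimately show ?thesis using x unfolding W_def by auto
      qed
      have "finite W" unfolding W_def using FV by auto
      then show ?thesis using finite_descent_eq[of W w0 \<rho> "\<lambda>x. a {v, x}" w] step w unfolding W_def by blast
    qed
    show ?thesis
    proof (cases "F = {v0}")
      case F0: True
      have "compat q v (a {v0}) (a {v})" if v: "v \<in> V" for v
      proof (cases "v = v0")
        case True
        then show ?thesis by (auto simp: compat_def)
      next
        case False
        then have "q \<bullet> v \<noteq> -1" "\<not> q \<bullet> v \<le> -2" using v F0 \<mu>[OF v] \<open>\<mu> = -1\<close> unfolding F_def by auto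
        then show ?thesis by (simp add: compat_def)
      qed
      moreover have "a {v0} \<in> a ` {A. exposed V A \<and> A \<noteq> V \<and> A \<noteq> {} \<and> dim A \<le> 3}"
        using single[of v0] v0 FV Fneg by auto
      ultimately show ?thesis by blast
    next
      case nF0: False
      obtain v1 where v1: "v1 \<in> F" "v1 \<noteq> v0" using nF0 v0 by blast
      have nbr: "\<exists>x\<in>F. x \<noteq> v \<and> exposed V {v, x}" if v: "v \<in> F" for v
      proof (cases "v = v0")
        case False
        then show ?thesis using edgeF[OF v] by auto
      next
        case v00: True
        \<comment> \<open>At the minimum \<open>v0\<close> of \<open>k0\<close> no edge improves
          \<open>k0\<close>; the opposite objective supplies a neighbour.\<close>
        have cv: "(- k0) \<bullet> v1 < (- k0) \<bullet> v0" using v0min[OF v1] by simp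
        show ?thesis unfolding v00
          by (rule improving_edge[OF F v0 v1(1) cv, of q]) (use Fneg in auto)
      qed
      \<comment> \<open>By \<open>link\<close> the value does not depend on the neighbour chosen:
        \<open>g v\<close> is the common vector of all edges of \<open>F\<close> at
        \<open>v\<close>, and the two ends of an edge share it.\<close>
      define g where "g v = a {v, SOME x. x \<in> F \<and> x \<noteq> v \<and> exposed V {v, x}}" for v
      have g: "g v = a {v, x}" if vx: "v \<in> F" "x \<in> F" "x \<noteq> v" "exposed V {v, x}" for v x
      proof -
        define y where "y = (SOME x. x \<in> F \<and> x \<noteq> v \<and> exposed V {v, x})"
        have "y \<in> F \<and> y \<noteq> v \<and> exposed V {v, y}" unfolding y_def by (rule someI[of _ x]) (use vx in blast)
        then show ?thesis unfolding g_def y_def[symmetric] using link[OF vx(1,2,3,4)] by blast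
      qed
      have stepg: "\<exists>x\<in>F. k0 \<bullet> x < k0 \<bullet> v \<and> g x = g v" if v: "v \<in> F" "v \<noteq> v0" for v
      proof -
        obtain x where x: "x \<in> F" "k0 \<bullet> x < k0 \<bullet> v" "exposed V {v, x}" using edgeF[OF v] by blast
        have xv: "x \<noteq> v" using x(2) by auto
        have "exposed V {x, v}" using x(3) by (simp add: insert_commute)
        then have "g x = a {x, v}" using g[OF x(1) v(1)] xv by blast
        also have "\<dots> = g v" using g[OF v(1) x(1) xv x(3)] by (simp add: insert_commute)
        finally show ?thesis using x by blast
      qed
      have gF: "g v = g v0" if "v \<in> F" for v using finite_descent_eq[OF FV(2) stepg that] .
      obtain x0 where x0: "x0 \<in> F" "x0 \<noteq> v0" "exposed V {v0, x0}" using nbr[OF v0] by blast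
      have pairV: "{v, x} \<noteq> V" if "v \<in> F" "x \<in> F" for v x using Fneg that by (intro negative_proper[of _ q]) auto
      have "compat q v (g v0) (a {v})" if v: "v \<in> V" for v
      proof (cases "v \<in> F")
        case False
        then have "q \<bullet> v \<noteq> -1" "\<not> q \<bullet> v \<le> -2" using v \<mu>[OF v] \<open>\<mu> = -1\<close> unfolding F_def by auto
        then show ?thesis by (simp add: compat_def)
      next
        case vF: True
        obtain x where x: "x \<in> F" "x \<noteq> v" "exposed V {v, x}" using nbr[OF vF] by blast
        have "g v0 = a {v, x}" using gF[OF vF] g[OF vF x] by simp
        then show ?thesis using a[OF x(3) pairV[OF vF x(1)] pair, of v] by simp
      qed
      moreover have "g v0 \<in> a ` {A. exposed V A \<and> A \<noteq> V \<and> A \<noteq> {} \<and> dim A \<le> 3}"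
        unfolding g[OF v0 x0] using x0 pairV[OF v0 x0(1)] pair[of v0 x0] by (intro imageI) auto
      ultimately show ?thesis by blast
    qed
  qed
qed

end

section \<open>The fan of a directed graph\<close>

lemma convex_cone_hull_empty: "convex_cone hull {} = {0}"
  by (rule hull_unique) (auto simp: convex_cone_iff)

lemma convex_cone_hull_convex_hull: "convex_cone hull (convex hull A) = convex_cone hull A"
proof (rule subset_antisym)
  have "convex hull A \<subseteq> convex_cone hull A" by (intro hull_minimal hull_subset convex_convex_cone_hull)
  then show "convex_cone hull (convex hull A) \<subseteq> convex_cone hull A"
    by (rule hull_minimal) (rule convex_cone_convex_cone_hull)
  show "convex_cone hull A \<subseteq> convex_cone hull (convex hull A)" by (intro hull_mono hull_subset)
qed

lemma convex_cone_hull_nonneg: "\<lbrakk>\<And>a. a \<in> A \<Longrightarrow> 0 \<le> w \<bullet> a; x \<in> convex_cone hull A\<rbrakk> \<Longrightarrow> 0 \<le> w \<bullet> x"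
  using hull_minimal[of A "{x. 0 \<le> w \<bullet> x}" convex_cone] convex_cone_halfspace_ge[of w] by auto

lemma convex_cone_hull_subset_span: "convex_cone hull A \<subseteq> span A"
proof (intro hull_minimal span_superset)
  show "convex_cone (span A)" by (auto simp: convex_cone_iff span_zero span_add span_scale)
qed

lemma dim_convex_cone_hull:
  fixes A :: "'a::euclidean_space set"
  shows "dim (convex_cone hull A) = dim A"
  using dim_subset[OF convex_cone_hull_subset_span[of A]] dim_subset[OF hull_subset[of A convex_cone]] by simp

text \<open>The points that are positive for \<open>w\<close> or lie in the cone over the zero set
  form a convex cone containing \<open>A\<close>, so nothing else of the hull meets the
  hyperplane.\<close>

lemma convex_cone_hull_Int_hyperplane:
  assumes w: "\<And>a. a \<in> A \<Longrightarrow> 0 \<le> w \<bullet> a"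
  shows "convex_cone hull A \<inter> {x. w \<bullet> x = 0} = convex_cone hull {a \<in> A. w \<bullet> a = 0}"
proof -
  let ?C = "convex_cone hull {a \<in> A. w \<bullet> a = 0}"
  let ?T = "{y. 0 < w \<bullet> y \<or> y \<in> ?C}"
  have z: "w \<bullet> y = 0" if "y \<in> ?C" for y
    using convex_cone_hull_nonneg[OF _ that, of w] convex_cone_hull_nonneg[OF _ that, of "- w"] by auto
  have "convex_cone ?T"
  proof -
    have "c *\<^sub>R x \<in> ?T" if "x \<in> ?T" "0 \<le> c" for x c
      using that by (cases "c = 0") (auto simp: convex_cone_hull_contains_0 convex_cone_hull_mul)
    moreover have "x + y \<in> ?T" if "x \<in> ?T" "y \<in> ?T" for x y
      using that z by (auto simp: inner_add_right convex_cone_hull_add)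
    ultimately show ?thesis by (auto simp: convex_cone_iff convex_cone_hull_contains_0)
  qed
  moreover have "A \<subseteq> ?T" using w by (auto simp: less_le intro: hull_inc)
  ultimately have T: "convex_cone hull A \<subseteq> ?T" by (rule hull_minimal[rotated])
  then show ?thesis using z hull_mono[of "{a \<in> A. w \<bullet> a = 0}" A convex_cone] by auto
qed

lemma convex_cone_hull_face:
  assumes w: "\<And>a. a \<in> A \<Longrightarrow> 0 \<le> w \<bullet> a"
  shows "convex_cone hull {a \<in> A. w \<bullet> a = 0} face_of convex_cone hull A"
proof -
  have "convex_cone hull A \<inter> {x. w \<bullet> x = 0} face_of convex_cone hull A"
    by (rule face_of_Int_supporting_hyperplane_ge[OF convex_convex_cone_hull]) (rule convex_cone_hull_nonneg[OF w])
  then show ?thesis using convex_cone_hull_Int_hyperplane[of A w] w by simp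
qed

lemma not_in_span_inner:
  fixes S :: "'a::euclidean_space set"
  assumes "\<And>s. s \<in> S \<Longrightarrow> z \<bullet> s = 0" "z \<bullet> e \<noteq> 0"
  shows "e \<notin> span S"
proof
  assume "e \<in> span S"
  moreover have "span S \<subseteq> {x. z \<bullet> x = 0}" using assms(1) by (intro span_minimal) (auto simp: subspace_hyperplane)
  ultimately show False using assms(2) by auto
qed

section \<open>Arc vectors and the faces of the edge polytope\<close>

definition arc_vec :: "'n::finite \<times> 'n \<Rightarrow> real ^ 'n" where
  "arc_vec e = axis (fst e) 1 - axis (snd e) 1"

lemma inner_arc_vec: "h \<bullet> arc_vec e = h $ fst e - h $ snd e"
  by (simp add: arc_vec_def inner_diff_right inner_axis)

lemma arc_vec_nth: "arc_vec e $ k = (if k = fst e then 1 else 0) - (if k = snd e then 1 else 0)"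
  by (simp add: arc_vec_def axis_def)

lemma inner_arc_vec_arc_vec:
  "arc_vec (a, b) \<bullet> arc_vec (c, d) = (if c = a then 1 else 0) - (if c = b then 1 else 0) - (if d = a then 1 else 0) + (if d = b then 1 else 0)"
  unfolding inner_arc_vec by (simp add: arc_vec_nth)

locale cyclic_digraph = pair_digraph G for G :: "'n::finite pair_pre_digraph" +
  assumes verts_UNIV: "pverts G = UNIV"
    and arc_in_cycle: "e \<in> parcs G \<Longrightarrow> \<exists>p. pre_digraph.cycle (with_proj G) p \<and> e \<in> set p"
begin

definition V where "V = arc_vec ` parcs G"

abbreviation N where "N \<equiv> edge_lattice G"

definition top_arcs :: "real ^ 'n \<Rightarrow> (real ^ 'n) set" where
  "top_arcs h = {v \<in> V. h \<bullet> v = 1}"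

definition admissible :: "real ^ 'n \<Rightarrow> bool" where
  "admissible h \<longleftrightarrow> (\<forall>v\<in>V. h \<bullet> v \<le> 1)"

lemma finite_V: "finite V"
  unfolding V_def using pair_finite_arcs by simp

lemma edge_polytope_eq: "edge_polytope G = convex hull V"
  unfolding edge_polytope_def V_def by (rule arg_cong[where f = "\<lambda>S. convex hull S"]) (force simp: arc_vec_def)

lemma V_E:
  assumes "v \<in> V"
  obtains i j where "v = arc_vec (i, j)" "(i, j) \<in> parcs G" "i \<noteq> j"
  using assms pair_no_loops unfolding V_def by fastforce

lemma V_inner_self: "v \<in> V \<Longrightarrow> v \<bullet> v = 2"
  by (elim V_E) (simp add: inner_arc_vec_arc_vec)

text \<open>Arc vectors are roots of type A, of squared length 2, so distinct ones have inner
  product at most 1. This gap makes each of them a vertex and keeps the cone over a face free of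
  other arc vectors.\<close>

lemma V_inner_le: "\<lbrakk>v \<in> V; w \<in> V; v \<noteq> w\<rbrakk> \<Longrightarrow> v \<bullet> w \<le> 1"
  by (elim V_E) (auto simp: inner_arc_vec_arc_vec)

lemma V_nth_Ints: "v \<in> V \<Longrightarrow> v $ k \<in> \<int>"
  by (elim V_E) (auto simp: arc_vec_nth)

lemma V_sub_N: "V \<subseteq> N"
  unfolding edge_lattice_def edge_polytope_eq using V_nth_Ints span_base[OF hull_inc] by blast

lemma N_eq: "N = {v \<in> span V. \<forall>k. v $ k \<in> \<int>}"
proof -
  have "span (edge_polytope G) = span V"
  proof -
    have "convex hull V \<subseteq> span V" by (intro hull_minimal span_superset subspace_imp_convex subspace_span)
    then have "span (convex hull V) \<subseteq> span V" by (intro span_minimal subspace_span)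
    then show ?thesis unfolding edge_polytope_eq using span_mono[OF hull_subset[of V convex]] by blast
  qed
  then show ?thesis unfolding edge_lattice_def by simp
qed

lemma pcas_telescope: "pcas u p v \<Longrightarrow> (\<Sum>e\<leftarrow>p. h \<bullet> arc_vec e) = h $ u - h $ v"
  by (induction p arbitrary: u) (auto simp: inner_arc_vec)

text \<open>The origin is in the relative interior of the polytope.\<close>

lemma balanced:
  assumes h: "\<And>x. x \<in> V \<Longrightarrow> 0 \<le> h \<bullet> x" and v: "v \<in> V"
  shows "h \<bullet> v = 0"
proof -
  obtain e where e: "e \<in> parcs G" "v = arc_vec e" using v unfolding V_def by blast
  obtain p u where p: "e \<in> set p" "set p \<subseteq> parcs G" "pcas u p u"
    using arc_in_cycle[OF e(1)] unfolding cycle_def awalk_def by auto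
  \<comment> \<open>Around a cycle the values of \<open>h\<close> telescope to 0; being nonnegative,
    they all vanish.\<close>
  have s: "(\<Sum>e\<leftarrow>p. h \<bullet> arc_vec e) = 0" using pcas_telescope[OF p(3), of h] by simp
  have nn: "0 \<le> x" if "x \<in> set (map (\<lambda>e. h \<bullet> arc_vec e) p)" for x
    using that h p(2) by (auto simp: V_def)
  have "\<forall>x\<in>set (map (\<lambda>e. h \<bullet> arc_vec e) p). x = 0"
    using s sum_list_nonneg_eq_0_iff[of "map (\<lambda>e. h \<bullet> arc_vec e) p"] nn by auto
  then show ?thesis using p(1) e(2) by auto
qed

lemma top_arcs_V: "top_arcs h \<subseteq> V"
  by (auto simp: top_arcs_def)

text \<open>For an arc vector \<open>x\<close> outside \<open>top_arcs h\<close> the functional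
  \<open>h - x\<close> is nonnegative on \<open>top_arcs h\<close>, since inner products of distinct
  arc vectors are at most 1, but at \<open>x\<close> it is at most \<open>1 - 2\<close>.\<close>

lemma top_arcs_cone:
  assumes h: "admissible h"
  shows "V \<inter> convex_cone hull top_arcs h = top_arcs h"
proof (intro subset_antisym subsetI)
  fix x assume x: "x \<in> V \<inter> convex_cone hull top_arcs h"
  show "x \<in> top_arcs h"
  proof (rule ccontr)
    assume n: "x \<notin> top_arcs h"
    have nn: "0 \<le> (h - x) \<bullet> v" if "v \<in> top_arcs h" for v
      using V_inner_le[of x v] that x n by (auto simp: top_arcs_def inner_diff_left)
    have "0 \<le> (h - x) \<bullet> x" by (rule convex_cone_hull_nonneg[OF nn]) (use x in auto)
    then have "2 \<le> h \<bullet> x" using V_inner_self[of x] x by (simp add: inner_diff_left)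
    moreover have "h \<bullet> x \<le> 1" using h x by (simp add: admissible_def)
    ultimately show False by simp
  qed
next
  fix x assume "x \<in> top_arcs h"
  then show "x \<in> V \<inter> convex_cone hull top_arcs h" using top_arcs_V by (auto intro: hull_inc)
qed

lemma admissible_zero: "admissible 0" "top_arcs 0 = {}"
  by (auto simp: admissible_def top_arcs_def)

lemma top_arcs_proper:
  assumes "top_arcs h = V"
  shows "V = {}"
proof (rule ccontr)
  assume "V \<noteq> {}"
  then obtain v where v: "v \<in> V" by blast
  have 1: "h \<bullet> x = 1" if "x \<in> V" for x using that assms by (auto simp: top_arcs_def)
  have "h \<bullet> v = 0" using 1 v by (intro balanced) auto
  then show False using 1[OF v] by simp
qed

text \<open>As the origin is in the relative interior, the minimum \<open>r\<close> on a nonempty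
  proper face is negative; dividing by it turns the minimum into the maximum 1.\<close>

lemma exposed_top_arcs:
  assumes A: "exposed V A" "A \<noteq> V" "A \<noteq> {}"
  obtains h where "admissible h" "A = top_arcs h"
proof -
  obtain k r where k: "\<And>x. x \<in> V \<Longrightarrow> r \<le> k \<bullet> x" "A = {x \<in> V. k \<bullet> x = r}" using A(1) exposedE by blast
  have r: "r < 0"
  proof (rule ccontr)
    assume "\<not> r < 0"
    then have "0 \<le> k \<bullet> x" if "x \<in> V" for x using k(1)[OF that] by linarith
    then have "k \<bullet> v = 0" if "v \<in> V" for v using that balanced by blast
    then show False using A k by auto
  qed
  have "admissible ((1 / r) *\<^sub>R k)" unfolding admissible_def using k(1) r by (auto simp: divide_simps)
  moreover have "A = top_arcs ((1 / r) *\<^sub>R k)" unfolding top_arcs_def k(2) using r by (auto simp: field_simps)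
  ultimately show thesis by (rule that)
qed

lemma top_arcs_exposed:
  assumes "admissible h"
  shows "exposed V (top_arcs h)"
  using assms unfolding admissible_def top_arcs_def by (intro exposedI[of V "-1" "- h"]) auto

text \<open>Proper faces are given by functionals normalized to height 1, and the functional 0
  yields the zero cone. This also covers a graph without arcs, where every set of top arcs is
  empty.\<close>

lemma spanning_fan_eq:
  "spanning_fan (edge_polytope G) = {convex_cone hull top_arcs h | h. admissible h}" (is "_ = ?R")
proof (intro subset_antisym subsetI)
  fix \<sigma> assume "\<sigma> \<in> spanning_fan (edge_polytope G)"
  then consider "\<sigma> = {0}" | F where "F face_of convex hull V" "F \<noteq> convex hull V" "\<sigma> = convex_cone hull F"
    unfolding spanning_fan_def edge_polytope_eq by blast
  then show "\<sigma> \<in> ?R"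
  proof cases
    case 1
    then show ?thesis using admissible_zero convex_cone_hull_empty by (auto intro!: exI[of _ 0])
  next
    case 2
    have "F exposed_face_of convex hull V"
      using 2(1) exposed_face_of_polyhedron[OF polytope_imp_polyhedron] finite_V unfolding polytope_def by blast
    then obtain a b where ab: "convex hull V \<subseteq> {x. a \<bullet> x \<le> b}" "F = convex hull V \<inter> {x. a \<bullet> x = b}"
      unfolding exposed_face_of_def by blast
    obtain S where S: "S \<subseteq> V" "F = convex hull S"
      using face_of_convex_hull_subset[OF finite_imp_compact[OF finite_V] 2(1)] by metis
    have FV: "F = convex hull (V \<inter> F)"
    proof (rule subset_antisym)
      show "F \<subseteq> convex hull (V \<inter> F)"
      proof -
        have "S \<subseteq> V \<inter> F" using S hull_subset[of S convex] by auto
        from hull_mono[OF this, of convex] show ?thesis using S(2) by simp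
      qed
      show "convex hull (V \<inter> F) \<subseteq> F" using face_of_imp_convex[OF 2(1)] by (intro hull_minimal) auto
    qed
    have A: "exposed V (V \<inter> F)"
      using ab hull_subset[of V convex] by (intro exposedI[of V "- b" "- a"]) auto
    have "V \<inter> F \<noteq> V" using 2(2) FV by auto
    then have "\<exists>h. admissible h \<and> V \<inter> F = top_arcs h"
      using exposed_top_arcs[OF A] admissible_zero by metis
    then obtain h where h: "admissible h" "V \<inter> F = top_arcs h" by blast
    have "\<sigma> = convex_cone hull top_arcs h" unfolding 2(3) h(2)[symmetric] by (metis FV convex_cone_hull_convex_hull)
    then show ?thesis using h(1) by blast
  qed
next
  fix \<sigma> assume "\<sigma> \<in> ?R"
  then obtain h where h: "admissible h" "\<sigma> = convex_cone hull top_arcs h" by blast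
  show "\<sigma> \<in> spanning_fan (edge_polytope G)"
  proof (cases "V = {}")
    case True
    then have "top_arcs h = {}" using top_arcs_V[of h] by simp
    then show ?thesis unfolding h(2) spanning_fan_def by (simp add: convex_cone_hull_empty)
  next
    case False
    let ?F = "convex hull V \<inter> {x. h \<bullet> x = 1}"
    have le: "h \<bullet> x \<le> 1" if "x \<in> convex hull V" for x
      using hull_minimal[of V "{x. h \<bullet> x \<le> 1}" convex] h(1) that convex_halfspace_le[of h 1] by (auto simp: admissible_def)
    have F: "?F face_of convex hull V" by (rule face_of_Int_supporting_hyperplane_le[OF convex_convex_hull le])
    obtain S where S: "S \<subseteq> V" "?F = convex hull S"
      using face_of_convex_hull_subset[OF finite_imp_compact[OF finite_V] F] by metis
    have "S \<subseteq> top_arcs h" using S hull_subset[of S convex] by (auto simp: top_arcs_def)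
    then have 1: "?F \<subseteq> convex hull top_arcs h" unfolding S(2) by (rule hull_mono)
    have "top_arcs h \<subseteq> ?F" using hull_subset[of V convex] by (auto simp: top_arcs_def)
    then have "convex hull top_arcs h \<subseteq> ?F" using face_of_imp_convex[OF F] by (rule hull_minimal)
    then have eq: "?F = convex hull top_arcs h" using 1 by auto
    have "?F \<noteq> convex hull V"
    proof
      assume "?F = convex hull V"
      then have "top_arcs h = V" using hull_subset[of V convex] by (auto simp: top_arcs_def)
      then show False using top_arcs_proper False by blast
    qed
    moreover have "\<sigma> = convex_cone hull ?F" unfolding h(2) eq convex_cone_hull_convex_hull ..
    ultimately show ?thesis using F unfolding spanning_fan_def edge_polytope_eq by blast
  qed
qed

end

text \<open>Moves a functional into the span, where \<open>dual_lattice\<close> requires it to be,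
  without changing its values there.\<close>

lemma projection_to_span:
  fixes m :: "'a::euclidean_space"
  obtains y where "y \<in> span W" "\<And>u. u \<in> span W \<Longrightarrow> y \<bullet> u = m \<bullet> u"
proof -
  obtain y z where yz: "y \<in> span W" "\<And>w. w \<in> span W \<Longrightarrow> orthogonal z w" "m = y + z"
    by (rule orthogonal_subspace_decomp_exists) (rule that)
  have "y \<bullet> u = m \<bullet> u" if "u \<in> span W" for u
    using yz(2)[OF that] unfolding yz(3) by (simp add: inner_add_left orthogonal_def)
  then show thesis using that yz(1) by blast
qed

section \<open>Integral functionals, localization at faces and lattice bases\<close>

context cyclic_digraph
begin

abbreviation \<Sigma> where "\<Sigma> \<equiv> {convex_cone hull top_arcs h | h. admissible h}"

lemma Int_fan: "\<sigma> \<in> \<Sigma> \<Longrightarrow> \<exists>h. admissible h \<and> \<sigma> = convex_cone hull top_arcs h \<and> V \<inter> \<sigma> = top_arcs h"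
  using top_arcs_cone by blast

lemma top_arcs_face:
  assumes hk: "admissible k" "top_arcs k \<subseteq> top_arcs h"
  shows "convex_cone hull top_arcs k face_of convex_cone hull top_arcs h"
proof -
  have "top_arcs k = {a \<in> top_arcs h. (h - k) \<bullet> a = 0}"
    using hk by (auto simp: top_arcs_def inner_diff_left)
  moreover have "0 \<le> (h - k) \<bullet> a" if "a \<in> top_arcs h" for a
    using hk(1) that by (auto simp: top_arcs_def admissible_def inner_diff_left)
  ultimately show ?thesis using convex_cone_hull_face[of "top_arcs h" "h - k"] by simp
qed

text \<open>By the inner products of arc vectors, half of \<open>v\<close> is a functional with
  value 1 at \<open>v\<close> and at most 1/2 at all other arc vectors.\<close>

lemma ray_top_arcs:
  assumes v: "v \<in> V"
  shows "admissible ((1/2) *\<^sub>R v)" "top_arcs ((1/2) *\<^sub>R v) = {v}" "ray v = convex_cone hull top_arcs ((1/2) *\<^sub>R v)"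
proof -
  show "admissible ((1/2) *\<^sub>R v)" unfolding admissible_def
  proof
    fix w assume "w \<in> V"
    then show "(1/2) *\<^sub>R v \<bullet> w \<le> 1"
      using V_inner_le[OF v, of w] V_inner_self[OF v] by (cases "v = w") auto
  qed
  show t: "top_arcs ((1/2) *\<^sub>R v) = {v}"
  proof -
    have "w = v" if "w \<in> V" "v \<bullet> w = 2" for w using V_inner_le[OF v that(1)] that(2) by fastforce
    then show ?thesis using V_inner_self[OF v] v unfolding top_arcs_def by auto
  qed
  show "ray v = convex_cone hull top_arcs ((1/2) *\<^sub>R v)" unfolding t ray_def ..
qed

lemma dual_monoid_top_arcs:
  "dual_monoid N (convex_cone hull top_arcs h) = {m \<in> dual_lattice N. \<forall>v\<in>top_arcs h. 0 \<le> m \<bullet> v}"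
  unfolding dual_monoid_def by (auto intro: hull_inc convex_cone_hull_nonneg)

definition level :: "real ^ 'n \<Rightarrow> real ^ 'n" where
  "level h = (\<chi> i. \<Sum>j\<in>UNIV. of_int \<lfloor>h $ i - h $ j\<rfloor>)"

text \<open>An integral functional with the same maximal arcs as \<open>h\<close>: rounding down \<open>h $ i - h $ j\<close>
  for the head \<open>j\<close> of an arc from \<open>i\<close> detects whether the arc has height 1.\<close>

lemma level:
  assumes h: "admissible h" and v: "v \<in> V"
  shows "level h \<bullet> v \<in> \<int>" "level h \<bullet> v \<le> CARD('n)" "level h \<bullet> v = CARD('n) \<longleftrightarrow> v \<in> top_arcs h"
proof -
  obtain a b where ab: "v = arc_vec (a, b)" using V_E[OF v] by metis
  have hv: "h \<bullet> v = h $ a - h $ b" unfolding ab inner_arc_vec by simp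
  have le: "h $ a - h $ b \<le> 1" using h v hv unfolding admissible_def by auto
  define d where "d j = \<lfloor>h $ a - h $ j\<rfloor> - \<lfloor>h $ b - h $ j\<rfloor>" for j
  have eq: "level h \<bullet> v = of_int (\<Sum>j\<in>UNIV. d j)"
    unfolding ab inner_arc_vec by (simp add: level_def d_def sum_subtractf)
  show "level h \<bullet> v \<in> \<int>" unfolding eq by (rule Ints_of_int)
  have d1: "d j \<le> 1" for j
  proof -
    have "\<lfloor>h $ a - h $ j\<rfloor> \<le> \<lfloor>h $ b - h $ j + 1\<rfloor>" using le by (intro floor_mono) simp
    then show ?thesis by (simp add: d_def)
  qed
  have s: "(\<Sum>j\<in>UNIV. d j) \<le> int CARD('n)"
    using sum_mono[of UNIV d "\<lambda>_. 1"] d1 by simp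
  then show "level h \<bullet> v \<le> CARD('n)" unfolding eq by linarith
  have "h $ a - h $ b = 1 \<longleftrightarrow> (\<Sum>j\<in>UNIV. d j) = int CARD('n)"
  proof
    assume 1: "h $ a - h $ b = 1"
    have "d j = 1" for j
    proof -
      have e: "h $ a - h $ j = h $ b - h $ j + 1" using 1 by simp
      show ?thesis unfolding d_def e by simp
    qed
    then show "(\<Sum>j\<in>UNIV. d j) = int CARD('n)" by simp
  next
    assume 1: "(\<Sum>j\<in>UNIV. d j) = int CARD('n)"
    show "h $ a - h $ b = 1"
    proof (rule ccontr)
      assume "h $ a - h $ b \<noteq> 1"
      \<comment> \<open>The summand for \<open>j = b\<close> is the floor of
        \<open>h $ a - h $ b\<close>, which drops below 1 as soon as the arc is lower than
        1.\<close>
      then have "d b < 1" using le by (simp add: d_def floor_less_iff)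
      then have "(\<Sum>j\<in>UNIV. d j) < (\<Sum>j\<in>(UNIV::'n set). 1)" using d1 by (intro sum_strict_mono_ex1) auto
      then show False using 1 by simp
    qed
  qed
  then show "level h \<bullet> v = CARD('n) \<longleftrightarrow> v \<in> top_arcs h"
    unfolding eq top_arcs_def using v hv by (auto simp del: of_int_sum)
qed

lemma level_Ints: "level h $ i \<in> \<int>"
  by (auto simp: level_def)

lemma integral_inner_N:
  assumes "\<And>i. m $ i \<in> \<int>" "u \<in> N"
  shows "m \<bullet> u \<in> \<int>"
  using assms unfolding N_eq inner_vec_def by auto

text \<open>The two integral functionals \<open>level h\<close> and \<open>level k\<close> have the
  same maximal value on their respective top arcs. Their difference, projected to the span, is 0 on
  the top arcs of the face and a positive integer on the other top arcs of \<open>\<sigma>\<close>,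
  so a large multiple outweighs any negative value of \<open>n\<close> there.\<close>

lemma fan_face_localization:
  assumes \<sigma>: "\<sigma> \<in> \<Sigma>" and \<tau>: "\<tau> \<in> \<Sigma>" and face: "\<tau> face_of \<sigma>"
  shows "\<exists>m\<in>dual_monoid N \<sigma>. - m \<in> dual_monoid N \<tau> \<and> (\<forall>n\<in>dual_monoid N \<tau>. \<exists>k. n + of_nat k *\<^sub>R m \<in> dual_monoid N \<sigma>)"
proof -
  obtain h where h: "admissible h" "\<sigma> = convex_cone hull top_arcs h" "V \<inter> \<sigma> = top_arcs h" using Int_fan[OF \<sigma>] by blast
  obtain k where k: "admissible k" "\<tau> = convex_cone hull top_arcs k" "V \<inter> \<tau> = top_arcs k" using Int_fan[OF \<tau>] by blast
  have sub: "top_arcs k \<subseteq> top_arcs h" using face_of_imp_subset[OF face] h(3) k(3) by blast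
  obtain m where m: "m \<in> span N" "\<And>u. u \<in> span N \<Longrightarrow> m \<bullet> u = (level h - level k) \<bullet> u"
    by (rule projection_to_span[of N "level h - level k"]) (rule that)
  have mN: "m \<bullet> u \<in> \<int>" if "u \<in> N" for u
    using m(2)[OF span_base[OF that]] integral_inner_N[OF _ that, of "level h - level k"] level_Ints by auto
  have mM: "m \<in> dual_lattice N" using m(1) mN unfolding dual_lattice_def by blast
  have mV: "m \<bullet> v = level h \<bullet> v - level k \<bullet> v" if "v \<in> V" for v
    using m(2)[of v] span_base[of v N] V_sub_N that by (auto simp: inner_diff_left)
  have top: "level h \<bullet> v = CARD('n)" if "v \<in> top_arcs h" for v using level(3)[OF h(1)] top_arcs_V that by blast
  have nn: "0 \<le> m \<bullet> v" if "v \<in> top_arcs h" for v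
    using mV[of v] level(2)[OF k(1), of v] top[OF that] subsetD[OF top_arcs_V that] by simp
  have zero: "m \<bullet> v = 0" if "v \<in> top_arcs k" for v
    using mV[of v] level(3)[OF k(1), of v] top[OF subsetD[OF sub that]] subsetD[OF top_arcs_V that] that by simp
  have pos: "1 \<le> m \<bullet> v" if v: "v \<in> top_arcs h - top_arcs k" for v
  proof -
    have vV: "v \<in> V" using v top_arcs_V by auto
    have "m \<bullet> v \<noteq> 0" using mV[OF vV] level(3)[OF k(1) vV] top[of v] v by auto
    moreover have "m \<bullet> v \<in> \<int>" using mN vV V_sub_N by blast
    ultimately show ?thesis using nn[of v] v by (auto elim!: Ints_cases)
  qed
  have "m \<in> dual_monoid N \<sigma>" unfolding h(2) dual_monoid_top_arcs using mM nn by auto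
  moreover have "- m \<in> dual_monoid N \<tau>"
    unfolding k(2) dual_monoid_top_arcs using mM zero by (auto simp: dual_lattice_def span_neg)
  moreover have "\<exists>K. n + of_nat K *\<^sub>R m \<in> dual_monoid N \<sigma>" if n: "n \<in> dual_monoid N \<tau>" for n
  proof -
    have n': "n \<in> dual_lattice N" "\<And>v. v \<in> top_arcs k \<Longrightarrow> 0 \<le> n \<bullet> v"
      using n unfolding k(2) dual_monoid_top_arcs by auto
    obtain K :: nat where K: "(\<Sum>v\<in>V. \<bar>n \<bullet> v\<bar>) \<le> real K" using real_arch_simple by blast
    have "0 \<le> (n + of_nat K *\<^sub>R m) \<bullet> v" if v: "v \<in> top_arcs h" for v
    proof (cases "v \<in> top_arcs k")
      case True
      then show ?thesis using n'(2) zero by (simp add: inner_add_left)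
    next
      case False
      have "\<bar>n \<bullet> v\<bar> \<le> (\<Sum>v\<in>V. \<bar>n \<bullet> v\<bar>)" using finite_V v top_arcs_V by (intro member_le_sum) auto
      moreover have "real K * 1 \<le> real K * (m \<bullet> v)" using pos[of v] v False by (intro mult_left_mono) auto
      ultimately show ?thesis using K by (simp add: inner_add_left)
    qed
    moreover have "n + of_nat K *\<^sub>R m \<in> dual_lattice N"
      using n'(1) mM unfolding dual_lattice_def by (auto simp: inner_add_left span_add span_scale)
    ultimately show ?thesis unfolding h(2) dual_monoid_top_arcs by blast
  qed
  ultimately show ?thesis by blast
qed

lemma toric_fan_fan: "toric_fan N \<Sigma>"
proof
  show "{0} \<in> \<Sigma>" using admissible_zero convex_cone_hull_empty by (auto intro!: exI[of _ 0])
  fix \<sigma> assume "\<sigma> \<in> \<Sigma>"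
  then obtain h where h: "admissible h" "\<sigma> = convex_cone hull top_arcs h" by blast
  show "{0} face_of \<sigma>"
    using top_arcs_face[of 0 h] admissible_zero convex_cone_hull_empty h by simp
qed (rule fan_face_localization)

text \<open>The coefficient of a member \<open>b\<close> of a forest is read off by the indicator vector of the
  component of its tail in the forest without \<open>b\<close>.\<close>

lemma independent_lattice_basis:
  assumes A: "A \<subseteq> V" "independent A"
  shows "\<exists>B. lattice_basis N B \<and> A \<subseteq> B"
proof -
  obtain B where B: "A \<subseteq> B" "B \<subseteq> V" "independent B" "V \<subseteq> span B" using maximal_independent_subset_extend[OF A] by blast
  have fB: "finite B" using B(2) finite_V finite_subset by blast
  have cut: "\<exists>z. (\<forall>i. z $ i \<in> \<int>) \<and> (\<forall>c\<in>B. z \<bullet> c = (if c = b then 1 else 0))" if b: "b \<in> B" for b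
  proof -
    obtain s t where st: "b = arc_vec (s, t)" using b B(2) V_E by (metis subsetD)
    define E where "E = {(x, y). arc_vec (x, y) \<in> B - {b} \<or> arc_vec (y, x) \<in> B - {b}}"
    define C where "C = E\<^sup>* `` {s}"
    define z :: "real ^ 'n" where "z = (\<chi> i. if i \<in> C then 1 else 0)"
    have sp: "axis s 1 - axis k 1 \<in> span (B - {b})" if "(s, k) \<in> E\<^sup>*" for k
      using that
    proof induction
      case base
      then show ?case by (simp add: span_zero)
    next
      case (step y k)
      have "axis y 1 - axis k 1 \<in> span (B - {b})"
      proof (cases "arc_vec (y, k) \<in> B - {b}")
        case True
        from span_base[OF this] show ?thesis by (simp add: arc_vec_def)
      next
        case False
        then have "arc_vec (k, y) \<in> B - {b}" using step(2) by (auto simp: E_def)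
        from span_neg[OF span_base[OF this]] show ?thesis by (simp add: arc_vec_def)
      qed
      from span_add[OF step.IH this] show ?case by simp
    qed
    \<comment> \<open>A path from \<open>s\<close> to \<open>t\<close> in the forest without
      \<open>b\<close> would add up to \<open>b\<close> and make \<open>B\<close> dependent.\<close>
    have t: "t \<notin> C"
    proof
      assume "t \<in> C"
      then have "b \<in> span (B - {b})" using sp[of t] unfolding C_def st arc_vec_def by auto
      then show False using B(3) b unfolding dependent_def by blast
    qed
    have s: "s \<in> C" by (simp add: C_def)
    have "z \<bullet> c = (if c = b then 1 else 0)" if c: "c \<in> B" for c
    proof (cases "c = b")
      case True
      then have "z \<bullet> c = z $ s - z $ t" unfolding st by (simp add: inner_arc_vec)
      then show ?thesis using True s t by (simp add: z_def)
    next
      case False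
      obtain x y where xy: "c = arc_vec (x, y)" using c B(2) V_E by (metis subsetD)
      have "(x, y) \<in> E" "(y, x) \<in> E" using c False xy unfolding E_def by auto
      then have "x \<in> C \<longleftrightarrow> y \<in> C" unfolding C_def by (auto intro: rtrancl_into_rtrancl)
      then show ?thesis using False unfolding xy inner_arc_vec by (simp add: z_def)
    qed
    then show ?thesis by (intro exI[of _ z]) (auto simp: z_def)
  qed
  have "N = {\<Sum>b\<in>B. real_of_int (c b) *\<^sub>R b | c. True}"
  proof (intro subset_antisym subsetI)
    fix u assume u: "u \<in> N"
    then have "u \<in> span B" using B(4) span_minimal[OF _ subspace_span, of V B] unfolding N_eq by blast
    then obtain r where r: "u = (\<Sum>b\<in>B. r b *\<^sub>R b)" unfolding span_finite[OF fB] by blast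
    have "\<exists>n. r b = of_int n" if b: "b \<in> B" for b
    proof -
      obtain z where z: "\<forall>i. z $ i \<in> \<int>" "\<forall>c\<in>B. z \<bullet> c = (if c = b then 1 else 0)" using cut[OF b] by blast
      have "z \<bullet> u = (\<Sum>c\<in>B. r c * (if c = b then 1 else 0))"
        unfolding r inner_sum_right using z(2) by (intro sum.cong) auto
      also have "\<dots> = r b" using fB b by (simp add: if_distrib[of "\<lambda>u. _ * u"] cong: if_cong)
      finally have "r b \<in> \<int>" using integral_inner_N[OF _ u, of z] z(1) by auto
      then show ?thesis by (auto elim: Ints_cases)
    qed
    then obtain n where "\<forall>b\<in>B. r b = of_int (n b)" by metis
    then have "u = (\<Sum>b\<in>B. real_of_int (n b) *\<^sub>R b)" unfolding r by (intro sum.cong) auto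
    then show "u \<in> {\<Sum>b\<in>B. real_of_int (c b) *\<^sub>R b | c. True}" by blast
  next
    fix u assume "u \<in> {\<Sum>b\<in>B. real_of_int (c b) *\<^sub>R b | c. True}"
    then obtain c where u: "u = (\<Sum>b\<in>B. real_of_int (c b) *\<^sub>R b)" by blast
    have "u $ k \<in> \<int>" for k
      unfolding u sum_component using V_nth_Ints B(2) by (auto intro!: Ints_sum Ints_mult)
    moreover have "u \<in> span V" unfolding u using B(2) by (intro span_sum span_scale span_base) auto
    ultimately show "u \<in> N" unfolding N_eq by blast
  qed
  then show ?thesis using B unfolding lattice_basis_def by blast
qed

end

section \<open>Simpliciality in codimension 3 in terms of the graph\<close>

context cyclic_digraph
begin

lemma arc_vec_in_V: "arc_vec (x, y) \<in> V \<longleftrightarrow> (x, y) \<in> parcs G"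
proof
  assume "arc_vec (x, y) \<in> V"
  then obtain i j where ij: "arc_vec (x, y) = arc_vec (i, j)" "(i, j) \<in> parcs G" "i \<noteq> j" by (rule V_E)
  have "arc_vec (x, y) $ i = 1" "arc_vec (x, y) $ j = -1" unfolding ij(1) using ij(3) by (auto simp: arc_vec_nth)
  then have "x = i" "y = j" by (auto simp: arc_vec_nth split: if_splits)
  then show "(x, y) \<in> parcs G" using ij(2) by simp
qed (auto simp: V_def)

lemma arc_vec_neq:
  assumes "(i, j) \<in> parcs G" "(k, l) \<in> parcs G" "i \<noteq> k \<or> j \<noteq> l"
  shows "arc_vec (i, j) \<noteq> arc_vec (k, l)"
proof
  assume eq: "arc_vec (i, j) = arc_vec (k, l)"
  have "i \<noteq> j" "k \<noteq> l" using pair_no_loops assms by fastforce+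
  moreover have "arc_vec (i, j) $ k = 1" "arc_vec (i, j) $ l = -1" unfolding eq using \<open>k \<noteq> l\<close> by (auto simp: arc_vec_nth)
  ultimately show False using assms(3) by (auto simp: arc_vec_nth split: if_splits)
qed

lemma top_arcs_arc_vec: "arc_vec (x, y) \<in> top_arcs h \<longleftrightarrow> (x, y) \<in> parcs G \<and> h $ x = h $ y + 1"
  unfolding top_arcs_def using arc_vec_in_V by (auto simp: inner_arc_vec)

text \<open>The independent generators \<open>T\<close> need not be arc vectors. But every arc
  vector on top spans an extreme ray, so a positive multiple of it belongs to \<open>T\<close>.
  Hence there are at most \<open>card T\<close> of them, which is the dimension that they
  span.\<close>

lemma simplicial_top_arcs:
  assumes h: "admissible h" and s: "simplicial_cone (convex_cone hull top_arcs h)"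
  shows "independent (top_arcs h)"
proof -
  obtain T where T: "independent T" "convex_cone hull top_arcs h = convex_cone hull T"
    using s unfolding simplicial_cone_def by blast
  have finT: "finite T" using T(1) independent_bound by blast
  have ex: "\<exists>c>0. c *\<^sub>R v \<in> T" if v: "v \<in> top_arcs h" for v
  proof (rule ccontr)
    assume no: "\<not> (\<exists>c>0. c *\<^sub>R v \<in> T)"
    have vV: "v \<in> V" using v top_arcs_V by blast
    note k = ray_top_arcs[OF vV]
    \<comment> \<open>On the top arcs \<open>h\<close> is 1 and half of the inner product with
      \<open>v\<close> is at most 1, with equality only at \<open>v\<close>. So \<open>w\<close>
      supports the cone exactly along the ray of \<open>v\<close>.\<close>
    define w where "w = h - (1/2) *\<^sub>R v"
    have w0: "0 \<le> w \<bullet> a" if "a \<in> top_arcs h" for a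
      using that k(1) unfolding w_def admissible_def top_arcs_def by (auto simp: inner_diff_left)
    have "w \<bullet> a = 0 \<longleftrightarrow> a = v" if a: "a \<in> top_arcs h" for a
    proof -
      have "a \<in> V" "w \<bullet> a = 1 - (1/2) * (v \<bullet> a)" using a by (auto simp: w_def top_arcs_def inner_diff_left)
      then show ?thesis using V_inner_self[OF vV] V_inner_le[OF vV, of a] by (cases "a = v") auto
    qed
    then have "{a \<in> top_arcs h. w \<bullet> a = 0} = {v}" using v by blast
    then have zero: "convex_cone hull T \<inter> {x. w \<bullet> x = 0} = convex_cone hull {v}"
      using convex_cone_hull_Int_hyperplane[of "top_arcs h" w] w0 unfolding T(2) by simp
    have ray: "convex_cone hull {v} \<subseteq> (\<lambda>c. c *\<^sub>R v) ` {0..}"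
    proof (rule hull_minimal)
      show "{v} \<subseteq> (\<lambda>c. c *\<^sub>R v) ` {0..}" by (auto intro!: image_eqI[of _ _ 1])
      have "0 \<in> (\<lambda>c. c *\<^sub>R v) ` {0..}" by (auto intro!: image_eqI[of _ _ 0])
      moreover have "c *\<^sub>R v + d *\<^sub>R v \<in> (\<lambda>c. c *\<^sub>R v) ` {0..}" if "0 \<le> c" "0 \<le> d" for c d
        using that by (auto simp: scaleR_add_left intro!: image_eqI[of _ _ "c + d"])
      ultimately show "convex_cone ((\<lambda>c. c *\<^sub>R v) ` {0..})" unfolding convex_cone_iff by auto
    qed
    have "0 < w \<bullet> s" if s: "s \<in> T" for s
    proof -
      have sT: "s \<in> convex_cone hull T" using s by (rule hull_inc)
      then have "0 \<le> w \<bullet> s" using convex_cone_hull_nonneg[OF w0] unfolding T(2)[symmetric] by blast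
      moreover have "w \<bullet> s \<noteq> 0"
      proof
        assume "w \<bullet> s = 0"
        then obtain c where c: "s = c *\<^sub>R v" "0 \<le> c" using sT zero ray by blast
        have "s \<noteq> 0" using T(1) s dependent_zero by blast
        then have "0 < c" using c by (cases "c = 0") auto
        then show False using no s c(1) by blast
      qed
      ultimately show ?thesis by simp
    qed
    then have e: "{a \<in> T. w \<bullet> a = 0} = {}" by fastforce
    have "convex_cone hull T \<inter> {x. w \<bullet> x = 0} = convex_cone hull {a \<in> T. w \<bullet> a = 0}"
      using \<open>\<And>s. s \<in> T \<Longrightarrow> 0 < w \<bullet> s\<close> by (intro convex_cone_hull_Int_hyperplane) (simp add: less_imp_le)
    then have "convex_cone hull {v} = {0}" unfolding zero e convex_cone_hull_empty .
    then have "v = 0" using hull_inc[of v "{v}" convex_cone] by auto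
    then show False using V_inner_self[OF vV] by simp
  qed
  then obtain c where c: "\<And>v. v \<in> top_arcs h \<Longrightarrow> 0 < c v \<and> c v *\<^sub>R v \<in> T" by metis
  have inj: "inj_on (\<lambda>v. c v *\<^sub>R v) (top_arcs h)"
  proof (rule inj_onI)
    fix u v assume uv: "u \<in> top_arcs h" "v \<in> top_arcs h" "c u *\<^sub>R u = c v *\<^sub>R v"
    have "h \<bullet> (c u *\<^sub>R u) = h \<bullet> (c v *\<^sub>R v)" using uv(3) by simp
    then have "c u = c v" using uv(1,2) by (simp add: top_arcs_def)
    then show "u = v" using uv(3) c[OF uv(2)] by auto
  qed
  have "card (top_arcs h) \<le> card T" using inj c finT by (intro card_inj_on_le) auto
  also have "\<dots> = dim T" using T(1) by (simp add: dim_eq_card_independent)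
  also have "\<dots> = dim (top_arcs h)" using T(2) dim_convex_cone_hull by metis
  finally show ?thesis
    using finite_subset[OF top_arcs_V finite_V] by (intro card_le_dim_spanning[of _ "top_arcs h"]) (auto intro: span_base)
qed

text \<open>The four arcs form a tree. Taken in the right order, each has an endpoint that the
  earlier ones do not meet, and the coordinate of this vertex shows that it is independent of
  them.\<close>

lemma filled_diamond_dim:
  assumes H: "arc_vec (i1, i2) \<in> top_arcs h" "arc_vec (i2, i3) \<in> top_arcs h" "arc_vec (i1, i4) \<in> top_arcs h"
    "arc_vec (i1, j) \<in> top_arcs h" and d: "i2 \<noteq> i4" "j \<noteq> i2" "j \<noteq> i4"
  shows "3 < dim (top_arcs h)"
proof -
  have lv: "h $ i1 = h $ i2 + 1" "h $ i2 = h $ i3 + 1" "h $ i1 = h $ i4 + 1" "h $ i1 = h $ j + 1"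
    using H by (auto simp: top_arcs_arc_vec)
  then have ne: "i1 \<noteq> i2" "i2 \<noteq> i3" "i1 \<noteq> i4" "i1 \<noteq> j" "i3 \<noteq> i1" "i3 \<noteq> i4" "i3 \<noteq> j" by auto
  have ins: "independent (insert e S) \<and> card (insert e S) = Suc (card S)"
    if "independent S" "\<forall>s\<in>S. z \<bullet> s = 0" "z \<bullet> e \<noteq> 0" for S :: "(real ^ 'n) set" and e z
    using not_in_span_inner[of S z e] that independent_insert[of e S] independent_bound[of S]
    by (auto intro: span_base)
  let ?A = "{arc_vec (i1, j), arc_vec (i1, i4), arc_vec (i2, i3), arc_vec (i1, i2)}"
  have 1: "independent {arc_vec (i1, i2)} \<and> card {arc_vec (i1, i2)} = 1"
    using ins[OF independent_empty, of "axis i2 1" "arc_vec (i1, i2)"] ne by (auto simp: inner_arc_vec axis_def)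
  have 2: "independent {arc_vec (i2, i3), arc_vec (i1, i2)} \<and> card {arc_vec (i2, i3), arc_vec (i1, i2)} = 2"
    using ins[OF conjunct1[OF 1], of "axis i3 1" "arc_vec (i2, i3)"] 1 ne by (auto simp: inner_arc_vec axis_def)
  have 3: "independent {arc_vec (i1, i4), arc_vec (i2, i3), arc_vec (i1, i2)} \<and>
      card {arc_vec (i1, i4), arc_vec (i2, i3), arc_vec (i1, i2)} = 3"
    using ins[OF conjunct1[OF 2], of "axis i4 1" "arc_vec (i1, i4)"] 2 ne d by (auto simp: inner_arc_vec axis_def)
  have 4: "independent ?A \<and> card ?A = 4"
    using ins[OF conjunct1[OF 3], of "axis j 1" "arc_vec (i1, j)"] 3 ne d by (auto simp: inner_arc_vec axis_def)
  have "?A \<subseteq> top_arcs h" using H by auto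
  then have "dim ?A \<le> dim (top_arcs h)" by (rule dim_subset)
  moreover have "dim ?A = 4" using 4 dim_eq_card_independent by metis
  ultimately show ?thesis by simp
qed

text \<open>Condition (b) leaves two ways out, and both fail: the arc from \<open>i1\<close> to
  \<open>i3\<close> would have height 2, and the two arcs through a further vertex \<open>j\<close>
  would have heights at most 1 with sum 2, hence be on top and raise the dimension to 4.\<close>

lemma no_diamond:
  assumes b: "diamonds_filled G" and h: "admissible h" and d: "dim (top_arcs h) \<le> 3"
    and H: "arc_vec (i1, i2) \<in> top_arcs h" "arc_vec (i2, i3) \<in> top_arcs h"
      "arc_vec (i1, i4) \<in> top_arcs h" "arc_vec (i4, i3) \<in> top_arcs h" and ne: "i2 \<noteq> i4"
  shows False
proof -
  have arcs: "(i1, i2) \<in> parcs G" "(i2, i3) \<in> parcs G" "(i1, i4) \<in> parcs G" "(i4, i3) \<in> parcs G"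
    and lv: "h $ i1 = h $ i2 + 1" "h $ i2 = h $ i3 + 1" "h $ i1 = h $ i4 + 1" "h $ i4 = h $ i3 + 1"
    using H by (auto simp: top_arcs_arc_vec)
  have le: "h $ x - h $ y \<le> 1" if "(x, y) \<in> parcs G" for x y
    using h that unfolding admissible_def V_def by (force simp: inner_arc_vec)
  have "distinct [i1, i2, i3, i4]" using lv ne by auto
  then consider "(i1, i3) \<in> parcs G" | j where "j \<noteq> i2" "j \<noteq> i4" "(i1, j) \<in> parcs G" "(j, i3) \<in> parcs G"
    using b arcs unfolding diamonds_filled_def verts_UNIV by blast
  then show False
  proof cases
    case 1
    then show False using le[OF 1] lv by linarith
  next
    case 2
    have "h $ i1 = h $ j + 1" using le[OF 2(3)] le[OF 2(4)] lv by linarith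
    then have "arc_vec (i1, j) \<in> top_arcs h" using 2(3) by (simp add: top_arcs_arc_vec)
    then show False using filled_diamond_dim[OF H(1-3) _ ne 2(1,2)] d by simp
  qed
qed

text \<open>A dependent set of arcs of equal height contains a cycle of the underlying graph; in dimension at
  most 3 the cycle has length at most 4, and as the height is a grading it is one of the two excluded squares.\<close>

lemma independent_top_arcs:
  assumes a: "no_crossing_pairs G" and b: "diamonds_filled G" and h: "admissible h" and d: "dim (top_arcs h) \<le> 3"
  shows "independent (top_arcs h)"
proof -
  obtain B where B: "B \<subseteq> top_arcs h" "independent B" "top_arcs h \<subseteq> span B" "card B = dim (top_arcs h)"
    using basis_exists[of "top_arcs h"] by blast
  show ?thesis
  proof (cases "B = top_arcs h")
    case False
    then obtain e where e: "e \<in> top_arcs h" "e \<notin> B" using B(1) by blast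
    obtain u v where uv: "e = arc_vec (u, v)" using V_E top_arcs_V e(1) by (metis subsetD)
    define ind :: "'n set \<Rightarrow> real ^ 'n" where "ind C = (\<chi> i. if i \<in> C then 1 else 0)" for C
    have ind: "ind C \<bullet> arc_vec (x, y) = (if x \<in> C then 1 else 0) - (if y \<in> C then 1 else 0)" for C x y
      by (simp add: ind_def inner_arc_vec)
    \<comment> \<open>The vector \<open>e\<close> lies in the span of \<open>B\<close> and leaves
      \<open>C\<close>, so the indicator of \<open>C\<close> cannot vanish on \<open>B\<close>: some
      member of \<open>B\<close> leaves \<open>C\<close> too. Applied to growing sets, this traces a
      path from \<open>u\<close>.\<close>
    have cross: "\<exists>f x y. f \<in> B \<and> x \<in> C \<and> y \<notin> C \<and> (f = arc_vec (x, y) \<or> f = arc_vec (y, x)) \<and> ind C \<bullet> f \<noteq> 0"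
      if C: "u \<in> C" "v \<notin> C" for C
    proof -
      have "\<exists>f\<in>B. ind C \<bullet> f \<noteq> 0"
        using not_in_span_inner[of B "ind C" e] B(3) e(1) C unfolding uv by (auto simp: ind)
      then obtain f where f: "f \<in> B" "ind C \<bullet> f \<noteq> 0" by blast
      obtain x y where xy: "f = arc_vec (x, y)" using V_E top_arcs_V f(1) B(1) by (metis subsetD)
      have "x \<in> C \<and> y \<notin> C \<or> y \<in> C \<and> x \<notin> C" using f(2) unfolding xy ind by (auto split: if_splits)
      then show ?thesis using f xy by blast
    qed
    define adj where "adj x y \<longleftrightarrow> arc_vec (x, y) \<in> B \<or> arc_vec (y, x) \<in> B" for x y
    have lv: "h $ x = h $ y + 1" if "arc_vec (x, y) \<in> B" for x y using that B(1) top_arcs_arc_vec by blast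
    have adj: "h $ x = h $ y + 1 \<or> h $ y = h $ x + 1" if "adj x y" for x y using that lv unfolding adj_def by blast
    have huv: "h $ u = h $ v + 1" using e(1) unfolding uv top_arcs_arc_vec by simp
    have nuv: "\<not> adj u v" using e(2) lv[of v u] huv unfolding uv adj_def by auto
    \<comment> \<open>Parity: a step changes the height by 1 or -1, so two steps cannot lead from
      \<open>u\<close> to \<open>v\<close>, whose heights differ by 1.\<close>
    have par: False if "adj u x" "adj x v" for x using adj[OF that(1)] adj[OF that(2)] huv by linarith
    have vu: "v \<notin> {u}" using huv by auto
    obtain f1 x1 where 1: "f1 \<in> B" "x1 \<noteq> u" "f1 = arc_vec (u, x1) \<or> f1 = arc_vec (x1, u)"
      using cross[OF singletonI vu] by blast
    have x1: "adj u x1" "x1 \<noteq> v" using 1 nuv unfolding adj_def by auto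
    have v2: "v \<notin> {u, x1}" using vu x1(2) by auto
    obtain f2 p2 x2 where 2: "f2 \<in> B" "p2 \<in> {u, x1}" "x2 \<notin> {u, x1}" "f2 = arc_vec (p2, x2) \<or> f2 = arc_vec (x2, p2)"
       "ind {u, x1} \<bullet> f2 \<noteq> 0" using cross[OF insertI1 v2] by blast
    have p2: "adj p2 x2" using 2 unfolding adj_def by auto
    have x2: "x2 \<noteq> v" using p2 2(2) nuv par[OF x1(1)] by auto
    have v3: "v \<notin> {u, x1, x2}" using v2 x2 by auto
    obtain f3 p3 x3 where 3: "f3 \<in> B" "p3 \<in> {u, x1, x2}" "x3 \<notin> {u, x1, x2}" "f3 = arc_vec (p3, x3) \<or> f3 = arc_vec (x3, p3)"
       "ind {u, x1, x2} \<bullet> f3 \<noteq> 0" using cross[OF insertI1 v3] by blast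
    have p3: "adj p3 x3" using 3 unfolding adj_def by auto
    have fB: "finite B" using B(2) independent_bound by blast
    have x3: "x3 = v"
    proof (rule ccontr)
      assume "x3 \<noteq> v"
      then have v4: "v \<notin> {u, x1, x2, x3}" using v3 by auto
      obtain f4 where 4: "f4 \<in> B" "ind {u, x1, x2, x3} \<bullet> f4 \<noteq> 0" using cross[OF insertI1 v4] by blast
      \<comment> \<open>Each new arc leaves the set of vertices reached so far, while the earlier
        ones lie inside it; the indicators therefore tell the four arcs apart.\<close>
      have "f2 \<noteq> f1" using 1(3) 2(5) by (auto simp: ind)
      moreover have "f3 \<noteq> f1" using 1(3) 3(5) by (auto simp: ind)
      moreover have "f3 \<noteq> f2" using 2(2,4) 3(5) by (auto simp: ind)
      moreover have "f4 \<noteq> f1" using 1(3) 4(2) by (auto simp: ind)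
      moreover have "f4 \<noteq> f2" using 2(2,4) 4(2) by (auto simp: ind)
      moreover have "f4 \<noteq> f3" using 3(2,4) 4(2) by (auto simp: ind)
      ultimately have "card {f1, f2, f3, f4} = 4" by auto
      moreover have "{f1, f2, f3, f4} \<subseteq> B" using 1(1) 2(1) 3(1) 4(1) by simp
      ultimately have "4 \<le> card B" using card_mono[OF fB] by metis
      then show False using B(4) d by simp
    qed
    have "p3 = x2" using p3 3(2) nuv par[OF x1(1)] unfolding x3 by auto
    then have a3: "adj x2 v" using p3 x3 by simp
    have "p2 = x1" using p2 2(2) par[OF _ a3] by auto
    then have a2: "adj x1 x2" using p2 by simp
    have top: "arc_vec (x, y) \<in> top_arcs h" if "adj x y" "h $ x = h $ y + 1" for x y
      using that lv[of y x] B(1) unfolding adj_def by auto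
    have adjs: "adj x y \<Longrightarrow> adj y x" for x y unfolding adj_def by blast
    \<comment> \<open>Three steps of height 1 or -1 lead down by 1 in total, so exactly one of them
      goes up. If it is the middle one, the square is a crossing pair; otherwise it is a
      diamond.\<close>
    consider "h $ x1 = h $ u + 1" "h $ x1 = h $ x2 + 1" "h $ x2 = h $ v + 1"
      | "h $ u = h $ x1 + 1" "h $ x2 = h $ x1 + 1" "h $ x2 = h $ v + 1"
      | "h $ u = h $ x1 + 1" "h $ x1 = h $ x2 + 1" "h $ v = h $ x2 + 1"
      using adj[OF x1(1)] adj[OF a2] adj[OF a3] huv by linarith
    then have False
    proof cases
      case 1
      show False
        by (rule no_diamond[OF b h d top[OF adjs[OF x1(1)] 1(1)] e(1)[unfolded uv] top[OF a2 1(2)] top[OF a3 1(3)]])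
          (use 2(3) in auto)
    next
      case c2: 2
      have "(u, x1) \<in> parcs G" "(x2, x1) \<in> parcs G" "(x2, v) \<in> parcs G" "(u, v) \<in> parcs G"
        using top[OF x1(1) c2(1)] top[OF adjs[OF a2] c2(2)] top[OF a3 c2(3)] e(1) unfolding uv top_arcs_arc_vec by auto
      moreover have "distinct [u, x1, x2, v]" using 1(2) 2(3) x1(2) x2 huv by auto
      ultimately show False using a unfolding no_crossing_pairs_def verts_UNIV by blast
    next
      case c3: 3
      show False
        by (rule no_diamond[OF b h d top[OF x1(1) c3(1)] top[OF a2 c3(2)] e(1)[unfolded uv] top[OF adjs[OF a3] c3(3)]])
          (use x1 in auto)
    qed
    then show ?thesis ..
  qed (use B(2) in simp)
qed

lemma dependent_square:
  assumes "p + q = r + s" "p \<notin> {q, r, s}" "q \<notin> {r, s}" "r \<noteq> s"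
  shows "\<not> independent {p, q, r, s :: 'b::euclidean_space}" "dim {p, q, r, s} \<le> 3"
proof -
  have "p = r + s - q" using assms(1) by (simp add: algebra_simps)
  moreover have "q \<in> span {q, r, s}" "r \<in> span {q, r, s}" "s \<in> span {q, r, s}" by (auto intro: span_base)
  ultimately have p: "p \<in> span {q, r, s}" by (metis span_add span_diff)
  have "{p, q, r, s} - {p} = {q, r, s}" using assms by auto
  then show "\<not> independent {p, q, r, s}" using p unfolding dependent_def by auto
  have "dim {p, q, r, s} = dim {q, r, s}" using p dim_insert[of p "{q, r, s}"] by simp
  also have "\<dots> \<le> card {q, r, s}" by (rule dim_le_card') simp
  also have "\<dots> \<le> 3" by (simp add: card_insert_if)
  finally show "dim {p, q, r, s} \<le> 3" .
qed

text \<open>With 1/2 at the two sources, -1/2 at the two targets and 0 elsewhere, height 1 is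
  reached only by arcs from a source to a target. The square is therefore a complete set of top
  arcs, and its alternating sum is a linear relation.\<close>

lemma no_crossing_pairs_if_independent:
  assumes ind: "\<And>h. \<lbrakk>admissible h; dim (top_arcs h) \<le> 3\<rbrakk> \<Longrightarrow> independent (top_arcs h)"
  shows "no_crossing_pairs G"
  unfolding no_crossing_pairs_def
proof (rule notI, elim exE conjE)
  fix i1 i2 i3 i4
  assume ne: "distinct [i1, i2, i3, i4]"
    and arcs: "(i1, i2) \<in> parcs G" "(i1, i4) \<in> parcs G" "(i3, i2) \<in> parcs G" "(i3, i4) \<in> parcs G"
  define h :: "real ^ 'n" where "h = (\<chi> i. if i \<in> {i1, i3} then 1/2 else if i \<in> {i2, i4} then -1/2 else 0)"
  have h: "h $ i = (if i \<in> {i1, i3} then 1/2 else if i \<in> {i2, i4} then -1/2 else 0)" for i by (simp add: h_def)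
  have "admissible h" unfolding admissible_def by (auto elim!: V_E simp: inner_arc_vec h)
  moreover have t: "top_arcs h = {arc_vec (i1, i2), arc_vec (i3, i4), arc_vec (i1, i4), arc_vec (i3, i2)}" (is "_ = ?A")
  proof (intro subset_antisym subsetI)
    fix x assume x: "x \<in> top_arcs h"
    then obtain i j where ij: "x = arc_vec (i, j)" using V_E top_arcs_V by (metis subsetD)
    have "h $ i = h $ j + 1" using x unfolding ij top_arcs_arc_vec by simp
    then have "i \<in> {i1, i3}" "j \<in> {i2, i4}" by (auto simp: h split: if_splits)
    then show "x \<in> ?A" using ij by auto
  next
    fix x assume "x \<in> ?A"
    then show "x \<in> top_arcs h" using arcs ne by (auto simp: top_arcs_arc_vec h)
  qed
  have e: "arc_vec (i1, i2) + arc_vec (i3, i4) = arc_vec (i1, i4) + arc_vec (i3, i2)" by (simp add: arc_vec_def)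
  have n: "arc_vec (i1, i2) \<notin> {arc_vec (i3, i4), arc_vec (i1, i4), arc_vec (i3, i2)}" "arc_vec (i3, i4) \<notin> {arc_vec (i1, i4), arc_vec (i3, i2)}" "arc_vec (i1, i4) \<noteq> arc_vec (i3, i2)"
    using arc_vec_neq arcs ne by auto
  from dependent_square[OF e n] have "\<not> independent (top_arcs h)" "dim (top_arcs h) \<le> 3" unfolding t .
  ultimately show False using ind by blast
qed

text \<open>The square gets the heights 1, 0, 0, -1. Any further out-neighbour of \<open>i1\<close>
  is raised to 1/4 and any further in-neighbour of \<open>i3\<close> lowered to -1/4, so that their
  arcs at \<open>i1\<close> and \<open>i3\<close> stay below height 1. No vertex requires both, and
  the arc from \<open>i1\<close> to \<open>i3\<close> is absent, precisely because the square is
  unfilled.\<close>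

lemma diamonds_filled_if_independent:
  assumes ind: "\<And>h. \<lbrakk>admissible h; dim (top_arcs h) \<le> 3\<rbrakk> \<Longrightarrow> independent (top_arcs h)"
  shows "diamonds_filled G"
  unfolding diamonds_filled_def
proof (intro allI impI, elim conjE, rule ccontr)
  fix i1 i2 i3 i4
  assume ne: "distinct [i1, i2, i3, i4]"
    and arcs: "(i1, i2) \<in> parcs G" "(i2, i3) \<in> parcs G" "(i1, i4) \<in> parcs G" "(i4, i3) \<in> parcs G"
    and no: "\<not> ((i1, i3) \<in> parcs G \<or> (\<exists>j\<in>pverts G - {i2, i4}. (i1, j) \<in> parcs G \<and> (j, i3) \<in> parcs G))"
  define h :: "real ^ 'n" where "h = (\<chi> i. if i = i1 then 1 else if i = i3 then -1 else if i \<in> {i2, i4} then 0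
    else if (i1, i) \<in> parcs G then 1/4 else if (i, i3) \<in> parcs G then -1/4 else 0)"
  have h: "h $ i = (if i = i1 then 1 else if i = i3 then -1 else if i \<in> {i2, i4} then 0
    else if (i1, i) \<in> parcs G then 1/4 else if (i, i3) \<in> parcs G then -1/4 else 0)" for i by (simp add: h_def)
  have sq: "h $ i - h $ j < 1 \<or> (i, j) \<in> {(i1, i2), (i2, i3), (i1, i4), (i4, i3)}" if "(i, j) \<in> parcs G" for i j
    using that no pair_no_loops[OF that] unfolding verts_UNIV by (auto simp: h)
  have lv: "h $ i1 = h $ i2 + 1" "h $ i2 = h $ i3 + 1" "h $ i1 = h $ i4 + 1" "h $ i4 = h $ i3 + 1"
    using ne by (auto simp: h)
  have "admissible h" unfolding admissible_def
  proof
    fix v assume "v \<in> V"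
    then obtain i j where ij: "v = arc_vec (i, j)" "(i, j) \<in> parcs G" by (rule V_E)
    show "h \<bullet> v \<le> 1" using sq[OF ij(2)] lv unfolding ij(1) inner_arc_vec by auto
  qed
  moreover have t: "top_arcs h = {arc_vec (i1, i2), arc_vec (i2, i3), arc_vec (i1, i4), arc_vec (i4, i3)}" (is "_ = ?A")
  proof (intro subset_antisym subsetI)
    fix x assume x: "x \<in> top_arcs h"
    then obtain i j where ij: "x = arc_vec (i, j)" using V_E top_arcs_V by (metis subsetD)
    have "h $ i = h $ j + 1" "(i, j) \<in> parcs G" using x unfolding ij top_arcs_arc_vec by auto
    then show "x \<in> ?A" using sq[of i j] ij by auto
  next
    fix x assume "x \<in> ?A"
    then show "x \<in> top_arcs h" using arcs lv by (auto simp: top_arcs_arc_vec)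
  qed
  have e: "arc_vec (i1, i2) + arc_vec (i2, i3) = arc_vec (i1, i4) + arc_vec (i4, i3)" by (simp add: arc_vec_def)
  have n: "arc_vec (i1, i2) \<notin> {arc_vec (i2, i3), arc_vec (i1, i4), arc_vec (i4, i3)}" "arc_vec (i2, i3) \<notin> {arc_vec (i1, i4), arc_vec (i4, i3)}" "arc_vec (i1, i4) \<noteq> arc_vec (i4, i3)"
    using arc_vec_neq arcs ne by auto
  from dependent_square[OF e n] have "\<not> independent (top_arcs h)" "dim (top_arcs h) \<le> 3" unfolding t .
  ultimately show False using ind by blast
qed

lemma codim_iff:
  "smooth_in_codim 2 N (spanning_fan (edge_polytope G)) \<and> Q_factorial_in_codim 3 (spanning_fan (edge_polytope G)) \<longleftrightarrow>
    no_crossing_pairs G \<and> diamonds_filled G" (is "?L \<longleftrightarrow> ?R")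
proof
  assume ?L
  then have "independent (top_arcs h)" if "admissible h" "dim (top_arcs h) \<le> 3" for h
    using that simplicial_top_arcs[OF that(1)] unfolding Q_factorial_in_codim_def spanning_fan_eq
    by (auto simp: dim_convex_cone_hull)
  then show ?R using no_crossing_pairs_if_independent diamonds_filled_if_independent by blast
next
  assume R: ?R
  have "simplicial_cone \<sigma> \<and> smooth_cone N \<sigma>" if \<sigma>: "\<sigma> \<in> \<Sigma>" "dim \<sigma> \<le> 3" for \<sigma>
  proof -
    obtain h where h: "admissible h" "\<sigma> = convex_cone hull top_arcs h" using \<sigma>(1) by blast
    have i: "independent (top_arcs h)" using independent_top_arcs R h \<sigma>(2) by (simp add: dim_convex_cone_hull)
    then show ?thesis
      using independent_lattice_basis[OF top_arcs_V i] unfolding simplicial_cone_def smooth_cone_def h(2) by blast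
  qed
  then show ?L unfolding smooth_in_codim_def Q_factorial_in_codim_def spanning_fan_eq by fastforce
qed

section \<open>Rigidity of the edge variety\<close>

lemma simplicial_skeleton_V:
  assumes "no_crossing_pairs G" "diamonds_filled G"
  shows "simplicial_skeleton V"
proof
  show "finite V" by (rule finite_V)
  show "exposed V {v}" if "v \<in> V" for v
    using top_arcs_exposed[OF ray_top_arcs(1)[OF that]] ray_top_arcs(2)[OF that] by simp
  show "h \<bullet> v = 0" if "\<And>x. x \<in> V \<Longrightarrow> 0 \<le> h \<bullet> x" "v \<in> V" for h v using balanced that by blast
  show "independent A" if A: "exposed V A" "A \<noteq> V" "dim A \<le> 3" for A
  proof (cases "A = {}")
    case False
    then obtain h where "admissible h" "A = top_arcs h" using exposed_top_arcs[OF A(1,2)] by blast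
    then show ?thesis using independent_top_arcs[OF assms] A(3) by simp
  qed (simp add: independent_empty)
qed

text \<open>The cones of dimension at most 3 serve as the smooth part. The condition
  \<open>extend_compat\<close> is \<open>ex_compat\<close> for the vectors attached to the cones
  over exposed sets; the vector found lies in the span because it is 0 or one of those
  given.\<close>

lemma rigid_fan_V:
  assumes ab: "no_crossing_pairs G" "diamonds_filled G"
  shows "rigid_fan N \<Sigma> V (\<lambda>\<sigma>. V \<inter> \<sigma>) {\<sigma> \<in> \<Sigma>. dim \<sigma> \<le> 3}"
proof -
  interpret toric_fan N \<Sigma> by (rule toric_fan_fan)
  have ray: "ray v \<in> \<Sigma>" "V \<inter> ray v = {v}" "dim (ray v) \<le> 3" if "v \<in> V" for v
  proof -
    note r = ray_top_arcs[OF that]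
    show "ray v \<in> \<Sigma>" using r by blast
    show "V \<inter> ray v = {v}" using top_arcs_cone[OF r(1)] r(2,3) by simp
    show "dim (ray v) \<le> 3" unfolding ray_def dim_convex_cone_hull using dim_le_card'[of "{v}"] by simp
  qed
  show ?thesis
  proof
    fix \<sigma> v assume \<sigma>: "\<sigma> \<in> \<Sigma>" and v: "v \<in> V \<inter> \<sigma>"
    obtain h where h: "admissible h" "\<sigma> = convex_cone hull top_arcs h" "V \<inter> \<sigma> = top_arcs h" using Int_fan[OF \<sigma>] by blast
    show "ray v face_of \<sigma>"
      using v ray_top_arcs[of v] top_arcs_face[of "(1/2) *\<^sub>R v" h] unfolding h(2,3) using h by auto
  next
    fix \<sigma> assume \<sigma>: "\<sigma> \<in> \<Sigma>"
    obtain h where h: "admissible h" "\<sigma> = convex_cone hull top_arcs h" "V \<inter> \<sigma> = top_arcs h" using Int_fan[OF \<sigma>] by blast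
    show "dual_monoid N \<sigma> = {m \<in> dual_lattice N. \<forall>v\<in>V \<inter> \<sigma>. 0 \<le> m \<bullet> v}"
      unfolding h(3) unfolding h(2) by (rule dual_monoid_top_arcs)
  next
    fix \<sigma> assume \<sigma>: "\<sigma> \<in> {\<sigma> \<in> \<Sigma>. dim \<sigma> \<le> 3}"
    then have "\<sigma> \<in> \<Sigma>" by simp
    from Int_fan[OF this] obtain h where h: "admissible h" "\<sigma> = convex_cone hull top_arcs h" "V \<inter> \<sigma> = top_arcs h" by blast
    have "independent (top_arcs h)" using independent_top_arcs[OF ab h(1)] \<sigma> unfolding h(2) by (simp add: dim_convex_cone_hull)
    then show "\<exists>B. lattice_basis N B \<and> V \<inter> \<sigma> \<subseteq> B" unfolding h(3) by (rule independent_lattice_basis[OF top_arcs_V])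
  next
    fix q a
    assume q: "q \<in> dual_lattice N" and a: "\<And>\<sigma>. \<sigma> \<in> {\<sigma> \<in> \<Sigma>. dim \<sigma> \<le> 3} \<Longrightarrow> a \<sigma> \<in> span N"
      and c: "\<And>\<sigma> v. \<lbrakk>\<sigma> \<in> {\<sigma> \<in> \<Sigma>. dim \<sigma> \<le> 3}; v \<in> V \<inter> \<sigma>\<rbrakk> \<Longrightarrow> compat q v (a \<sigma>) (a (ray v))"
    interpret simplicial_skeleton V by (rule simplicial_skeleton_V[OF ab])
    have S: "convex_cone hull A \<in> {\<sigma> \<in> \<Sigma>. dim \<sigma> \<le> 3}" if A: "exposed V A" "A \<noteq> V" "dim A \<le> 3" "A \<noteq> {}" for A
      using exposed_top_arcs[OF A(1,2,4)] A(3) by (fastforce simp: dim_convex_cone_hull)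
    have "\<exists>d\<in>insert 0 ((\<lambda>A. a (convex_cone hull A)) ` {A. exposed V A \<and> A \<noteq> V \<and> A \<noteq> {} \<and> dim A \<le> 3}).
        \<forall>v\<in>V. compat q v d (a (convex_cone hull {v}))"
    proof (rule ex_compat)
      show "q \<bullet> v \<in> \<int>" if "v \<in> V" for v using q that V_sub_N unfolding dual_lattice_def by blast
      fix A v assume A: "exposed V A" "A \<noteq> V" "dim A \<le> 3" "v \<in> A"
      have "v \<in> V \<inter> convex_cone hull A" using A(4) exposed_subset[OF A(1)] by (auto intro: hull_inc)
      then show "compat q v (a (convex_cone hull A)) (a (convex_cone hull {v}))"
        using c[OF S[OF A(1-3)]] A(4) unfolding ray_def by blast
    qed
    then obtain d where d: "d \<in> insert 0 ((\<lambda>A. a (convex_cone hull A)) ` {A. exposed V A \<and> A \<noteq> V \<and> A \<noteq> {} \<and> dim A \<le> 3})"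
      "\<forall>v\<in>V. compat q v d (a (ray v))" unfolding ray_def by blast
    have "d \<in> span N" using d(1) a[OF S] by (auto simp: span_zero)
    then show "\<exists>d\<in>span N. \<forall>v\<in>V. compat q v d (a (ray v))" using d(2) by blast
  next
    show "{0} \<in> {\<sigma> \<in> \<Sigma>. dim \<sigma> \<le> 3}" using origin_mem by simp
  qed (use finite_V V_sub_N ray in auto)
qed

theorem rigid_edge_variety:
  assumes "no_crossing_pairs G" "diamonds_filled G"
  shows "rigid TYPE('q) TYPE('t) (edge_variety G)"
  unfolding edge_variety_def spanning_fan_eq by (rule rigid_fan.rigid_toric_variety[OF rigid_fan_V[OF assms]])

end

theorem theorem1p4:
  fixes G :: "'n::finite pair_pre_digraph"
  assumes "pair_digraph G"
    and "pverts G = UNIV"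
    and "\<forall>e\<in>parcs G. \<exists>p. pre_digraph.cycle (with_proj G) p \<and> e \<in> set p"
  shows "((smooth_in_codim 2 (edge_lattice G) (spanning_fan (edge_polytope G)) \<and>
           Q_factorial_in_codim 3 (spanning_fan (edge_polytope G)))
          \<longleftrightarrow> no_crossing_pairs G \<and> diamonds_filled G) \<and>
         (no_crossing_pairs G \<and> diamonds_filled G \<longrightarrow>
           rigid TYPE('q) TYPE('t) (edge_variety G))"
proof -
  interpret cyclic_digraph G
    using assms by (simp add: cyclic_digraph_def cyclic_digraph_axioms_def)
  show ?thesis using codim_iff rigid_edge_variety by blast
qed

end
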